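(* Let $P$ be a join-factorization lattice, $\mathcal{M}$ a good model category, $F\colon P\to\mathcal{M}$ a functor, and $n\ge 0$ an integer. Then $\varepsilon_n\colon T_nF\to F$ is the universal map from a codegree $n$ functor to $F$ in the homotopy category $\operatorname{Ho}\operatorname{Fun}(P,\mathcal{M})$. In other words, for any codegree $n$ functor $G\colon P\to\mathcal{M}$ and any natural transformation $\zeta\colon G\to F$, there exists a unique morphism $\upsilon\colon G\to T_nF$ in $\operatorname{Ho}\operatorname{Fun}(P,\mathcal{M})$ such that $\zeta=\varepsilon_n\circ\upsilon$ in $\operatorname{Ho}\operatorname{Fun}(P,\mathcal{M})$.
   Context: A lattice is a poset with all binary joins $\vee$ and meets $\wedge$, viewed as a category; it is distributive if $x\wedge(y\vee z)=(x\wedge y)\vee(x\wedge z)$ for all $x,y,z$. Cubes. Let $[n]=\{0,\dots,n\}$ and let $\mathcal{P}_{n+1}$ be the power set of $[n]$ ordered by inclusion. An $(n+1)$-cube in a category $C$ is a functor $\mathcal{X}\colon\mathcal{P}_{n+1}\to C$. It is cocartesian if $\operatorname{colim}_{S\subsetneq[n]}\mathcal{X}(S)\to\mathcal{X}([n])$ is an isomorphism, and cartesian if $\mathcal{X}(\emptyset)\to\lim_{\emptyset\ne S\subseteq[n]}\mathcal{X}(S)$ is an isomorphism. It is strongly bicartesian if every face of dimension $\ge 2$ is both cartesian and cocartesian (so every 1-cube is strongly bicartesian). A cube in a model category is homotopy cocartesian if $\operatorname{hocolim}_{S\subsetneq[n]}\mathcal{X}(S)\to\mathcal{X}([n])$ is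 a weak equivalence. A model category $\mathcal{M}$ is good if $\operatorname{Fun}(P,\mathcal{M})$ admits the projective model structure for every poset $P$. $\operatorname{Ho}\operatorname{Fun}(P,\mathcal{M})$ is the localization of $\operatorname{Fun}(P,\mathcal{M})$ at the objectwise weak equivalences. A functor $F\colon P\to\mathcal{M}$ from a lattice to a good model category is codegree $n$ if for every strongly bicartesian $(n+1)$-cube $\mathcal{X}$ in $P$, the cube $F\circ\mathcal{X}$ is homotopy cocartesian. Join-dimension. Let $P$ be a distributive lattice. An element $v$ is join-irreducible if there are no $x,y<v$ with $v=x\vee y$. A join-decomposition of $v$ of size $k$ is a finite collection $p^0,\dots,p^{k-1}$ with $v=p^0\vee\dots\vee p^{k-1}$; it is reduced if omitting any one $p^i$ gives a join different from $v$ (by convention the size 1 decomposition $p^0=v$ is reduced unless $v$ is minimal), and indecomposable if all $p^i$ are join-irreducible. An indecomposable reduced join-decomposition is unique if it exists. Put $\operatorname{jdim}(v)=0$ if $v$ is minimal in $P$; $\operatorname{jdim}(v)=k$ if $v$ is not minimal and has a reduced indecomposable join-decomposition of size $k$; and $\operatorname{jdim}(v)=\infty$ otherwise. Let $P_{\le k}=\{v\in P:\operatorname{jdim}(v)\le k\}$. A join-factorization lattice is a distributive lattice $P$ with a minimal element for which there exist a distributive lattice $Q$ satisfying the descending chain condition (every nonempty subset of $Q$ has a minimal element) and an order-preserving function $f\colon P\to Q$ with $\operatorname{jdim}(f(v))=\operatorname{jdim}(v)$ for all $v\in P$. The codegree $k$ approximation $T_kF$ of $F\colon P\to\mathcal{M}$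 is the homotopy left Kan extension of $F|_{P_{\le k}}$ along the inclusion $P_{\le k}\hookrightarrow P$; on objects $T_kF(x)=\operatorname{hocolim}_{v\in P_{\le k},\,v\le x}F(v)$. The map $\varepsilon_k\colon T_kF\to F$ is the canonical comparison map. Concretely: if $q_k\colon Q_k\to F|_{P_{\le k}}$ is a projectively cofibrant replacement, then $T_kF$ is the left Kan extension of $Q_k$ along $P_{\le k}\hookrightarrow P$ and $\varepsilon_k$ corresponds to $q_k$ under the universal property. *)

theory Defs
  imports "HOL-Algebra.Lattice" "HOL-Library.Extended_Nat" "HOL-Library.FuncSet"
begin

section \<open>Categories and functors\<close>

record ('o, 'a) precat =
  Obj :: "'o set"
  Arr :: "'a set"
  Dom :: "'a \<Rightarrow> 'o"
  Cod :: "'a \<Rightarrow> 'o"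
  Id :: "'o \<Rightarrow> 'a"
  Comp :: "'a \<Rightarrow> 'a \<Rightarrow> 'a" (infixr "\<cdot>\<index>" 70)

definition Hom :: "('o, 'a, 'z) precat_scheme \<Rightarrow> 'o \<Rightarrow> 'o \<Rightarrow> 'a set" where
  "Hom C x y = {f \<in> Arr C. Dom C f = x \<and> Cod C f = y}"

locale category =
  fixes C :: "('o, 'a, 'z) precat_scheme" (structure)
  assumes dom_obj: "f \<in> Arr C \<Longrightarrow> Dom C f \<in> Obj C"
    and cod_obj: "f \<in> Arr C \<Longrightarrow> Cod C f \<in> Obj C"
    and id_hom: "x \<in> Obj C \<Longrightarrow> Id C x \<in> Hom C x x"
    and comp_hom: "\<lbrakk>f \<in> Hom C x y; g \<in> Hom C y z\<rbrakk> \<Longrightarrow> g \<cdot> f \<in> Hom C x z"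
    and id_right: "f \<in> Hom C x y \<Longrightarrow> f \<cdot> Id C x = f"
    and id_left: "f \<in> Hom C x y \<Longrightarrow> Id C y \<cdot> f = f"
    and comp_assoc:
      "\<lbrakk>f \<in> Hom C w x; g \<in> Hom C x y; h \<in> Hom C y z\<rbrakk> \<Longrightarrow> h \<cdot> (g \<cdot> f) = (h \<cdot> g) \<cdot> f"

definition is_iso :: "('o, 'a, 'z) precat_scheme \<Rightarrow> 'a \<Rightarrow> bool" where
  "is_iso C f \<longleftrightarrow> f \<in> Arr C \<and>
     (\<exists>g \<in> Hom C (Cod C f) (Dom C f).
        g \<cdot>\<^bsub>C\<^esub> f = Id C (Dom C f) \<and> f \<cdot>\<^bsub>C\<^esub> g = Id C (Cod C f))"

definition is_initial :: "('o, 'a, 'z) precat_scheme \<Rightarrow> 'o \<Rightarrow> bool" where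
  "is_initial C i \<longleftrightarrow> i \<in> Obj C \<and> (\<forall>x \<in> Obj C. \<exists>!f. f \<in> Hom C i x)"

text \<open>
  Functors and natural transformations are required to be \<open>undefined\<close> off the source category,
  so that they are equal in the logic exactly when they are equal as functors or transformations.
\<close>

record ('o1, 'a1, 'o2, 'a2) func =
  fobj :: "'o1 \<Rightarrow> 'o2"
  farr :: "'a1 \<Rightarrow> 'a2"

definition is_functor ::
  "('o1, 'a1, 'y) precat_scheme \<Rightarrow> ('o2, 'a2, 'z) precat_scheme \<Rightarrow> ('o1, 'a1, 'o2, 'a2) func \<Rightarrow> bool"
where
  "is_functor C D F \<longleftrightarrow>
     fobj F \<in> Obj C \<rightarrow>\<^sub>E Obj D \<and>
     farr F \<in> Arr C \<rightarrow>\<^sub>E Arr D \<and>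
     (\<forall>f \<in> Arr C. farr F f \<in> Hom D (fobj F (Dom C f)) (fobj F (Cod C f))) \<and>
     (\<forall>x \<in> Obj C. farr F (Id C x) = Id D (fobj F x)) \<and>
     (\<forall>f \<in> Arr C. \<forall>g \<in> Arr C. Cod C f = Dom C g \<longrightarrow>
        farr F (g \<cdot>\<^bsub>C\<^esub> f) = farr F g \<cdot>\<^bsub>D\<^esub> farr F f)"

definition comp_functor ::
  "('o1, 'a1, 'y) precat_scheme \<Rightarrow> ('o2, 'a2, 'o3, 'a3) func \<Rightarrow> ('o1, 'a1, 'o2, 'a2) func
    \<Rightarrow> ('o1, 'a1, 'o3, 'a3) func"
where
  "comp_functor C G F =
     \<lparr> fobj = compose (Obj C) (fobj G) (fobj F), farr = compose (Arr C) (farr G) (farr F) \<rparr>"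

definition incl_functor :: "('o, 'a, 'y) precat_scheme \<Rightarrow> ('o, 'a, 'o, 'a) func" where
  "incl_functor J = \<lparr> fobj = (\<lambda>x \<in> Obj J. x), farr = (\<lambda>f \<in> Arr J. f) \<rparr>"

record ('o1, 'a1, 'o2, 'a2) ntrans =
  nt_dom :: "('o1, 'a1, 'o2, 'a2) func"
  nt_cod :: "('o1, 'a1, 'o2, 'a2) func"
  nt_at :: "'o1 \<Rightarrow> 'a2"

definition is_nat_trans ::
  "('o1, 'a1, 'y) precat_scheme \<Rightarrow> ('o2, 'a2, 'z) precat_scheme \<Rightarrow> ('o1, 'a1, 'o2, 'a2) ntrans \<Rightarrow> bool"
where
  "is_nat_trans C D \<eta> \<longleftrightarrow>
     is_functor C D (nt_dom \<eta>) \<and> is_functor C D (nt_cod \<eta>) \<and>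
     nt_at \<eta> \<in> extensional (Obj C) \<and>
     (\<forall>x \<in> Obj C. nt_at \<eta> x \<in> Hom D (fobj (nt_dom \<eta>) x) (fobj (nt_cod \<eta>) x)) \<and>
     (\<forall>f \<in> Arr C. nt_at \<eta> (Cod C f) \<cdot>\<^bsub>D\<^esub> farr (nt_dom \<eta>) f
                    = farr (nt_cod \<eta>) f \<cdot>\<^bsub>D\<^esub> nt_at \<eta> (Dom C f))"

definition functor_cat ::
  "('o1, 'a1, 'y) precat_scheme \<Rightarrow> ('o2, 'a2, 'z) precat_scheme
    \<Rightarrow> (('o1, 'a1, 'o2, 'a2) func, ('o1, 'a1, 'o2, 'a2) ntrans) precat"
where
  "functor_cat C D =
     \<lparr> Obj = {F. is_functor C D F},
       Arr = {\<eta>. is_nat_trans C D \<eta>},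
       Dom = nt_dom,
       Cod = nt_cod,
       Id = (\<lambda>F. \<lparr> nt_dom = F, nt_cod = F, nt_at = (\<lambda>x \<in> Obj C. Id D (fobj F x)) \<rparr>),
       Comp = (\<lambda>\<beta> \<alpha>. \<lparr> nt_dom = nt_dom \<alpha>, nt_cod = nt_cod \<beta>,
                       nt_at = (\<lambda>x \<in> Obj C. nt_at \<beta> x \<cdot>\<^bsub>D\<^esub> nt_at \<alpha> x) \<rparr>) \<rparr>"

definition whisker ::
  "('o1, 'a1, 'y) precat_scheme \<Rightarrow> ('o2, 'a2, 'o3, 'a3) ntrans \<Rightarrow> ('o1, 'a1, 'o2, 'a2) func
    \<Rightarrow> ('o1, 'a1, 'o3, 'a3) ntrans"
where
  "whisker J \<beta> K =
     \<lparr> nt_dom = comp_functor J (nt_dom \<beta>) K, nt_cod = comp_functor J (nt_cod \<beta>) K,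
       nt_at = compose (Obj J) (nt_at \<beta>) (fobj K) \<rparr>"

subsection \<open>Limits, colimits, left Kan extensions\<close>

definition is_cocone ::
  "('j, 'b, 'y) precat_scheme \<Rightarrow> ('o, 'a, 'z) precat_scheme \<Rightarrow> ('j, 'b, 'o, 'a) func
    \<Rightarrow> 'o \<Rightarrow> ('j \<Rightarrow> 'a) \<Rightarrow> bool"
where
  "is_cocone J C D c l \<longleftrightarrow>
     c \<in> Obj C \<and> (\<forall>j \<in> Obj J. l j \<in> Hom C (fobj D j) c) \<and>
     (\<forall>f \<in> Arr J. l (Cod J f) \<cdot>\<^bsub>C\<^esub> farr D f = l (Dom J f))"

definition is_colimit ::
  "('j, 'b, 'y) precat_scheme \<Rightarrow> ('o, 'a, 'z) precat_scheme \<Rightarrow> ('j, 'b, 'o, 'a) func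
    \<Rightarrow> 'o \<Rightarrow> ('j \<Rightarrow> 'a) \<Rightarrow> bool"
where
  "is_colimit J C D c l \<longleftrightarrow>
     is_cocone J C D c l \<and>
     (\<forall>c' l'. is_cocone J C D c' l' \<longrightarrow>
        (\<exists>!u. u \<in> Hom C c c' \<and> (\<forall>j \<in> Obj J. u \<cdot>\<^bsub>C\<^esub> l j = l' j)))"

definition is_cone ::
  "('j, 'b, 'y) precat_scheme \<Rightarrow> ('o, 'a, 'z) precat_scheme \<Rightarrow> ('j, 'b, 'o, 'a) func
    \<Rightarrow> 'o \<Rightarrow> ('j \<Rightarrow> 'a) \<Rightarrow> bool"
where
  "is_cone J C D c l \<longleftrightarrow>
     c \<in> Obj C \<and> (\<forall>j \<in> Obj J. l j \<in> Hom C c (fobj D j)) \<and>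
     (\<forall>f \<in> Arr J. farr D f \<cdot>\<^bsub>C\<^esub> l (Dom J f) = l (Cod J f))"

definition is_limit ::
  "('j, 'b, 'y) precat_scheme \<Rightarrow> ('o, 'a, 'z) precat_scheme \<Rightarrow> ('j, 'b, 'o, 'a) func
    \<Rightarrow> 'o \<Rightarrow> ('j \<Rightarrow> 'a) \<Rightarrow> bool"
where
  "is_limit J C D c l \<longleftrightarrow>
     is_cone J C D c l \<and>
     (\<forall>c' l'. is_cone J C D c' l' \<longrightarrow>
        (\<exists>!u. u \<in> Hom C c' c \<and> (\<forall>j \<in> Obj J. l j \<cdot>\<^bsub>C\<^esub> u = l' j)))"

definition is_left_kan_extension ::
  "('j, 'b, 'x) precat_scheme \<Rightarrow> ('o1, 'a1, 'y) precat_scheme \<Rightarrow> ('o2, 'a2, 'z) precat_scheme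
    \<Rightarrow> ('j, 'b, 'o1, 'a1) func \<Rightarrow> ('j, 'b, 'o2, 'a2) func
    \<Rightarrow> ('o1, 'a1, 'o2, 'a2) func \<Rightarrow> ('j, 'b, 'o2, 'a2) ntrans \<Rightarrow> bool"
where
  "is_left_kan_extension J C D K Q T \<eta> \<longleftrightarrow>
     T \<in> Obj (functor_cat C D) \<and>
     \<eta> \<in> Hom (functor_cat J D) Q (comp_functor J T K) \<and>
     (\<forall>G \<in> Obj (functor_cat C D). \<forall>\<alpha> \<in> Hom (functor_cat J D) Q (comp_functor J G K).
        \<exists>!\<beta>. \<beta> \<in> Hom (functor_cat C D) T G \<and>
             whisker J \<beta> K \<cdot>\<^bsub>functor_cat J D\<^esub> \<eta> = \<alpha>)"

text \<open>
  Smallness is relative to a type \<open>'i\<close>: a category is small if its objects and its arrows are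
  elements of \<open>'i\<close>. For infinite \<open>'i\<close> this covers, up to isomorphism, all categories
  with at most as many arrows as \<open>'i\<close> has elements.
\<close>

definition small_cocomplete :: "'i itself \<Rightarrow> ('o, 'a, 'z) precat_scheme \<Rightarrow> bool" where
  "small_cocomplete _ C \<longleftrightarrow>
     (\<forall>(J :: ('i, 'i) precat) D. category J \<and> is_functor J C D \<longrightarrow> (\<exists>c l. is_colimit J C D c l))"

definition small_complete :: "'i itself \<Rightarrow> ('o, 'a, 'z) precat_scheme \<Rightarrow> bool" where
  "small_complete _ C \<longleftrightarrow>
     (\<forall>(J :: ('i, 'i) precat) D. category J \<and> is_functor J C D \<longrightarrow> (\<exists>c l. is_limit J C D c l))"

subsection \<open>Localization\<close>

text \<open>
  The localization of \<open>C\<close> at a set \<open>W\<close> of arrows: its arrows are zigzags, whose backward steps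
  lie in \<open>W\<close>, modulo the congruence that makes \<open>Fwd\<close> functorial and \<open>Bwd w\<close> inverse
  to \<open>Fwd w\<close>. Zigzags are read from left to right.
\<close>

datatype 'a step = Fwd 'a | Bwd 'a

fun zigzag :: "('o, 'a, 'z) precat_scheme \<Rightarrow> 'a set \<Rightarrow> 'o \<Rightarrow> 'a step list \<Rightarrow> 'o \<Rightarrow> bool" where
  "zigzag C W x [] y \<longleftrightarrow> x \<in> Obj C \<and> x = y"
| "zigzag C W x (Fwd f # s) y \<longleftrightarrow> f \<in> Arr C \<and> Dom C f = x \<and> zigzag C W (Cod C f) s y"
| "zigzag C W x (Bwd w # s) y \<longleftrightarrow>
     w \<in> Arr C \<and> w \<in> W \<and> Cod C w = x \<and> zigzag C W (Dom C w) s y"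

inductive zigzag_eq ::
  "('o, 'a, 'z) precat_scheme \<Rightarrow> 'a set \<Rightarrow> 'o \<Rightarrow> 'o \<Rightarrow> 'a step list \<Rightarrow> 'a step list \<Rightarrow> bool"
  for C :: "('o, 'a, 'z) precat_scheme" and W :: "'a set"
where
  refl: "zigzag C W x s y \<Longrightarrow> zigzag_eq C W x y s s"
| sym: "zigzag_eq C W x y s t \<Longrightarrow> zigzag_eq C W x y t s"
| trans: "\<lbrakk>zigzag_eq C W x y s t; zigzag_eq C W x y t u\<rbrakk> \<Longrightarrow> zigzag_eq C W x y s u"
| cong: "\<lbrakk>zigzag C W x u x'; zigzag_eq C W x' y' s t; zigzag C W y' v y\<rbrakk>
           \<Longrightarrow> zigzag_eq C W x y (u @ s @ v) (u @ t @ v)"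
| ident: "x \<in> Obj C \<Longrightarrow> zigzag_eq C W x x [Fwd (Id C x)] []"
| comp: "\<lbrakk>f \<in> Hom C x y; g \<in> Hom C y z\<rbrakk>
           \<Longrightarrow> zigzag_eq C W x z [Fwd f, Fwd g] [Fwd (g \<cdot>\<^bsub>C\<^esub> f)]"
| inv_right: "\<lbrakk>w \<in> W; w \<in> Hom C x y\<rbrakk> \<Longrightarrow> zigzag_eq C W x x [Fwd w, Bwd w] []"
| inv_left: "\<lbrakk>w \<in> W; w \<in> Hom C x y\<rbrakk> \<Longrightarrow> zigzag_eq C W y y [Bwd w, Fwd w] []"

definition zigzag_class ::
  "('o, 'a, 'z) precat_scheme \<Rightarrow> 'a set \<Rightarrow> 'o \<Rightarrow> 'o \<Rightarrow> 'a step list \<Rightarrow> 'a step list set"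
where
  "zigzag_class C W x y s = {t. zigzag_eq C W x y s t}"

definition localization ::
  "('o, 'a, 'z) precat_scheme \<Rightarrow> 'a set \<Rightarrow> ('o, 'o \<times> 'a step list set \<times> 'o) precat"
where
  "localization C W =
     \<lparr> Obj = Obj C,
       Arr = {(x, zigzag_class C W x y s, y) | x s y. zigzag C W x s y},
       Dom = (\<lambda>(x, _, _). x),
       Cod = (\<lambda>(_, _, y). y),
       Id = (\<lambda>x. (x, zigzag_class C W x x [], x)),
       Comp = (\<lambda>(_, B, z) (x, A, _). (x, \<Union>s\<in>A. \<Union>t\<in>B. zigzag_class C W x z (s @ t), z)) \<rparr>"

definition loc_arr ::
  "('o, 'a, 'z) precat_scheme \<Rightarrow> 'a set \<Rightarrow> 'a \<Rightarrow> 'o \<times> 'a step list set \<times> 'o"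
where
  "loc_arr C W f = (Dom C f, zigzag_class C W (Dom C f) (Cod C f) [Fwd f], Cod C f)"

section \<open>Model categories\<close>

record ('o, 'a) premodel = "('o, 'a) precat" +
  weq :: "'a set"
  cof :: "'a set"
  fib :: "'a set"

definition wide_subcategory :: "('o, 'a, 'z) precat_scheme \<Rightarrow> 'a set \<Rightarrow> bool" where
  "wide_subcategory C S \<longleftrightarrow>
     S \<subseteq> Arr C \<and> (\<forall>x \<in> Obj C. Id C x \<in> S) \<and>
     (\<forall>f \<in> S. \<forall>g \<in> S. Cod C f = Dom C g \<longrightarrow> g \<cdot>\<^bsub>C\<^esub> f \<in> S)"

definition two_out_of_three :: "('o, 'a, 'z) precat_scheme \<Rightarrow> 'a set \<Rightarrow> bool" where
  "two_out_of_three C S \<longleftrightarrow>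
     (\<forall>f \<in> Arr C. \<forall>g \<in> Arr C. Cod C f = Dom C g \<longrightarrow>
        (f \<in> S \<and> g \<in> S \<longrightarrow> g \<cdot>\<^bsub>C\<^esub> f \<in> S) \<and>
        (f \<in> S \<and> g \<cdot>\<^bsub>C\<^esub> f \<in> S \<longrightarrow> g \<in> S) \<and>
        (g \<in> S \<and> g \<cdot>\<^bsub>C\<^esub> f \<in> S \<longrightarrow> f \<in> S))"

definition retract_of :: "('o, 'a, 'z) precat_scheme \<Rightarrow> 'a \<Rightarrow> 'a \<Rightarrow> bool" where
  "retract_of C f g \<longleftrightarrow> f \<in> Arr C \<and> g \<in> Arr C \<and>
     (\<exists>i \<in> Hom C (Dom C f) (Dom C g). \<exists>r \<in> Hom C (Dom C g) (Dom C f).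
      \<exists>i' \<in> Hom C (Cod C f) (Cod C g). \<exists>r' \<in> Hom C (Cod C g) (Cod C f).
        r \<cdot>\<^bsub>C\<^esub> i = Id C (Dom C f) \<and> r' \<cdot>\<^bsub>C\<^esub> i' = Id C (Cod C f) \<and>
        g \<cdot>\<^bsub>C\<^esub> i = i' \<cdot>\<^bsub>C\<^esub> f \<and> f \<cdot>\<^bsub>C\<^esub> r = r' \<cdot>\<^bsub>C\<^esub> g)"

definition retract_closed :: "('o, 'a, 'z) precat_scheme \<Rightarrow> 'a set \<Rightarrow> bool" where
  "retract_closed C S \<longleftrightarrow> (\<forall>f g. g \<in> S \<and> retract_of C f g \<longrightarrow> f \<in> S)"

definition has_lifting :: "('o, 'a, 'z) precat_scheme \<Rightarrow> 'a \<Rightarrow> 'a \<Rightarrow> bool" where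
  "has_lifting C i p \<longleftrightarrow>
     (\<forall>u \<in> Hom C (Dom C i) (Dom C p). \<forall>v \<in> Hom C (Cod C i) (Cod C p).
        p \<cdot>\<^bsub>C\<^esub> u = v \<cdot>\<^bsub>C\<^esub> i \<longrightarrow>
        (\<exists>h \<in> Hom C (Cod C i) (Dom C p). h \<cdot>\<^bsub>C\<^esub> i = u \<and> p \<cdot>\<^bsub>C\<^esub> h = v))"

definition factorizes :: "('o, 'a, 'z) precat_scheme \<Rightarrow> 'a set \<Rightarrow> 'a set \<Rightarrow> bool" where
  "factorizes C L R \<longleftrightarrow>
     (\<forall>f \<in> Arr C. \<exists>i \<in> L. \<exists>p \<in> R. Cod C i = Dom C p \<and> f = p \<cdot>\<^bsub>C\<^esub> i)"

text \<open>Factorizations are required to exist, but not to be functorial.\<close>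

definition model_category :: "'i itself \<Rightarrow> ('o, 'a) premodel \<Rightarrow> bool" where
  "model_category small M \<longleftrightarrow>
     category M \<and> small_complete small M \<and> small_cocomplete small M \<and>
     wide_subcategory M (weq M) \<and> wide_subcategory M (cof M) \<and> wide_subcategory M (fib M) \<and>
     two_out_of_three M (weq M) \<and>
     retract_closed M (weq M) \<and> retract_closed M (cof M) \<and> retract_closed M (fib M) \<and>
     (\<forall>i \<in> cof M. \<forall>p \<in> fib M \<inter> weq M. has_lifting M i p) \<and>
     (\<forall>i \<in> cof M \<inter> weq M. \<forall>p \<in> fib M. has_lifting M i p) \<and>
     factorizes M (cof M) (fib M \<inter> weq M) \<and>
     factorizes M (cof M \<inter> weq M) (fib M)"

definition cofibrant :: "('o, 'a) premodel \<Rightarrow> 'o \<Rightarrow> bool" where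
  "cofibrant M x \<longleftrightarrow> (\<exists>i f. is_initial M i \<and> f \<in> Hom M i x \<and> f \<in> cof M)"

definition cofibrant_replacement :: "('o, 'a) premodel \<Rightarrow> 'o \<Rightarrow> 'o \<Rightarrow> 'a \<Rightarrow> bool" where
  "cofibrant_replacement M x q_obj q \<longleftrightarrow>
     cofibrant M q_obj \<and> q \<in> Hom M q_obj x \<and> q \<in> weq M"

definition objectwise ::
  "('o1, 'a1, 'y) precat_scheme \<Rightarrow> ('o2, 'a2, 'z) precat_scheme \<Rightarrow> 'a2 set
    \<Rightarrow> ('o1, 'a1, 'o2, 'a2) ntrans set"
where
  "objectwise C D S = {\<eta> \<in> Arr (functor_cat C D). \<forall>x \<in> Obj C. nt_at \<eta> x \<in> S}"

text \<open>
  The category \<open>Fun(C, M)\<close> with its three projective classes of maps; whether these form a model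
  structure depends on \<open>C\<close> and \<open>M\<close>.
\<close>

definition projective ::
  "('o1, 'a1, 'y) precat_scheme \<Rightarrow> ('o2, 'a2) premodel
    \<Rightarrow> (('o1, 'a1, 'o2, 'a2) func, ('o1, 'a1, 'o2, 'a2) ntrans) premodel"
where
  "projective C M =
     precat.extend (functor_cat C M)
       (premodel.fields
          (objectwise C M (weq M))
          {i \<in> Arr (functor_cat C M).
             \<forall>p \<in> objectwise C M (fib M \<inter> weq M). has_lifting (functor_cat C M) i p}
          (objectwise C M (fib M)))"

section \<open>Posets as categories, cubes\<close>

definition poset_cat :: "('p, 'z) gorder_scheme \<Rightarrow> ('p, 'p \<times> 'p) precat" where
  "poset_cat P =
     \<lparr> Obj = carrier P,
       Arr = {(x, y). x \<in> carrier P \<and> y \<in> carrier P \<and> x \<sqsubseteq>\<^bsub>P\<^esub> y},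
       Dom = fst,
       Cod = snd,
       Id = (\<lambda>x. (x, x)),
       Comp = (\<lambda>g f. (fst f, snd g)) \<rparr>"

text \<open>
  The posets quantified over have their carrier in the type \<open>'i\<close> that also governs smallness.
\<close>

definition good_model_category :: "'i itself \<Rightarrow> ('o, 'a) premodel \<Rightarrow> bool" where
  "good_model_category small M \<longleftrightarrow>
     model_category small M \<and>
     (\<forall>P :: 'i gorder. partial_order P \<longrightarrow> model_category small (projective (poset_cat P) M))"

text \<open>
  A cube is a functor out of \<open>cube_cat N\<close>, with \<open>N\<close> a finite set of directions; an
  \<open>(n+1)\<close>-cube has \<open>N = {0..n}\<close>. Arbitrary \<open>N\<close> are allowed so that faces need not be
  reindexed.
\<close>

definition subset_cat :: "nat set set \<Rightarrow> (nat set, nat set \<times> nat set) precat" where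
  "subset_cat A = poset_cat \<lparr> carrier = A, eq = (=), le = (\<subseteq>) \<rparr>"

definition cube_cat :: "nat set \<Rightarrow> (nat set, nat set \<times> nat set) precat" where
  "cube_cat N = subset_cat (Pow N)"

definition cocartesian_cube ::
  "('o, 'a, 'z) precat_scheme \<Rightarrow> nat set \<Rightarrow> (nat set, nat set \<times> nat set, 'o, 'a) func \<Rightarrow> bool"
where
  "cocartesian_cube C N X \<longleftrightarrow>
     (let J = subset_cat (Pow N - {N}) in
      \<exists>c l u. is_colimit J C (comp_functor J X (incl_functor J)) c l \<and>
        u \<in> Hom C c (fobj X N) \<and> (\<forall>S \<in> Obj J. u \<cdot>\<^bsub>C\<^esub> l S = farr X (S, N)) \<and> is_iso C u)"

definition cartesian_cube ::
  "('o, 'a, 'z) precat_scheme \<Rightarrow> nat set \<Rightarrow> (nat set, nat set \<times> nat set, 'o, 'a) func \<Rightarrow> bool"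
where
  "cartesian_cube C N X \<longleftrightarrow>
     (let J = subset_cat (Pow N - {{}}) in
      \<exists>c l u. is_limit J C (comp_functor J X (incl_functor J)) c l \<and>
        u \<in> Hom C (fobj X {}) c \<and> (\<forall>S \<in> Obj J. l S \<cdot>\<^bsub>C\<^esub> u = farr X ({}, S)) \<and> is_iso C u)"

text \<open>The face between \<open>A \<subseteq> B\<close> is the cube \<open>U \<mapsto> X (A \<union> U)\<close> with directions \<open>B - A\<close>.\<close>

definition cube_face ::
  "(nat set, nat set \<times> nat set, 'o, 'a) func \<Rightarrow> nat set \<Rightarrow> nat set
    \<Rightarrow> (nat set, nat set \<times> nat set, 'o, 'a) func"
where
  "cube_face X A B =
     \<lparr> fobj = (\<lambda>U \<in> Obj (cube_cat (B - A)). fobj X (A \<union> U)),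
       farr = (\<lambda>(U, V) \<in> Arr (cube_cat (B - A)). farr X (A \<union> U, A \<union> V)) \<rparr>"

definition strongly_bicartesian_cube ::
  "('o, 'a, 'z) precat_scheme \<Rightarrow> nat set \<Rightarrow> (nat set, nat set \<times> nat set, 'o, 'a) func \<Rightarrow> bool"
where
  "strongly_bicartesian_cube C N X \<longleftrightarrow>
     (\<forall>A B. A \<subseteq> B \<and> B \<subseteq> N \<and> 2 \<le> card (B - A) \<longrightarrow>
        cartesian_cube C (B - A) (cube_face X A B) \<and>
        cocartesian_cube C (B - A) (cube_face X A B))"

text \<open>
  The homotopy colimit over the punctured cube is the colimit \<open>c\<close> of a projectively cofibrant
  replacement \<open>q : Q \<rightarrow> X\<close>, and \<open>u\<close> is the induced map to \<open>X(N)\<close>. In a good model category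
  such data exist and the condition does not depend on them.
\<close>

definition homotopy_cocartesian_cube ::
  "('o, 'a) premodel \<Rightarrow> nat set \<Rightarrow> (nat set, nat set \<times> nat set, 'o, 'a) func \<Rightarrow> bool"
where
  "homotopy_cocartesian_cube M N X \<longleftrightarrow>
     (let J = subset_cat (Pow N - {N}) in
      \<exists>Q q c l u.
        cofibrant_replacement (projective J M) (comp_functor J X (incl_functor J)) Q q \<and>
        is_colimit J M Q c l \<and>
        u \<in> Hom M c (fobj X N) \<and>
        (\<forall>S \<in> Obj J. u \<cdot>\<^bsub>M\<^esub> l S = farr X (S, N) \<cdot>\<^bsub>M\<^esub> nt_at q S) \<and>
        u \<in> weq M)"

definition codegree ::
  "('p, 'z) gorder_scheme \<Rightarrow> ('o, 'a) premodel \<Rightarrow> nat \<Rightarrow> ('p, 'p \<times> 'p, 'o, 'a) func \<Rightarrow> bool"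
where
  "codegree P M n F \<longleftrightarrow>
     (\<forall>X. is_functor (cube_cat {0..n}) (poset_cat P) X \<and>
          strongly_bicartesian_cube (poset_cat P) {0..n} X \<longrightarrow>
          homotopy_cocartesian_cube M {0..n} (comp_functor (cube_cat {0..n}) F X))"

section \<open>Join-dimension\<close>

definition distributive_lattice :: "('p, 'z) gorder_scheme \<Rightarrow> bool" where
  "distributive_lattice P \<longleftrightarrow> lattice P \<and>
     (\<forall>x \<in> carrier P. \<forall>y \<in> carrier P. \<forall>z \<in> carrier P.
        x \<sqinter>\<^bsub>P\<^esub> (y \<squnion>\<^bsub>P\<^esub> z) = (x \<sqinter>\<^bsub>P\<^esub> y) \<squnion>\<^bsub>P\<^esub> (x \<sqinter>\<^bsub>P\<^esub> z))"

definition minimal_in :: "('p, 'z) gorder_scheme \<Rightarrow> 'p set \<Rightarrow> 'p \<Rightarrow> bool" where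
  "minimal_in P A v \<longleftrightarrow> v \<in> A \<and> (\<forall>x \<in> A. x \<sqsubseteq>\<^bsub>P\<^esub> v \<longrightarrow> x = v)"

definition join_irreducible :: "('p, 'z) gorder_scheme \<Rightarrow> 'p \<Rightarrow> bool" where
  "join_irreducible P v \<longleftrightarrow> v \<in> carrier P \<and>
     \<not> (\<exists>x \<in> carrier P. \<exists>y \<in> carrier P. x \<sqsubset>\<^bsub>P\<^esub> v \<and> y \<sqsubset>\<^bsub>P\<^esub> v \<and> v = x \<squnion>\<^bsub>P\<^esub> y)"

definition join_decomposition :: "('p, 'z) gorder_scheme \<Rightarrow> 'p \<Rightarrow> nat \<Rightarrow> (nat \<Rightarrow> 'p) \<Rightarrow> bool" where
  "join_decomposition P v k p \<longleftrightarrow>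
     0 < k \<and> p ` {..<k} \<subseteq> carrier P \<and> v = \<Squnion>\<^bsub>P\<^esub> (p ` {..<k})"

definition reduced_decomposition :: "('p, 'z) gorder_scheme \<Rightarrow> 'p \<Rightarrow> nat \<Rightarrow> (nat \<Rightarrow> 'p) \<Rightarrow> bool" where
  "reduced_decomposition P v k p \<longleftrightarrow>
     join_decomposition P v k p \<and>
     (if k = 1 then \<not> minimal_in P (carrier P) v
      else \<forall>i<k. \<Squnion>\<^bsub>P\<^esub> (p ` ({..<k} - {i})) \<noteq> v)"

definition indecomposable_decomposition ::
  "('p, 'z) gorder_scheme \<Rightarrow> 'p \<Rightarrow> nat \<Rightarrow> (nat \<Rightarrow> 'p) \<Rightarrow> bool"
where
  "indecomposable_decomposition P v k p \<longleftrightarrow>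
     join_decomposition P v k p \<and> (\<forall>i<k. join_irreducible P (p i))"

text \<open>In a distributive lattice the size \<open>k\<close> below is unique.\<close>

definition jdim :: "('p, 'z) gorder_scheme \<Rightarrow> 'p \<Rightarrow> enat" where
  "jdim P v =
     (if minimal_in P (carrier P) v then 0
      else if \<exists>k p. reduced_decomposition P v k p \<and> indecomposable_decomposition P v k p
      then enat (THE k. \<exists>p. reduced_decomposition P v k p \<and> indecomposable_decomposition P v k p)
      else \<infinity>)"

definition jdim_le :: "('p, 'z) gorder_scheme \<Rightarrow> nat \<Rightarrow> ('p, 'z) gorder_scheme" where
  "jdim_le P k = P\<lparr> carrier := {v \<in> carrier P. jdim P v \<le> enat k} \<rparr>"

definition descending_chain_condition :: "('p, 'z) gorder_scheme \<Rightarrow> bool" where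
  "descending_chain_condition P \<longleftrightarrow>
     (\<forall>A. A \<subseteq> carrier P \<and> A \<noteq> {} \<longrightarrow> (\<exists>v. minimal_in P A v))"

text \<open>
  The type \<open>'q\<close> carries the auxiliary lattice. A theorem assuming
  \<open>join_factorization_lattice TYPE('q) P\<close> with \<open>'q\<close> a type variable covers auxiliary lattices
  on all types.
\<close>

definition join_factorization_lattice :: "'q itself \<Rightarrow> ('p, 'z) gorder_scheme \<Rightarrow> bool" where
  "join_factorization_lattice _ P \<longleftrightarrow>
     distributive_lattice P \<and> (\<exists>v. minimal_in P (carrier P) v) \<and>
     (\<exists>(Q :: 'q gorder) f.
        distributive_lattice Q \<and> descending_chain_condition Q \<and>
        f \<in> carrier P \<rightarrow> carrier Q \<and> isotone P Q f \<and>
        (\<forall>v \<in> carrier P. jdim Q (f v) = jdim P v))"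

section \<open>Codegree approximation\<close>

text \<open>
  \<open>(T, \<epsilon>)\<close> is a codegree \<open>k\<close> approximation of \<open>F\<close>, computed from some projectively cofibrant
  replacement \<open>q : Q \<rightarrow> F\<close> on the subposet of elements of join-dimension at most \<open>k\<close>.
\<close>

definition codegree_approximation ::
  "('p, 'z) gorder_scheme \<Rightarrow> ('o, 'a) premodel \<Rightarrow> nat \<Rightarrow> ('p, 'p \<times> 'p, 'o, 'a) func
    \<Rightarrow> ('p, 'p \<times> 'p, 'o, 'a) func \<Rightarrow> ('p, 'p \<times> 'p, 'o, 'a) ntrans \<Rightarrow> bool"
where
  "codegree_approximation P M k F T \<epsilon> \<longleftrightarrow>
     (let J = poset_cat (jdim_le P k); K = incl_functor J in
      \<exists>Q q \<eta>.
        cofibrant_replacement (projective J M) (comp_functor J F K) Q q \<and>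
        is_left_kan_extension J (poset_cat P) M K Q T \<eta> \<and>
        \<epsilon> \<in> Hom (functor_cat (poset_cat P) M) T F \<and>
        whisker J \<epsilon> K \<cdot>\<^bsub>functor_cat J M\<^esub> \<eta> = q)"

abbreviation Fun ::
  "('p, 'z) gorder_scheme \<Rightarrow> ('o, 'a) premodel
    \<Rightarrow> (('p, 'p \<times> 'p, 'o, 'a) func, ('p, 'p \<times> 'p, 'o, 'a) ntrans) precat"
where
  "Fun P M \<equiv> functor_cat (poset_cat P) M"

definition Ho_Fun ::
  "('p, 'z) gorder_scheme \<Rightarrow> ('o, 'a) premodel
    \<Rightarrow> (('p, 'p \<times> 'p, 'o, 'a) func,
        ('p, 'p \<times> 'p, 'o, 'a) func \<times> ('p, 'p \<times> 'p, 'o, 'a) ntrans step list set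
          \<times> ('p, 'p \<times> 'p, 'o, 'a) func) precat"
where
  "Ho_Fun P M = localization (Fun P M) (objectwise (poset_cat P) M (weq M))"

definition Ho_class ::
  "('p, 'z) gorder_scheme \<Rightarrow> ('o, 'a) premodel \<Rightarrow> ('p, 'p \<times> 'p, 'o, 'a) ntrans
    \<Rightarrow> ('p, 'p \<times> 'p, 'o, 'a) func \<times> ('p, 'p \<times> 'p, 'o, 'a) ntrans step list set
          \<times> ('p, 'p \<times> 'p, 'o, 'a) func"
where
  "Ho_class P M \<alpha> = loc_arr (Fun P M) (objectwise (poset_cat P) M (weq M)) \<alpha>"

end

(*
  Let J be the subposet of elements of join-dimension at most n, and T the left Kan extension to P of
  a projectively cofibrant Q on J. For a strongly bicartesian (n+1)-cube X, an element v of J below the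
  top vertex X N is a join of at most n join-primes, each of which lies below all but at most one of the
  n+1 facets X (N - {i}); so v lies below a facet, and there is a least vertex s v above it. Hence T o X,
  restricted to the punctured cube, is the left Kan extension along s of the restriction of Q to a
  down-set of J. It is therefore cofibrant as it stands, with colimit T (X N), and T is codegree n.

  If G is codegree n and v has an irredundant set of join-irreducibles with more than n elements, v is
  the top of a strongly bicartesian cube all of whose other vertices lie below an element of smaller
  join-dimension. The map to a lattice with descending chain condition makes this a well-founded
  recursion, so T_n G -> G is a weak equivalence as soon as it is one on J.

  For the universal property, maps Y -> Z lift to T_n Y -> T_n Z, uniquely up to a cylinder homotopy.
  So T_n acts on zigzags, the counit e is natural for this action, and T_n inverts the maps that are
  weak equivalences on J, among them epsilon. The solution of zeta = epsilon u is therefore the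
  composite of the inverse of e_G, T_n zeta, the inverse of T_n epsilon, and e_T.
*)

theory Submission
  imports Defs
begin

section \<open>Functor categories\<close>

text \<open>Factorizations in \<open>M\<close> need not be functorial, so the approximations cannot
  be chosen as an endofunctor of \<open>Fun(P, M)\<close>. Each functor gets some approximation, and
  the coherence lacking between the choices is recovered only in the localization, on zigzags.
  Moreover the given \<open>\<epsilon>\<close> comes from a replacement that is merely a weak
  equivalence, whereas lifts need a trivial fibration. The chosen approximations are therefore
  independent of it, and \<open>\<epsilon>\<close> enters only as a map that is a weak equivalence
  on \<open>J\<close>.

  Weak equivalences on \<open>P\<close> are obtained from lifting properties on \<open>J\<close>: a
  map lifting against all fibrations is a weak equivalence by the retract argument, and passing to
  colimits over down-sets keeps this property, because constant diagrams extended by the terminal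
  object preserve fibrations.

  Goodness and cocompleteness speak of index categories inside one type. \<open>'p + nat\<close> is
  infinite and has room for the elements of \<open>P\<close>, for pairs of them, for the finite
  punctured cubes, and for the two-object category that indexes binary coproducts.\<close>

lemma HomD:
  assumes "f \<in> Hom C x y"
  shows "f \<in> Arr C" and "Dom C f = x" and "Cod C f = y"
  using assms by (auto simp: Hom_def)

context category
begin

lemma comp_arr:
  assumes "f \<in> Arr C" "g \<in> Arr C" "Cod C f = Dom C g"
  shows "g \<cdot> f \<in> Arr C" and "Dom C (g \<cdot> f) = Dom C f" and "Cod C (g \<cdot> f) = Cod C g"
  using comp_hom[of f "Dom C f" "Dom C g" g "Cod C g"] assms by (auto simp: Hom_def)

lemma assoc:
  assumes "f \<in> Arr C" "g \<in> Arr C" "h \<in> Arr C" "Cod C f = Dom C g" "Cod C g = Dom C h"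
  shows "(h \<cdot> g) \<cdot> f = h \<cdot> (g \<cdot> f)"
  using comp_assoc[of f "Dom C f" "Dom C g" g "Dom C h" h "Cod C h"] assms by (auto simp: Hom_def)

lemma id_arr:
  assumes "x \<in> Obj C"
  shows "Id C x \<in> Arr C" and "Dom C (Id C x) = x" and "Cod C (Id C x) = x"
  using id_hom[OF assms] by (auto simp: Hom_def)

lemma comp_id: "\<lbrakk>f \<in> Arr C; Dom C f = x\<rbrakk> \<Longrightarrow> f \<cdot> Id C x = f"
  using id_right by (auto simp: Hom_def)

lemma id_comp: "\<lbrakk>f \<in> Arr C; Cod C f = x\<rbrakk> \<Longrightarrow> Id C x \<cdot> f = f"
  using id_left by (auto simp: Hom_def)

lemmas cat_simps = comp_arr assoc id_arr comp_id id_comp dom_obj cod_obj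

lemma hom_obj:
  assumes "f \<in> Hom C x y"
  shows "x \<in> Obj C" and "y \<in> Obj C"
  using assms dom_obj cod_obj by (auto simp: Hom_def)

end

lemma functor_cat_simps [simp]:
  "Obj (functor_cat C D) = {F. is_functor C D F}"
  "Arr (functor_cat C D) = {\<eta>. is_nat_trans C D \<eta>}"
  "Dom (functor_cat C D) = nt_dom"
  "Cod (functor_cat C D) = nt_cod"
  by (simp_all add: functor_cat_def)

lemma functor_cat_ops:
  "Id (functor_cat C D) F = \<lparr> nt_dom = F, nt_cod = F, nt_at = (\<lambda>x \<in> Obj C. Id D (fobj F x)) \<rparr>"
  "Comp (functor_cat C D) \<beta> \<alpha> = \<lparr> nt_dom = nt_dom \<alpha>, nt_cod = nt_cod \<beta>,
                       nt_at = (\<lambda>x \<in> Obj C. nt_at \<beta> x \<cdot>\<^bsub>D\<^esub> nt_at \<alpha> x) \<rparr>"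
  by (simp_all add: functor_cat_def)

lemma functorD:
  assumes "is_functor C D F"
  shows "x \<in> Obj C \<Longrightarrow> fobj F x \<in> Obj D"
    and "f \<in> Arr C \<Longrightarrow> farr F f \<in> Hom D (fobj F (Dom C f)) (fobj F (Cod C f))"
    and "x \<in> Obj C \<Longrightarrow> farr F (Id C x) = Id D (fobj F x)"
    and "\<lbrakk>f \<in> Arr C; g \<in> Arr C; Cod C f = Dom C g\<rbrakk>
      \<Longrightarrow> farr F (g \<cdot>\<^bsub>C\<^esub> f) = farr F g \<cdot>\<^bsub>D\<^esub> farr F f"
    and "fobj F \<in> extensional (Obj C)" and "farr F \<in> extensional (Arr C)"
  using assms by (auto simp: is_functor_def PiE_def)

lemma functor_eqI:
  assumes "is_functor C D F" "is_functor C D G"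
    and "\<And>x. x \<in> Obj C \<Longrightarrow> fobj F x = fobj G x"
    and "\<And>f. f \<in> Arr C \<Longrightarrow> farr F f = farr G f"
  shows "F = G"
proof -
  have "fobj F = fobj G"
    using assms functorD(5)[OF assms(1)] functorD(5)[OF assms(2)] by (intro extensionalityI) auto
  moreover have "farr F = farr G"
    using assms functorD(6)[OF assms(1)] functorD(6)[OF assms(2)] by (intro extensionalityI) auto
  ultimately show ?thesis by simp
qed

lemma natD:
  assumes "\<alpha> \<in> Hom (functor_cat C D) F G"
  shows "is_functor C D F" and "is_functor C D G"
    and "x \<in> Obj C \<Longrightarrow> nt_at \<alpha> x \<in> Hom D (fobj F x) (fobj G x)"
    and "f \<in> Arr C \<Longrightarrow> nt_at \<alpha> (Cod C f) \<cdot>\<^bsub>D\<^esub> farr F f = farr G f \<cdot>\<^bsub>D\<^esub> nt_at \<alpha> (Dom C f)"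
    and "nt_at \<alpha> \<in> extensional (Obj C)"
    and "nt_dom \<alpha> = F" and "nt_cod \<alpha> = G"
  using assms by (auto simp: Hom_def is_nat_trans_def)

lemma nat_eqI:
  assumes "\<alpha> \<in> Hom (functor_cat C D) F G" "\<beta> \<in> Hom (functor_cat C D) F G"
    and "\<And>x. x \<in> Obj C \<Longrightarrow> nt_at \<alpha> x = nt_at \<beta> x"
  shows "\<alpha> = \<beta>"
proof -
  have "nt_at \<alpha> = nt_at \<beta>"
    using assms natD(5)[OF assms(1)] natD(5)[OF assms(2)] by (intro extensionalityI) auto
  then show ?thesis
    using natD(6,7)[OF assms(1)] natD(6,7)[OF assms(2)] by simp
qed

text \<open>\<open>restrict\<close> is there because \<open>is_nat_trans\<close> demands components
  that are \<open>undefined\<close> off \<open>Obj C\<close>.\<close>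

definition mk_nat where
  "mk_nat C F G a = \<lparr> nt_dom = F, nt_cod = G, nt_at = restrict a (Obj C) \<rparr>"

lemma mk_nat_at [simp]: "x \<in> Obj C \<Longrightarrow> nt_at (mk_nat C F G a) x = a x"
  by (simp add: mk_nat_def)

lemma mk_nat_hom:
  assumes "is_functor C D F" "is_functor C D G"
    and "\<And>x. x \<in> Obj C \<Longrightarrow> a x \<in> Hom D (fobj F x) (fobj G x)"
    and "\<And>f. f \<in> Arr C \<Longrightarrow> a (Cod C f) \<cdot>\<^bsub>D\<^esub> farr F f = farr G f \<cdot>\<^bsub>D\<^esub> a (Dom C f)"
    and "category C"
  shows "mk_nat C F G a \<in> Hom (functor_cat C D) F G"
  using assms by (auto simp: Hom_def is_nat_trans_def mk_nat_def category.dom_obj category.cod_obj)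

lemma nat_comp_at [simp]:
  "x \<in> Obj C \<Longrightarrow> nt_at (\<beta> \<cdot>\<^bsub>functor_cat C D\<^esub> \<alpha>) x = nt_at \<beta> x \<cdot>\<^bsub>D\<^esub> nt_at \<alpha> x"
  by (simp add: functor_cat_ops)

lemma nat_id_at [simp]: "x \<in> Obj C \<Longrightarrow> nt_at (Id (functor_cat C D) F) x = Id D (fobj F x)"
  by (simp add: functor_cat_ops)

lemma category_functor_cat:
  assumes C: "category C" and D: "category D"
  shows "category (functor_cat C D)"
proof -
  interpret C: category C by (rule C)
  interpret D: category D by (rule D)
  let ?F = "functor_cat C D"
  have idh: "Id ?F F \<in> Hom ?F F F" if "is_functor C D F" for F
  proof -
    have "mk_nat C F F (\<lambda>x. Id D (fobj F x)) \<in> Hom ?F F F"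
    proof (rule mk_nat_hom[OF that that _ _ C])
      fix f assume f: "f \<in> Arr C"
      show "Id D (fobj F (Cod C f)) \<cdot>\<^bsub>D\<^esub> farr F f = farr F f \<cdot>\<^bsub>D\<^esub> Id D (fobj F (Dom C f))"
        using D.id_left D.id_right functorD(2)[OF that f] by metis
    qed (use functorD(1)[OF that] in \<open>auto intro: D.id_hom\<close>)
    then show ?thesis by (simp add: mk_nat_def functor_cat_ops)
  qed
  have comph: "\<beta> \<cdot>\<^bsub>?F\<^esub> \<alpha> \<in> Hom ?F F H" if a: "\<alpha> \<in> Hom ?F F G" and b: "\<beta> \<in> Hom ?F G H" for \<alpha> \<beta> F G H
  proof -
    have "mk_nat C F H (\<lambda>x. nt_at \<beta> x \<cdot>\<^bsub>D\<^esub> nt_at \<alpha> x) \<in> Hom ?F F H"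
    proof (rule mk_nat_hom[OF natD(1)[OF a] natD(2)[OF b] _ _ C])
      fix f assume f: "f \<in> Arr C"
      have d: "Dom C f \<in> Obj C" "Cod C f \<in> Obj C" using f by (auto simp: C.cat_simps)
      note h = functorD(2)[OF natD(1)[OF a] f] functorD(2)[OF natD(1)[OF b] f]
        functorD(2)[OF natD(2)[OF b] f]
        natD(3)[OF a d(1)] natD(3)[OF b d(1)] natD(3)[OF a d(2)] natD(3)[OF b d(2)]
      have "(nt_at \<beta> (Cod C f) \<cdot>\<^bsub>D\<^esub> nt_at \<alpha> (Cod C f)) \<cdot>\<^bsub>D\<^esub> farr F f
        = nt_at \<beta> (Cod C f) \<cdot>\<^bsub>D\<^esub> (farr G f \<cdot>\<^bsub>D\<^esub> nt_at \<alpha> (Dom C f))"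
        using D.comp_assoc[OF h(1) h(6) h(7)] natD(4)[OF a f] by simp
      also have "\<dots> = (farr H f \<cdot>\<^bsub>D\<^esub> nt_at \<beta> (Dom C f)) \<cdot>\<^bsub>D\<^esub> nt_at \<alpha> (Dom C f)"
        using D.comp_assoc[OF h(4) h(2) h(7)] natD(4)[OF b f] by simp
      also have "\<dots> = farr H f \<cdot>\<^bsub>D\<^esub> (nt_at \<beta> (Dom C f) \<cdot>\<^bsub>D\<^esub> nt_at \<alpha> (Dom C f))"
        using D.comp_assoc[OF h(4) h(5) h(3)] by simp
      finally show "(nt_at \<beta> (Cod C f) \<cdot>\<^bsub>D\<^esub> nt_at \<alpha> (Cod C f)) \<cdot>\<^bsub>D\<^esub> farr F f =
         farr H f \<cdot>\<^bsub>D\<^esub> (nt_at \<beta> (Dom C f) \<cdot>\<^bsub>D\<^esub> nt_at \<alpha> (Dom C f))" .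
    qed (use natD(3)[OF a] natD(3)[OF b] in \<open>auto intro: D.comp_hom\<close>)
    then show ?thesis
      using natD(6)[OF a] natD(7)[OF b] by (simp add: mk_nat_def functor_cat_ops)
  qed
  show ?thesis
  proof
    fix f x y assume f: "f \<in> Hom ?F x y"
    show "f \<cdot>\<^bsub>?F\<^esub> Id ?F x = f"
      by (rule nat_eqI[OF comph[OF idh[OF natD(1)[OF f]] f] f]) (use D.id_right natD(3)[OF f] in auto)
    show "Id ?F y \<cdot>\<^bsub>?F\<^esub> f = f"
      by (rule nat_eqI[OF comph[OF f idh[OF natD(2)[OF f]]] f]) (use D.id_left natD(3)[OF f] in auto)
  next
    fix f g h w x y z assume f: "f \<in> Hom ?F w x" and g: "g \<in> Hom ?F x y" and h: "h \<in> Hom ?F y z"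
    show "h \<cdot>\<^bsub>?F\<^esub> (g \<cdot>\<^bsub>?F\<^esub> f) = (h \<cdot>\<^bsub>?F\<^esub> g) \<cdot>\<^bsub>?F\<^esub> f"
      by (rule nat_eqI[OF comph[OF comph[OF f g] h] comph[OF f comph[OF g h]]])
        (use D.comp_assoc[OF natD(3)[OF f] natD(3)[OF g] natD(3)[OF h]] in auto)
  qed (use idh comph in \<open>auto simp: is_nat_trans_def\<close>)
qed

lemma comp_functor_simps [simp]:
  "x \<in> Obj J \<Longrightarrow> fobj (comp_functor J F K) x = fobj F (fobj K x)"
  "f \<in> Arr J \<Longrightarrow> farr (comp_functor J F K) f = farr F (farr K f)"
  by (simp_all add: comp_functor_def compose_def)

lemma is_functor_comp:
  assumes J: "category J" and K: "is_functor J C K" and F: "is_functor C D F"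
  shows "is_functor J D (comp_functor J F K)"
proof -
  interpret J: category J by (rule J)
  note k = functorD[OF K] and f = functorD[OF F]
  have k2: "farr K a \<in> Arr C" "Dom C (farr K a) = fobj K (Dom J a)" "Cod C (farr K a) = fobj K (Cod J a)"
    if "a \<in> Arr J" for a using k(2)[OF that] by (auto simp: Hom_def)
  show ?thesis
    unfolding is_functor_def
    using f(2)[OF k2(1)] by (auto simp: comp_functor_def compose_def J.cat_simps k2 f k dest: HomD(1))
qed

lemma whisker_at [simp]: "x \<in> Obj J \<Longrightarrow> nt_at (whisker J \<beta> K) x = nt_at \<beta> (fobj K x)"
  by (simp add: whisker_def compose_def)

lemma whisker_hom:
  assumes J: "category J" and K: "is_functor J C K" and b: "\<beta> \<in> Hom (functor_cat C D) F G"
  shows "whisker J \<beta> K \<in> Hom (functor_cat J D) (comp_functor J F K) (comp_functor J G K)"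
proof -
  interpret J: category J by (rule J)
  note k = functorD[OF K]
  have k2: "farr K a \<in> Arr C" "Dom C (farr K a) = fobj K (Dom J a)" "Cod C (farr K a) = fobj K (Cod J a)"
    if "a \<in> Arr J" for a using k(2)[OF that] by (auto simp: Hom_def)
  have "mk_nat J (comp_functor J F K) (comp_functor J G K) (\<lambda>x. nt_at \<beta> (fobj K x))
     \<in> Hom (functor_cat J D) (comp_functor J F K) (comp_functor J G K)"
    by (rule mk_nat_hom[OF is_functor_comp[OF J K natD(1)[OF b]]
      is_functor_comp[OF J K natD(2)[OF b]] _ _ J])
      (use natD(3)[OF b k(1)] natD(4)[OF b k2(1)] k2 in \<open>auto simp: J.cat_simps\<close>)
  then show ?thesis
    using natD(6,7)[OF b] by (simp add: mk_nat_def whisker_def compose_def)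
qed

lemma whisker_comp:
  assumes J: "category J" and D: "category D" and K: "is_functor J C K" and C: "category C"
    and a: "\<alpha> \<in> Hom (functor_cat C D) F G" and b: "\<beta> \<in> Hom (functor_cat C D) G H"
  shows "whisker J (\<beta> \<cdot>\<^bsub>functor_cat C D\<^esub> \<alpha>) K = whisker J \<beta> K \<cdot>\<^bsub>functor_cat J D\<^esub> whisker J \<alpha> K"
proof (rule nat_eqI)
  interpret FC: category "functor_cat C D" by (rule category_functor_cat[OF C D])
  interpret FJ: category "functor_cat J D" by (rule category_functor_cat[OF J D])
  show "whisker J (\<beta> \<cdot>\<^bsub>functor_cat C D\<^esub> \<alpha>) K
    \<in> Hom (functor_cat J D) (comp_functor J F K) (comp_functor J H K)"
    by (rule whisker_hom[OF J K FC.comp_hom[OF a b]])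
  show "whisker J \<beta> K \<cdot>\<^bsub>functor_cat J D\<^esub> whisker J \<alpha> K
    \<in> Hom (functor_cat J D) (comp_functor J F K) (comp_functor J H K)"
    by (rule FJ.comp_hom[OF whisker_hom[OF J K a] whisker_hom[OF J K b]])
  show "nt_at (whisker J (\<beta> \<cdot>\<^bsub>functor_cat C D\<^esub> \<alpha>) K) x
    = nt_at (whisker J \<beta> K \<cdot>\<^bsub>functor_cat J D\<^esub> whisker J \<alpha> K) x"
    if "x \<in> Obj J" for x
    using that functorD(1)[OF K that] by simp
qed

subsection \<open>Posets\<close>

lemma poset_cat_simps [simp]:
  "Obj (poset_cat P) = carrier P"
  "(x, y) \<in> Arr (poset_cat P) \<longleftrightarrow> x \<in> carrier P \<and> y \<in> carrier P \<and> x \<sqsubseteq>\<^bsub>P\<^esub> y"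
  "Dom (poset_cat P) = fst"
  "Cod (poset_cat P) = snd"
  "Id (poset_cat P) x = (x, x)"
  "Comp (poset_cat P) g f = (fst f, snd g)"
  by (simp_all add: poset_cat_def)

lemma poset_cat_arrE:
  assumes "f \<in> Arr (poset_cat P)"
  obtains x y where "f = (x, y)" "x \<in> carrier P" "y \<in> carrier P" "x \<sqsubseteq>\<^bsub>P\<^esub> y"
  using assms by (auto simp: poset_cat_def)

lemma category_poset_cat:
  assumes "partial_order P"
  shows "category (poset_cat P)"
proof -
  interpret partial_order P by (rule assms)
  show ?thesis
    by standard (auto simp: Hom_def poset_cat_def intro: le_trans)
qed

lemma partial_order_subset:
  assumes "partial_order P" "A \<subseteq> carrier P"
  shows "partial_order (P\<lparr> carrier := A \<rparr>)"
proof -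
  interpret partial_order P by (rule assms)
  interpret S: weak_partial_order "P\<lparr> carrier := A \<rparr>"
    by (rule weak_partial_order_subset[OF weak_partial_order_axioms assms(2)])
  show ?thesis
    by standard (simp add: eq_is_equal)
qed

definition mk_functor where
  "mk_functor P ob ar = \<lparr> fobj = restrict ob (carrier P),
     farr = restrict (\<lambda>(x, y). ar x y) (Arr (poset_cat P)) \<rparr>"

lemma mk_functor_simps [simp]:
  "x \<in> carrier P \<Longrightarrow> fobj (mk_functor P ob ar) x = ob x"
  "\<lbrakk>x \<in> carrier P; y \<in> carrier P; x \<sqsubseteq>\<^bsub>P\<^esub> y\<rbrakk> \<Longrightarrow> farr (mk_functor P ob ar) (x, y) = ar x y"
  by (simp_all add: mk_functor_def)

lemma is_functor_mk_functor:
  assumes "partial_order P" and "category M"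
    and "\<And>x y. \<lbrakk>x \<in> carrier P; y \<in> carrier P; x \<sqsubseteq>\<^bsub>P\<^esub> y\<rbrakk> \<Longrightarrow> ar x y \<in> Hom M (ob x) (ob y)"
    and "\<And>x. x \<in> carrier P \<Longrightarrow> ar x x = Id M (ob x)"
    and "\<And>x y z. \<lbrakk>x \<in> carrier P; y \<in> carrier P; z \<in> carrier P; x \<sqsubseteq>\<^bsub>P\<^esub> y; y \<sqsubseteq>\<^bsub>P\<^esub> z\<rbrakk>
      \<Longrightarrow> ar x z = ar y z \<cdot>\<^bsub>M\<^esub> ar x y"
  shows "is_functor (poset_cat P) M (mk_functor P ob ar)"
proof -
  interpret partial_order P by (rule assms)
  interpret M: category M by (rule assms)
  have ob: "ob x \<in> Obj M" if "x \<in> carrier P" for x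
    using M.hom_obj[OF assms(3)[OF that that le_refl[OF that]]] by simp
  have "a \<in> Arr (poset_cat P) \<Longrightarrow> farr (mk_functor P ob ar) a \<in> Hom M (ob (fst a)) (ob (snd a))" for a
    by (auto elim!: poset_cat_arrE intro: assms)
  then show ?thesis
    unfolding is_functor_def
    by (auto simp: ob assms(4) PiE_def Pi_def elim!: poset_cat_arrE dest: HomD(1)[OF assms(3)])
      (auto simp: mk_functor_def intro: assms HomD(1)[OF assms(3)] le_trans)
qed

lemma poset_functorD:
  assumes "is_functor (poset_cat P) M F"
  shows "x \<in> carrier P \<Longrightarrow> fobj F x \<in> Obj M"
    and "\<lbrakk>x \<in> carrier P; y \<in> carrier P; x \<sqsubseteq>\<^bsub>P\<^esub> y\<rbrakk> \<Longrightarrow> farr F (x, y) \<in> Hom M (fobj F x) (fobj F y)"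
    and "x \<in> carrier P \<Longrightarrow> farr F (x, x) = Id M (fobj F x)"
    and "\<lbrakk>x \<in> carrier P; y \<in> carrier P; z \<in> carrier P; x \<sqsubseteq>\<^bsub>P\<^esub> y; y \<sqsubseteq>\<^bsub>P\<^esub> z\<rbrakk>
      \<Longrightarrow> farr F (y, z) \<cdot>\<^bsub>M\<^esub> farr F (x, y) = farr F (x, z)"
  using functorD(1)[OF assms, of x] functorD(2)[OF assms, of "(x, y)"] functorD(3)[OF assms, of x]
    functorD(4)[OF assms, of "(x, y)" "(y, z)"] by auto

lemma poset_natD:
  assumes "\<alpha> \<in> Hom (functor_cat (poset_cat P) M) F G"
  shows "x \<in> carrier P \<Longrightarrow> nt_at \<alpha> x \<in> Hom M (fobj F x) (fobj G x)"
    and "\<lbrakk>x \<in> carrier P; y \<in> carrier P; x \<sqsubseteq>\<^bsub>P\<^esub> y\<rbrakk>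
      \<Longrightarrow> nt_at \<alpha> y \<cdot>\<^bsub>M\<^esub> farr F (x, y) = farr G (x, y) \<cdot>\<^bsub>M\<^esub> nt_at \<alpha> x"
  using natD(3)[OF assms, of x] natD(4)[OF assms, of "(x, y)"] by auto

lemma poset_natI:
  assumes "partial_order P" "is_functor (poset_cat P) M F" "is_functor (poset_cat P) M G"
    and "\<And>x. x \<in> carrier P \<Longrightarrow> a x \<in> Hom M (fobj F x) (fobj G x)"
    and "\<And>x y. \<lbrakk>x \<in> carrier P; y \<in> carrier P; x \<sqsubseteq>\<^bsub>P\<^esub> y\<rbrakk>
      \<Longrightarrow> a y \<cdot>\<^bsub>M\<^esub> farr F (x, y) = farr G (x, y) \<cdot>\<^bsub>M\<^esub> a x"
  shows "mk_nat (poset_cat P) F G a \<in> Hom (functor_cat (poset_cat P) M) F G"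
  by (rule mk_nat_hom[OF assms(2,3)])
    (use assms in \<open>auto intro: category_poset_cat elim!: poset_cat_arrE\<close>)

lemma incl_functor_simps [simp]:
  "x \<in> Obj J \<Longrightarrow> fobj (incl_functor J) x = x"
  "f \<in> Arr J \<Longrightarrow> farr (incl_functor J) f = f"
  by (simp_all add: incl_functor_def)

lemma is_functor_incl_poset:
  assumes "partial_order P" "A \<subseteq> carrier P"
  shows "is_functor (poset_cat (P\<lparr>carrier := A\<rparr>)) (poset_cat P)
    (incl_functor (poset_cat (P\<lparr>carrier := A\<rparr>)))"
proof -
  interpret partial_order P by (rule assms)
  show ?thesis
    using assms(2) unfolding is_functor_def
    by (auto simp: incl_functor_def Hom_def PiE_def Pi_def elim!: poset_cat_arrE)
      (auto simp: poset_cat_def intro: le_trans)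
qed

section \<open>Colimits\<close>

text \<open>\<open>small_cocomplete\<close> quantifies over index categories whose objects and
  arrows both lie in \<open>'i\<close>. An index category that merely injects into \<open>'i\<close>
  is copied along the injections; cocones over the copy and over the original correspond.\<close>

lemma has_colimit:
  fixes C :: "('o, 'a, 'z) precat_scheme" and J :: "('j, 'b, 'y) precat_scheme"
    and a :: "'j \<Rightarrow> 'i" and b :: "'b \<Rightarrow> 'i"
  assumes C: "small_cocomplete TYPE('i) C"
    and J: "category J" and a: "inj_on a (Obj J)" and b: "inj_on b (Arr J)"
    and D: "is_functor J C D"
  obtains c l where "is_colimit J C D c l"
proof -
  interpret J: category J by (rule J)
  define J' :: "('i, 'i) precat" where "J' = \<lparr> Obj = a ` Obj J, Arr = b ` Arr J,
    Dom = (\<lambda>f. a (Dom J (inv_into (Arr J) b f))), Cod = (\<lambda>f. a (Cod J (inv_into (Arr J) b f))),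
    Id = (\<lambda>x. b (Id J (inv_into (Obj J) a x))),
    Comp = (\<lambda>g f. b (inv_into (Arr J) b g \<cdot>\<^bsub>J\<^esub> inv_into (Arr J) b f)) \<rparr>"
  define D' where "D' = \<lparr> fobj = (\<lambda>x \<in> a ` Obj J. fobj D (inv_into (Obj J) a x)),
    farr = (\<lambda>f \<in> b ` Arr J. farr D (inv_into (Arr J) b f)) \<rparr>"
  note [simp] = inv_into_f_f[OF a] inv_into_f_f[OF b] inj_on_eq_iff[OF a] inj_on_eq_iff[OF b]
  have J': "category J'"
    by standard (auto simp: J'_def Hom_def J.cat_simps)
  have "is_functor J' C D'"
    using functorD(2)[OF D] HomD(1)[OF functorD(2)[OF D]] unfolding is_functor_def
    by (auto simp: J'_def D'_def J.cat_simps functorD[OF D])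
  then obtain c l where cl: "is_colimit J' C D' c l"
    using C J' unfolding small_cocomplete_def by blast
  have cocone: "is_cocone J' C D' c' l' \<longleftrightarrow> is_cocone J C D c' (\<lambda>j. l' (a j))" for c' l'
    by (auto simp: is_cocone_def J'_def D'_def J.cat_simps)
  have "is_colimit J C D c (\<lambda>j. l (a j))"
    unfolding is_colimit_def
  proof (intro conjI allI impI)
    show "is_cocone J C D c (\<lambda>j. l (a j))"
      using cl cocone by (simp add: is_colimit_def)
    fix c' l' assume "is_cocone J C D c' l'"
    \<comment> \<open>The legs are rewritten as functions of \<open>a j\<close> so that the
      equivalence \<open>cocone\<close> applies.\<close>
    then have "is_cocone J C D c' (\<lambda>j. l' (inv_into (Obj J) a (a j)))"
      by (simp add: is_cocone_def J.cat_simps)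
    then have "is_cocone J' C D' c' (\<lambda>x. l' (inv_into (Obj J) a x))"
      by (simp add: cocone)
    then have "\<exists>!u. u \<in> Hom C c c' \<and> (\<forall>x \<in> Obj J'. u \<cdot>\<^bsub>C\<^esub> l x = l' (inv_into (Obj J) a x))"
      using cl unfolding is_colimit_def by blast
    then show "\<exists>!u. u \<in> Hom C c c' \<and> (\<forall>j \<in> Obj J. u \<cdot>\<^bsub>C\<^esub> l (a j) = l' j)"
      by (simp add: J'_def)
  qed
  then show ?thesis by (rule that)
qed

section \<open>Terminal and initial objects, binary coproducts\<close>

definition is_terminal :: "('o, 'a, 'z) precat_scheme \<Rightarrow> 'o \<Rightarrow> bool" where
  "is_terminal C t \<longleftrightarrow> t \<in> Obj C \<and> (\<forall>x \<in> Obj C. \<exists>!f. f \<in> Hom C x t)"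

definition to_terminal :: "('o, 'a, 'z) precat_scheme \<Rightarrow> 'o \<Rightarrow> 'o \<Rightarrow> 'a" where
  "to_terminal C t x = (THE f. f \<in> Hom C x t)"

lemma to_terminal_hom: "\<lbrakk>is_terminal C t; x \<in> Obj C\<rbrakk> \<Longrightarrow> to_terminal C t x \<in> Hom C x t"
  using theI'[of "\<lambda>f. f \<in> Hom C x t"] unfolding to_terminal_def is_terminal_def by simp

lemma terminal_unique: "\<lbrakk>is_terminal C t; x \<in> Obj C; f \<in> Hom C x t; g \<in> Hom C x t\<rbrakk> \<Longrightarrow> f = g"
  unfolding is_terminal_def by blast

definition empty_cat :: "('i, 'i) precat" where
  "empty_cat = \<lparr> Obj = {}, Arr = {}, Dom = id, Cod = id, Id = id, Comp = (\<lambda>_ f. f) \<rparr>"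

lemma category_empty_cat: "category empty_cat"
  by standard (auto simp: empty_cat_def Hom_def)

text \<open>On the empty category, extensionality forces both components to be
  \<open>undefined\<close> everywhere.\<close>

lemma is_functor_empty_cat: "is_functor empty_cat C \<lparr> fobj = (\<lambda>_. undefined), farr = (\<lambda>_. undefined) \<rparr>"
  by (simp add: is_functor_def empty_cat_def)

text \<open>A limit of the empty diagram: every object is the vertex of a cone, and no leg
  constrains the mediating map.\<close>

lemma has_terminal:
  assumes "small_complete TYPE('i) C"
  obtains t where "is_terminal C t"
proof -
  obtain t l where "is_limit (empty_cat :: ('i, 'i) precat) C
    \<lparr> fobj = (\<lambda>_. undefined), farr = (\<lambda>_. undefined) \<rparr> t l"
    using assms category_empty_cat is_functor_empty_cat unfolding small_complete_def by blast
  then have "is_terminal C t"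
    by (simp add: is_limit_def is_cone_def is_terminal_def empty_cat_def)
  then show ?thesis by (rule that)
qed

lemma has_initial:
  assumes "small_cocomplete TYPE('i) C"
  obtains t where "is_initial C t"
proof -
  obtain t l where "is_colimit (empty_cat :: ('i, 'i) precat) C
    \<lparr> fobj = (\<lambda>_. undefined), farr = (\<lambda>_. undefined) \<rparr> t l"
    using assms category_empty_cat is_functor_empty_cat unfolding small_cocomplete_def by blast
  then have "is_initial C t"
    by (simp add: is_colimit_def is_cocone_def is_initial_def empty_cat_def)
  then show ?thesis by (rule that)
qed

definition is_coproduct where
  "is_coproduct C x y c i j \<longleftrightarrow> i \<in> Hom C x c \<and> j \<in> Hom C y c \<and>
     (\<forall>z f g. f \<in> Hom C x z \<and> g \<in> Hom C y z \<longrightarrow>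
        (\<exists>!h. h \<in> Hom C c z \<and> h \<cdot>\<^bsub>C\<^esub> i = f \<and> h \<cdot>\<^bsub>C\<^esub> j = g))"

text \<open>The colimit over the discrete category on \<open>bool\<close>. Objects and arrows of
  that category are both the elements of \<open>bool\<close>, so the single injection
  \<open>e\<close> places it inside \<open>'i\<close>.\<close>

lemma has_coproduct:
  fixes e :: "bool \<Rightarrow> 'i"
  assumes C: "small_cocomplete TYPE('i) C" and cat: "category C" and e: "inj e"
    and x: "x \<in> Obj C" and y: "y \<in> Obj C"
  obtains c i j where "is_coproduct C x y c i j"
proof -
  interpret category C by (rule cat)
  define J :: "(bool, bool) precat" where
    "J = \<lparr> Obj = UNIV, Arr = UNIV, Dom = id, Cod = id, Id = id, Comp = (\<lambda>_ f. f) \<rparr>"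
  define D where "D = \<lparr> fobj = (\<lambda>b. if b then x else y), farr = (\<lambda>b. Id C (if b then x else y)) \<rparr>"
  have J: "category J" by standard (auto simp: J_def Hom_def)
  have D: "is_functor J C D"
    using x y by (auto simp: is_functor_def J_def D_def Hom_def cat_simps)
  have "inj_on e (Obj J)" "inj_on e (Arr J)" using e by (auto simp: inj_on_def)
  from has_colimit[OF C J this D] obtain c l where cl: "is_colimit J C D c l" .
  have co: "is_cocone J C D c' l' \<longleftrightarrow> l' True \<in> Hom C x c' \<and> l' False \<in> Hom C y c'" for c' l'
    using hom_obj(2) id_right by (auto simp: is_cocone_def J_def D_def all_bool_eq ball_UNIV)
  have "is_coproduct C x y c (l True) (l False)"
    unfolding is_coproduct_def
  proof (intro conjI allI impI)
    show "l True \<in> Hom C x c" "l False \<in> Hom C y c"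
      using cl co by (auto simp: is_colimit_def)
    fix z f g assume "f \<in> Hom C x z \<and> g \<in> Hom C y z"
    then have "is_cocone J C D z (\<lambda>b. if b then f else g)" by (simp add: co)
    then have "\<exists>!u. u \<in> Hom C c z \<and> (\<forall>b \<in> Obj J. u \<cdot>\<^bsub>C\<^esub> l b = (if b then f else g))"
      using cl unfolding is_colimit_def by blast
    then show "\<exists>!h. h \<in> Hom C c z \<and> h \<cdot>\<^bsub>C\<^esub> l True = f \<and> h \<cdot>\<^bsub>C\<^esub> l False = g"
      by (simp add: J_def all_bool_eq ball_UNIV)
  qed
  then show ?thesis by (rule that)
qed

section \<open>Extension by the terminal object\<close>

text \<open>Transformations from the restriction of \<open>X\<close> to \<open>D\<close> into the
  composite of \<open>Y\<close> with \<open>s\<close>, described without forming either functor.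
  Values of \<open>a\<close> off \<open>D\<close> are unconstrained.\<close>

definition natural_on where
  "natural_on M J D s X Y a \<longleftrightarrow>
     (\<forall>v \<in> D. a v \<in> Hom M (fobj X v) (fobj Y (s v))) \<and>
     (\<forall>v \<in> D. \<forall>w \<in> D. v \<sqsubseteq>\<^bsub>J\<^esub> w \<longrightarrow>
        a w \<cdot>\<^bsub>M\<^esub> farr X (v, w) = farr Y (s v, s w) \<cdot>\<^bsub>M\<^esub> a v)"

text \<open>
  For a down-set \<open>D\<close> of \<open>J\<close> and a monotone \<open>s : D \<rightarrow> K\<close>, the functor \<open>ext B\<close> is the right Kan
  extension along \<open>D \<subseteq> J\<close> of \<open>B \<circ> s\<close>. As it preserves objectwise classes of maps, restriction
  to \<open>D\<close> followed by left Kan extension along \<open>s\<close> preserves the maps that lift against them.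
\<close>

locale terminal_extension =
  fixes M :: "('o, 'a, 'z) precat_scheme" (structure)
    and J :: "('j, 'x) gorder_scheme" and K :: "('k, 'y) gorder_scheme"
    and D :: "'j set" and s :: "'j \<Rightarrow> 'k" and t :: 'o
  assumes cat_M: "category M" and po_J: "partial_order J" and po_K: "partial_order K"
    and D_sub: "D \<subseteq> carrier J"
    and D_down: "\<lbrakk>w \<in> D; v \<in> carrier J; v \<sqsubseteq>\<^bsub>J\<^esub> w\<rbrakk> \<Longrightarrow> v \<in> D"
    and s_closed: "v \<in> D \<Longrightarrow> s v \<in> carrier K"
    and s_mono: "\<lbrakk>v \<in> D; w \<in> D; v \<sqsubseteq>\<^bsub>J\<^esub> w\<rbrakk> \<Longrightarrow> s v \<sqsubseteq>\<^bsub>K\<^esub> s w"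
    and terminal: "is_terminal M t"
begin

sublocale M: category M by (rule cat_M)

definition ext_obj :: "('k, 'k \<times> 'k, 'o, 'a) func \<Rightarrow> 'j \<Rightarrow> 'o" where
  "ext_obj B v = (if v \<in> D then fobj B (s v) else t)"

definition ext :: "('k, 'k \<times> 'k, 'o, 'a) func \<Rightarrow> ('j, 'j \<times> 'j, 'o, 'a) func" where
  "ext B = mk_functor J (ext_obj B)
     (\<lambda>v w. if w \<in> D then farr B (s v, s w) else to_terminal M t (ext_obj B v))"

lemma t_obj: "t \<in> Obj M"
  using terminal by (simp add: is_terminal_def)

lemma ext_obj_closed: "is_functor (poset_cat K) M B \<Longrightarrow> ext_obj B v \<in> Obj M"
  using poset_functorD(1) s_closed t_obj by (fastforce simp: ext_obj_def)

lemma is_functor_ext: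
  assumes B: "is_functor (poset_cat K) M B"
  shows "is_functor (poset_cat J) M (ext B)"
proof -
  note b = poset_functorD[OF B]
  note tt = to_terminal_hom[OF terminal ext_obj_closed[OF B]]
  show ?thesis
    unfolding ext_def
  proof (rule is_functor_mk_functor[OF po_J cat_M])
    fix v w assume "v \<in> carrier J" "w \<in> carrier J" "v \<sqsubseteq>\<^bsub>J\<^esub> w"
    then show "(if w \<in> D then farr B (s v, s w) else to_terminal M t (ext_obj B v))
      \<in> Hom M (ext_obj B v) (ext_obj B w)"
      using D_down tt by (auto simp: ext_obj_def intro!: b s_closed s_mono)
  next
    fix v assume "v \<in> carrier J"
    have "to_terminal M t t = Id M t"
      using terminal_unique[OF terminal t_obj to_terminal_hom[OF terminal t_obj] M.id_hom[OF t_obj]] .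
    then show "(if v \<in> D then farr B (s v, s v) else to_terminal M t (ext_obj B v)) = Id M (ext_obj B v)"
      using b(3) s_closed by (auto simp: ext_obj_def)
  next
    fix u v w assume uvw: "u \<in> carrier J" "v \<in> carrier J" "w \<in> carrier J" "u \<sqsubseteq>\<^bsub>J\<^esub> v" "v \<sqsubseteq>\<^bsub>J\<^esub> w"
    let ?ar = "\<lambda>v w. if w \<in> D then farr B (s v, s w) else to_terminal M t (ext_obj B v)"
    have ar: "?ar u v \<in> Hom M (ext_obj B u) (ext_obj B v)"
      using uvw D_down tt by (auto simp: ext_obj_def intro!: b s_closed s_mono)
    show "?ar u w = ?ar v w \<cdot> ?ar u v"
    proof (cases "w \<in> D")
      case True
      then have "v \<in> D" "u \<in> D" using D_down uvw by auto
      then show ?thesis using True uvw by (simp add: b(4) s_closed s_mono)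
    next
      case False
      then show ?thesis
        using terminal_unique[OF terminal ext_obj_closed[OF B] tt M.comp_hom[OF ar tt]] by simp
    qed
  qed
qed

lemma ext_simps [simp]:
  "v \<in> carrier J \<Longrightarrow> fobj (ext B) v = ext_obj B v"
  "\<lbrakk>v \<in> D; w \<in> D; v \<sqsubseteq>\<^bsub>J\<^esub> w\<rbrakk> \<Longrightarrow> farr (ext B) (v, w) = farr B (s v, s w)"
  using D_sub by (auto simp: ext_def subsetD)

lemma ext_obj_simps [simp]:
  "v \<in> D \<Longrightarrow> ext_obj B v = fobj B (s v)"
  "v \<notin> D \<Longrightarrow> ext_obj B v = t"
  by (simp_all add: ext_obj_def)

text \<open>Adjoint transpose of a family natural on \<open>D\<close>. Off \<open>D\<close> there is
  no choice, as the target is \<open>t\<close>; the passage back is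
  \<open>natural_on_ext\<close>.\<close>

definition ext_transpose where
  "ext_transpose X B a = mk_nat (poset_cat J) X (ext B)
     (\<lambda>v. if v \<in> D then a v else to_terminal M t (fobj X v))"

lemma ext_transpose_at [simp]: "v \<in> D \<Longrightarrow> nt_at (ext_transpose X B a) v = a v"
  using D_sub by (auto simp: ext_transpose_def)

lemma ext_transpose_hom:
  assumes X: "is_functor (poset_cat J) M X" and B: "is_functor (poset_cat K) M B"
    and a: "natural_on M J D s X B a"
  shows "ext_transpose X B a \<in> Hom (functor_cat (poset_cat J) M) X (ext B)"
  unfolding ext_transpose_def
proof (rule poset_natI[OF po_J X is_functor_ext[OF B]])
  note x = poset_functorD[OF X]
  let ?a = "\<lambda>v. if v \<in> D then a v else to_terminal M t (fobj X v)"
  show *: "?a v \<in> Hom M (fobj X v) (fobj (ext B) v)" if "v \<in> carrier J" for v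
    using that a to_terminal_hom[OF terminal x(1)] by (auto simp: natural_on_def)
  fix v w assume vw: "v \<in> carrier J" "w \<in> carrier J" "v \<sqsubseteq>\<^bsub>J\<^esub> w"
  show "?a w \<cdot> farr X (v, w) = farr (ext B) (v, w) \<cdot> ?a v"
  proof (cases "w \<in> D")
    case True
    then have "v \<in> D" using D_down vw by auto
    then show ?thesis using True vw a by (auto simp: natural_on_def)
  next
    case False
    have "?a w \<cdot> farr X (v, w) \<in> Hom M (fobj X v) (fobj (ext B) w)"
      by (rule M.comp_hom[OF x(2)[OF vw] *[OF vw(2)]])
    moreover have "farr (ext B) (v, w) \<cdot> ?a v \<in> Hom M (fobj X v) (fobj (ext B) w)"
      by (rule M.comp_hom[OF *[OF vw(1)] poset_functorD(2)[OF is_functor_ext[OF B] vw]])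
    ultimately show ?thesis
      using False vw terminal_unique[OF terminal x(1)[OF vw(1)]] by simp
  qed
qed

lemma natural_on_ext:
  assumes a: "\<alpha> \<in> Hom (functor_cat (poset_cat J) M) X (ext B)"
  shows "natural_on M J D s X B (nt_at \<alpha>)"
  unfolding natural_on_def
proof (intro conjI ballI impI)
  fix v assume v: "v \<in> D"
  then show "nt_at \<alpha> v \<in> Hom M (fobj X v) (fobj B (s v))"
    using poset_natD(1)[OF a, of v] D_sub by auto
  fix w assume "w \<in> D" "v \<sqsubseteq>\<^bsub>J\<^esub> w"
  then show "nt_at \<alpha> w \<cdot> farr X (v, w) = farr B (s v, s w) \<cdot> nt_at \<alpha> v"
    using poset_natD(2)[OF a, of v w] v D_sub by auto
qed

definition ext_nat where
  "ext_nat \<beta> = mk_nat (poset_cat J) (ext (nt_dom \<beta>)) (ext (nt_cod \<beta>))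
     (\<lambda>v. if v \<in> D then nt_at \<beta> (s v) else Id M t)"

lemma ext_nat_at [simp]:
  "v \<in> D \<Longrightarrow> nt_at (ext_nat \<beta>) v = nt_at \<beta> (s v)"
  "v \<in> carrier J - D \<Longrightarrow> nt_at (ext_nat \<beta>) v = Id M t"
  using D_sub by (auto simp: ext_nat_def)

lemma ext_nat_hom:
  assumes b: "\<beta> \<in> Hom (functor_cat (poset_cat K) M) B B'"
  shows "ext_nat \<beta> \<in> Hom (functor_cat (poset_cat J) M) (ext B) (ext B')"
proof -
  note bb = natD(1,2)[OF b] and n = poset_natD[OF b]
  have "mk_nat (poset_cat J) (ext B) (ext B') (\<lambda>v. if v \<in> D then nt_at \<beta> (s v) else Id M t)
     \<in> Hom (functor_cat (poset_cat J) M) (ext B) (ext B')"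
  proof (rule poset_natI[OF po_J is_functor_ext[OF bb(1)] is_functor_ext[OF bb(2)]])
    let ?a = "\<lambda>v. if v \<in> D then nt_at \<beta> (s v) else Id M t"
    show *: "?a v \<in> Hom M (fobj (ext B) v) (fobj (ext B') v)" if "v \<in> carrier J" for v
      using that by (auto intro: n s_closed M.id_hom t_obj)
    fix v w assume vw: "v \<in> carrier J" "w \<in> carrier J" "v \<sqsubseteq>\<^bsub>J\<^esub> w"
    show "?a w \<cdot> farr (ext B) (v, w) = farr (ext B') (v, w) \<cdot> ?a v"
    proof (cases "w \<in> D")
      case True
      then have "v \<in> D" using D_down vw by auto
      then show ?thesis using True vw n(2)[OF s_closed s_closed s_mono] by auto
    next
      case False
      have "?a w \<cdot> farr (ext B) (v, w) \<in> Hom M (fobj (ext B) v) (fobj (ext B') w)"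
        by (rule M.comp_hom[OF poset_functorD(2)[OF is_functor_ext[OF bb(1)] vw] *[OF vw(2)]])
      moreover have "farr (ext B') (v, w) \<cdot> ?a v \<in> Hom M (fobj (ext B) v) (fobj (ext B') w)"
        by (rule M.comp_hom[OF *[OF vw(1)] poset_functorD(2)[OF is_functor_ext[OF bb(2)] vw]])
      ultimately show ?thesis
        using False vw terminal_unique[OF terminal ext_obj_closed[OF bb(1)]] by simp
    qed
  qed
  then show ?thesis
    using natD(6,7)[OF b] by (simp add: ext_nat_def)
qed

text \<open>Off \<open>D\<close> the components are \<open>Id M t\<close>, which is why
  \<open>S\<close> must contain this identity.\<close>

lemma ext_nat_objectwise:
  assumes b: "\<beta> \<in> objectwise (poset_cat K) M S" and S: "Id M t \<in> S"
  shows "ext_nat \<beta> \<in> objectwise (poset_cat J) M S"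
proof -
  have "\<beta> \<in> Hom (functor_cat (poset_cat K) M) (nt_dom \<beta>) (nt_cod \<beta>)"
    using b by (auto simp: objectwise_def Hom_def)
  from ext_nat_hom[OF this] have "ext_nat \<beta> \<in> Arr (functor_cat (poset_cat J) M)"
    by (rule HomD)
  moreover have "nt_at (ext_nat \<beta>) v \<in> S" if "v \<in> carrier J" for v
    using that b S s_closed by (cases "v \<in> D") (auto simp: objectwise_def)
  ultimately show ?thesis by (simp add: objectwise_def)
qed

text \<open>A lifting problem posed on \<open>D\<close> against \<open>p\<close> along
  \<open>s\<close> transposes to a square from \<open>j\<close> to \<open>ext_nat p\<close>, which
  is again objectwise in \<open>S\<close>. Its diagonal is transposed back.\<close>

lemma objectwise_lift:
  assumes j: "j \<in> Hom (functor_cat (poset_cat J) M) X X'"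
    and lift: "\<And>p. p \<in> objectwise (poset_cat J) M S \<Longrightarrow> has_lifting (functor_cat (poset_cat J) M) j p"
    and S: "Id M t \<in> S"
    and p: "p \<in> Hom (functor_cat (poset_cat K) M) B B'" "p \<in> objectwise (poset_cat K) M S"
    and a: "natural_on M J D s X B a" and b: "natural_on M J D s X' B' b"
    and ab: "\<And>v. v \<in> D \<Longrightarrow> nt_at p (s v) \<cdot> a v = b v \<cdot> nt_at j v"
  obtains h where "natural_on M J D s X' B h"
    and "\<And>v. v \<in> D \<Longrightarrow> h v \<cdot> nt_at j v = a v"
    and "\<And>v. v \<in> D \<Longrightarrow> nt_at p (s v) \<cdot> h v = b v"
proof -
  interpret F: category "functor_cat (poset_cat J) M"
    by (rule category_functor_cat[OF category_poset_cat[OF po_J] cat_M])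
  note jf = natD(1,2)[OF j] and pf = natD(1,2)[OF p(1)]
  let ?u = "ext_transpose X B a" and ?v = "ext_transpose X' B' b"
  have u: "?u \<in> Hom (functor_cat (poset_cat J) M) X (ext B)"
    by (rule ext_transpose_hom[OF jf(1) pf(1) a])
  have v: "?v \<in> Hom (functor_cat (poset_cat J) M) X' (ext B')"
    by (rule ext_transpose_hom[OF jf(2) pf(2) b])
  have e: "ext_nat p \<in> Hom (functor_cat (poset_cat J) M) (ext B) (ext B')"
    by (rule ext_nat_hom[OF p(1)])
  have "ext_nat p \<cdot>\<^bsub>functor_cat (poset_cat J) M\<^esub> ?u = ?v \<cdot>\<^bsub>functor_cat (poset_cat J) M\<^esub> j"
  proof (rule nat_eqI[OF F.comp_hom[OF u e] F.comp_hom[OF j v]])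
    fix v assume v': "v \<in> Obj (poset_cat J)"
    show "nt_at (ext_nat p \<cdot>\<^bsub>functor_cat (poset_cat J) M\<^esub> ?u) v
      = nt_at (?v \<cdot>\<^bsub>functor_cat (poset_cat J) M\<^esub> j) v"
    proof (cases "v \<in> D")
      case True
      then show ?thesis using v' ab by simp
    next
      case False
      have "fobj X v \<in> Obj M" "fobj (ext B') v = t"
        using v' False poset_functorD(1)[OF jf(1)] by auto
      then show ?thesis
        using terminal_unique[OF terminal] natD(3)[OF F.comp_hom[OF u e] v']
          natD(3)[OF F.comp_hom[OF j v] v'] by metis
    qed
  qed
  then obtain h where h: "h \<in> Hom (functor_cat (poset_cat J) M) X' (ext B)"
     "h \<cdot>\<^bsub>functor_cat (poset_cat J) M\<^esub> j = ?u" "ext_nat p \<cdot>\<^bsub>functor_cat (poset_cat J) M\<^esub> h = ?v"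
    using lift[OF ext_nat_objectwise[OF p(2) S]] u v HomD[OF j] HomD[OF e]
      unfolding has_lifting_def by auto
  have *: "nt_at h v \<cdot> nt_at j v = a v" "nt_at p (s v) \<cdot> nt_at h v = b v" if "v \<in> D" for v
    using arg_cong[OF h(2), of "\<lambda>n. nt_at n v"] arg_cong[OF h(3), of "\<lambda>n. nt_at n v"] that D_sub
    by auto
  show ?thesis
    by (rule that[OF natural_on_ext[OF h(1)]]) (use * in auto)
qed

end

text \<open>\<open>is_colimit\<close> evaluates the diagram on \<open>J\<close> only, so a functor
  on a larger category can serve as a diagram on \<open>J\<close> without being restricted.\<close>

lemma colimit_incl_functor:
  assumes "category J"
  shows "is_colimit J C (comp_functor J Q (incl_functor J)) c l \<longleftrightarrow> is_colimit J C Q c l"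
proof -
  interpret J: category J by (rule assms)
  have "is_cocone J C (comp_functor J Q (incl_functor J)) c' l' \<longleftrightarrow> is_cocone J C Q c' l'" for c' l'
    by (auto simp: is_cocone_def J.cat_simps)
  then show ?thesis by (simp add: is_colimit_def)
qed

section \<open>Constant diagrams, cocones and colimits over subposets\<close>

definition const_functor where
  "const_functor P M c = mk_functor P (\<lambda>_. c) (\<lambda>_ _. Id M c)"

lemma const_functor_simps [simp]:
  "x \<in> carrier P \<Longrightarrow> fobj (const_functor P M c) x = c"
  "\<lbrakk>x \<in> carrier P; y \<in> carrier P; x \<sqsubseteq>\<^bsub>P\<^esub> y\<rbrakk> \<Longrightarrow> farr (const_functor P M c) (x, y) = Id M c"
  by (simp_all add: const_functor_def)

lemma is_functor_const:
  assumes "partial_order P" "category M" "c \<in> Obj M"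
  shows "is_functor (poset_cat P) M (const_functor P M c)"
  unfolding const_functor_def
  using assms by (intro is_functor_mk_functor) (auto intro: category.id_hom simp: category.cat_simps)

lemma poset_cocone_iff:
  "is_cocone (poset_cat (P\<lparr>carrier := D\<rparr>)) M Q c l \<longleftrightarrow>
     c \<in> Obj M \<and> (\<forall>v \<in> D. l v \<in> Hom M (fobj Q v) c) \<and>
     (\<forall>v \<in> D. \<forall>w \<in> D. v \<sqsubseteq>\<^bsub>P\<^esub> w \<longrightarrow> l w \<cdot>\<^bsub>M\<^esub> farr Q (v, w) = l v)"
proof -
  have "(\<forall>f \<in> Arr (poset_cat (P\<lparr>carrier := D\<rparr>)). Pr f) \<longleftrightarrow>
      (\<forall>v \<in> D. \<forall>w \<in> D. v \<sqsubseteq>\<^bsub>P\<^esub> w \<longrightarrow> Pr (v, w))" for Pr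
    by (auto simp: poset_cat_def)
  then show ?thesis by (simp add: is_cocone_def)
qed

lemma colimit_unique:
  assumes "is_colimit J C Q c l" "is_cocone J C Q c' l'"
    and "u \<in> Hom C c c'" "\<And>j. j \<in> Obj J \<Longrightarrow> u \<cdot>\<^bsub>C\<^esub> l j = l' j"
    and "u' \<in> Hom C c c'" "\<And>j. j \<in> Obj J \<Longrightarrow> u' \<cdot>\<^bsub>C\<^esub> l j = l' j"
  shows "u = u'"
  using assms unfolding is_colimit_def by blast

lemma colimit_ex:
  assumes "is_colimit J C Q c l" "is_cocone J C Q c' l'"
  obtains u where "u \<in> Hom C c c'" "\<And>j. j \<in> Obj J \<Longrightarrow> u \<cdot>\<^bsub>C\<^esub> l j = l' j"
  using assms unfolding is_colimit_def by blast

text \<open>The legs of a colimit are jointly epic: both maps mediate the same cocone.\<close>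

lemma poset_colimit_eqI:
  assumes M: "category M" and Q: "is_functor (poset_cat P) M Q" and D: "D \<subseteq> carrier P"
    and c: "is_colimit (poset_cat (P\<lparr>carrier := D\<rparr>)) M Q c l"
    and u: "u \<in> Hom M c z" "u' \<in> Hom M c z" "\<And>v. v \<in> D \<Longrightarrow> u \<cdot>\<^bsub>M\<^esub> l v = u' \<cdot>\<^bsub>M\<^esub> l v"
  shows "u = u'"
proof -
  interpret category M by (rule M)
  have cc: "is_cocone (poset_cat (P\<lparr>carrier := D\<rparr>)) M Q c l"
    using c by (simp add: is_colimit_def)
  then have h: "\<And>v. v \<in> D \<Longrightarrow> l v \<in> Hom M (fobj Q v) c"
    "\<And>v w. \<lbrakk>v \<in> D; w \<in> D; v \<sqsubseteq>\<^bsub>P\<^esub> w\<rbrakk> \<Longrightarrow> l w \<cdot>\<^bsub>M\<^esub> farr Q (v, w) = l v"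
    by (auto simp: poset_cocone_iff)
  have e: "(u \<cdot>\<^bsub>M\<^esub> l w) \<cdot>\<^bsub>M\<^esub> farr Q (v, w) = u \<cdot>\<^bsub>M\<^esub> l v"
    if "v \<in> D" "w \<in> D" "v \<sqsubseteq>\<^bsub>P\<^esub> w" for v w
    using comp_assoc[OF poset_functorD(2)[OF Q] h(1) u(1), of v w] h(2)[OF that] that D
    by (auto simp: subsetD)
  have uc: "is_cocone (poset_cat (P\<lparr>carrier := D\<rparr>)) M Q z (\<lambda>v. u \<cdot>\<^bsub>M\<^esub> l v)"
    using h e hom_obj(2)[OF u(1)] comp_hom[OF h(1) u(1)] by (simp add: poset_cocone_iff)
  show ?thesis
    by (rule colimit_unique[OF c uc u(1) _ u(2)]) (simp_all add: u(3))
qed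

section \<open>Left Kan extensions along subposets\<close>

locale subposet_kan =
  fixes M :: "('o, 'a, 'z) precat_scheme" (structure) and P :: "('p, 'x) gorder_scheme"
    and A :: "'p set" and t :: 'o
  assumes cat_M: "category M" and po_P: "partial_order P" and A_sub: "A \<subseteq> carrier P"
    and terminal: "is_terminal M t"
begin

sublocale M: category M by (rule cat_M)
sublocale P: partial_order P by (rule po_P)

abbreviation J where "J \<equiv> P\<lparr>carrier := A\<rparr>"
abbreviation CJ where "CJ \<equiv> poset_cat J"
abbreviation CP where "CP \<equiv> poset_cat P"
abbreviation FJ where "FJ \<equiv> functor_cat CJ M"
abbreviation FP where "FP \<equiv> functor_cat CP M"
abbreviation R where "R X \<equiv> comp_functor CJ X (incl_functor CJ)"
abbreviation Rn where "Rn \<alpha> \<equiv> whisker CJ \<alpha> (incl_functor CJ)"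
abbreviation is_lan where "is_lan Q T \<eta> \<equiv> is_left_kan_extension CJ CP M (incl_functor CJ) Q T \<eta>"
abbreviation below where "below x \<equiv> {v \<in> A. v \<sqsubseteq>\<^bsub>P\<^esub> x}"

lemma po_J: "partial_order J"
  by (rule partial_order_subset[OF po_P A_sub])

sublocale CJ: category CJ by (rule category_poset_cat[OF po_J])
sublocale CP: category CP by (rule category_poset_cat[OF po_P])
sublocale FJ: category FJ by (rule category_functor_cat[OF CJ.category_axioms cat_M])
sublocale FP: category FP by (rule category_functor_cat[OF CP.category_axioms cat_M])

lemma incl: "is_functor CJ CP (incl_functor CJ)"
  by (rule is_functor_incl_poset[OF po_P A_sub])

lemma A_carrier [simp]: "v \<in> A \<Longrightarrow> v \<in> carrier P"
  using A_sub by auto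

lemmas is_functor_R = is_functor_comp[OF CJ.category_axioms incl]
lemmas Rn_hom = whisker_hom[OF CJ.category_axioms incl]
lemmas Rn_comp = whisker_comp[OF CJ.category_axioms cat_M incl CP.category_axioms]

lemma is_lanD:
  assumes "is_lan Q T \<eta>"
  shows "is_functor CP M T" and "\<eta> \<in> Hom FJ Q (R T)" and "is_functor CJ M Q"
  using assms natD(1) unfolding is_left_kan_extension_def by auto

lemma lan_ex:
  assumes "is_lan Q T \<eta>" "is_functor CP M G" "\<alpha> \<in> Hom FJ Q (R G)"
  obtains \<beta> where "\<beta> \<in> Hom FP T G" "Rn \<beta> \<cdot>\<^bsub>FJ\<^esub> \<eta> = \<alpha>"
  using assms unfolding is_left_kan_extension_def functor_cat_simps by blast

lemma lan_unique:
  assumes "is_lan Q T \<eta>" "\<beta> \<in> Hom FP T G" "\<beta>' \<in> Hom FP T G"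
    and "\<And>v. v \<in> A \<Longrightarrow> nt_at \<beta> v \<cdot> nt_at \<eta> v = nt_at \<beta>' v \<cdot> nt_at \<eta> v"
  shows "\<beta> = \<beta>'"
proof -
  have G: "is_functor CP M G" using natD(2)[OF assms(2)] .
  have h: "Rn \<beta> \<cdot>\<^bsub>FJ\<^esub> \<eta> \<in> Hom FJ Q (R G)" "Rn \<beta>' \<cdot>\<^bsub>FJ\<^esub> \<eta> \<in> Hom FJ Q (R G)"
    using FJ.comp_hom[OF is_lanD(2)[OF assms(1)] Rn_hom] assms by auto
  have "Rn \<beta> \<cdot>\<^bsub>FJ\<^esub> \<eta> = Rn \<beta>' \<cdot>\<^bsub>FJ\<^esub> \<eta>"
    by (rule nat_eqI[OF h]) (simp add: assms(4))
  then show ?thesis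
    using assms(1,2,3) G h(1) unfolding is_left_kan_extension_def by auto
qed

text \<open>Uses the universal property for functors that are constant below \<open>x\<close> and terminal elsewhere.\<close>

lemma lan_pointwise:
  assumes lan: "is_lan Q T \<eta>" and x: "x \<in> carrier P"
  shows "is_colimit (poset_cat (P\<lparr>carrier := below x\<rparr>)) M Q (fobj T x)
           (\<lambda>v. farr T (v, x) \<cdot> nt_at \<eta> v)"
proof -
  note T = is_lanD(1)[OF lan] and eta = is_lanD(2)[OF lan] and Q = is_lanD(3)[OF lan]
  note tf = poset_functorD[OF T]
  have en: "nt_at \<eta> v \<in> Hom M (fobj Q v) (fobj T v)" if "v \<in> A" for v
    using poset_natD(1)[OF eta, of v] that by simp
  have en2: "nt_at \<eta> w \<cdot> farr Q (v, w) = farr T (v, w) \<cdot> nt_at \<eta> v"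
    if "v \<in> A" "w \<in> A" "v \<sqsubseteq>\<^bsub>P\<^esub> w" for v w
    using poset_natD(2)[OF eta, of v w] that by simp
  let ?l = "\<lambda>v. farr T (v, x) \<cdot> nt_at \<eta> v"
  have lh: "?l v \<in> Hom M (fobj Q v) (fobj T x)" if "v \<in> below x" for v
    using that x by (intro M.comp_hom[OF en tf(2)]) auto
  have "?l w \<cdot> farr Q (v, w) = ?l v" if "v \<in> below x" "w \<in> below x" "v \<sqsubseteq>\<^bsub>P\<^esub> w" for v w
  proof -
    have m: "farr Q (v, w) \<in> Hom M (fobj Q v) (fobj Q w)" "nt_at \<eta> w \<in> Hom M (fobj Q w) (fobj T w)"
      "farr T (w, x) \<in> Hom M (fobj T w) (fobj T x)" "nt_at \<eta> v \<in> Hom M (fobj Q v) (fobj T v)"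
      "farr T (v, w) \<in> Hom M (fobj T v) (fobj T w)"
      using that x poset_functorD(2)[OF Q, of v w] by (auto intro: en tf)
    have "?l w \<cdot> farr Q (v, w) = farr T (w, x) \<cdot> (farr T (v, w) \<cdot> nt_at \<eta> v)"
      using M.comp_assoc[OF m(1-3)] en2[of v w] that by simp
    also have "\<dots> = ?l v"
      using M.comp_assoc[OF m(4,5,3)] tf(4)[of v w x] that x by simp
    finally show ?thesis .
  qed
  then have cocone: "is_cocone (poset_cat (P\<lparr>carrier := below x\<rparr>)) M Q (fobj T x) ?l"
    using lh tf(1)[OF x] by (simp add: poset_cocone_iff)
  show ?thesis
    unfolding is_colimit_def
  proof (intro conjI allI impI cocone)
    fix c' l' assume "is_cocone (poset_cat (P\<lparr>carrier := below x\<rparr>)) M Q c' l'"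
    then have c': "c' \<in> Obj M" and l': "\<And>v. v \<in> below x \<Longrightarrow> l' v \<in> Hom M (fobj Q v) c'"
      "\<And>v w. v \<in> below x \<Longrightarrow> w \<in> below x \<Longrightarrow> v \<sqsubseteq>\<^bsub>P\<^esub> w \<Longrightarrow> l' w \<cdot> farr Q (v, w) = l' v"
      by (auto simp: poset_cocone_iff)
    define D where "D = {v \<in> carrier P. v \<sqsubseteq>\<^bsub>P\<^esub> x}"
    have D_iff: "v \<in> D \<longleftrightarrow> v \<in> carrier P \<and> v \<sqsubseteq>\<^bsub>P\<^esub> x" for v
      by (simp add: D_def)
    have down: "v \<sqsubseteq>\<^bsub>P\<^esub> x" if "v \<sqsubseteq>\<^bsub>P\<^esub> w" "w \<sqsubseteq>\<^bsub>P\<^esub> x" "v \<in> carrier P" "w \<in> carrier P" for v w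
      using P.le_trans[OF that(1,2) that(3,4) x] .
    \<comment> \<open>Two versions of the probe with value \<open>c'\<close>: on \<open>P\<close>,
      supported on the principal down-set of \<open>x\<close>, and on \<open>J\<close>, supported on
      \<open>below x\<close>. The first restricts to the second, so a cocone on
      \<open>below x\<close> is a transformation from \<open>Q\<close> to a restricted
      functor.\<close>
    interpret EP: terminal_extension M P P D "\<lambda>v. v" t
      by (rule terminal_extension.intro) (use x in \<open>auto simp: cat_M po_P terminal D_def intro: down\<close>)
    interpret EJ: terminal_extension M J P "below x" "\<lambda>v. v" t
      by (rule terminal_extension.intro) (use x in \<open>auto simp: cat_M po_P po_J terminal intro: down\<close>)
    let ?B = "const_functor P M c'"
    have B: "is_functor CP M ?B" by (rule is_functor_const[OF po_P cat_M c'])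
    have eB: "is_functor CP M (EP.ext ?B)" "is_functor CJ M (EJ.ext ?B)"
      by (rule EP.is_functor_ext[OF B], rule EJ.is_functor_ext[OF B])
    have obj_eq: "EP.ext_obj ?B v = EJ.ext_obj ?B v" if "v \<in> A" for v
      using that by (simp add: EP.ext_obj_def EJ.ext_obj_def D_iff)
    have RE: "R (EP.ext ?B) = EJ.ext ?B"
    proof (rule functor_eqI[OF is_functor_R[OF eB(1)] eB(2)])
      show "fobj (R (EP.ext ?B)) v = fobj (EJ.ext ?B) v" if "v \<in> Obj CJ" for v
        using that obj_eq by simp
      fix f assume "f \<in> Arr CJ"
      then show "farr (R (EP.ext ?B)) f = farr (EJ.ext ?B) f"
        by (auto simp: EP.ext_def EJ.ext_def obj_eq D_iff elim!: poset_cat_arrE)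
    qed
    have "natural_on M J (below x) (\<lambda>v. v) Q ?B l'"
      using l' c' by (auto simp: natural_on_def M.id_left[OF l'(1)])
    from EJ.ext_transpose_hom[OF Q B this]
    have al: "EJ.ext_transpose Q ?B l' \<in> Hom FJ Q (R (EP.ext ?B))"
      by (simp add: RE)
    \<comment> \<open>At \<open>x\<close> the probe has value \<open>c'\<close>, so the component of
      \<open>\<beta>\<close> there is the mediating map.\<close>
    obtain \<beta> where b: "\<beta> \<in> Hom FP T (EP.ext ?B)" "Rn \<beta> \<cdot>\<^bsub>FJ\<^esub> \<eta> = EJ.ext_transpose Q ?B l'"
      by (rule lan_ex[OF lan eB(1) al])
    have nb: "natural_on M P D (\<lambda>v. v) T ?B (nt_at \<beta>)"
      by (rule EP.natural_on_ext[OF b(1)])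
    have xD: "x \<in> D" using x by (simp add: D_def)
    show "\<exists>!u. u \<in> Hom M (fobj T x) c' \<and> (\<forall>j\<in>Obj (poset_cat (P\<lparr>carrier := below x\<rparr>)). u \<cdot> ?l j = l' j)"
    proof (rule ex1I[of _ "nt_at \<beta> x"], intro conjI ballI)
      show bx: "nt_at \<beta> x \<in> Hom M (fobj T x) c'"
        using nb xD x by (auto simp: natural_on_def)
      fix v assume "v \<in> Obj (poset_cat (P\<lparr>carrier := below x\<rparr>))"
      then have v: "v \<in> below x" by simp
      then have vD: "v \<in> D" by (simp add: D_def)
      have m: "nt_at \<eta> v \<in> Hom M (fobj Q v) (fobj T v)" "farr T (v, x) \<in> Hom M (fobj T v) (fobj T x)"
        "nt_at \<beta> v \<in> Hom M (fobj T v) c'"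
        using v x nb vD by (auto intro: en tf simp: natural_on_def)
      have "nt_at \<beta> x \<cdot> ?l v = (nt_at \<beta> x \<cdot> farr T (v, x)) \<cdot> nt_at \<eta> v"
        by (rule M.comp_assoc[OF m(1,2) bx])
      also have "\<dots> = nt_at \<beta> v \<cdot> nt_at \<eta> v"
        using nb xD vD v x by (auto simp: natural_on_def M.id_left[OF m(3)])
      also have "\<dots> = l' v"
        using arg_cong[OF b(2), of "\<lambda>n. nt_at n v"] v EJ.ext_transpose_at[OF v] by simp
      finally show "nt_at \<beta> x \<cdot> ?l v = l' v" .
    next
      fix u assume u: "u \<in> Hom M (fobj T x) c'
        \<and> (\<forall>j\<in>Obj (poset_cat (P\<lparr>carrier := below x\<rparr>)). u \<cdot> ?l j = l' j)"
      \<comment> \<open>Any mediating map \<open>u\<close> spreads over the down-set of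
        \<open>x\<close> to a transformation from \<open>T\<close> to the probe. It agrees with
        \<open>\<beta>\<close> after the unit, hence everywhere, in particular at
        \<open>x\<close>.\<close>
      let ?a = "\<lambda>v. u \<cdot> farr T (v, x)"
      have ah: "?a v \<in> Hom M (fobj T v) c'" if "v \<in> D" for v
        using that u x by (auto simp: D_def intro!: M.comp_hom[OF tf(2)])
      have "?a w \<cdot> farr T (v, w) = ?a v" if "v \<in> D" "w \<in> D" "v \<sqsubseteq>\<^bsub>P\<^esub> w" for v w
      proof -
        have "?a w \<cdot> farr T (v, w) = u \<cdot> (farr T (w, x) \<cdot> farr T (v, w))"
          using M.comp_assoc[OF tf(2) tf(2), of v w x u c'] that u x by (simp add: D_def)
        also have "\<dots> = ?a v" using that x by (simp add: D_def tf(4))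
        finally show ?thesis .
      qed
      then have "natural_on M P D (\<lambda>v. v) T ?B ?a"
        using ah by (auto simp: natural_on_def D_iff M.id_left[OF ah])
      from EP.ext_transpose_hom[OF T B this]
      have g: "EP.ext_transpose T ?B ?a \<in> Hom FP T (EP.ext ?B)" .
      have "EP.ext_transpose T ?B ?a = \<beta>"
      proof (rule lan_unique[OF lan g b(1)])
        fix v assume v: "v \<in> A"
        show "nt_at (EP.ext_transpose T ?B ?a) v \<cdot> nt_at \<eta> v = nt_at \<beta> v \<cdot> nt_at \<eta> v"
        proof (cases "v \<sqsubseteq>\<^bsub>P\<^esub> x")
          case True
          then have v': "v \<in> below x" "v \<in> D" using v by (auto simp: D_def)
          have "nt_at (EP.ext_transpose T ?B ?a) v \<cdot> nt_at \<eta> v = u \<cdot> ?l v"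
            using M.comp_assoc[OF en[OF v] tf(2), of x u c'] v u x True
              EP.ext_transpose_at[OF v'(2)] by simp
          also have "\<dots> = l' v" using u v' by simp
          also have "\<dots> = nt_at \<beta> v \<cdot> nt_at \<eta> v"
            using arg_cong[OF b(2), of "\<lambda>n. nt_at n v"] v EJ.ext_transpose_at[OF v'(1)] by simp
          finally show ?thesis .
        next
          case False
          then have "v \<notin> D" by (simp add: D_def)
          then have "fobj (EP.ext ?B) v = t" using v by simp
          then show ?thesis
            using poset_natD(1)[OF g] poset_natD(1)[OF b(1)] v M.comp_hom[OF en[OF v]]
              terminal_unique[OF terminal] M.hom_obj(1)[OF en[OF v]]
            by (metis A_carrier)
        qed
      qed
      then have "nt_at \<beta> x = u \<cdot> farr T (x, x)"
        using EP.ext_transpose_at[OF xD, of T ?B ?a] by simp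
      then show "u = nt_at \<beta> x" using u x by (auto simp: tf(3) M.id_right)
    qed
  qed
qed

lemma lan_eqI:
  assumes "is_lan Q T \<eta>" "x \<in> carrier P" "u \<in> Hom M (fobj T x) z" "u' \<in> Hom M (fobj T x) z"
    and "\<And>v. v \<in> A \<Longrightarrow> v \<sqsubseteq>\<^bsub>P\<^esub> x \<Longrightarrow> u \<cdot> (farr T (v, x) \<cdot> nt_at \<eta> v) = u' \<cdot> (farr T (v, x) \<cdot> nt_at \<eta> v)"
  shows "u = u'"
proof -
  have "is_colimit (poset_cat (J\<lparr>carrier := below x\<rparr>)) M Q (fobj T x)
           (\<lambda>v. farr T (v, x) \<cdot> nt_at \<eta> v)"
    using lan_pointwise[OF assms(1,2)] by simp
  from poset_colimit_eqI[OF cat_M is_lanD(3)[OF assms(1)] _ this assms(3,4)] show ?thesis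
    using assms(5) by auto
qed

text \<open>For \<open>v\<close> in \<open>A\<close>, \<open>v\<close> is the greatest element of
  \<open>below v\<close>, so the colimit that computes \<open>T\<close> at \<open>v\<close> is
  \<open>Q\<close> at \<open>v\<close>.\<close>

lemma lan_unit_inverse:
  assumes lan: "is_lan Q T \<eta>" and v: "v \<in> A"
  obtains r where "r \<in> Hom M (fobj T v) (fobj Q v)"
    and "r \<cdot> nt_at \<eta> v = Id M (fobj Q v)" and "nt_at \<eta> v \<cdot> r = Id M (fobj T v)"
proof -
  note T = is_lanD(1)[OF lan] and eta = is_lanD(2)[OF lan] and Q = is_lanD(3)[OF lan]
  note tf = poset_functorD[OF T]
  have qf: "\<And>x. x \<in> A \<Longrightarrow> fobj Q x \<in> Obj M"
    "\<And>x y. \<lbrakk>x \<in> A; y \<in> A; x \<sqsubseteq>\<^bsub>P\<^esub> y\<rbrakk> \<Longrightarrow> farr Q (x, y) \<in> Hom M (fobj Q x) (fobj Q y)"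
    "\<And>x y z. \<lbrakk>x \<in> A; y \<in> A; z \<in> A; x \<sqsubseteq>\<^bsub>P\<^esub> y; y \<sqsubseteq>\<^bsub>P\<^esub> z\<rbrakk>
      \<Longrightarrow> farr Q (y, z) \<cdot> farr Q (x, y) = farr Q (x, z)"
    "\<And>x. x \<in> A \<Longrightarrow> farr Q (x, x) = Id M (fobj Q x)"
    using poset_functorD[OF Q] by auto
  have en: "nt_at \<eta> v \<in> Hom M (fobj Q v) (fobj T v)" if "v \<in> A" for v
    using poset_natD(1)[OF eta, of v] that by simp
  have en2: "nt_at \<eta> w \<cdot> farr Q (v, w) = farr T (v, w) \<cdot> nt_at \<eta> v"
    if "v \<in> A" "w \<in> A" "v \<sqsubseteq>\<^bsub>P\<^esub> w" for v w
    using poset_natD(2)[OF eta, of v w] that by simp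
  have vP: "v \<in> carrier P" using v by simp
  have "is_cocone (poset_cat (P\<lparr>carrier := below v\<rparr>)) M Q (fobj Q v) (\<lambda>w. farr Q (w, v))"
    using v by (auto simp: poset_cocone_iff qf)
  then obtain r where r: "r \<in> Hom M (fobj T v) (fobj Q v)"
    "\<And>w. w \<in> below v \<Longrightarrow> r \<cdot> (farr T (w, v) \<cdot> nt_at \<eta> w) = farr Q (w, v)"
    by (rule colimit_ex[OF lan_pointwise[OF lan vP]]) auto
  have r1: "r \<cdot> nt_at \<eta> v = Id M (fobj Q v)"
    using r(2)[of v] v tf(3)[OF vP] M.id_left[OF en[OF v]] by (simp add: qf)
  have "nt_at \<eta> v \<cdot> r = Id M (fobj T v)"
  proof (rule lan_eqI[OF lan vP M.comp_hom[OF r(1) en[OF v]] M.id_hom[OF tf(1)[OF vP]]])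
    fix w assume w: "w \<in> A" "w \<sqsubseteq>\<^bsub>P\<^esub> v"
    have l: "farr T (w, v) \<cdot> nt_at \<eta> w \<in> Hom M (fobj Q w) (fobj T v)"
      using w v by (intro M.comp_hom[OF en tf(2)]) auto
    have "(nt_at \<eta> v \<cdot> r) \<cdot> (farr T (w, v) \<cdot> nt_at \<eta> w) = nt_at \<eta> v \<cdot> farr Q (w, v)"
      using M.comp_assoc[OF l r(1) en[OF v]] r(2) w by simp
    also have "\<dots> = Id M (fobj T v) \<cdot> (farr T (w, v) \<cdot> nt_at \<eta> w)"
      using en2 w v M.id_left[OF l] by simp
    finally show "(nt_at \<eta> v \<cdot> r) \<cdot> (farr T (w, v) \<cdot> nt_at \<eta> w)
      = Id M (fobj T v) \<cdot> (farr T (w, v) \<cdot> nt_at \<eta> w)" .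
  qed
  with r(1) r1 show ?thesis by (rule that)
qed

end

context subposet_kan
begin

text \<open>The values are pointwise colimits; the transition maps and the components of every
  factorization are mediating maps. Each identity between them is therefore checked on colimit
  legs.\<close>

lemma lan_exists:
  assumes Q: "is_functor CJ M Q"
    and col: "\<And>x. x \<in> carrier P \<Longrightarrow> \<exists>c l. is_colimit (poset_cat (P\<lparr>carrier := below x\<rparr>)) M Q c l"
  obtains T \<eta> where "is_lan Q T \<eta>"
proof -
  obtain c l where cl: "\<And>x. x \<in> carrier P
    \<Longrightarrow> is_colimit (poset_cat (P\<lparr>carrier := below x\<rparr>)) M Q (c x) (l x)"
    using col by metis
  have cc: "is_cocone (poset_cat (P\<lparr>carrier := below x\<rparr>)) M Q (c x) (l x)" if "x \<in> carrier P" for x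
    using cl[OF that] by (simp add: is_colimit_def)
  have lh: "l x v \<in> Hom M (fobj Q v) (c x)" if "x \<in> carrier P" "v \<in> A" "v \<sqsubseteq>\<^bsub>P\<^esub> x" for x v
    using cc[OF that(1)] that by (simp add: poset_cocone_iff)
  have ln: "l x w \<cdot> farr Q (v, w) = l x v"
    if "x \<in> carrier P" "v \<in> A" "v \<sqsubseteq>\<^bsub>P\<^esub> x" "w \<in> A" "w \<sqsubseteq>\<^bsub>P\<^esub> x" "v \<sqsubseteq>\<^bsub>P\<^esub> w" for x v w
    using cc[OF that(1)] that by (simp add: poset_cocone_iff)
  have eqI: "u = u'" if "x \<in> carrier P" "u \<in> Hom M (c x) z" "u' \<in> Hom M (c x) z"
      "\<And>v. v \<in> A \<Longrightarrow> v \<sqsubseteq>\<^bsub>P\<^esub> x \<Longrightarrow> u \<cdot> l x v = u' \<cdot> l x v" for x u u' z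
  proof -
    have "is_colimit (poset_cat (J\<lparr>carrier := below x\<rparr>)) M Q (c x) (l x)"
      using cl[OF that(1)] by simp
    from poset_colimit_eqI[OF cat_M Q _ this that(2,3)] show ?thesis using that(4) by auto
  qed
  have exI: "\<exists>u. u \<in> Hom M (c x) z \<and> (\<forall>v\<in>A. v \<sqsubseteq>\<^bsub>P\<^esub> x \<longrightarrow> u \<cdot> l x v = m v)"
    if "x \<in> carrier P" "z \<in> Obj M" "\<And>v. v \<in> A \<Longrightarrow> v \<sqsubseteq>\<^bsub>P\<^esub> x \<Longrightarrow> m v \<in> Hom M (fobj Q v) z"
      "\<And>v w. v \<in> A \<Longrightarrow> v \<sqsubseteq>\<^bsub>P\<^esub> x \<Longrightarrow> w \<in> A \<Longrightarrow> w \<sqsubseteq>\<^bsub>P\<^esub> x \<Longrightarrow> v \<sqsubseteq>\<^bsub>P\<^esub> w \<Longrightarrow> m w \<cdot> farr Q (v, w) = m v"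
    for x z m
  proof -
    have "is_cocone (poset_cat (P\<lparr>carrier := below x\<rparr>)) M Q z m"
      using that by (auto simp: poset_cocone_iff)
    from colimit_ex[OF cl[OF that(1)] this]
    obtain u where "u \<in> Hom M (c x) z" "\<And>v. v \<in> below x \<Longrightarrow> u \<cdot> l x v = m v" by auto
    then show ?thesis by auto
  qed
  have "\<exists>u. u \<in> Hom M (c x) (c y) \<and> (\<forall>v\<in>A. v \<sqsubseteq>\<^bsub>P\<^esub> x \<longrightarrow> u \<cdot> l x v = l y v)"
    if "x \<in> carrier P" "y \<in> carrier P" "x \<sqsubseteq>\<^bsub>P\<^esub> y" for x y
  proof (rule exI)
    have le: "v \<sqsubseteq>\<^bsub>P\<^esub> y" if "v \<in> A" "v \<sqsubseteq>\<^bsub>P\<^esub> x" for v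
      using P.le_trans[OF that(2)] \<open>x \<sqsubseteq>\<^bsub>P\<^esub> y\<close> that \<open>x \<in> carrier P\<close> \<open>y \<in> carrier P\<close> by simp
    show "c y \<in> Obj M" using cc[OF that(2)] by (simp add: is_cocone_def)
    show "l y v \<in> Hom M (fobj Q v) (c y)" if "v \<in> A" "v \<sqsubseteq>\<^bsub>P\<^esub> x" for v
      using lh le that \<open>y \<in> carrier P\<close> by simp
    show "l y w \<cdot> farr Q (v, w) = l y v"
      if "v \<in> A" "v \<sqsubseteq>\<^bsub>P\<^esub> x" "w \<in> A" "w \<sqsubseteq>\<^bsub>P\<^esub> x" "v \<sqsubseteq>\<^bsub>P\<^esub> w" for v w
      using ln le that \<open>y \<in> carrier P\<close> by simp
  qed (rule that(1))
  then obtain u where uh: "\<And>x y. \<lbrakk>x \<in> carrier P; y \<in> carrier P; x \<sqsubseteq>\<^bsub>P\<^esub> y\<rbrakk> \<Longrightarrow> u x y \<in> Hom M (c x) (c y)"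
    and ul: "\<And>x y v. \<lbrakk>x \<in> carrier P; y \<in> carrier P; x \<sqsubseteq>\<^bsub>P\<^esub> y; v \<in> A; v \<sqsubseteq>\<^bsub>P\<^esub> x\<rbrakk> \<Longrightarrow> u x y \<cdot> l x v = l y v"
    by metis
  define T where "T = mk_functor P c u"
  have T: "is_functor CP M T"
    unfolding T_def
  proof (rule is_functor_mk_functor[OF po_P cat_M uh])
    fix x assume x: "x \<in> carrier P"
    show "u x x = Id M (c x)"
    proof (rule eqI[OF x uh[OF x x] M.id_hom])
      show "c x \<in> Obj M" using cc[OF x] by (simp add: is_cocone_def)
      show "u x x \<cdot> l x v = Id M (c x) \<cdot> l x v" if "v \<in> A" "v \<sqsubseteq>\<^bsub>P\<^esub> x" for v
        using M.id_left[OF lh[OF x that]] ul[OF x x _ that] x by simp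
    qed (use x in simp)
  next
    fix x y z assume x: "x \<in> carrier P" and y: "y \<in> carrier P" and z: "z \<in> carrier P"
      and xy: "x \<sqsubseteq>\<^bsub>P\<^esub> y" and yz: "y \<sqsubseteq>\<^bsub>P\<^esub> z"
    have xz: "x \<sqsubseteq>\<^bsub>P\<^esub> z" by (rule P.le_trans[OF xy yz x y z])
    show "u x z = u y z \<cdot> u x y"
    proof (rule eqI[OF x uh[OF x z xz] M.comp_hom[OF uh[OF x y xy] uh[OF y z yz]]])
      fix v assume v: "v \<in> A" "v \<sqsubseteq>\<^bsub>P\<^esub> x"
      have vy: "v \<sqsubseteq>\<^bsub>P\<^esub> y" using P.le_trans[OF v(2) xy] v x y by simp
      show "u x z \<cdot> l x v = (u y z \<cdot> u x y) \<cdot> l x v"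
        using M.comp_assoc[OF lh[OF x v] uh[OF x y xy] uh[OF y z yz]]
          ul[OF x z xz v] ul[OF x y xy v] ul[OF y z yz v(1) vy] by simp
    qed
  qed
  have Tl: "farr T (v, x) \<cdot> l v v = l x v" if "v \<in> A" "x \<in> carrier P" "v \<sqsubseteq>\<^bsub>P\<^esub> x" for v x
    using that ul[of v x v] by (simp add: T_def)
  \<comment> \<open>Since \<open>v\<close> belongs to \<open>below v\<close>, the colimit at
    \<open>v\<close> has a leg indexed by \<open>v\<close> itself.\<close>
  define \<eta> where "\<eta> = mk_nat CJ Q (R T) (\<lambda>v. l v v)"
  have eta: "\<eta> \<in> Hom FJ Q (R T)"
    unfolding \<eta>_def
  proof (rule poset_natI[OF po_J Q is_functor_R[OF T]])
    show "l x x \<in> Hom M (fobj Q x) (fobj (R T) x)" if "x \<in> carrier J" for x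
      using that lh[of x x] by (simp add: T_def)
    show "l y y \<cdot> farr Q (x, y) = farr (R T) (x, y) \<cdot> l x x"
      if "x \<in> carrier J" "y \<in> carrier J" "x \<sqsubseteq>\<^bsub>J\<^esub> y" for x y
      using that ln[of y x y] Tl[of x y] by simp
  qed
  have etav: "nt_at \<eta> v = l v v" if "v \<in> A" for v
    using that by (simp add: \<eta>_def)
  have "is_lan Q T \<eta>"
    unfolding is_left_kan_extension_def
  proof (intro conjI ballI)
    show "T \<in> Obj FP" using T by simp
    show "\<eta> \<in> Hom FJ Q (R T)" by (rule eta)
    fix G \<alpha> assume "G \<in> Obj FP" and al: "\<alpha> \<in> Hom FJ Q (R G)"
    then have G: "is_functor CP M G" by simp
    note gf = poset_functorD[OF G]
    have ah: "nt_at \<alpha> v \<in> Hom M (fobj Q v) (fobj G v)" if "v \<in> A" for v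
      using poset_natD(1)[OF al, of v] that by simp
    have an: "nt_at \<alpha> w \<cdot> farr Q (v, w) = farr G (v, w) \<cdot> nt_at \<alpha> v"
      if "v \<in> A" "w \<in> A" "v \<sqsubseteq>\<^bsub>P\<^esub> w" for v w
      using poset_natD(2)[OF al, of v w] that by simp
    have "\<exists>b. b \<in> Hom M (c x) (fobj G x) \<and> (\<forall>v\<in>A. v \<sqsubseteq>\<^bsub>P\<^esub> x \<longrightarrow> b \<cdot> l x v = farr G (v, x) \<cdot> nt_at \<alpha> v)"
      if x: "x \<in> carrier P" for x
    proof (rule exI[OF x gf(1)[OF x]])
      show "farr G (v, x) \<cdot> nt_at \<alpha> v \<in> Hom M (fobj Q v) (fobj G x)" if "v \<in> A" "v \<sqsubseteq>\<^bsub>P\<^esub> x" for v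
        using that x by (intro M.comp_hom[OF ah gf(2)]) auto
      show "(farr G (w, x) \<cdot> nt_at \<alpha> w) \<cdot> farr Q (v, w) = farr G (v, x) \<cdot> nt_at \<alpha> v"
        if vw: "v \<in> A" "v \<sqsubseteq>\<^bsub>P\<^esub> x" "w \<in> A" "w \<sqsubseteq>\<^bsub>P\<^esub> x" "v \<sqsubseteq>\<^bsub>P\<^esub> w" for v w
      proof -
        have m: "farr Q (v, w) \<in> Hom M (fobj Q v) (fobj Q w)"
          "farr G (w, x) \<in> Hom M (fobj G w) (fobj G x)"
          "farr G (v, w) \<in> Hom M (fobj G v) (fobj G w)"
          using vw x poset_functorD(2)[OF Q, of v w] by (auto intro: gf)
        show ?thesis
          using M.comp_assoc[OF m(1) ah[OF vw(3)] m(2)] M.comp_assoc[OF ah[OF vw(1)] m(3) m(2)]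
            an[OF vw(1,3,5)] gf(4)[of v w x] vw x by simp
      qed
    qed
    then obtain b where bh: "\<And>x. x \<in> carrier P \<Longrightarrow> b x \<in> Hom M (c x) (fobj G x)"
      and bl: "\<And>x v. \<lbrakk>x \<in> carrier P; v \<in> A; v \<sqsubseteq>\<^bsub>P\<^esub> x\<rbrakk> \<Longrightarrow> b x \<cdot> l x v = farr G (v, x) \<cdot> nt_at \<alpha> v"
      by metis
    define \<beta> where "\<beta> = mk_nat CP T G b"
    have b: "\<beta> \<in> Hom FP T G"
      unfolding \<beta>_def
    proof (rule poset_natI[OF po_P T G])
      show "b x \<in> Hom M (fobj T x) (fobj G x)" if "x \<in> carrier P" for x
        using that bh by (simp add: T_def)
      fix x y assume xy: "x \<in> carrier P" "y \<in> carrier P" "x \<sqsubseteq>\<^bsub>P\<^esub> y"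
      note m = uh[OF xy] bh[OF xy(1)] bh[OF xy(2)] gf(2)[OF xy]
      have "b y \<cdot> u x y = farr G (x, y) \<cdot> b x"
      proof (rule eqI[OF xy(1) M.comp_hom[OF m(1,3)] M.comp_hom[OF m(2,4)]])
        fix v assume v: "v \<in> A" "v \<sqsubseteq>\<^bsub>P\<^esub> x"
        have vy: "v \<sqsubseteq>\<^bsub>P\<^esub> y" using P.le_trans[OF v(2) xy(3)] v xy by simp
        have gv: "farr G (v, x) \<in> Hom M (fobj G v) (fobj G x)" using v xy by (simp add: gf)
        have "(b y \<cdot> u x y) \<cdot> l x v = farr G (v, y) \<cdot> nt_at \<alpha> v"
          using M.comp_assoc[OF lh[OF xy(1) v] m(1,3)] ul[OF xy v] bl[OF xy(2) v(1) vy] by simp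
        also have "\<dots> = farr G (x, y) \<cdot> (farr G (v, x) \<cdot> nt_at \<alpha> v)"
          using M.comp_assoc[OF ah[OF v(1)] gv m(4)] gf(4)[of v x y] v xy by simp
        also have "\<dots> = (farr G (x, y) \<cdot> b x) \<cdot> l x v"
          using M.comp_assoc[OF lh[OF xy(1) v] m(2,4)] bl[OF xy(1) v] by simp
        finally show "(b y \<cdot> u x y) \<cdot> l x v = (farr G (x, y) \<cdot> b x) \<cdot> l x v" .
      qed
      then show "b y \<cdot> farr T (x, y) = farr G (x, y) \<cdot> b x"
        using xy by (simp add: T_def)
    qed
    show "\<exists>!\<beta>. \<beta> \<in> Hom FP T G \<and> Rn \<beta> \<cdot>\<^bsub>FJ\<^esub> \<eta> = \<alpha>"
    proof (rule ex1I[of _ \<beta>], intro conjI b)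
      show "Rn \<beta> \<cdot>\<^bsub>FJ\<^esub> \<eta> = \<alpha>"
      proof (rule nat_eqI[OF FJ.comp_hom[OF eta Rn_hom[OF b]] al])
        fix v assume "v \<in> Obj CJ"
        then have v: "v \<in> A" by simp
        then show "nt_at (Rn \<beta> \<cdot>\<^bsub>FJ\<^esub> \<eta>) v = nt_at \<alpha> v"
          using bl[of v v] gf(3)[of v] M.id_left[OF ah] by (simp add: etav \<beta>_def)
      qed
      fix \<gamma> assume g: "\<gamma> \<in> Hom FP T G \<and> Rn \<gamma> \<cdot>\<^bsub>FJ\<^esub> \<eta> = \<alpha>"
      then have g1: "\<gamma> \<in> Hom FP T G" by simp
      have gv: "nt_at \<gamma> v \<cdot> l v v = nt_at \<alpha> v" if "v \<in> A" for v
        using arg_cong[OF conjunct2[OF g], of "\<lambda>n. nt_at n v"] that by (simp add: etav)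
      show "\<gamma> = \<beta>"
      proof (rule nat_eqI[OF g1 b])
        fix x assume "x \<in> Obj CP"
        then have x: "x \<in> carrier P" by simp
        have gx: "nt_at \<gamma> x \<in> Hom M (c x) (fobj G x)" using poset_natD(1)[OF g1 x] x by (simp add: T_def)
        have "nt_at \<gamma> x = b x"
        proof (rule eqI[OF x gx bh[OF x]])
          fix v assume v: "v \<in> A" "v \<sqsubseteq>\<^bsub>P\<^esub> x"
          have vP: "v \<in> carrier P" using v by simp
          have m: "l v v \<in> Hom M (fobj Q v) (fobj T v)" "nt_at \<gamma> v \<in> Hom M (fobj T v) (fobj G v)"
            "farr T (v, x) \<in> Hom M (fobj T v) (fobj T x)" "nt_at \<gamma> x \<in> Hom M (fobj T x) (fobj G x)"
            "farr G (v, x) \<in> Hom M (fobj G v) (fobj G x)"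
            using lh[of v v] v vP x poset_natD(1)[OF g1]
              by (auto simp: T_def poset_functorD[OF T, unfolded T_def] gf uh)
          have "nt_at \<gamma> x \<cdot> l x v = (nt_at \<gamma> x \<cdot> farr T (v, x)) \<cdot> l v v"
            using M.comp_assoc[OF m(1,3,4)] Tl[OF v(1) x v(2)] by simp
          also have "\<dots> = farr G (v, x) \<cdot> nt_at \<alpha> v"
            using poset_natD(2)[OF g1 vP x v(2)] M.comp_assoc[OF m(1,2,5)] gv[OF v(1)] by simp
          also have "\<dots> = b x \<cdot> l x v"
            using bl[OF x v] by simp
          finally show "nt_at \<gamma> x \<cdot> l x v = b x \<cdot> l x v" .
        qed
        then show "nt_at \<gamma> x = nt_at \<beta> x" using x by (simp add: \<beta>_def)
      qed
    qed
  qed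
  then show ?thesis by (rule that)
qed

end

section \<open>Projective model structures\<close>

text \<open>Collects axioms of \<open>M\<close> that do not mention the smallness type, so that they
  can be combined with index posets on any type.\<close>

locale model_core =
  fixes M :: "('o, 'a) premodel" (structure)
  assumes cat_M: "category M"
    and wide_weq: "wide_subcategory M (weq M)" and wide_fib: "wide_subcategory M (fib M)"
    and two_of_three: "two_out_of_three M (weq M)"
    and retract_weq: "retract_closed M (weq M)" and retract_fib: "retract_closed M (fib M)"
    and factor: "factorizes M (cof M \<inter> weq M) (fib M)"
begin

sublocale M: category M by (rule cat_M)

lemma id_weq: "x \<in> Obj M \<Longrightarrow> Id M x \<in> weq M"
  and id_fib: "x \<in> Obj M \<Longrightarrow> Id M x \<in> fib M"
  using wide_weq wide_fib by (auto simp: wide_subcategory_def)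

lemma
  assumes "f \<in> Hom M x y" "g \<in> Hom M y z"
  shows weq_comp: "\<lbrakk>f \<in> weq M; g \<in> weq M\<rbrakk> \<Longrightarrow> g \<cdot> f \<in> weq M"
    and weq_cancel_right: "\<lbrakk>f \<in> weq M; g \<cdot> f \<in> weq M\<rbrakk> \<Longrightarrow> g \<in> weq M"
    and weq_cancel_left: "\<lbrakk>g \<in> weq M; g \<cdot> f \<in> weq M\<rbrakk> \<Longrightarrow> f \<in> weq M"
  using two_of_three assms by (auto simp: two_out_of_three_def Hom_def)

text \<open>Retract argument: factor \<open>u\<close> as a trivial cofibration \<open>j\<close>
  followed by a fibration \<open>p\<close>. Lifting \<open>u\<close> against \<open>p\<close>
  exhibits \<open>u\<close> as a retract of \<open>j\<close>.\<close>

lemma lifting_imp_weq: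
  assumes u: "u \<in> Hom M x y" and lift: "\<And>p. p \<in> fib M \<Longrightarrow> has_lifting M u p"
  shows "u \<in> weq M"
proof -
  have uA: "u \<in> Arr M" using u by (rule HomD)
  then obtain j p where jp: "j \<in> cof M \<inter> weq M" "p \<in> fib M" "Cod M j = Dom M p" "u = p \<cdot> j"
    using factor unfolding factorizes_def by blast
  have A: "j \<in> Arr M" "p \<in> Arr M"
    using jp wide_weq wide_fib by (auto simp: wide_subcategory_def)
  have j: "j \<in> Hom M x (Dom M p)" and p: "p \<in> Hom M (Dom M p) y"
    using A jp M.comp_arr[OF A(1,2) jp(3)] u by (auto simp: Hom_def)
  have "Id M y \<in> Hom M y y" "p \<cdot> j = Id M y \<cdot> u"
    using u jp(4) M.id_left[OF u] M.id_hom M.hom_obj(2)[OF u] by auto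
  then obtain h where h: "h \<in> Hom M y (Dom M p)" "h \<cdot> u = j" "p \<cdot> h = Id M y"
    using lift[OF jp(2)] j HomD[OF u] HomD[OF p] unfolding has_lifting_def by auto
  have "retract_of M u j"
    unfolding retract_of_def
  proof (intro conjI bexI)
    show "Id M x \<cdot> Id M x = Id M (Dom M u)"
      using HomD[OF u] M.id_left[OF M.id_hom] M.hom_obj(1)[OF u] by auto
    show "p \<cdot> h = Id M (Cod M u)" using h HomD[OF u] by auto
    show "j \<cdot> Id M x = h \<cdot> u" using h M.id_right[OF j] by simp
    show "u \<cdot> Id M x = p \<cdot> j" using jp M.id_right[OF u] by simp
  qed (use u p j h M.id_hom M.hom_obj(1)[OF u] HomD[OF u] HomD[OF j] in auto)
  then show ?thesis
    using retract_weq jp(1) unfolding retract_closed_def by blast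
qed

end

lemma model_core: "model_category small M \<Longrightarrow> model_core M"
  by (auto simp: model_category_def intro!: model_core.intro)

text \<open>A square from the map of colimits to a fibration \<open>p\<close> transposes to a square
  over \<open>D\<close> from \<open>j\<close> to the constant transformation at \<open>p\<close>,
  which is solved there. The solution is a cocone and so induces the diagonal. Thus the map of
  colimits lifts against every fibration.\<close>

lemma colimit_map_weq:
  assumes M: "model_core M" and t: "is_terminal M t" and po: "partial_order J"
    and D: "D \<subseteq> carrier J" "\<And>v w. \<lbrakk>w \<in> D; v \<in> carrier J; v \<sqsubseteq>\<^bsub>J\<^esub> w\<rbrakk> \<Longrightarrow> v \<in> D"
    and j: "j \<in> Hom (functor_cat (poset_cat J) M) X Y"
    and lift: "\<And>p. p \<in> objectwise (poset_cat J) M (fib M) \<Longrightarrow> has_lifting (functor_cat (poset_cat J) M) j p"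
    and c: "is_colimit (poset_cat (J\<lparr>carrier := D\<rparr>)) M X c l"
    and c': "is_colimit (poset_cat (J\<lparr>carrier := D\<rparr>)) M Y c' l'"
    and u: "u \<in> Hom M c c'" "\<And>v. v \<in> D \<Longrightarrow> u \<cdot>\<^bsub>M\<^esub> l v = l' v \<cdot>\<^bsub>M\<^esub> nt_at j v"
  shows "u \<in> weq M"
proof -
  interpret M: model_core M by (rule M)
  interpret E: terminal_extension M J J D "\<lambda>v. v" t
    by (rule terminal_extension.intro) (use D t po M.cat_M in auto)
  note jf = natD(1,2)[OF j]
  have cc: "is_cocone (poset_cat (J\<lparr>carrier := D\<rparr>)) M X c l"
    "is_cocone (poset_cat (J\<lparr>carrier := D\<rparr>)) M Y c' l'"
    using c c' by (auto simp: is_colimit_def)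
  then have lh: "\<And>v. v \<in> D \<Longrightarrow> l v \<in> Hom M (fobj X v) c" "\<And>v. v \<in> D \<Longrightarrow> l' v \<in> Hom M (fobj Y v) c'"
    and ln: "\<And>v w. v \<in> D \<Longrightarrow> w \<in> D \<Longrightarrow> v \<sqsubseteq>\<^bsub>J\<^esub> w \<Longrightarrow> l w \<cdot>\<^bsub>M\<^esub> farr X (v, w) = l v"
     "\<And>v w. v \<in> D \<Longrightarrow> w \<in> D \<Longrightarrow> v \<sqsubseteq>\<^bsub>J\<^esub> w \<Longrightarrow> l' w \<cdot>\<^bsub>M\<^esub> farr Y (v, w) = l' v"
    by (auto simp: poset_cocone_iff)
  have xh: "farr X (v, w) \<in> Hom M (fobj X v) (fobj X w)" "farr Y (v, w) \<in> Hom M (fobj Y v) (fobj Y w)"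
    if "v \<in> D" "w \<in> D" "v \<sqsubseteq>\<^bsub>J\<^esub> w" for v w
    using that D(1) by (auto intro: poset_functorD(2)[OF jf(1)] poset_functorD(2)[OF jf(2)])
  have jh: "nt_at j v \<in> Hom M (fobj X v) (fobj Y v)" if "v \<in> D" for v
    using poset_natD(1)[OF j] that D(1) by auto
  show ?thesis
  proof (rule M.lifting_imp_weq[OF u(1)])
    fix p assume pf: "p \<in> fib M"
    then have "p \<in> Arr M" using M.wide_fib by (auto simp: wide_subcategory_def)
    then obtain B Z where p: "p \<in> Hom M B Z" by (auto simp: Hom_def)
    have BZ: "B \<in> Obj M" "Z \<in> Obj M" using M.M.hom_obj[OF p] .
    let ?B = "const_functor J M B" and ?Z = "const_functor J M Z"
    note cf = is_functor_const[OF po M.cat_M BZ(1)] is_functor_const[OF po M.cat_M BZ(2)]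
    let ?p = "mk_nat (poset_cat J) ?B ?Z (\<lambda>_. p)"
    have ph: "?p \<in> Hom (functor_cat (poset_cat J) M) ?B ?Z"
      by (rule poset_natI[OF po cf]) (use p M.M.id_left[OF p] M.M.id_right[OF p] in auto)
    have pw: "?p \<in> objectwise (poset_cat J) M (fib M)"
      using ph pf by (auto simp: objectwise_def Hom_def)
    show "has_lifting M u p"
      unfolding has_lifting_def
    proof (intro ballI impI)
      fix a b assume "a \<in> Hom M (Dom M u) (Dom M p)"
        "b \<in> Hom M (Cod M u) (Cod M p)" and ab: "p \<cdot>\<^bsub>M\<^esub> a = b \<cdot>\<^bsub>M\<^esub> u"
      then have a: "a \<in> Hom M c B" and b: "b \<in> Hom M c' Z"
        using HomD[OF u(1)] HomD[OF p] by auto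
      let ?a = "\<lambda>v. a \<cdot>\<^bsub>M\<^esub> l v" and ?b = "\<lambda>v. b \<cdot>\<^bsub>M\<^esub> l' v"
      have ah: "?a v \<in> Hom M (fobj X v) B" and bh: "?b v \<in> Hom M (fobj Y v) Z" if "v \<in> D" for v
        using M.M.comp_hom[OF lh(1)[OF that] a] M.M.comp_hom[OF lh(2)[OF that] b] by auto
      have na: "natural_on M J D (\<lambda>v. v) X ?B ?a"
        unfolding natural_on_def
        using ah D(1) M.M.id_left[OF ah] ln(1) M.M.comp_assoc[OF xh(1) lh(1) a, symmetric]
        by (auto simp: subset_iff)
      have nb: "natural_on M J D (\<lambda>v. v) Y ?Z ?b"
        unfolding natural_on_def
        using bh D(1) M.M.id_left[OF bh] ln(2) M.M.comp_assoc[OF xh(2) lh(2) b, symmetric]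
        by (auto simp: subset_iff)
      have sq: "nt_at ?p v \<cdot>\<^bsub>M\<^esub> ?a v = ?b v \<cdot>\<^bsub>M\<^esub> nt_at j v" if "v \<in> D" for v
        using that D(1) M.M.comp_assoc[OF lh(1)[OF that] a p] M.M.comp_assoc[OF lh(1)[OF that] u(1) b]
          M.M.comp_assoc[OF jh[OF that] lh(2)[OF that] b] ab u(2)[OF that] by (auto simp: subset_iff)
      have St: "Id M t \<in> fib M" using M.id_fib E.t_obj by simp
      obtain h where h: "natural_on M J D (\<lambda>v. v) Y ?B h" "\<And>v. v \<in> D \<Longrightarrow> h v \<cdot>\<^bsub>M\<^esub> nt_at j v = ?a v"
        "\<And>v. v \<in> D \<Longrightarrow> nt_at ?p v \<cdot>\<^bsub>M\<^esub> h v = ?b v"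
        by (rule E.objectwise_lift[OF j lift St ph pw na nb sq]) auto
      have hh: "h v \<in> Hom M (fobj Y v) B" if "v \<in> D" for v
        using bspec[OF conjunct1[OF h(1)[unfolded natural_on_def]] that] subsetD[OF D(1) that] by simp
      have "is_cocone (poset_cat (J\<lparr>carrier := D\<rparr>)) M Y B h"
        unfolding poset_cocone_iff using h(1) D(1) BZ hh M.M.id_left[OF hh]
        by (auto simp: natural_on_def subset_iff)
      from colimit_ex[OF c' this] obtain k where k: "k \<in> Hom M c' B" "\<And>v. v \<in> D \<Longrightarrow> k \<cdot>\<^bsub>M\<^esub> l' v = h v"
        by auto
      have "k \<cdot>\<^bsub>M\<^esub> u = a"
      proof (rule poset_colimit_eqI[OF M.cat_M jf(1) D(1) c M.M.comp_hom[OF u(1) k(1)] a])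
        fix v assume v: "v \<in> D"
        show "(k \<cdot>\<^bsub>M\<^esub> u) \<cdot>\<^bsub>M\<^esub> l v = a \<cdot>\<^bsub>M\<^esub> l v"
          using M.M.comp_assoc[OF lh(1)[OF v] u(1) k(1)]
            M.M.comp_assoc[OF jh[OF v] lh(2)[OF v] k(1)] u(2)[OF v] k(2)[OF v] h(2)[OF v]
          by simp
      qed
      moreover have "p \<cdot>\<^bsub>M\<^esub> k = b"
      proof (rule poset_colimit_eqI[OF M.cat_M jf(2) D(1) c' M.M.comp_hom[OF k(1) p] b])
        fix v assume v: "v \<in> D"
        have "nt_at ?p v = p" using v D(1) by auto
        then show "(p \<cdot>\<^bsub>M\<^esub> k) \<cdot>\<^bsub>M\<^esub> l' v = b \<cdot>\<^bsub>M\<^esub> l' v"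
          using M.M.comp_assoc[OF lh(2)[OF v] k(1) p] k(2)[OF v] h(3)[OF v] by simp
      qed
      ultimately show "\<exists>h\<in>Hom M (Cod M u) (Dom M p). h \<cdot>\<^bsub>M\<^esub> u = a \<and> p \<cdot>\<^bsub>M\<^esub> h = b"
        using k(1) HomD[OF u(1)] HomD[OF p] by auto
    qed
  qed
qed

section \<open>Objectwise classes of maps and projective cofibrancy\<close>

lemma objectwiseI:
  assumes "\<alpha> \<in> Hom (functor_cat C M) F G" "\<And>x. x \<in> Obj C \<Longrightarrow> nt_at \<alpha> x \<in> S"
  shows "\<alpha> \<in> objectwise C M S"
  using assms HomD(1) by (fastforce simp: objectwise_def)

lemma objectwiseD: "\<lbrakk>\<alpha> \<in> objectwise C M S; x \<in> Obj C\<rbrakk> \<Longrightarrow> nt_at \<alpha> x \<in> S"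
  by (simp add: objectwise_def)

lemma objectwise_Int: "objectwise C M (S \<inter> S') = objectwise C M S \<inter> objectwise C M S'"
  by (auto simp: objectwise_def)

lemma projective_simps [simp]:
  "Obj (projective C M) = Obj (functor_cat C M)" "Arr (projective C M) = Arr (functor_cat C M)"
  "Dom (projective C M) = Dom (functor_cat C M)" "Cod (projective C M) = Cod (functor_cat C M)"
  "Id (projective C M) = Id (functor_cat C M)" "Comp (projective C M) = Comp (functor_cat C M)"
  "weq (projective C M) = objectwise C M (weq M)" "fib (projective C M) = objectwise C M (fib M)"
  "cof (projective C M) = {i \<in> Arr (functor_cat C M).
             \<forall>p \<in> objectwise C M (fib M \<inter> weq M). has_lifting (functor_cat C M) i p}"
  by (simp_all add: projective_def precat.defs premodel.defs)

lemma projective_hom [simp]: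
  "Hom (projective C M) = Hom (functor_cat C M)"
  "is_initial (projective C M) = is_initial (functor_cat C M)"
  "has_lifting (projective C M) = has_lifting (functor_cat C M)"
  "is_coproduct (projective C M) = is_coproduct (functor_cat C M)"
  by (intro ext, auto simp: Hom_def is_initial_def has_lifting_def is_coproduct_def)+

lemma is_initial_unique:
  assumes "is_initial C i" "f \<in> Hom C i x" "g \<in> Hom C i x" "category C"
  shows "f = g"
  using assms category.hom_obj(2)[OF assms(4,2)] unfolding is_initial_def by blast

text \<open>
  The part of the projective model structure on \<open>Fun(C, M)\<close> that is invariant under isomorphism
  of \<open>C\<close> without reference to limits of a given size.
\<close>

locale projective_model = model_core M for M :: "('o, 'a) premodel" (structure) +
  fixes C :: "('o1, 'a1) precat"
  assumes cat_C: "category C"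
    and has_init: "\<exists>i. is_initial (functor_cat C M) i"
    and has_coprod: "\<lbrakk>is_functor C M X; is_functor C M Y\<rbrakk>
      \<Longrightarrow> \<exists>c i j. is_coproduct (functor_cat C M) X Y c i j"
    and factor_trivfib: "f \<in> Arr (functor_cat C M) \<Longrightarrow>
      \<exists>i \<in> cof (projective C M). \<exists>p \<in> objectwise C M (fib M \<inter> weq M).
        Cod (functor_cat C M) i = Dom (functor_cat C M) p \<and> f = p \<cdot>\<^bsub>functor_cat C M\<^esub> i"
    and trivcof_lift: "\<lbrakk>i \<in> cof (projective C M); i \<in> objectwise C M (weq M); p \<in> objectwise C M (fib M)\<rbrakk>
      \<Longrightarrow> has_lifting (functor_cat C M) i p"
begin

abbreviation F where "F \<equiv> functor_cat C M"

sublocale F: category F by (rule category_functor_cat[OF cat_C cat_M])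

definition proj_cofibrant where
  "proj_cofibrant Q \<longleftrightarrow> is_functor C M Q \<and>
     (\<forall>p \<in> objectwise C M (fib M \<inter> weq M). \<forall>b \<in> Hom F Q (Cod F p).
        \<exists>h \<in> Hom F Q (Dom F p). p \<cdot>\<^bsub>F\<^esub> h = b)"

lemma proj_cofibrant_lift:
  assumes "proj_cofibrant Q" "p \<in> objectwise C M (fib M \<inter> weq M)" "p \<in> Hom F X Y" "b \<in> Hom F Q Y"
  obtains h where "h \<in> Hom F Q X" "p \<cdot>\<^bsub>F\<^esub> h = b"
  using assms HomD[OF assms(3)] unfolding proj_cofibrant_def by blast

lemma cof_projectiveI:
  assumes "i \<in> Hom F X Y"
    and "\<And>p Z Z' u v. \<lbrakk>p \<in> objectwise C M (fib M \<inter> weq M); p \<in> Hom F Z Z'; u \<in> Hom F X Z; v \<in> Hom F Y Z';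
      p \<cdot>\<^bsub>F\<^esub> u = v \<cdot>\<^bsub>F\<^esub> i\<rbrakk> \<Longrightarrow> \<exists>h \<in> Hom F Y Z. h \<cdot>\<^bsub>F\<^esub> i = u \<and> p \<cdot>\<^bsub>F\<^esub> h = v"
  shows "i \<in> cof (projective C M)"
proof -
  have "has_lifting F i p" if p: "p \<in> objectwise C M (fib M \<inter> weq M)" for p
  proof -
    have "p \<in> Hom F (Dom F p) (Cod F p)" using p by (simp add: objectwise_def Hom_def)
    then show ?thesis
      unfolding has_lifting_def HomD(2,3)[OF assms(1)] using assms(2)[OF p] by blast
  qed
  then show ?thesis using HomD(1)[OF assms(1)] by simp
qed

text \<open>A square whose upper left corner is initial commutes automatically, and its upper
  triangle imposes nothing on the diagonal. What is left is lifting maps out of \<open>Q\<close>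
  through trivial fibrations.\<close>

lemma cofibrant_iff: "cofibrant (projective C M) Q \<longleftrightarrow> proj_cofibrant Q"
proof
  assume "cofibrant (projective C M) Q"
  then obtain i f where i: "is_initial F i" and f: "f \<in> Hom F i Q" and c: "f \<in> cof (projective C M)"
    unfolding cofibrant_def by auto
  show "proj_cofibrant Q"
    unfolding proj_cofibrant_def
  proof (intro conjI ballI)
    show "is_functor C M Q" using natD(2)[OF f] .
    fix p b assume p: "p \<in> objectwise C M (fib M \<inter> weq M)" and b: "b \<in> Hom F Q (Cod F p)"
    have "p \<in> Arr F" using p by (simp add: objectwise_def)
    then have ph: "p \<in> Hom F (Dom F p) (Cod F p)" by (simp add: Hom_def)
    obtain u where u: "u \<in> Hom F i (Dom F p)"
      using i F.hom_obj(1)[OF ph] unfolding is_initial_def by blast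
    have "p \<cdot>\<^bsub>F\<^esub> u = b \<cdot>\<^bsub>F\<^esub> f"
      by (rule is_initial_unique[OF i F.comp_hom[OF u ph] F.comp_hom[OF f b] F.category_axioms])
    moreover have "has_lifting F f p" using c p by simp
    ultimately show "\<exists>h \<in> Hom F Q (Dom F p). p \<cdot>\<^bsub>F\<^esub> h = b"
      using u b HomD(2,3)[OF f] unfolding has_lifting_def by blast
  qed
next
  assume Q: "proj_cofibrant Q"
  obtain i where i: "is_initial F i" using has_init by blast
  have "Q \<in> Obj F" using Q by (simp add: proj_cofibrant_def)
  then obtain f where f: "f \<in> Hom F i Q" using i unfolding is_initial_def by blast
  have "has_lifting F f p" if p: "p \<in> objectwise C M (fib M \<inter> weq M)" for p
    unfolding has_lifting_def
  proof (intro ballI impI)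
    fix u v assume u: "u \<in> Hom F (Dom F f) (Dom F p)" and v: "v \<in> Hom F (Cod F f) (Cod F p)"
    then obtain h where h: "h \<in> Hom F Q (Dom F p)" "p \<cdot>\<^bsub>F\<^esub> h = v"
      using Q p HomD(3)[OF f] unfolding proj_cofibrant_def by blast
    have "h \<cdot>\<^bsub>F\<^esub> f = u"
      by (rule is_initial_unique[OF i F.comp_hom[OF f h(1)] _ F.category_axioms])
        (use u HomD[OF f] in simp)
    then show "\<exists>h \<in> Hom F (Cod F f) (Dom F p). h \<cdot>\<^bsub>F\<^esub> f = u \<and> p \<cdot>\<^bsub>F\<^esub> h = v"
      using h HomD[OF f] by auto
  qed
  then have "f \<in> cof (projective C M)" using HomD[OF f] by simp
  then show "cofibrant (projective C M) Q" using i f unfolding cofibrant_def by auto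
qed

text \<open>The replacement map is a trivial fibration, more than
  \<open>cofibrant_replacement\<close> asks; this is what later allows maps to be lifted through
  it.\<close>

lemma cofibrant_replacement_ex:
  assumes X: "is_functor C M X"
  obtains Q q where "proj_cofibrant Q" "q \<in> Hom F Q X" "q \<in> objectwise C M (fib M \<inter> weq M)"
proof -
  obtain i where i: "is_initial F i" using has_init by blast
  obtain f where f: "f \<in> Hom F i X" using i X unfolding is_initial_def by auto
  from factor_trivfib[OF HomD(1)[OF f]] obtain k p where kp: "k \<in> cof (projective C M)"
    "p \<in> objectwise C M (fib M \<inter> weq M)" "Cod F k = Dom F p" "f = p \<cdot>\<^bsub>F\<^esub> k" by blast
  have A: "k \<in> Arr F" "p \<in> Arr F" using kp by (auto simp: objectwise_def)
  have k: "k \<in> Hom F i (Dom F p)" and p: "p \<in> Hom F (Dom F p) X"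
    using A kp F.comp_arr[OF A kp(3)] HomD[OF f] by (auto simp: Hom_def)
  have "cofibrant (projective C M) (Dom F p)"
    using i k kp(1) unfolding cofibrant_def by auto
  then show ?thesis using that p kp(2) cofibrant_iff by blast
qed

lemma
  assumes "\<alpha> \<in> Hom F X Y" "\<beta> \<in> Hom F Y Z"
  shows objectwise_weq_comp: "\<lbrakk>\<alpha> \<in> objectwise C M (weq M); \<beta> \<in> objectwise C M (weq M)\<rbrakk>
      \<Longrightarrow> \<beta> \<cdot>\<^bsub>F\<^esub> \<alpha> \<in> objectwise C M (weq M)"
    and objectwise_weq_cancel_left: "\<lbrakk>\<beta> \<in> objectwise C M (weq M); \<beta> \<cdot>\<^bsub>F\<^esub> \<alpha> \<in> objectwise C M (weq M)\<rbrakk>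
      \<Longrightarrow> \<alpha> \<in> objectwise C M (weq M)"
    and objectwise_weq_cancel_right: "\<lbrakk>\<alpha> \<in> objectwise C M (weq M); \<beta> \<cdot>\<^bsub>F\<^esub> \<alpha> \<in> objectwise C M (weq M)\<rbrakk>
      \<Longrightarrow> \<beta> \<in> objectwise C M (weq M)"
proof -
  note n = natD(3)[OF assms(1)] natD(3)[OF assms(2)]
  show "\<beta> \<cdot>\<^bsub>F\<^esub> \<alpha> \<in> objectwise C M (weq M)" if "\<alpha> \<in> objectwise C M (weq M)" "\<beta> \<in> objectwise C M (weq M)"
    by (rule objectwiseI[OF F.comp_hom[OF assms]])
      (use objectwiseD[OF that(1)] objectwiseD[OF that(2)] weq_comp[OF n] in simp)
  show "\<alpha> \<in> objectwise C M (weq M)" if "\<beta> \<in> objectwise C M (weq M)" "\<beta> \<cdot>\<^bsub>F\<^esub> \<alpha> \<in> objectwise C M (weq M)"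
    by (rule objectwiseI[OF assms(1)])
      (use objectwiseD[OF that(1)] objectwiseD[OF that(2)] weq_cancel_left[OF n] in simp)
  show "\<beta> \<in> objectwise C M (weq M)" if "\<alpha> \<in> objectwise C M (weq M)" "\<beta> \<cdot>\<^bsub>F\<^esub> \<alpha> \<in> objectwise C M (weq M)"
    by (rule objectwiseI[OF assms(2)])
      (use objectwiseD[OF that(1)] objectwiseD[OF that(2)] weq_cancel_right[OF n] in simp)
qed

text \<open>
  Factoring \<open>Q \<squnion> Q' \<rightarrow> H\<close> yields Ken Brown's lemma, and a cylinder object when \<open>q = q' = id\<close>.
\<close>

lemma cofibrant_cospan:
  assumes Q: "proj_cofibrant Q" and Q': "proj_cofibrant Q'"
    and q: "q \<in> Hom F Q H" "q \<in> objectwise C M (weq M)"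
    and q': "q' \<in> Hom F Q' H" "q' \<in> objectwise C M (weq M)"
  obtains X j j' r where "j \<in> Hom F Q X" "j' \<in> Hom F Q' X" "r \<in> Hom F X H"
    and "r \<cdot>\<^bsub>F\<^esub> j = q" "r \<cdot>\<^bsub>F\<^esub> j' = q'"
    and "\<And>p. p \<in> objectwise C M (fib M) \<Longrightarrow> has_lifting F j p"
    and "\<And>p. p \<in> objectwise C M (fib M) \<Longrightarrow> has_lifting F j' p"
    and "\<And>p Y Z u u' v. \<lbrakk>p \<in> objectwise C M (fib M \<inter> weq M); p \<in> Hom F Y Z; u \<in> Hom F Q Y;
      u' \<in> Hom F Q' Y;
       v \<in> Hom F X Z; p \<cdot>\<^bsub>F\<^esub> u = v \<cdot>\<^bsub>F\<^esub> j; p \<cdot>\<^bsub>F\<^esub> u' = v \<cdot>\<^bsub>F\<^esub> j'\<rbrakk>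
       \<Longrightarrow> \<exists>h \<in> Hom F X Y. h \<cdot>\<^bsub>F\<^esub> j = u \<and> h \<cdot>\<^bsub>F\<^esub> j' = u'"
proof -
  have QF: "is_functor C M Q" "is_functor C M Q'" using Q Q' by (auto simp: proj_cofibrant_def)
  obtain S i i' where S: "is_coproduct F Q Q' S i i'" using has_coprod[OF QF] by blast
  then have i: "i \<in> Hom F Q S" "i' \<in> Hom F Q' S" by (auto simp: is_coproduct_def)
  have univ: "\<exists>!h. h \<in> Hom F S z \<and> h \<cdot>\<^bsub>F\<^esub> i = f \<and> h \<cdot>\<^bsub>F\<^esub> i' = g"
    if "f \<in> Hom F Q z" "g \<in> Hom F Q' z" for z f g
    using S that unfolding is_coproduct_def by blast
  have eq: "f = g" if "f \<in> Hom F S z" "g \<in> Hom F S z" "f \<cdot>\<^bsub>F\<^esub> i = g \<cdot>\<^bsub>F\<^esub> i" "f \<cdot>\<^bsub>F\<^esub> i' = g \<cdot>\<^bsub>F\<^esub> i'" for f g z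
    using univ[OF F.comp_hom[OF i(1) that(1)] F.comp_hom[OF i(2) that(1)]] that by metis
  obtain f where f: "f \<in> Hom F S H" "f \<cdot>\<^bsub>F\<^esub> i = q" "f \<cdot>\<^bsub>F\<^esub> i' = q'"
    using univ[OF q(1) q'(1)] by blast
  from factor_trivfib[OF HomD(1)[OF f(1)]] obtain k r where kr: "k \<in> cof (projective C M)"
    "r \<in> objectwise C M (fib M \<inter> weq M)" "Cod F k = Dom F r" "f = r \<cdot>\<^bsub>F\<^esub> k" by blast
  have A: "k \<in> Arr F" "r \<in> Arr F" using kr by (auto simp: objectwise_def)
  define X where "X = Dom F r"
  have k: "k \<in> Hom F S X" and r: "r \<in> Hom F X H"
    using A kr F.comp_arr[OF A kr(3)] HomD[OF f(1)] by (auto simp: Hom_def X_def)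
  have rw: "r \<in> objectwise C M (weq M)" using kr(2) by (simp add: objectwise_Int)
  define j where "j = k \<cdot>\<^bsub>F\<^esub> i"
  define j' where "j' = k \<cdot>\<^bsub>F\<^esub> i'"
  have j: "j \<in> Hom F Q X" "j' \<in> Hom F Q' X" unfolding j_def j'_def
    using F.comp_hom[OF i(1) k] F.comp_hom[OF i(2) k] .
  have rj: "r \<cdot>\<^bsub>F\<^esub> j = q" "r \<cdot>\<^bsub>F\<^esub> j' = q'"
    using F.comp_assoc[OF i(1) k r] F.comp_assoc[OF i(2) k r] f kr(4) by (auto simp: j_def j'_def)
  \<comment> \<open>The lifting property of the cofibration \<open>k\<close>, with maps out of the
    coproduct read as pairs.\<close>
  have joint: "\<exists>h \<in> Hom F X Y. h \<cdot>\<^bsub>F\<^esub> j = u \<and> h \<cdot>\<^bsub>F\<^esub> j' = u' \<and> p \<cdot>\<^bsub>F\<^esub> h = v"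
    if p: "p \<in> objectwise C M (fib M \<inter> weq M)" "p \<in> Hom F Y Z" and u: "u \<in> Hom F Q Y" "u' \<in> Hom F Q' Y"
      and v: "v \<in> Hom F X Z" and pu: "p \<cdot>\<^bsub>F\<^esub> u = v \<cdot>\<^bsub>F\<^esub> j" "p \<cdot>\<^bsub>F\<^esub> u' = v \<cdot>\<^bsub>F\<^esub> j'" for p Y Z u u' v
  proof -
    obtain w where w: "w \<in> Hom F S Y" "w \<cdot>\<^bsub>F\<^esub> i = u" "w \<cdot>\<^bsub>F\<^esub> i' = u'" using univ[OF u] by blast
    have "p \<cdot>\<^bsub>F\<^esub> w = v \<cdot>\<^bsub>F\<^esub> k"
    proof (rule eq[OF F.comp_hom[OF w(1) p(2)] F.comp_hom[OF k v]])
      show "(p \<cdot>\<^bsub>F\<^esub> w) \<cdot>\<^bsub>F\<^esub> i = (v \<cdot>\<^bsub>F\<^esub> k) \<cdot>\<^bsub>F\<^esub> i"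
        using F.comp_assoc[OF i(1) w(1) p(2)] F.comp_assoc[OF i(1) k v] w pu by (simp add: j_def)
      show "(p \<cdot>\<^bsub>F\<^esub> w) \<cdot>\<^bsub>F\<^esub> i' = (v \<cdot>\<^bsub>F\<^esub> k) \<cdot>\<^bsub>F\<^esub> i'"
        using F.comp_assoc[OF i(2) w(1) p(2)] F.comp_assoc[OF i(2) k v] w pu by (simp add: j'_def)
    qed
    moreover have "has_lifting F k p" using kr(1) p(1) by simp
    ultimately obtain h where h: "h \<in> Hom F X Y" "h \<cdot>\<^bsub>F\<^esub> k = w" "p \<cdot>\<^bsub>F\<^esub> h = v"
      using w(1) v HomD[OF k] HomD[OF p(2)] unfolding has_lifting_def by blast
    then have "h \<cdot>\<^bsub>F\<^esub> j = u" "h \<cdot>\<^bsub>F\<^esub> j' = u'"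
      using F.comp_assoc[OF i(1) k h(1)] F.comp_assoc[OF i(2) k h(1)] w by (auto simp: j_def j'_def)
    then show ?thesis using h by blast
  qed
  \<comment> \<open>A lifting problem for \<open>j\<close> alone is completed to one for the pair:
    cofibrancy of \<open>Q'\<close> supplies a compatible map on the other summand.\<close>
  have jc: "j \<in> cof (projective C M)"
  proof (rule cof_projectiveI[OF j(1)])
    fix p Y Z u v assume p: "p \<in> objectwise C M (fib M \<inter> weq M)" "p \<in> Hom F Y Z"
      and u: "u \<in> Hom F Q Y" and v: "v \<in> Hom F X Z" and e: "p \<cdot>\<^bsub>F\<^esub> u = v \<cdot>\<^bsub>F\<^esub> j"
    obtain u' where "u' \<in> Hom F Q' Y" "p \<cdot>\<^bsub>F\<^esub> u' = v \<cdot>\<^bsub>F\<^esub> j'"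
      by (rule proj_cofibrant_lift[OF Q' p F.comp_hom[OF j(2) v]])
    from joint[OF p u this(1) v e this(2)] show "\<exists>h \<in> Hom F X Y. h \<cdot>\<^bsub>F\<^esub> j = u \<and> p \<cdot>\<^bsub>F\<^esub> h = v" by blast
  qed
  have jc': "j' \<in> cof (projective C M)"
  proof (rule cof_projectiveI[OF j(2)])
    fix p Y Z u' v assume p: "p \<in> objectwise C M (fib M \<inter> weq M)" "p \<in> Hom F Y Z"
      and u': "u' \<in> Hom F Q' Y" and v: "v \<in> Hom F X Z" and e: "p \<cdot>\<^bsub>F\<^esub> u' = v \<cdot>\<^bsub>F\<^esub> j'"
    obtain u where "u \<in> Hom F Q Y" "p \<cdot>\<^bsub>F\<^esub> u = v \<cdot>\<^bsub>F\<^esub> j"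
      by (rule proj_cofibrant_lift[OF Q p F.comp_hom[OF j(1) v]])
    from joint[OF p this(1) u' v this(2) e] show "\<exists>h \<in> Hom F X Y. h \<cdot>\<^bsub>F\<^esub> j' = u' \<and> p \<cdot>\<^bsub>F\<^esub> h = v" by blast
  qed
  \<comment> \<open>Two-out-of-three: \<open>r\<close> and its composite with \<open>j\<close> are
    weak equivalences. So \<open>j\<close> is a projective trivial cofibration.\<close>
  have jw: "j \<in> objectwise C M (weq M)"
    using objectwise_weq_cancel_left[OF j(1) r rw] rj q by simp
  have jw': "j' \<in> objectwise C M (weq M)"
    using objectwise_weq_cancel_left[OF j(2) r rw] rj q' by simp
  show ?thesis
    by (rule that[OF j r rj trivcof_lift[OF jc jw] trivcof_lift[OF jc' jw']]) (use joint in blast)+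
qed

end

section \<open>Invariance under isomorphism of the index category\<close>

text \<open>To be instantiated by whiskering along mutually inverse functors of index categories.
  The maps are axiomatised on objects and hom-sets instead of by \<open>is_functor\<close>, because
  whiskering is not \<open>undefined\<close> off the functor category.\<close>

locale cat_iso = N: category N + N': category N'
  for N :: "('o, 'a, 'z) precat_scheme" and N' :: "('o', 'a', 'z') precat_scheme" +
  fixes \<Phi>o :: "'o' \<Rightarrow> 'o" and \<Phi> :: "'a' \<Rightarrow> 'a" and \<Psi>o :: "'o \<Rightarrow> 'o'" and \<Psi> :: "'a \<Rightarrow> 'a'"
  assumes Phi_hom: "f \<in> Hom N' x' y' \<Longrightarrow> \<Phi> f \<in> Hom N (\<Phi>o x') (\<Phi>o y')"
    and Psi_hom: "g \<in> Hom N x y \<Longrightarrow> \<Psi> g \<in> Hom N' (\<Psi>o x) (\<Psi>o y)"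
    and Phi_comp: "\<lbrakk>f \<in> Hom N' x' y'; f' \<in> Hom N' y' z'\<rbrakk> \<Longrightarrow> \<Phi> (f' \<cdot>\<^bsub>N'\<^esub> f) = \<Phi> f' \<cdot>\<^bsub>N\<^esub> \<Phi> f"
    and Psi_comp: "\<lbrakk>g \<in> Hom N x y; g' \<in> Hom N y z\<rbrakk> \<Longrightarrow> \<Psi> (g' \<cdot>\<^bsub>N\<^esub> g) = \<Psi> g' \<cdot>\<^bsub>N'\<^esub> \<Psi> g"
    and Phi_Psi: "g \<in> Hom N x y \<Longrightarrow> \<Phi> (\<Psi> g) = g"
    and Psi_Phi: "f \<in> Hom N' x' y' \<Longrightarrow> \<Psi> (\<Phi> f) = f"
    and Phio_Psio: "x \<in> Obj N \<Longrightarrow> \<Phi>o (\<Psi>o x) = x"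
    and Psio_Phio: "x' \<in> Obj N' \<Longrightarrow> \<Psi>o (\<Phi>o x') = x'"
    and Phio_obj: "x' \<in> Obj N' \<Longrightarrow> \<Phi>o x' \<in> Obj N"
    and Psio_obj: "x \<in> Obj N \<Longrightarrow> \<Psi>o x \<in> Obj N'"
begin

lemma Psi_hom': "\<lbrakk>g \<in> Hom N (\<Phi>o x') y; x' \<in> Obj N'\<rbrakk> \<Longrightarrow> \<Psi> g \<in> Hom N' x' (\<Psi>o y)"
  using Psi_hom[of g "\<Phi>o x'" y] Psio_Phio by simp

lemma Phi_hom': "\<lbrakk>f \<in> Hom N' x' (\<Psi>o y); y \<in> Obj N\<rbrakk> \<Longrightarrow> \<Phi> f \<in> Hom N (\<Phi>o x') y"
  using Phi_hom[of f x' "\<Psi>o y"] Phio_Psio by simp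

lemma is_initial_iso:
  assumes "is_initial N' i"
  shows "is_initial N (\<Phi>o i)"
  unfolding is_initial_def
proof (intro conjI ballI)
  have i: "i \<in> Obj N'" using assms by (simp add: is_initial_def)
  then show "\<Phi>o i \<in> Obj N" by (rule Phio_obj)
  fix x assume x: "x \<in> Obj N"
  from assms Psio_obj[OF x] obtain f where f: "f \<in> Hom N' i (\<Psi>o x)" unfolding is_initial_def by blast
  show "\<exists>!f. f \<in> Hom N (\<Phi>o i) x"
  proof (rule ex1I[of _ "\<Phi> f"])
    show "\<Phi> f \<in> Hom N (\<Phi>o i) x" by (rule Phi_hom'[OF f x])
    fix g assume g: "g \<in> Hom N (\<Phi>o i) x"
    have "\<Psi> g = f" by (rule is_initial_unique[OF assms Psi_hom'[OF g i] f N'.category_axioms])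
    then show "g = \<Phi> f" using Phi_Psi[OF g] by simp
  qed
qed

lemma is_coproduct_iso:
  assumes c: "is_coproduct N' x y c i j" and x: "x \<in> Obj N'" and y: "y \<in> Obj N'"
  shows "is_coproduct N (\<Phi>o x) (\<Phi>o y) (\<Phi>o c) (\<Phi> i) (\<Phi> j)"
  unfolding is_coproduct_def
proof (intro conjI allI impI)
  have ij: "i \<in> Hom N' x c" "j \<in> Hom N' y c" using c by (auto simp: is_coproduct_def)
  show "\<Phi> i \<in> Hom N (\<Phi>o x) (\<Phi>o c)" "\<Phi> j \<in> Hom N (\<Phi>o y) (\<Phi>o c)" using Phi_hom ij by auto
  fix z f g assume "f \<in> Hom N (\<Phi>o x) z \<and> g \<in> Hom N (\<Phi>o y) z"
  then have f: "f \<in> Hom N (\<Phi>o x) z" and g: "g \<in> Hom N (\<Phi>o y) z" by auto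
  have z: "z \<in> Obj N" using N.hom_obj(2)[OF f] .
  have "\<exists>!h. h \<in> Hom N' c (\<Psi>o z) \<and> h \<cdot>\<^bsub>N'\<^esub> i = \<Psi> f \<and> h \<cdot>\<^bsub>N'\<^esub> j = \<Psi> g"
    using c Psi_hom'[OF f x] Psi_hom'[OF g y] unfolding is_coproduct_def by blast
  then obtain h where h: "h \<in> Hom N' c (\<Psi>o z)" "h \<cdot>\<^bsub>N'\<^esub> i = \<Psi> f" "h \<cdot>\<^bsub>N'\<^esub> j = \<Psi> g"
    and uniq: "\<And>h'. h' \<in> Hom N' c (\<Psi>o z) \<Longrightarrow> h' \<cdot>\<^bsub>N'\<^esub> i = \<Psi> f \<Longrightarrow> h' \<cdot>\<^bsub>N'\<^esub> j = \<Psi> g \<Longrightarrow> h' = h"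
    by metis
  have co: "c \<in> Obj N'" using N'.hom_obj(2)[OF ij(1)] .
  show "\<exists>!h. h \<in> Hom N (\<Phi>o c) z \<and> h \<cdot>\<^bsub>N\<^esub> \<Phi> i = f \<and> h \<cdot>\<^bsub>N\<^esub> \<Phi> j = g"
  proof (rule ex1I[of _ "\<Phi> h"], intro conjI)
    show "\<Phi> h \<in> Hom N (\<Phi>o c) z" by (rule Phi_hom'[OF h(1) z])
    show "\<Phi> h \<cdot>\<^bsub>N\<^esub> \<Phi> i = f" "\<Phi> h \<cdot>\<^bsub>N\<^esub> \<Phi> j = g"
      using Phi_comp[OF ij(1) h(1)] Phi_comp[OF ij(2) h(1)] h Phi_Psi f g by auto
    fix k assume "k \<in> Hom N (\<Phi>o c) z \<and> k \<cdot>\<^bsub>N\<^esub> \<Phi> i = f \<and> k \<cdot>\<^bsub>N\<^esub> \<Phi> j = g"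
    then have k: "k \<in> Hom N (\<Phi>o c) z" "k \<cdot>\<^bsub>N\<^esub> \<Phi> i = f" "k \<cdot>\<^bsub>N\<^esub> \<Phi> j = g" by auto
    have "\<Psi> k = h"
      by (rule uniq[OF Psi_hom'[OF k(1) co]])
        (use Psi_comp[OF Phi_hom[OF ij(1)] k(1)] Psi_comp[OF Phi_hom[OF ij(2)] k(1)] k
          Psi_Phi[OF ij(1)] Psi_Phi[OF ij(2)] in auto)
    then show "k = \<Phi> h" using Phi_Psi[OF k(1)] by simp
  qed
qed

lemma has_lifting_iso:
  assumes l: "has_lifting N' i p" and i: "i \<in> Arr N'" and p: "p \<in> Arr N'"
  shows "has_lifting N (\<Phi> i) (\<Phi> p)"
proof -
  obtain x y z w where i: "i \<in> Hom N' x y" and p: "p \<in> Hom N' z w" using i p by (auto simp: Hom_def)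
  note obj = N'.hom_obj[OF i] N'.hom_obj[OF p]
  show ?thesis
    unfolding has_lifting_def HomD[OF Phi_hom[OF i]] HomD[OF Phi_hom[OF p]]
  proof (intro ballI impI)
    fix u v assume u: "u \<in> Hom N (\<Phi>o x) (\<Phi>o z)" and v: "v \<in> Hom N (\<Phi>o y) (\<Phi>o w)"
      and e: "\<Phi> p \<cdot>\<^bsub>N\<^esub> u = v \<cdot>\<^bsub>N\<^esub> \<Phi> i"
    have u': "\<Psi> u \<in> Hom N' x z" and v': "\<Psi> v \<in> Hom N' y w"
      using Psi_hom[OF u] Psi_hom[OF v] obj Psio_Phio by auto
    have "p \<cdot>\<^bsub>N'\<^esub> \<Psi> u = \<Psi> v \<cdot>\<^bsub>N'\<^esub> i"
      using arg_cong[OF e, of \<Psi>] Psi_comp[OF u Phi_hom[OF p]] Psi_comp[OF Phi_hom[OF i] v]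
        Psi_Phi[OF i] Psi_Phi[OF p] by simp
    then obtain h where h: "h \<in> Hom N' y z" "h \<cdot>\<^bsub>N'\<^esub> i = \<Psi> u" "p \<cdot>\<^bsub>N'\<^esub> h = \<Psi> v"
      using l u' v' unfolding has_lifting_def HomD[OF i] HomD[OF p] by blast
    show "\<exists>h \<in> Hom N (\<Phi>o y) (\<Phi>o z). h \<cdot>\<^bsub>N\<^esub> \<Phi> i = u \<and> \<Phi> p \<cdot>\<^bsub>N\<^esub> h = v"
      using Phi_hom[OF h(1)] Phi_comp[OF i h(1)] Phi_comp[OF h(1) p] h Phi_Psi[OF u]
        Phi_Psi[OF v] by metis
  qed
qed

lemma flip: "cat_iso N' N \<Psi>o \<Psi> \<Phi>o \<Phi>"
  by (intro cat_iso.intro cat_iso_axioms.intro N.category_axioms N'.category_axioms)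
    (fact Phi_hom Psi_hom Phi_comp Psi_comp Phi_Psi Psi_Phi Phio_Psio Psio_Phio Phio_obj Psio_obj)+

end

lemma whisker_objectwise:
  assumes C: "category C" and K: "is_functor C C' K" and a: "\<alpha> \<in> objectwise C' M S"
  shows "whisker C \<alpha> K \<in> objectwise C M S"
proof -
  have "\<alpha> \<in> Hom (functor_cat C' M) (nt_dom \<alpha>) (nt_cod \<alpha>)"
    using a by (auto simp: objectwise_def Hom_def)
  from whisker_hom[OF C K this] show ?thesis
    by (rule objectwiseI) (use objectwiseD[OF a functorD(1)[OF K]] in simp)
qed

text \<open>Whiskering with \<open>K\<close> and \<open>K'\<close> identifies the two functor
  categories and matches their objectwise classes. Classes defined by lifting then match as well,
  and each assumption of the locale is transported.\<close>

lemma projective_model_iso: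
  fixes C :: "('c, 'b) precat" and C' :: "('c2, 'b2) precat"
  assumes M: "projective_model M C'" and C: "category C"
    and K: "is_functor C C' K" and K': "is_functor C' C K'"
    and inv: "\<And>x. x \<in> Obj C \<Longrightarrow> fobj K' (fobj K x) = x" "\<And>f. f \<in> Arr C \<Longrightarrow> farr K' (farr K f) = f"
      "\<And>x. x \<in> Obj C' \<Longrightarrow> fobj K (fobj K' x) = x" "\<And>f. f \<in> Arr C' \<Longrightarrow> farr K (farr K' f) = f"
  shows "projective_model M C"
proof -
  interpret M': projective_model M C' by (rule M)
  interpret C: category C by (rule C)
  have C': "category C'" by (rule M'.cat_C)
  let ?F = "functor_cat C M" and ?F' = "functor_cat C' M"
  let ?\<Phi>o = "\<lambda>X. comp_functor C X K" and ?\<Phi> = "\<lambda>\<alpha>. whisker C \<alpha> K"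
  let ?\<Psi>o = "\<lambda>X. comp_functor C' X K'" and ?\<Psi> = "\<lambda>\<alpha>. whisker C' \<alpha> K'"
  have k: "farr K a \<in> Arr C'" if "a \<in> Arr C" for a
    using HomD(1)[OF functorD(2)[OF K that]] .
  have k': "farr K' a \<in> Arr C" if "a \<in> Arr C'" for a
    using HomD(1)[OF functorD(2)[OF K' that]] .
  have o1: "?\<Phi>o (?\<Psi>o X) = X" if "is_functor C M X" for X
    by (rule functor_eqI[OF is_functor_comp[OF C K is_functor_comp[OF C' K' that]] that])
      (use functorD(1)[OF K] k inv in auto)
  have o2: "?\<Psi>o (?\<Phi>o X) = X" if "is_functor C' M X" for X
    by (rule functor_eqI[OF is_functor_comp[OF C' K' is_functor_comp[OF C K that]] that])
      (use functorD(1)[OF K'] k' inv in auto)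
  have a1: "?\<Phi> (?\<Psi> \<alpha>) = \<alpha>" if a: "\<alpha> \<in> Hom ?F X Y" for \<alpha> X Y
    by (rule nat_eqI[OF _ a], use whisker_hom[OF C K whisker_hom[OF C' K' a]] o1 natD(1,2)[OF a] in simp)
      (use functorD(1)[OF K] inv in simp)
  have a2: "?\<Psi> (?\<Phi> \<alpha>) = \<alpha>" if a: "\<alpha> \<in> Hom ?F' X Y" for \<alpha> X Y
    by (rule nat_eqI[OF _ a], use whisker_hom[OF C' K' whisker_hom[OF C K a]] o2 natD(1,2)[OF a] in simp)
      (use functorD(1)[OF K'] inv in simp)
  interpret I: cat_iso ?F ?F' ?\<Phi>o ?\<Phi> ?\<Psi>o ?\<Psi>
  proof (intro cat_iso.intro cat_iso_axioms.intro M'.F.category_axioms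
    category_functor_cat[OF C M'.cat_M])
    show "?\<Phi> f \<in> Hom ?F (?\<Phi>o x) (?\<Phi>o y)" if "f \<in> Hom ?F' x y" for f x y
      using whisker_hom[OF C K that(1)] by simp
    show "?\<Psi> f \<in> Hom ?F' (?\<Psi>o x) (?\<Psi>o y)" if "f \<in> Hom ?F x y" for f x y
      using whisker_hom[OF C' K' that(1)] by simp
  qed (use a1 a2 o1 o2 whisker_hom[OF C K] whisker_hom[OF C' K'] is_functor_comp[OF C K]
    is_functor_comp[OF C' K']
      whisker_comp[OF C M'.cat_M K C'] whisker_comp[OF C' M'.cat_M K' C] in auto)
  have obj1: "\<And>X. is_functor C M X \<Longrightarrow> is_functor C' M (?\<Psi>o X)" using is_functor_comp[OF C' K'] .
  have homE: "\<exists>X Y. \<alpha> \<in> Hom ?F X Y" if "\<alpha> \<in> Arr ?F" for \<alpha> using that by (auto simp: Hom_def)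
  have homE': "\<exists>X Y. \<alpha> \<in> Hom ?F' X Y" if "\<alpha> \<in> Arr ?F'" for \<alpha> using that by (auto simp: Hom_def)
  have A1: "?\<Phi> (?\<Psi> \<alpha>) = \<alpha>" "?\<Psi> \<alpha> \<in> Arr ?F'" if "\<alpha> \<in> Arr ?F" for \<alpha>
    using homE[OF that] a1 HomD(1)[OF whisker_hom[OF C' K']] by blast+
  have A2: "?\<Psi> (?\<Phi> \<alpha>) = \<alpha>" "?\<Phi> \<alpha> \<in> Arr ?F" if "\<alpha> \<in> Arr ?F'" for \<alpha>
    using homE'[OF that] a2 HomD(1)[OF whisker_hom[OF C K]] by blast+
  have owA: "\<alpha> \<in> Arr ?F" if "\<alpha> \<in> objectwise C M S" for \<alpha> S using that by (simp add: objectwise_def)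
  have owA': "\<alpha> \<in> Arr ?F'" if "\<alpha> \<in> objectwise C' M S" for \<alpha> S using that by (simp add: objectwise_def)
  have cof1: "?\<Phi> i \<in> cof (projective C M)" if i: "i \<in> cof (projective C' M)" for i
  proof -
    have iA: "i \<in> Arr ?F'" using i by simp
    have "has_lifting ?F (?\<Phi> i) p" if p: "p \<in> objectwise C M (fib M \<inter> weq M)" for p
      using I.has_lifting_iso[OF _ iA A1(2)[OF owA[OF p]]] i whisker_objectwise[OF C' K' p]
        A1(1)[OF owA[OF p]] by simp
    then show ?thesis using A2(2)[OF iA] by simp
  qed
  have cof2: "?\<Psi> i \<in> cof (projective C' M)" if i: "i \<in> cof (projective C M)" for i
  proof -
    have iA: "i \<in> Arr ?F" using i by simp
    have "has_lifting ?F' (?\<Psi> i) p" if p: "p \<in> objectwise C' M (fib M \<inter> weq M)" for p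
      using cat_iso.has_lifting_iso[OF I.flip _ iA A2(2)[OF owA'[OF p]]] i
        whisker_objectwise[OF C K p] A2(1)[OF owA'[OF p]] by simp
    then show ?thesis using A1(2)[OF iA] by simp
  qed
  show ?thesis
  proof (intro projective_model.intro projective_model_axioms.intro M'.model_core_axioms C)
    show "\<exists>i. is_initial ?F i" using M'.has_init I.is_initial_iso by blast
    fix X Y assume X: "is_functor C M X" and Y: "is_functor C M Y"
    show "\<exists>c i j. is_coproduct ?F X Y c i j"
      using M'.has_coprod[OF obj1[OF X] obj1[OF Y]] I.is_coproduct_iso obj1[OF X] obj1[OF Y]
        o1[OF X] o1[OF Y]
      by (metis functor_cat_simps(1) mem_Collect_eq)
  next
    fix f assume f: "f \<in> Arr ?F"
    obtain i p where ip: "i \<in> cof (projective C' M)" "p \<in> objectwise C' M (fib M \<inter> weq M)"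
      "Cod ?F' i = Dom ?F' p" "?\<Psi> f = p \<cdot>\<^bsub>?F'\<^esub> i"
      using M'.factor_trivfib[OF A1(2)[OF f]] by blast
    have ih: "i \<in> Hom ?F' (Dom ?F' i) (Dom ?F' p)" and ph: "p \<in> Hom ?F' (Dom ?F' p) (Cod ?F' p)"
      using ip owA'[OF ip(2)] by (auto simp: Hom_def)
    have "f = ?\<Phi> p \<cdot>\<^bsub>?F\<^esub> ?\<Phi> i" using I.Phi_comp[OF ih ph] A1(1)[OF f] ip(4) by simp
    moreover have "Cod ?F (?\<Phi> i) = Dom ?F (?\<Phi> p)"
      using HomD[OF I.Phi_hom[OF ih]] HomD[OF I.Phi_hom[OF ph]] by simp
    ultimately show "\<exists>i\<in>cof (projective C M). \<exists>p\<in>objectwise C M (fib M \<inter> weq M). Cod ?F i = Dom ?F p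
      \<and> f = p \<cdot>\<^bsub>?F\<^esub> i"
      using cof1[OF ip(1)] whisker_objectwise[OF C K ip(2)] by blast
  next
    fix i p assume i: "i \<in> cof (projective C M)"
      "i \<in> objectwise C M (weq M)" and p: "p \<in> objectwise C M (fib M)"
    have "has_lifting ?F' (?\<Psi> i) (?\<Psi> p)"
      by (rule M'.trivcof_lift[OF cof2[OF i(1)] whisker_objectwise[OF C' K' i(2)]
        whisker_objectwise[OF C' K' p]])
    from I.has_lifting_iso[OF this A1(2)[OF owA[OF i(2)]] A1(2)[OF owA[OF p]]]
    show "has_lifting ?F i p" using A1(1)[OF owA[OF i(2)]] A1(1)[OF owA[OF p]] by simp
  qed
qed

text \<open>The model structure on \<open>Fun(P, M)\<close> is itself cocomplete, which yields the
  initial object and the coproducts; \<open>e\<close> guarantees that \<open>'i\<close> has room for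
  the two-object index category of a coproduct.\<close>

lemma projective_model_good:
  fixes P :: "'i gorder" and e :: "bool \<Rightarrow> 'i"
  assumes good: "good_model_category TYPE('i) M" and P: "partial_order P" and e: "inj e"
  shows "projective_model M (poset_cat P)"
proof -
  let ?C = "poset_cat P" let ?N = "projective ?C M"
  have M: "model_category TYPE('i) M" and N: "model_category TYPE('i) ?N"
    using good P by (auto simp: good_model_category_def)
  interpret M: model_core M by (rule model_core[OF M])
  have Nc: "small_cocomplete TYPE('i) ?N" "category ?N" using N by (auto simp: model_category_def)
  show ?thesis
  proof (intro projective_model.intro projective_model_axioms.intro M.model_core_axioms
    category_poset_cat[OF P])
    show "\<exists>i. is_initial (functor_cat ?C M) i"
      using has_initial[OF Nc(1)] by auto
    show "\<exists>c i j. is_coproduct (functor_cat ?C M) X Y c i j"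
      if XY: "is_functor ?C M X" "is_functor ?C M Y" for X Y
    proof -
      obtain c i j where "is_coproduct ?N X Y c i j"
        by (rule has_coproduct[OF Nc e, of X Y]) (use XY in auto)
      then show ?thesis by auto
    qed
    fix f assume "f \<in> Arr (functor_cat ?C M)"
    moreover have "factorizes ?N (cof ?N) (fib ?N \<inter> weq ?N)"
      using N unfolding model_category_def by (elim conjE)
    ultimately have "\<exists>i \<in> cof ?N. \<exists>p \<in> fib ?N \<inter> weq ?N. Cod ?N i = Dom ?N p \<and> f = p \<cdot>\<^bsub>?N\<^esub> i"
      unfolding factorizes_def projective_simps(2) by (rule bspec[rotated])
    then show "\<exists>i\<in>cof ?N. \<exists>p\<in>objectwise ?C M (fib M \<inter> weq M).
       Cod (functor_cat ?C M) i = Dom (functor_cat ?C M) p \<and> f = p \<cdot>\<^bsub>functor_cat ?C M\<^esub> i"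
      by (simp add: objectwise_Int)
  next
    fix i p assume "i \<in> cof ?N" "i \<in> objectwise ?C M (weq M)" "p \<in> objectwise ?C M (fib M)"
    then have "i \<in> cof ?N \<inter> weq ?N" "p \<in> fib ?N" by simp_all
    moreover have "\<forall>i \<in> cof ?N \<inter> weq ?N. \<forall>p \<in> fib ?N. has_lifting ?N i p"
      using N unfolding model_category_def by (elim conjE)
    ultimately have "has_lifting ?N i p" by blast
    then show "has_lifting (functor_cat ?C M) i p" by simp
  qed
qed

text \<open>Goodness concerns posets with carrier in \<open>'i\<close>. A poset whose carrier
  injects into \<open>'i\<close> is isomorphic to one of these.\<close>

lemma projective_model_poset:
  fixes P :: "('x, 'y) gorder_scheme" and g :: "'x \<Rightarrow> 'i" and e :: "bool \<Rightarrow> 'i"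
  assumes good: "good_model_category TYPE('i) M" and P: "partial_order P" and g: "inj_on g (carrier P)"
    and e: "inj e"
  shows "projective_model M (poset_cat P)"
proof -
  interpret partial_order P by (rule P)
  define h where "h = inv_into (carrier P) g"
  have hg: "h (g x) = x" if "x \<in> carrier P" for x using that g by (simp add: h_def)
  \<comment> \<open>The copy lives on the image of \<open>g\<close> and takes its order through the
    inverse \<open>h\<close>.\<close>
  define P' :: "'i gorder" where "P' = \<lparr> carrier = g ` carrier P, eq = (=), le = (\<lambda>x y. h x \<sqsubseteq>\<^bsub>P\<^esub> h y) \<rparr>"
  have P': "partial_order P'"
    by standard (auto simp: P'_def hg intro: le_trans dest: le_antisym)
  let ?K = "\<lparr> fobj = restrict g (carrier P), farr = restrict (map_prod g g) (Arr (poset_cat P)) \<rparr>"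
  let ?K' = "\<lparr> fobj = restrict h (carrier P'), farr = restrict (map_prod h h) (Arr (poset_cat P')) \<rparr>"
  have K: "is_functor (poset_cat P) (poset_cat P') ?K"
    unfolding is_functor_def
    by (auto simp: P'_def hg Hom_def elim!: poset_cat_arrE dest: le_trans)
  have K': "is_functor (poset_cat P') (poset_cat P) ?K'"
    unfolding is_functor_def
    by (auto simp: P'_def hg Hom_def elim!: poset_cat_arrE intro: le_trans) (meson le_trans)+
  show ?thesis
    by (rule projective_model_iso[OF projective_model_good[OF good P' e] category_poset_cat[OF P] K K'])
      (auto simp: P'_def hg elim!: poset_cat_arrE simp: inj_on_eq_iff[OF g])
qed

section \<open>Localization\<close>

locale localization_setup = category C for C :: "('o, 'a, 'z) precat_scheme" (structure) +
  fixes W :: "'a set"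
  assumes W_arr: "W \<subseteq> Arr C"
begin

abbreviation zz where "zz \<equiv> zigzag C W"
abbreviation zeq where "zeq \<equiv> zigzag_eq C W"

lemma zigzag_obj: "zz x s y \<Longrightarrow> x \<in> Obj C \<and> y \<in> Obj C"
proof (induction s arbitrary: x)
  case (Cons a s)
  then show ?case by (cases a) (auto simp: dom_obj cod_obj)
qed auto

lemma zigzag_append: "zz x s y \<Longrightarrow> zz y t z \<Longrightarrow> zz x (s @ t) z"
proof (induction s arbitrary: x)
  case (Cons a s)
  then show ?case by (cases a) auto
qed auto

lemma zigzag_eq_zigzag: "zeq x y s t \<Longrightarrow> zz x s y \<and> zz x t y"
proof (induction rule: zigzag_eq.induct)
  case (cong x u x' y' s t v y)
  then show ?case by (auto intro!: zigzag_append)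
next
  case (comp f x y g z)
  then show ?case using comp_hom[OF comp] cod_obj by (auto simp: Hom_def)
qed (auto simp: Hom_def id_arr dom_obj cod_obj)

lemmas zeq_refl = zigzag_eq.refl and zeq_sym = zigzag_eq.sym and zeq_trans [trans] = zigzag_eq.trans

lemma zeq_append:
  assumes "zeq x y s s'" "zeq y z t t'"
  shows "zeq x z (s @ t) (s' @ t')"
proof -
  have zs: "zz x s y" "zz x s' y" "zz y t z" "zz y t' z"
    using assms zigzag_eq_zigzag by auto
  note o = zigzag_obj[OF zs(1)] zigzag_obj[OF zs(3)]
  have "zeq x z ([] @ s @ t) ([] @ s' @ t)"
    by (rule zigzag_eq.cong[OF _ assms(1) zs(3)]) (use o in simp)
  moreover have "zeq x z (s' @ t @ []) (s' @ t' @ [])"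
    by (rule zigzag_eq.cong[OF zs(2) assms(2)]) (use o in simp)
  ultimately show ?thesis using zigzag_eq.trans by force
qed

lemma zigzag_Fwd: "f \<in> Hom C x y \<Longrightarrow> zz x [Fwd f] y"
  by (auto simp: Hom_def cod_obj)

lemma zigzag_Bwd: "\<lbrakk>w \<in> W; w \<in> Hom C x y\<rbrakk> \<Longrightarrow> zz y [Bwd w] x"
  by (auto simp: Hom_def dom_obj)

lemma zigzag_class_eq_iff: "zz x s y \<Longrightarrow> zigzag_class C W x y s = zigzag_class C W x y t \<longleftrightarrow> zeq x y s t"
  unfolding zigzag_class_def by (auto intro: zeq_refl zeq_sym zeq_trans)

lemma localization_hom:
  "Hom (localization C W) x y = {(x, zigzag_class C W x y s, y) | s. zz x s y}"
  by (auto simp: Hom_def localization_def)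

text \<open>Composition in \<open>localization\<close> is a union over all pairs of representatives.
  All of them yield the same class by \<open>zeq_append\<close>, so the union collapses.\<close>

lemma localization_comp:
  assumes "zz x s y" "zz y t z"
  shows "(y, zigzag_class C W y z t, z) \<cdot>\<^bsub>localization C W\<^esub> (x, zigzag_class C W x y s, y)
    = (x, zigzag_class C W x z (s @ t), z)"
proof -
  have "zigzag_class C W x z (s' @ t') = zigzag_class C W x z (s @ t)"
    if "s' \<in> zigzag_class C W x y s" "t' \<in> zigzag_class C W y z t" for s' t'
  proof -
    have "zeq x z (s @ t) (s' @ t')"
      using that by (auto simp: zigzag_class_def intro: zeq_append)
    then show ?thesis
      using zigzag_class_eq_iff[OF zigzag_append[OF assms]] by metis
  qed
  moreover have "s \<in> zigzag_class C W x y s" "t \<in> zigzag_class C W y z t"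
    using assms by (auto simp: zigzag_class_def intro: zeq_refl)
  ultimately have "(\<Union>s'\<in>zigzag_class C W x y s. \<Union>t'\<in>zigzag_class C W y z t. zigzag_class C W x z
    (s' @ t'))
      = zigzag_class C W x z (s @ t)" by blast
  then show ?thesis by (simp add: localization_def)
qed

text \<open>In the localization, \<open>j\<close> and \<open>j'\<close> are both right inverses of
  the invertible \<open>r\<close>, hence equal to its inverse. So left homotopic maps become
  equal.\<close>

lemma zeq_cylinder:
  assumes "j \<in> Hom C x c" "j' \<in> Hom C x c" "r \<in> Hom C c x" "r \<in> W" "r \<cdot> j = Id C x" "r \<cdot> j' = Id C x"
    and h: "h \<in> Hom C c y"
  shows "zeq x y [Fwd (h \<cdot> j)] [Fwd (h \<cdot> j')]"
proof -
  have x: "x \<in> Obj C" using hom_obj assms(1) by blast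
  have *: "zeq x c [Fwd k] [Bwd r]" if k: "k \<in> Hom C x c" "r \<cdot> k = Id C x" for k
  proof -
    have "zeq x c ([Fwd k] @ []) ([Fwd k] @ [Fwd r, Bwd r])"
      by (rule zeq_append[OF zeq_refl[OF zigzag_Fwd[OF k(1)]]
        zeq_sym[OF zigzag_eq.inv_right[OF assms(4,3)]]])
    also have "zeq x c ([Fwd k] @ [Fwd r, Bwd r]) ([] @ [Bwd r])"
    proof -
      have "zeq x x [Fwd k, Fwd r] []"
        using zigzag_eq.comp[OF k(1) assms(3), of W] k(2) zigzag_eq.ident[OF x, of W] zeq_trans by metis
      from zeq_append[OF this zeq_refl[OF zigzag_Bwd[OF assms(4,3)]]] show ?thesis by simp
    qed
    finally show ?thesis by simp
  qed
  have **: "zeq x y [Fwd (h \<cdot> k)] [Bwd r, Fwd h]" if k: "k \<in> Hom C x c" "r \<cdot> k = Id C x" for k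
    using zeq_trans[OF zeq_sym[OF zigzag_eq.comp[OF k(1) h]]
      zeq_append[OF *[OF k] zeq_refl[OF zigzag_Fwd[OF h]], simplified]] .
  show ?thesis using zeq_trans[OF **[OF assms(1,5)] zeq_sym[OF **[OF assms(2,6)]]] .
qed

end

text \<open>
  \<open>T\<close> is a coreflection up to homotopy: lifts along \<open>e\<close> exist and are unique in the localization.
  It need not be a functor on \<open>C\<close>, but it acts on zigzags and \<open>e\<close> is natural for this action.
\<close>

locale homotopy_coreflection = localization_setup C W
  for C :: "('o, 'a, 'z) precat_scheme" (structure) and W +
  fixes W' :: "'a set" and T :: "'o \<Rightarrow> 'o" and e :: "'o \<Rightarrow> 'a"
  assumes W_sub: "W \<subseteq> W'"
    and e_hom: "x \<in> Obj C \<Longrightarrow> e x \<in> Hom C (T x) x"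
    and lift_ex: "g \<in> Hom C x y \<Longrightarrow> \<exists>h \<in> Hom C (T x) (T y). e y \<cdot> h = g \<cdot> e x"
    and lift_unique: "\<lbrakk>x \<in> Obj C; y \<in> Obj C; h \<in> Hom C (T x) (T y); k \<in> Hom C (T x) (T y);
      e y \<cdot> h = e y \<cdot> k\<rbrakk>
      \<Longrightarrow> zigzag_eq C W (T x) (T y) [Fwd h] [Fwd k]"
    and lift_W: "\<lbrakk>g \<in> Hom C x y; g \<in> W'; h \<in> Hom C (T x) (T y); e y \<cdot> h = g \<cdot> e x\<rbrakk> \<Longrightarrow> h \<in> W"
begin

text \<open>An arbitrary choice, which need not respect identities or composites;
  \<open>lift_unique\<close> makes the choice immaterial in the localization.\<close>

definition lift where
  "lift g = (SOME h. h \<in> Hom C (T (Dom C g)) (T (Cod C g)) \<and> e (Cod C g) \<cdot> h = g \<cdot> e (Dom C g))"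

lemma
  assumes "g \<in> Hom C x y"
  shows lift_hom: "lift g \<in> Hom C (T x) (T y)" and lift_eq: "e y \<cdot> lift g = g \<cdot> e x"
proof -
  have "\<exists>h. h \<in> Hom C (T x) (T y) \<and> e y \<cdot> h = g \<cdot> e x" using lift_ex[OF assms] by blast
  from someI_ex[OF this] show "lift g \<in> Hom C (T x) (T y)" "e y \<cdot> lift g = g \<cdot> e x"
    unfolding lift_def HomD(2,3)[OF assms] by auto
qed

lemma lift_in_W: "g \<in> Hom C x y \<Longrightarrow> g \<in> W' \<Longrightarrow> lift g \<in> W"
  using lift_W lift_hom lift_eq by blast

fun lift_step where
  "lift_step (Fwd g) = Fwd (lift g)"
| "lift_step (Bwd g) = Bwd (lift g)"

abbreviation lifts where "lifts \<equiv> map lift_step"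

lemma T_obj: "x \<in> Obj C \<Longrightarrow> T x \<in> Obj C"
  using e_hom hom_obj by blast

lemma zigzag_lifts: "zz x s y \<Longrightarrow> zz (T x) (lifts s) (T y)"
proof (induction s arbitrary: x)
  case Nil
  then show ?case using T_obj by auto
next
  case (Cons a s)
  show ?case
  proof (cases a)
    case (Fwd g)
    then have g: "g \<in> Hom C x (Cod C g)" "zz (Cod C g) s y" using Cons.prems by (auto simp: Hom_def)
    then show ?thesis using Fwd Cons.IH[OF g(2)] HomD[OF lift_hom[OF g(1)]] by simp
  next
    case (Bwd w)
    then have w: "w \<in> Hom C (Dom C w) x" "w \<in> W" "zz (Dom C w) s y" using Cons.prems
      by (auto simp: Hom_def)
    then show ?thesis using Bwd Cons.IH[OF w(3)] HomD[OF lift_hom[OF w(1)]] lift_in_W[OF w(1)]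
      W_sub by auto
  qed
qed

text \<open>The lift of an identity or of a composite agrees with the expected map after composing
  with \<open>e\<close>, hence in the localization by \<open>lift_unique\<close>. The relations for
  inverses carry over because lifts of maps in \<open>W\<close> lie in \<open>W\<close>.\<close>

lemma zeq_lifts: "zeq x y s t \<Longrightarrow> zeq (T x) (T y) (lifts s) (lifts t)"
proof (induction rule: zigzag_eq.induct)
  case (refl x s y)
  then show ?case by (intro zeq_refl zigzag_lifts)
next
  case (sym x y s t)
  show ?case by (rule zeq_sym[OF sym(2)])
next
  case (trans x y s t u)
  show ?case by (rule zeq_trans[OF trans(3,4)])
next
  case (cong x u x' y' s t v y)
  then show ?case using zigzag_eq.cong[OF zigzag_lifts[OF cong(1)] cong(4)
    zigzag_lifts[OF cong(3)]] by simp
next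
  case (ident x)
  have i: "Id C x \<in> Hom C x x" by (rule id_hom[OF ident])
  have ti: "Id C (T x) \<in> Hom C (T x) (T x)" by (rule id_hom[OF T_obj[OF ident]])
  have "e x \<cdot> lift (Id C x) = e x \<cdot> Id C (T x)"
    using lift_eq[OF i] id_left[OF e_hom[OF ident]] id_right[OF e_hom[OF ident]] by simp
  from zeq_trans[OF lift_unique[OF ident ident lift_hom[OF i] ti this]
    zigzag_eq.ident[OF T_obj[OF ident]]]
  show ?case by simp
next
  case (comp f x y g z)
  have gf: "g \<cdot> f \<in> Hom C x z" by (rule comp_hom[OF comp])
  have o: "x \<in> Obj C" "y \<in> Obj C" "z \<in> Obj C" using hom_obj[OF comp(1)] hom_obj[OF comp(2)] by auto
  note lf = lift_hom[OF comp(1)] and lg = lift_hom[OF comp(2)]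
  have "e z \<cdot> (lift g \<cdot> lift f) = (g \<cdot> f) \<cdot> e x"
    using comp_assoc[OF lf lg e_hom[OF o(3)]] lift_eq[OF comp(2)] comp_assoc[OF lf e_hom[OF o(2)] comp(2)]
      lift_eq[OF comp(1)] comp_assoc[OF e_hom[OF o(1)] comp] by simp
  then have "e z \<cdot> (lift g \<cdot> lift f) = e z \<cdot> lift (g \<cdot> f)" using lift_eq[OF gf] by simp
  from zeq_trans[OF zigzag_eq.comp[OF lf lg]
    lift_unique[OF o(1,3) comp_hom[OF lf lg] lift_hom[OF gf] this]]
  show ?case by simp
next
  case (inv_right w x y)
  then show ?case using zigzag_eq.inv_right[OF lift_in_W lift_hom] W_sub by auto
next
  case (inv_left w x y)
  then show ?case using zigzag_eq.inv_left[OF lift_in_W lift_hom] W_sub by auto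
qed

lemma zeq_square:
  assumes "f \<in> Hom C x y" "g \<in> Hom C y w" "f' \<in> Hom C x z" "g' \<in> Hom C z w" "g \<cdot> f = g' \<cdot> f'"
  shows "zeq x w [Fwd f, Fwd g] [Fwd f', Fwd g']"
  using zigzag_eq.comp[OF assms(1,2), of W] zigzag_eq.comp[OF assms(3,4), of W] assms(5) zeq_sym
    zeq_trans by metis

text \<open>Induction along the zigzag: a forward step pastes on the square \<open>lift_eq\<close>,
  a backward step the same square with its two parallel sides inverted.\<close>

lemma lifts_natural: "zz x s y \<Longrightarrow> zeq (T x) y (lifts s @ [Fwd (e y)]) (Fwd (e x) # s)"
proof (induction s arbitrary: x)
  case Nil
  then show ?case using zeq_refl[OF zigzag_Fwd[OF e_hom]] by auto
next
  case (Cons a s)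
  show ?case
  proof (cases a)
    case (Fwd g)
    then have g: "g \<in> Hom C x (Cod C g)" "zz (Cod C g) s y" using Cons.prems by (auto simp: Hom_def)
    note o = hom_obj[OF g(1)]
    have "zeq (T x) y ([Fwd (lift g)] @ (lifts s @ [Fwd (e y)]))
      ([Fwd (lift g)] @ (Fwd (e (Cod C g)) # s))"
      by (rule zeq_append[OF zeq_refl[OF zigzag_Fwd[OF lift_hom[OF g(1)]]] Cons.IH[OF g(2)]])
    moreover have "zeq (T x) y ([Fwd (lift g), Fwd (e (Cod C g))] @ s) ([Fwd (e x), Fwd g] @ s)"
      by (rule zeq_append[OF zeq_square[OF lift_hom[OF g(1)] e_hom[OF o(2)] e_hom[OF o(1)] g(1)
        lift_eq[OF g(1)]] zeq_refl[OF g(2)]])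
    ultimately show ?thesis using Fwd zeq_trans by simp
  next
    case (Bwd w)
    define d where "d = Dom C w"
    have w: "w \<in> Hom C d x" "w \<in> W" "zz d s y" using Cons.prems Bwd by (auto simp: Hom_def d_def)
    note o = hom_obj[OF w(1)]
    have lw: "lift w \<in> W" using lift_in_W[OF w(1)] w(2) W_sub by auto
    note lh = lift_hom[OF w(1)]
    have sq: "zeq (T d) x [Fwd (lift w), Fwd (e x)] [Fwd (e d), Fwd w]"
      by (rule zeq_square[OF lh e_hom[OF o(2)] e_hom[OF o(1)] w(1) lift_eq[OF w(1)]])
    \<comment> \<open>The square \<open>sq\<close> preceded by the inverse of \<open>lift w\<close>
      and followed by the inverse of \<open>w\<close>.\<close>
    have a: "zeq (T x) d [Bwd (lift w), Fwd (e d)] [Fwd (e x), Bwd w]"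
    proof -
      have "zeq (T x) d ([Bwd (lift w), Fwd (e d)] @ []) ([Bwd (lift w), Fwd (e d)] @ [Fwd w, Bwd w])"
        by (rule zeq_append[OF zeq_refl zeq_sym[OF zigzag_eq.inv_right[OF w(2,1)]]])
          (use lw HomD[OF lh] HomD[OF e_hom[OF o(1)]] o in simp)
      also have "zeq (T x) d ([Bwd (lift w)] @ ([Fwd (e d), Fwd w] @ [Bwd w]))
        ([Bwd (lift w)] @ ([Fwd (lift w), Fwd (e x)] @ [Bwd w]))"
        by (intro zeq_append[OF zeq_refl[OF zigzag_Bwd[OF lw lh]]]
          zeq_append[OF zeq_sym[OF sq] zeq_refl[OF zigzag_Bwd[OF w(2,1)]]])
      then have "zeq (T x) d ([Bwd (lift w), Fwd (e d)] @ [Fwd w, Bwd w])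
        ([Bwd (lift w), Fwd (lift w)] @ [Fwd (e x), Bwd w])" by simp
      also have "zeq (T x) d ([Bwd (lift w), Fwd (lift w)] @ [Fwd (e x), Bwd w])
        ([] @ [Fwd (e x), Bwd w])"
        by (rule zeq_append[OF zigzag_eq.inv_left[OF lw lh] zeq_refl])
          (use w(2) HomD[OF w(1)] HomD[OF e_hom[OF o(2)]] o in simp)
      finally show ?thesis by simp
    qed
    have "zeq (T x) y ([Bwd (lift w)] @ (lifts s @ [Fwd (e y)])) ([Bwd (lift w)] @ (Fwd (e d) # s))"
      by (rule zeq_append[OF zeq_refl[OF zigzag_Bwd[OF lw lh]] Cons.IH[OF w(3)]])
    moreover have "zeq (T x) y ([Bwd (lift w), Fwd (e d)] @ s) ([Fwd (e x), Bwd w] @ s)"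
      by (rule zeq_append[OF a zeq_refl[OF w(3)]])
    ultimately show ?thesis using Bwd zeq_trans by simp
  qed
qed

text \<open>For uniqueness, naturality of \<open>e\<close> rewrites a zigzag \<open>y\<close> from
  \<open>G\<close> to \<open>S\<close> as the inverse of \<open>e G\<close>, then
  \<open>lifts y\<close>, then \<open>e S\<close>. Inserting \<open>lift \<epsilon>\<close> and its
  inverse replaces \<open>lifts y\<close> by \<open>lifts (y @ [Fwd \<epsilon>])\<close>, which is
  determined by \<open>z\<close>. It is \<open>lift \<epsilon>\<close>, and not
  \<open>\<epsilon>\<close>, that is inverted here.\<close>

lemma unique_factorization:
  assumes G: "G \<in> Obj C" "e G \<in> W" and eps: "\<epsilon> \<in> Hom C S X" "\<epsilon> \<in> W'" and z: "zz G z X"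
  shows "\<exists>y. zz G y S \<and> zeq G X (y @ [Fwd \<epsilon>]) z"
    and "\<lbrakk>zz G y S; zz G y' S; zeq G X (y @ [Fwd \<epsilon>]) z; zeq G X (y' @ [Fwd \<epsilon>]) z\<rbrakk> \<Longrightarrow> zeq G S y y'"
proof -
  note o = hom_obj[OF eps(1)]
  note le = lift_hom[OF eps(1)] and eG = e_hom[OF G(1)] and eS = e_hom[OF o(1)]
  have lw: "lift \<epsilon> \<in> W" by (rule lift_in_W[OF eps])
  have zB: "zz G [Bwd (e G)] (T G)" by (rule zigzag_Bwd[OF G(2) eG])
  have zE: "zz (T X) [Bwd (lift \<epsilon>), Fwd (e S)] S"
    using zigzag_append[OF zigzag_Bwd[OF lw le] zigzag_Fwd[OF eS]] o by simp
  let ?y = "[Bwd (e G)] @ (lifts z @ [Bwd (lift \<epsilon>), Fwd (e S)])"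
  have y: "zz G ?y S" by (intro zigzag_append[OF zB] zigzag_append[OF zigzag_lifts[OF z] zE])
  \<comment> \<open>Naturality of \<open>e\<close> at \<open>\<epsilon>\<close>, with
    \<open>lift \<epsilon>\<close> moved to the other side.\<close>
  have a: "zeq (T X) X ([Bwd (lift \<epsilon>), Fwd (e S)] @ [Fwd \<epsilon>]) [Fwd (e X)]"
  proof -
    have "zeq (T X) X ([Bwd (lift \<epsilon>)] @ [Fwd (e S), Fwd \<epsilon>]) ([Bwd (lift \<epsilon>)] @ [Fwd (lift \<epsilon>), Fwd (e X)])"
      by (rule zeq_append[OF zeq_refl[OF zigzag_Bwd[OF lw le]]
        zeq_square[OF eS eps(1) le e_hom[OF o(2)] lift_eq[OF eps(1), symmetric]]])
    moreover have "zeq (T X) X ([Bwd (lift \<epsilon>), Fwd (lift \<epsilon>)] @ [Fwd (e X)]) ([] @ [Fwd (e X)])"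
      by (rule zeq_append[OF zigzag_eq.inv_left[OF lw le] zeq_refl[OF zigzag_Fwd[OF e_hom[OF o(2)]]]])
    ultimately show ?thesis using zeq_trans by simp
  qed
  have retr: "zeq G Y ([Bwd (e G)] @ Fwd (e G) # s) s" if "zz G s Y" for s Y
    using zeq_append[OF zigzag_eq.inv_left[OF G(2) eG] zeq_refl[OF that]] by simp
  have "zeq G X ([Bwd (e G)] @ (lifts z @ ([Bwd (lift \<epsilon>), Fwd (e S)] @ [Fwd \<epsilon>])))
    ([Bwd (e G)] @ (lifts z @ [Fwd (e X)]))"
    by (intro zeq_append[OF zeq_refl[OF zB]] zeq_append[OF zeq_refl[OF zigzag_lifts[OF z]] a])
  also have "zeq G X \<dots> ([Bwd (e G)] @ (Fwd (e G) # z))"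
    by (rule zeq_append[OF zeq_refl[OF zB] lifts_natural[OF z]])
  also have "zeq G X \<dots> z" by (rule retr[OF z])
  finally show "\<exists>y. zz G y S \<and> zeq G X (y @ [Fwd \<epsilon>]) z" using y by (intro exI[of _ ?y]) simp
  have *: "zeq G S y ?y" if y: "zz G y S" "zeq G X (y @ [Fwd \<epsilon>]) z" for y
  proof -
    have "zeq G S y ([Bwd (e G)] @ (Fwd (e G) # y))" by (rule zeq_sym[OF retr[OF y(1)]])
    also have "zeq G S \<dots> ([Bwd (e G)] @ (lifts y @ [Fwd (e S)]))"
      by (rule zeq_append[OF zeq_refl[OF zB] zeq_sym[OF lifts_natural[OF y(1)]]])
    also have "zeq G S \<dots> ([Bwd (e G)] @ (lifts y @ ([Fwd (lift \<epsilon>), Bwd (lift \<epsilon>)] @ [Fwd (e S)])))"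
      using zeq_append[OF zeq_refl[OF zB] zeq_append[OF zeq_refl[OF zigzag_lifts[OF y(1)]]
          zeq_append[OF zeq_sym[OF zigzag_eq.inv_right[OF lw le]]
            zeq_refl[OF zigzag_Fwd[OF eS]]]]] by simp
    also have "\<dots> = [Bwd (e G)] @ (lifts (y @ [Fwd \<epsilon>]) @ [Bwd (lift \<epsilon>), Fwd (e S)])" by simp
    also have "zeq G S \<dots> ?y"
      by (intro zeq_append[OF zeq_refl[OF zB]] zeq_append[OF zeq_lifts[OF y(2)] zeq_refl[OF zE]])
    finally show ?thesis .
  qed
  show "zeq G S y y'" if "zz G y S" "zz G y' S" "zeq G X (y @ [Fwd \<epsilon>]) z" "zeq G X (y' @ [Fwd \<epsilon>]) z"
    using zeq_trans[OF *[OF that(1,3)] zeq_sym[OF *[OF that(2,4)]]] .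
qed

theorem localization_unique_factorization:
  assumes G: "G \<in> Obj C" "e G \<in> W" and eps: "\<epsilon> \<in> Hom C S X" "\<epsilon> \<in> W'"
    and zeta: "\<zeta> \<in> Hom (localization C W) G X"
  shows "\<exists>!\<upsilon>. \<upsilon> \<in> Hom (localization C W) G S \<and> \<zeta> = loc_arr C W \<epsilon> \<cdot>\<^bsub>localization C W\<^esub> \<upsilon>"
proof -
  obtain z where z: "zz G z X" "\<zeta> = (G, zigzag_class C W G X z, X)"
    using zeta by (auto simp: localization_hom)
  have le: "loc_arr C W \<epsilon> = (S, zigzag_class C W S X [Fwd \<epsilon>], X)"
    using HomD[OF eps(1)] by (simp add: loc_arr_def)
  have comp: "loc_arr C W \<epsilon> \<cdot>\<^bsub>localization C W\<^esub> (G, zigzag_class C W G S y, S)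
      = (G, zigzag_class C W G X (y @ [Fwd \<epsilon>]), X)" if "zz G y S" for y
    unfolding le by (rule localization_comp[OF that zigzag_Fwd[OF eps(1)]])
  have iff: "\<zeta> = loc_arr C W \<epsilon> \<cdot>\<^bsub>localization C W\<^esub> (G, zigzag_class C W G S y, S) \<longleftrightarrow> zeq G X (y @ [Fwd \<epsilon>]) z"
    if "zz G y S" for y
    using comp[OF that] z zigzag_class_eq_iff[OF z(1)] zeq_sym by auto
  from unique_factorization(1)[OF G eps z(1)] obtain y where y: "zz G y S"
    "zeq G X (y @ [Fwd \<epsilon>]) z" by blast
  show ?thesis
  proof (rule ex1I[of _ "(G, zigzag_class C W G S y, S)"])
    show "(G, zigzag_class C W G S y, S) \<in> Hom (localization C W) G S \<and>
      \<zeta> = loc_arr C W \<epsilon> \<cdot>\<^bsub>localization C W\<^esub> (G, zigzag_class C W G S y, S)"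
      using y iff by (auto simp: localization_hom)
    fix \<upsilon> assume u: "\<upsilon> \<in> Hom (localization C W) G S \<and> \<zeta> = loc_arr C W \<epsilon> \<cdot>\<^bsub>localization C W\<^esub> \<upsilon>"
    then obtain y' where y': "zz G y' S" "\<upsilon> = (G, zigzag_class C W G S y', S)"
      by (auto simp: localization_hom)
    then have "zeq G X (y' @ [Fwd \<epsilon>]) z" using u iff by blast
    then show "\<upsilon> = (G, zigzag_class C W G S y, S)"
      using unique_factorization(2)[OF G eps z(1) y'(1) y(1) _ y(2)] zigzag_class_eq_iff[OF y'(1)]
        y'(2) by simp
  qed
qed

end

section \<open>Left Kan extensions of cofibrant diagrams as a coreflection up to homotopy\<close>

section \<open>Approximations\<close>

text \<open>An isomorphism lifts against every map, in particular against every fibration.\<close>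

lemma (in model_core) iso_weq:
  assumes f: "f \<in> Hom M x y" and r: "r \<in> Hom M y x" "r \<cdot> f = Id M x" "f \<cdot> r = Id M y"
  shows "f \<in> weq M"
proof (rule lifting_imp_weq[OF f])
  fix p assume "p \<in> fib M"
  then have "p \<in> Arr M" using wide_fib by (auto simp: wide_subcategory_def)
  then have p: "p \<in> Hom M (Dom M p) (Cod M p)" by (simp add: Hom_def)
  show "has_lifting M f p"
    unfolding has_lifting_def HomD(2,3)[OF f]
  proof (intro ballI impI)
    fix u v assume u: "u \<in> Hom M x (Dom M p)" and v: "v \<in> Hom M y (Cod M p)" and e: "p \<cdot> u = v \<cdot> f"
    have "(u \<cdot> r) \<cdot> f = u"
      using M.comp_assoc[OF f r(1) u] r(2) M.id_right[OF u] by simp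
    moreover have "p \<cdot> (u \<cdot> r) = v"
      using M.comp_assoc[OF r(1) u p] M.comp_assoc[OF r(1) f v] e r(3) M.id_right[OF v] by simp
    ultimately show "\<exists>h \<in> Hom M y (Dom M p). h \<cdot> f = u \<and> p \<cdot> h = v"
      using M.comp_hom[OF r(1) u] by blast
  qed
qed

text \<open>Existence of left Kan extensions is an assumption of the locale, so that the smallness
  type, from which it will be derived, does not occur here.\<close>

locale approximation = subposet_kan M P A t + projective_model M "poset_cat (P\<lparr>carrier := A\<rparr>)"
  for M :: "('o, 'a) premodel" (structure) and P :: "('p, 'x) gorder_scheme" and A t +
  assumes has_lan: "is_functor CJ M Q \<Longrightarrow> \<exists>T \<eta>. is_lan Q T \<eta>"
begin

abbreviation WP where "WP \<equiv> objectwise CP M (weq M)"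
abbreviation WJ where "WJ \<equiv> objectwise CJ M (weq M)"

sublocale loc: localization_setup FP WP
  by standard (auto simp: objectwise_def)

lemma lan_unique_nat:
  assumes "is_lan Q T \<eta>" "\<beta> \<in> Hom FP T G" "\<beta>' \<in> Hom FP T G" "Rn \<beta> \<cdot>\<^bsub>FJ\<^esub> \<eta> = Rn \<beta>' \<cdot>\<^bsub>FJ\<^esub> \<eta>"
  shows "\<beta> = \<beta>'"
proof (rule lan_unique[OF assms(1-3)])
  fix v assume "v \<in> A"
  then show "nt_at \<beta> v \<cdot> nt_at \<eta> v = nt_at \<beta>' v \<cdot> nt_at \<eta> v"
    using arg_cong[OF assms(4), of "\<lambda>n. nt_at n v"] by simp
qed

lemma Rn_comp_unit:
  assumes lan: "is_lan Q T \<eta>" and b: "\<beta> \<in> Hom FP T G" and g: "\<gamma> \<in> Hom FP G H"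
  shows "Rn (\<gamma> \<cdot>\<^bsub>FP\<^esub> \<beta>) \<cdot>\<^bsub>FJ\<^esub> \<eta> = Rn \<gamma> \<cdot>\<^bsub>FJ\<^esub> (Rn \<beta> \<cdot>\<^bsub>FJ\<^esub> \<eta>)"
  using Rn_comp[OF b g] FJ.comp_assoc[OF is_lanD(2)[OF lan] Rn_hom[OF b] Rn_hom[OF g]] by simp

lemma unit_weq:
  assumes lan: "is_lan Q T \<eta>"
  shows "\<eta> \<in> WJ"
proof (rule objectwiseI[OF is_lanD(2)[OF lan]])
  fix v assume "v \<in> Obj CJ"
  then have v: "v \<in> A" by simp
  obtain r where "r \<in> Hom M (fobj T v) (fobj Q v)"
    "r \<cdot> nt_at \<eta> v = Id M (fobj Q v)" "nt_at \<eta> v \<cdot> r = Id M (fobj T v)"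
    by (rule lan_unit_inverse[OF lan v])
  then show "nt_at \<eta> v \<in> weq M"
    using poset_natD(1)[OF is_lanD(2)[OF lan], of v]
      v iso_weq[of "nt_at \<eta> v" "fobj Q v" "fobj T v" r] by simp
qed

text \<open>At \<open>x\<close> the transformation is the map of colimits over
  \<open>below x\<close>, a down-set of \<open>J\<close>, so \<open>colimit_map_weq\<close>
  applies.\<close>

lemma lan_map_weq:
  assumes X: "is_lan X TX \<eta>X" and Y: "is_lan Y TY \<eta>Y" and j: "j \<in> Hom FJ X Y"
    and lift: "\<And>p. p \<in> objectwise CJ M (fib M) \<Longrightarrow> has_lifting FJ j p"
    and b: "\<beta> \<in> Hom FP TX TY" "Rn \<beta> \<cdot>\<^bsub>FJ\<^esub> \<eta>X = \<eta>Y \<cdot>\<^bsub>FJ\<^esub> j"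
  shows "\<beta> \<in> WP"
proof (rule objectwiseI[OF b(1)])
  fix x assume "x \<in> Obj CP"
  then have x: "x \<in> carrier P" by simp
  have bx: "nt_at \<beta> x \<in> Hom M (fobj TX x) (fobj TY x)" by (rule poset_natD(1)[OF b(1) x])
  show "nt_at \<beta> x \<in> weq M"
  proof (rule colimit_map_weq[OF model_core_axioms terminal po_J _ _ j lift _ _ bx])
    show "below x \<subseteq> carrier J" by auto
    show "v \<in> below x" if "w \<in> below x" "v \<in> carrier J" "v \<sqsubseteq>\<^bsub>J\<^esub> w" for v w
      using that P.le_trans[of v w x] x by simp
    show "is_colimit (poset_cat (J\<lparr>carrier := below x\<rparr>)) M X (fobj TX x)
      (\<lambda>v. farr TX (v, x) \<cdot> nt_at \<eta>X v)"
      using lan_pointwise[OF X x] by simp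
    show "is_colimit (poset_cat (J\<lparr>carrier := below x\<rparr>)) M Y (fobj TY x)
      (\<lambda>v. farr TY (v, x) \<cdot> nt_at \<eta>Y v)"
      using lan_pointwise[OF Y x] by simp
    fix v assume v: "v \<in> below x"
    then have vA: "v \<in> A" and vP: "v \<in> carrier P" and vx: "v \<sqsubseteq>\<^bsub>P\<^esub> x" by auto
    have m: "nt_at \<eta>X v \<in> Hom M (fobj X v) (fobj TX v)" "nt_at \<eta>Y v \<in> Hom M (fobj Y v) (fobj TY v)"
      "nt_at j v \<in> Hom M (fobj X v) (fobj Y v)" "nt_at \<beta> v \<in> Hom M (fobj TX v) (fobj TY v)"
      "farr TX (v, x) \<in> Hom M (fobj TX v) (fobj TX x)" "farr TY (v, x) \<in> Hom M (fobj TY v) (fobj TY x)"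
      using poset_natD(1)[OF is_lanD(2)[OF X], of v] poset_natD(1)[OF is_lanD(2)[OF Y], of v]
        poset_natD(1)[OF j, of v]
        poset_natD(1)[OF b(1) vP] vA poset_functorD(2)[OF is_lanD(1)[OF X] vP x vx]
          poset_functorD(2)[OF is_lanD(1)[OF Y] vP x vx]
      by auto
    have e: "nt_at \<beta> v \<cdot> nt_at \<eta>X v = nt_at \<eta>Y v \<cdot> nt_at j v"
      using arg_cong[OF b(2), of "\<lambda>n. nt_at n v"] vA by simp
    show "nt_at \<beta> x \<cdot> (farr TX (v, x) \<cdot> nt_at \<eta>X v) = (farr TY (v, x) \<cdot> nt_at \<eta>Y v) \<cdot> nt_at j v"
      using M.comp_assoc[OF m(1,5) bx] poset_natD(2)[OF b(1) vP x vx] M.comp_assoc[OF m(1,4,6)] e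
        M.comp_assoc[OF m(3,2,6)] by simp
  qed
qed

text \<open>Ken Brown's argument. The cospan \<open>j\<close>, \<open>j'\<close> with retraction
  \<open>r\<close> extends to \<open>P\<close>, where \<open>Lr\<close> composed with
  \<open>Lj\<close> is \<open>h\<close> and \<open>Lr\<close> composed with \<open>Lj'\<close> is
  the identity. The maps \<open>Lj\<close> and \<open>Lj'\<close> are weak equivalences, hence so
  are \<open>Lr\<close> and \<open>h\<close>.\<close>

lemma lan_weq:
  assumes Q: "proj_cofibrant Q" "is_lan Q T \<eta>" and Q': "proj_cofibrant Q'" "is_lan Q' T' \<eta>'"
    and h: "h \<in> Hom FP T T'" "Rn h \<in> WJ"
  shows "h \<in> WP"
proof -
  note eta = is_lanD(2)[OF Q(2)] and eta' = is_lanD(2)[OF Q'(2)]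
  have q: "Rn h \<cdot>\<^bsub>FJ\<^esub> \<eta> \<in> Hom FJ Q (R T')" "Rn h \<cdot>\<^bsub>FJ\<^esub> \<eta> \<in> WJ"
    using FJ.comp_hom[OF eta Rn_hom[OF h(1)]]
      objectwise_weq_comp[OF eta Rn_hom[OF h(1)] unit_weq[OF Q(2)] h(2)] by auto
  obtain X j j' r where j: "j \<in> Hom FJ Q X" "j' \<in> Hom FJ Q' X" and r: "r \<in> Hom FJ X (R T')"
    and rj: "r \<cdot>\<^bsub>FJ\<^esub> j = Rn h \<cdot>\<^bsub>FJ\<^esub> \<eta>" "r \<cdot>\<^bsub>FJ\<^esub> j' = \<eta>'"
    and lift: "\<And>p. p \<in> objectwise CJ M (fib M) \<Longrightarrow> has_lifting FJ j p"
      "\<And>p. p \<in> objectwise CJ M (fib M) \<Longrightarrow> has_lifting FJ j' p"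
    by (rule cofibrant_cospan[OF Q(1) Q'(1) q eta' unit_weq[OF Q'(2)]]) blast
  obtain TX \<eta>X where X: "is_lan X TX \<eta>X" using has_lan natD(1)[OF r] by blast
  note etaX = is_lanD(2)[OF X]
  obtain Lj where Lj: "Lj \<in> Hom FP T TX" "Rn Lj \<cdot>\<^bsub>FJ\<^esub> \<eta> = \<eta>X \<cdot>\<^bsub>FJ\<^esub> j"
    by (rule lan_ex[OF Q(2) is_lanD(1)[OF X] FJ.comp_hom[OF j(1) etaX]])
  obtain Lj' where Lj': "Lj' \<in> Hom FP T' TX" "Rn Lj' \<cdot>\<^bsub>FJ\<^esub> \<eta>' = \<eta>X \<cdot>\<^bsub>FJ\<^esub> j'"
    by (rule lan_ex[OF Q'(2) is_lanD(1)[OF X] FJ.comp_hom[OF j(2) etaX]])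
  obtain Lr where Lr: "Lr \<in> Hom FP TX T'" "Rn Lr \<cdot>\<^bsub>FJ\<^esub> \<eta>X = r"
    by (rule lan_ex[OF X is_lanD(1)[OF Q'(2)] r])
  have T': "is_functor CP M T'" by (rule is_lanD(1)[OF Q'(2)])
  have w: "Lj \<in> WP" "Lj' \<in> WP"
    using lan_map_weq[OF Q(2) X j(1) lift(1) Lj] lan_map_weq[OF Q'(2) X j(2) lift(2) Lj'] by auto
  have LrLj: "Lr \<cdot>\<^bsub>FP\<^esub> Lj = h"
  proof (rule lan_unique_nat[OF Q(2) FP.comp_hom[OF Lj(1) Lr(1)] h(1)])
    show "Rn (Lr \<cdot>\<^bsub>FP\<^esub> Lj) \<cdot>\<^bsub>FJ\<^esub> \<eta> = Rn h \<cdot>\<^bsub>FJ\<^esub> \<eta>"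
      using Rn_comp_unit[OF Q(2) Lj(1) Lr(1)] Lj(2) FJ.comp_assoc[OF j(1) etaX Rn_hom[OF Lr(1)]]
        Lr(2) rj(1) by simp
  qed
  have LrLj': "Lr \<cdot>\<^bsub>FP\<^esub> Lj' = Id FP T'"
  proof (rule lan_unique[OF Q'(2) FP.comp_hom[OF Lj'(1) Lr(1)] FP.id_hom])
    fix v assume v: "v \<in> A"
    have "Rn (Lr \<cdot>\<^bsub>FP\<^esub> Lj') \<cdot>\<^bsub>FJ\<^esub> \<eta>' = \<eta>'"
      using Rn_comp_unit[OF Q'(2) Lj'(1) Lr(1)] Lj'(2) FJ.comp_assoc[OF j(2) etaX Rn_hom[OF Lr(1)]]
        Lr(2) rj(2) by simp
    from arg_cong[OF this, of "\<lambda>n. nt_at n v"] v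
    show "nt_at (Lr \<cdot>\<^bsub>FP\<^esub> Lj') v \<cdot> nt_at \<eta>' v = nt_at (Id FP T') v \<cdot> nt_at \<eta>' v"
      using M.id_left[OF poset_natD(1)[OF eta', of v]] by simp
  qed (use T' in simp)
  have e: "nt_at Lr x \<cdot> nt_at Lj x = nt_at h x" "nt_at Lr x \<cdot> nt_at Lj' x = Id M (fobj T' x)"
    if "x \<in> carrier P" for x
    using that arg_cong[OF LrLj, of "\<lambda>n. nt_at n x"] arg_cong[OF LrLj', of "\<lambda>n. nt_at n x"] by simp_all
  show ?thesis
  proof (rule objectwiseI[OF h(1)])
    fix x assume "x \<in> Obj CP"
    then have x: "x \<in> carrier P" by simp
    note n = poset_natD(1)[OF Lj(1) x] poset_natD(1)[OF Lj'(1) x] poset_natD(1)[OF Lr(1) x]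
    have wx: "nt_at Lj x \<in> weq M" "nt_at Lj' x \<in> weq M"
      using objectwiseD[OF w(1)] objectwiseD[OF w(2)] x by auto
    have "nt_at Lr x \<in> weq M"
      using weq_cancel_right[OF n(2,3) wx(2)] e(2)[OF x] id_weq[OF poset_functorD(1)[OF T' x]] by simp
    then show "nt_at h x \<in> weq M"
      using weq_comp[OF n(1,3) wx(1)] e(1)[OF x] by simp
  qed
qed

text \<open>The composite in the last clause is the replacement map on \<open>J\<close>.
  \<open>codegree_approximation\<close> asks for a weak equivalence at this place; a trivial
  fibration is required here in order to lift maps through \<open>e\<close>.\<close>

definition trivfib_approx where
  "trivfib_approx Y Q T \<eta> e \<longleftrightarrow> proj_cofibrant Q \<and> is_lan Q T \<eta> \<and> e \<in> Hom FP T Y \<and>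
     Rn e \<cdot>\<^bsub>FJ\<^esub> \<eta> \<in> objectwise CJ M (fib M \<inter> weq M)"

lemma trivfib_approx_ex:
  assumes Y: "is_functor CP M Y"
  shows "\<exists>Q T \<eta> e. trivfib_approx Y Q T \<eta> e"
proof -
  obtain Q q where Q: "proj_cofibrant Q" "q \<in> Hom FJ Q (R Y)" "q \<in> objectwise CJ M (fib M \<inter> weq M)"
    by (rule cofibrant_replacement_ex[OF is_functor_R[OF Y]])
  obtain T \<eta> where T: "is_lan Q T \<eta>" using has_lan natD(1)[OF Q(2)] by blast
  obtain e where "e \<in> Hom FP T Y" "Rn e \<cdot>\<^bsub>FJ\<^esub> \<eta> = q" by (rule lan_ex[OF T Y Q(2)])
  then have "trivfib_approx Y Q T \<eta> e" using Q T by (simp add: trivfib_approx_def)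
  then show ?thesis by blast
qed

lemma approx_restrict_weq:
  assumes lan: "is_lan Q T \<eta>" and e: "e \<in> Hom FP T Y" and q: "Rn e \<cdot>\<^bsub>FJ\<^esub> \<eta> \<in> WJ"
  shows "Rn e \<in> WJ"
  by (rule objectwise_weq_cancel_right[OF is_lanD(2)[OF lan] Rn_hom[OF e] unit_weq[OF lan] q])

text \<open>As the unit of a left Kan extension along a full inclusion is invertible, the restriction
  of \<open>e\<close> is a retract of \<open>q\<close>.\<close>

lemma approx_restrict_trivfib:
  assumes "trivfib_approx Y Q T \<eta> e"
  shows "Rn e \<in> objectwise CJ M (fib M \<inter> weq M)"
proof -
  have lan: "is_lan Q T \<eta>" and e: "e \<in> Hom FP T Y" and q: "Rn e \<cdot>\<^bsub>FJ\<^esub> \<eta> \<in> objectwise CJ M (fib M \<inter> weq M)"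
    using assms by (auto simp: trivfib_approx_def)
  show ?thesis
  proof (rule objectwiseI[OF Rn_hom[OF e]])
    fix v assume "v \<in> Obj CJ"
    then have v: "v \<in> A" and vP: "v \<in> carrier P" by auto
    obtain r where r: "r \<in> Hom M (fobj T v) (fobj Q v)"
      "r \<cdot> nt_at \<eta> v = Id M (fobj Q v)" "nt_at \<eta> v \<cdot> r = Id M (fobj T v)"
      by (rule lan_unit_inverse[OF lan v])
    have ev: "nt_at e v \<in> Hom M (fobj T v) (fobj Y v)" by (rule poset_natD(1)[OF e vP])
    have nv: "nt_at \<eta> v \<in> Hom M (fobj Q v) (fobj T v)"
      using poset_natD(1)[OF is_lanD(2)[OF lan], of v] v by simp
    let ?q = "nt_at e v \<cdot> nt_at \<eta> v"
    have qv: "?q \<in> Hom M (fobj Q v) (fobj Y v)" by (rule M.comp_hom[OF nv ev])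
    have qw: "?q \<in> fib M \<inter> weq M" using objectwiseD[OF q, of v] v by simp
    have Yv: "fobj Y v \<in> Obj M" using M.hom_obj(2)[OF ev] .
    have "retract_of M (nt_at e v) ?q"
      unfolding retract_of_def HomD(2,3)[OF ev] HomD(2,3)[OF qv]
    proof (intro conjI bexI)
      show "nt_at \<eta> v \<cdot> r = Id M (fobj T v)" by (rule r)
      show "Id M (fobj Y v) \<cdot> Id M (fobj Y v) = Id M (fobj Y v)" using M.id_left[OF M.id_hom[OF Yv]] .
      show "?q \<cdot> r = Id M (fobj Y v) \<cdot> nt_at e v"
        using M.comp_assoc[OF r(1) nv ev] r(3) M.id_right[OF ev] M.id_left[OF ev] by simp
      show "nt_at e v \<cdot> nt_at \<eta> v = Id M (fobj Y v) \<cdot> ?q" using M.id_left[OF qv] by simp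
    qed (use HomD(1)[OF ev] HomD(1)[OF qv] r(1) nv M.id_hom[OF Yv] in auto)
    then show "nt_at (Rn e) v \<in> fib M \<inter> weq M"
      using v qw retract_weq retract_fib unfolding retract_closed_def by auto
  qed
qed

text \<open>Lifting happens on \<open>J\<close>, where \<open>Q\<close> is cofibrant and
  \<open>eZ\<close> restricts to a trivial fibration. The universal property of \<open>T\<close>
  carries the lift and its equation over to \<open>P\<close>.\<close>

lemma lan_lift_ex:
  assumes Q: "proj_cofibrant Q" "is_lan Q T \<eta>" and Z: "trivfib_approx Z QZ TZ \<eta>Z eZ"
    and a: "a \<in> Hom FP T Z"
  shows "\<exists>h \<in> Hom FP T TZ. eZ \<cdot>\<^bsub>FP\<^esub> h = a"
proof -
  have lanZ: "is_lan QZ TZ \<eta>Z" and eZ: "eZ \<in> Hom FP TZ Z" using Z by (auto simp: trivfib_approx_def)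
  note eta = is_lanD(2)[OF Q(2)]
  obtain h' where h': "h' \<in> Hom FJ Q (R TZ)" "Rn eZ \<cdot>\<^bsub>FJ\<^esub> h' = Rn a \<cdot>\<^bsub>FJ\<^esub> \<eta>"
    by (rule proj_cofibrant_lift[OF Q(1) approx_restrict_trivfib[OF Z] Rn_hom[OF eZ]
      FJ.comp_hom[OF eta Rn_hom[OF a]]])
  obtain h where h: "h \<in> Hom FP T TZ" "Rn h \<cdot>\<^bsub>FJ\<^esub> \<eta> = h'"
    by (rule lan_ex[OF Q(2) is_lanD(1)[OF lanZ] h'(1)])
  have "eZ \<cdot>\<^bsub>FP\<^esub> h = a"
    by (rule lan_unique_nat[OF Q(2) FP.comp_hom[OF h(1) eZ] a])
      (use Rn_comp_unit[OF Q(2) h(1) eZ] h(2) h'(2) in simp)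
  then show ?thesis using h(1) by blast
qed

text \<open>A cylinder \<open>X\<close> of \<open>Q\<close> is taken on \<open>J\<close> and
  extended to \<open>P\<close>. There \<open>Lr\<close> is a weak equivalence, because its section
  \<open>Lj\<close> is the extension of a projective trivial cofibration; so the extended cylinder
  identifies \<open>h\<close> and \<open>k\<close> in the localization.\<close>

lemma lan_lift_unique:
  assumes Q: "proj_cofibrant Q" "is_lan Q T \<eta>" and Z: "trivfib_approx Z QZ TZ \<eta>Z eZ"
    and h: "h \<in> Hom FP T TZ" and k: "k \<in> Hom FP T TZ" and eq: "eZ \<cdot>\<^bsub>FP\<^esub> h = eZ \<cdot>\<^bsub>FP\<^esub> k"
  shows "zigzag_eq FP WP T TZ [Fwd h] [Fwd k]"
proof -
  have lanZ: "is_lan QZ TZ \<eta>Z" and eZ: "eZ \<in> Hom FP TZ Z" using Z by (auto simp: trivfib_approx_def)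
  note eta = is_lanD(2)[OF Q(2)]
  have QF: "is_functor CJ M Q" and T: "is_functor CP M T" using is_lanD[OF Q(2)] by auto
  have id: "Id FJ Q \<in> Hom FJ Q Q" by (rule FJ.id_hom) (use QF in simp)
  have idw: "Id FJ Q \<in> WJ"
    by (rule objectwiseI[OF id]) (use id_weq functorD(1)[OF QF] in simp)
  obtain X j j' r where j: "j \<in> Hom FJ Q X" "j' \<in> Hom FJ Q X" and r: "r \<in> Hom FJ X Q"
    and rj: "r \<cdot>\<^bsub>FJ\<^esub> j = Id FJ Q" "r \<cdot>\<^bsub>FJ\<^esub> j' = Id FJ Q"
    and lift: "\<And>p. p \<in> objectwise CJ M (fib M) \<Longrightarrow> has_lifting FJ j p"
    and joint: "\<And>p Y Z u u' v. \<lbrakk>p \<in> objectwise CJ M (fib M \<inter> weq M); p \<in> Hom FJ Y Z; u \<in> Hom FJ Q Y;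
      u' \<in> Hom FJ Q Y;
       v \<in> Hom FJ X Z; p \<cdot>\<^bsub>FJ\<^esub> u = v \<cdot>\<^bsub>FJ\<^esub> j; p \<cdot>\<^bsub>FJ\<^esub> u' = v \<cdot>\<^bsub>FJ\<^esub> j'\<rbrakk>
       \<Longrightarrow> \<exists>h \<in> Hom FJ X Y. h \<cdot>\<^bsub>FJ\<^esub> j = u \<and> h \<cdot>\<^bsub>FJ\<^esub> j' = u'"
    by (rule cofibrant_cospan[OF Q(1) Q(1) id idw id idw]) blast
  let ?u = "Rn h \<cdot>\<^bsub>FJ\<^esub> \<eta>" and ?u' = "Rn k \<cdot>\<^bsub>FJ\<^esub> \<eta>"
  have u: "?u \<in> Hom FJ Q (R TZ)" "?u' \<in> Hom FJ Q (R TZ)"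
    using FJ.comp_hom[OF eta Rn_hom[OF h]] FJ.comp_hom[OF eta Rn_hom[OF k]] by auto
  have c: "Rn eZ \<cdot>\<^bsub>FJ\<^esub> ?u \<in> Hom FJ Q (R Z)" by (rule FJ.comp_hom[OF u(1) Rn_hom[OF eZ]])
  have cu: "Rn eZ \<cdot>\<^bsub>FJ\<^esub> ?u' = Rn eZ \<cdot>\<^bsub>FJ\<^esub> ?u"
    using Rn_comp_unit[OF Q(2) h eZ] Rn_comp_unit[OF Q(2) k eZ] eq by simp
  have vj: "((Rn eZ \<cdot>\<^bsub>FJ\<^esub> ?u) \<cdot>\<^bsub>FJ\<^esub> r) \<cdot>\<^bsub>FJ\<^esub> j = Rn eZ \<cdot>\<^bsub>FJ\<^esub> ?u" "((Rn eZ \<cdot>\<^bsub>FJ\<^esub> ?u) \<cdot>\<^bsub>FJ\<^esub> r) \<cdot>\<^bsub>FJ\<^esub> j' = Rn eZ \<cdot>\<^bsub>FJ\<^esub> ?u"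
    using FJ.comp_assoc[OF j(1) r c] FJ.comp_assoc[OF j(2) r c] rj FJ.id_right[OF c] by auto
  \<comment> \<open>Both maps have the same composite with \<open>eZ\<close>. The constant homotopy
    at this composite, taken through \<open>r\<close>, is lifted along the trivial fibration with
    the two given ends.\<close>
  obtain H where H: "H \<in> Hom FJ X (R TZ)" "H \<cdot>\<^bsub>FJ\<^esub> j = ?u" "H \<cdot>\<^bsub>FJ\<^esub> j' = ?u'"
    using joint[OF approx_restrict_trivfib[OF Z] Rn_hom[OF eZ] u FJ.comp_hom[OF r c]
      vj(1)[symmetric]] vj(2) cu by auto
  obtain TX \<eta>X where X: "is_lan X TX \<eta>X" using has_lan natD(1)[OF r] by blast
  note etaX = is_lanD(2)[OF X]
  obtain Lj where Lj: "Lj \<in> Hom FP T TX" "Rn Lj \<cdot>\<^bsub>FJ\<^esub> \<eta> = \<eta>X \<cdot>\<^bsub>FJ\<^esub> j"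
    by (rule lan_ex[OF Q(2) is_lanD(1)[OF X] FJ.comp_hom[OF j(1) etaX]])
  obtain Lj' where Lj': "Lj' \<in> Hom FP T TX" "Rn Lj' \<cdot>\<^bsub>FJ\<^esub> \<eta> = \<eta>X \<cdot>\<^bsub>FJ\<^esub> j'"
    by (rule lan_ex[OF Q(2) is_lanD(1)[OF X] FJ.comp_hom[OF j(2) etaX]])
  obtain Lr where Lr: "Lr \<in> Hom FP TX T" "Rn Lr \<cdot>\<^bsub>FJ\<^esub> \<eta>X = \<eta> \<cdot>\<^bsub>FJ\<^esub> r"
    by (rule lan_ex[OF X T FJ.comp_hom[OF r eta]])
  obtain LH where LH: "LH \<in> Hom FP TX TZ" "Rn LH \<cdot>\<^bsub>FJ\<^esub> \<eta>X = H"
    by (rule lan_ex[OF X is_lanD(1)[OF lanZ] H(1)])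
  have retr: "Lr \<cdot>\<^bsub>FP\<^esub> L = Id FP T"
    if L: "L \<in> Hom FP T TX" "Rn L \<cdot>\<^bsub>FJ\<^esub> \<eta> = \<eta>X \<cdot>\<^bsub>FJ\<^esub> i" and i: "i \<in> Hom FJ Q X" "r \<cdot>\<^bsub>FJ\<^esub> i = Id FJ Q" for L i
  proof (rule lan_unique[OF Q(2) FP.comp_hom[OF L(1) Lr(1)] FP.id_hom])
    fix v assume v: "v \<in> A"
    have "Rn (Lr \<cdot>\<^bsub>FP\<^esub> L) \<cdot>\<^bsub>FJ\<^esub> \<eta> = \<eta>"
      using Rn_comp_unit[OF Q(2) L(1) Lr(1)] L(2) FJ.comp_assoc[OF i(1) etaX Rn_hom[OF Lr(1)]] Lr(2)
        FJ.comp_assoc[OF i(1) r eta] i(2) FJ.id_right[OF eta] by simp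
    from arg_cong[OF this, of "\<lambda>n. nt_at n v"] v
    show "nt_at (Lr \<cdot>\<^bsub>FP\<^esub> L) v \<cdot> nt_at \<eta> v = nt_at (Id FP T) v \<cdot> nt_at \<eta> v"
      using M.id_left[OF poset_natD(1)[OF eta, of v]] by simp
  qed (use T in simp)
  have LjW: "Lj \<in> WP" by (rule lan_map_weq[OF Q(2) X j(1) lift Lj])
  note rL = retr[OF Lj j(1) rj(1)] and rL' = retr[OF Lj' j(2) rj(2)]
  have LrW: "Lr \<in> WP"
  proof (rule objectwiseI[OF Lr(1)])
    fix x assume "x \<in> Obj CP"
    then have x: "x \<in> carrier P" by simp
    have "nt_at Lr x \<cdot> nt_at Lj x = Id M (fobj T x)" using arg_cong[OF rL, of "\<lambda>n. nt_at n x"] x by simp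
    then show "nt_at Lr x \<in> weq M"
      using weq_cancel_right[OF poset_natD(1)[OF Lj(1) x] poset_natD(1)[OF Lr(1) x]] objectwiseD[OF LjW] x
        id_weq[OF poset_functorD(1)[OF T x]] by simp
  qed
  have "LH \<cdot>\<^bsub>FP\<^esub> Lj = h"
    by (rule lan_unique_nat[OF Q(2) FP.comp_hom[OF Lj(1) LH(1)] h])
      (use Rn_comp_unit[OF Q(2) Lj(1) LH(1)] Lj(2) FJ.comp_assoc[OF j(1) etaX Rn_hom[OF LH(1)]]
        LH(2) H(2) in simp)
  moreover have "LH \<cdot>\<^bsub>FP\<^esub> Lj' = k"
    by (rule lan_unique_nat[OF Q(2) FP.comp_hom[OF Lj'(1) LH(1)] k])
      (use Rn_comp_unit[OF Q(2) Lj'(1) LH(1)] Lj'(2) FJ.comp_assoc[OF j(2) etaX Rn_hom[OF LH(1)]]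
        LH(2) H(3) in simp)
  ultimately show ?thesis
    using loc.zeq_cylinder[OF Lj(1) Lj'(1) Lr(1) LrW rL rL' LH(1)] by simp
qed

text \<open>\<open>W'\<close> consists of the maps that are weak equivalences on \<open>J\<close>,
  and \<open>\<epsilon>\<close> is one of these; the approximation built for \<open>X\<close> may
  come from a different replacement. The codegree condition on \<open>G\<close> is represented by
  \<open>GW\<close>, which makes the counit at \<open>G\<close> invertible.\<close>

theorem approximation_universal:
  assumes G: "is_functor CP M G" and GW: "\<And>Q T \<eta> e. trivfib_approx G Q T \<eta> e \<Longrightarrow> e \<in> WP"
    and eps: "\<epsilon> \<in> Hom FP S X" "Rn \<epsilon> \<in> WJ"
    and zeta: "\<zeta> \<in> Hom (localization FP WP) G X"
  shows "\<exists>!\<upsilon>. \<upsilon> \<in> Hom (localization FP WP) G S \<and> \<zeta> = loc_arr FP WP \<epsilon> \<cdot>\<^bsub>localization FP WP\<^esub> \<upsilon>"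
proof -
  obtain Q T \<eta> e where ap: "\<And>Y. is_functor CP M Y \<Longrightarrow> trivfib_approx Y (Q Y) (T Y) (\<eta> Y) (e Y)"
    using trivfib_approx_ex by metis
  then have D: "\<And>Y. is_functor CP M Y \<Longrightarrow> proj_cofibrant (Q Y)"
    "\<And>Y. is_functor CP M Y \<Longrightarrow> is_lan (Q Y) (T Y) (\<eta> Y)"
    "\<And>Y. is_functor CP M Y \<Longrightarrow> e Y \<in> Hom FP (T Y) Y"
    by (auto simp: trivfib_approx_def)
  let ?W' = "{g \<in> Arr FP. Rn g \<in> WJ}"
  interpret hc: homotopy_coreflection FP WP ?W' T e
  proof
    show "WP \<subseteq> ?W'"
      using whisker_objectwise[OF CJ.category_axioms incl] by (auto simp: objectwise_def)
  next
    fix Y assume "Y \<in> Obj FP"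
    then show "e Y \<in> Hom FP (T Y) Y" using D(3) by simp
  next
    fix g Y Z assume g: "g \<in> Hom FP Y Z"
    note YZ = natD(1,2)[OF g]
    show "\<exists>h \<in> Hom FP (T Y) (T Z). e Z \<cdot>\<^bsub>FP\<^esub> h = g \<cdot>\<^bsub>FP\<^esub> e Y"
      by (rule lan_lift_ex[OF D(1)[OF YZ(1)] D(2)[OF YZ(1)] ap[OF YZ(2)]
        FP.comp_hom[OF D(3)[OF YZ(1)] g]])
  next
    fix Y Z h k assume Y: "Y \<in> Obj FP" and Z: "Z \<in> Obj FP" and hk: "h \<in> Hom FP (T Y) (T Z)"
      "k \<in> Hom FP (T Y) (T Z)"
      "e Z \<cdot>\<^bsub>FP\<^esub> h = e Z \<cdot>\<^bsub>FP\<^esub> k"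
    then show "zigzag_eq FP WP (T Y) (T Z) [Fwd h] [Fwd k]"
      using lan_lift_unique[OF D(1) D(2) ap hk] by simp
  next
    fix g Y Z h assume g: "g \<in> Hom FP Y Z" "g \<in> ?W'" and h: "h \<in> Hom FP (T Y) (T Z)"
      "e Z \<cdot>\<^bsub>FP\<^esub> h = g \<cdot>\<^bsub>FP\<^esub> e Y"
    note YZ = natD(1,2)[OF g(1)]
    have eW: "Rn (e Y') \<in> WJ" if "is_functor CP M Y'" for Y'
      using approx_restrict_trivfib[OF ap[OF that]] by (simp add: objectwise_Int)
    \<comment> \<open>On \<open>J\<close> three sides of the square of \<open>h\<close> and
      \<open>g\<close> are weak equivalences, hence so is the fourth; \<open>lan_weq\<close>
      promotes this from \<open>J\<close> to \<open>P\<close>.\<close>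
    have "Rn (g \<cdot>\<^bsub>FP\<^esub> e Y) \<in> WJ"
      using objectwise_weq_comp[OF Rn_hom[OF D(3)[OF YZ(1)]] Rn_hom[OF g(1)] eW[OF YZ(1)]] g(2)
        Rn_comp[OF D(3)[OF YZ(1)] g(1)] by simp
    then have "Rn (e Z) \<cdot>\<^bsub>FJ\<^esub> Rn h \<in> WJ"
      using Rn_comp[OF h(1) D(3)[OF YZ(2)]] h(2) by simp
    then have "Rn h \<in> WJ"
      by (rule objectwise_weq_cancel_left[OF Rn_hom[OF h(1)] Rn_hom[OF D(3)[OF YZ(2)]] eW[OF YZ(2)]])
    then show "h \<in> WP"
      using lan_weq[OF D(1)[OF YZ(1)] D(2)[OF YZ(1)] D(1)[OF YZ(2)] D(2)[OF YZ(2)] h(1)] by simp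
  qed
  show ?thesis
    by (rule hc.localization_unique_factorization[OF _ _ eps(1) _ zeta])
      (use G GW[OF ap[OF G]] eps HomD(1)[OF eps(1)] in auto)
qed

end

section \<open>Join-dimension in distributive lattices\<close>

definition irredundant_set :: "('p, 'z) gorder_scheme \<Rightarrow> 'p \<Rightarrow> 'p set \<Rightarrow> bool" where
  "irredundant_set P v S \<longleftrightarrow> finite S \<and> (\<forall>s \<in> S. join_irreducible P s) \<and> \<Squnion>\<^bsub>P\<^esub>S = v \<and>
     (\<forall>s \<in> S. \<Squnion>\<^bsub>P\<^esub>(S - {s}) \<noteq> v)"

locale bottomed_distrib_lattice = Lattice.lattice P for P :: "('p, 'z) gorder_scheme" (structure) +
  assumes distrib: "\<lbrakk>x \<in> carrier P; y \<in> carrier P; z \<in> carrier P\<rbrakk>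
      \<Longrightarrow> x \<sqinter> (y \<squnion> z) = (x \<sqinter> y) \<squnion> (x \<sqinter> z)"
    and has_minimal: "\<exists>v. minimal_in P (carrier P) v"
begin

lemma po: "partial_order P" by (rule partial_order_axioms)

section \<open>Finite joins and join-primes in a distributive lattice with least element\<close>

lemma join_le_iff:
  assumes "x \<in> carrier P" "y \<in> carrier P" "z \<in> carrier P"
  shows "x \<squnion> y \<sqsubseteq> z \<longleftrightarrow> x \<sqsubseteq> z \<and> y \<sqsubseteq> z"
proof
  note c = join_closed[OF assms(1,2)]
  show "x \<sqsubseteq> z \<and> y \<sqsubseteq> z" if "x \<squnion> y \<sqsubseteq> z"
    using le_trans[OF join_left[OF assms(1,2)] that assms(1) c assms(3)]
      le_trans[OF join_right[OF assms(1,2)] that assms(2) c assms(3)] by simp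
qed (use assms in \<open>auto intro: join_le\<close>)

lemma meet_ge_iff:
  assumes "x \<in> carrier P" "y \<in> carrier P" "z \<in> carrier P"
  shows "z \<sqsubseteq> x \<sqinter> y \<longleftrightarrow> z \<sqsubseteq> x \<and> z \<sqsubseteq> y"
proof
  note c = meet_closed[OF assms(1,2)]
  show "z \<sqsubseteq> x \<and> z \<sqsubseteq> y" if "z \<sqsubseteq> x \<sqinter> y"
    using le_trans[OF that meet_left[OF assms(1,2)] assms(3) c assms(1)]
      le_trans[OF that meet_right[OF assms(1,2)] assms(3) c assms(2)] by simp
qed (use assms in \<open>auto intro: meet_le\<close>)

lemma minimal_least:
  assumes "minimal_in P (carrier P) b" "x \<in> carrier P"
  shows "b \<sqsubseteq> x"
proof -
  have b: "b \<in> carrier P" using assms by (simp add: minimal_in_def)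
  have "b \<sqinter> x = b"
    using assms(1) meet_left[OF b assms(2)] meet_closed[OF b assms(2)] by (simp add: minimal_in_def)
  then show ?thesis using meet_right[OF b assms(2)] by simp
qed

text \<open>A minimal element of a lattice is its least element, hence the least upper bound of the
  empty set; by antisymmetry the choice in \<open>sup\<close> has no alternative.\<close>

lemma sup_empty_minimal: "minimal_in P (carrier P) (\<Squnion>{})"
proof -
  obtain b where b: "minimal_in P (carrier P) b" using has_minimal by blast
  then have "least P b (Upper P {})"
    using minimal_least[OF b] by (auto simp: least_def minimal_in_def)
  then have "least P (\<Squnion>{}) (Upper P {})"
    unfolding sup_def by (rule someI)
  then have "\<Squnion>{} = b"
    using minimal_least[OF b] b le_antisym by (auto simp: least_def minimal_in_def)
  then show ?thesis using b by simp
qed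

lemma minimal_iff: "minimal_in P (carrier P) v \<longleftrightarrow> v = \<Squnion>{}"
  using sup_empty_minimal minimal_least le_antisym by (metis minimal_in_def)

lemma finite_sup_least': "\<lbrakk>finite S; S \<subseteq> carrier P\<rbrakk> \<Longrightarrow> least P (\<Squnion>S) (Upper P S)"
  using finite_sup_least[of S] minimal_least[OF sup_empty_minimal] sup_empty_minimal
  by (cases "S = {}") (auto simp: least_def minimal_in_def)

lemma sup_closed: "\<lbrakk>finite S; S \<subseteq> carrier P\<rbrakk> \<Longrightarrow> \<Squnion>S \<in> carrier P"
  using finite_sup_least' by blast

lemma sup_le_iff:
  assumes S: "finite S" "S \<subseteq> carrier P" and x: "x \<in> carrier P"
  shows "\<Squnion>S \<sqsubseteq> x \<longleftrightarrow> (\<forall>s \<in> S. s \<sqsubseteq> x)"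
proof
  note l = finite_sup_least'[OF S]
  show "\<forall>s \<in> S. s \<sqsubseteq> x" if "\<Squnion>S \<sqsubseteq> x"
    using least_Upper_above[OF l _ S(2)] le_trans[OF _ that] sup_closed[OF S] S(2) x by blast
  show "\<Squnion>S \<sqsubseteq> x" if "\<forall>s \<in> S. s \<sqsubseteq> x"
    using least_le[OF l] that x by (simp add: Upper_def)
qed

lemma sup_upper: "\<lbrakk>finite S; S \<subseteq> carrier P; s \<in> S\<rbrakk> \<Longrightarrow> s \<sqsubseteq> \<Squnion>S"
  using sup_le_iff[of S "\<Squnion>S"] sup_closed by auto

lemma sup_mono: "\<lbrakk>finite S; S \<subseteq> carrier P; S' \<subseteq> S\<rbrakk> \<Longrightarrow> \<Squnion>S' \<sqsubseteq> \<Squnion>S"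
  using sup_le_iff[of S' "\<Squnion>S"] sup_upper sup_closed finite_subset[of S' S] by (metis subset_iff)

lemma sup_insert:
  assumes "finite S" "S \<subseteq> carrier P" "a \<in> carrier P"
  shows "\<Squnion>(insert a S) = a \<squnion> \<Squnion>S"
proof (rule le_antisym)
  have c: "finite (insert a S)" "insert a S \<subseteq> carrier P" using assms by auto
  note j = join_closed[OF assms(3) sup_closed[OF assms(1,2)]]
  show "\<Squnion>(insert a S) \<sqsubseteq> a \<squnion> \<Squnion>S"
  proof -
    have "s \<sqsubseteq> a \<squnion> \<Squnion>S" if "s \<in> S" for s
      using le_trans[OF sup_upper[OF assms(1,2) that] join_right[OF assms(3) sup_closed[OF assms(1,2)]]]
        sup_closed[OF assms(1,2)] assms(2) j that by blast
    then show ?thesis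
      using sup_le_iff[OF c j] join_left[OF assms(3) sup_closed[OF assms(1,2)]] by simp
  qed
  show "a \<squnion> \<Squnion>S \<sqsubseteq> \<Squnion>(insert a S)"
    using join_le_iff[OF assms(3) sup_closed[OF assms(1,2)] sup_closed[OF c]] sup_upper[OF c]
      sup_mono[OF c, of S] by auto
qed (use assms sup_closed join_closed in auto)

text \<open>By distributivity \<open>p\<close> is the join of its meets with \<open>x\<close> and
  \<open>y\<close>; irreducibility makes one of these equal to \<open>p\<close>.\<close>

lemma join_prime:
  assumes p: "join_irreducible P p" and xy: "x \<in> carrier P" "y \<in> carrier P" and le: "p \<sqsubseteq> x \<squnion> y"
  shows "p \<sqsubseteq> x \<or> p \<sqsubseteq> y"
proof -
  have pc: "p \<in> carrier P" using p by (simp add: join_irreducible_def)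
  have "p = p \<sqinter> (x \<squnion> y)"
    using meet_ge_iff[OF pc join_closed[OF xy] pc] le meet_left[OF pc join_closed[OF xy]] pc xy
    by (intro le_antisym) auto
  then have e: "p = (p \<sqinter> x) \<squnion> (p \<sqinter> y)" using distrib[OF pc xy] by simp
  have "\<not> (p \<sqinter> x \<sqsubset> p \<and> p \<sqinter> y \<sqsubset> p)"
  proof
    assume h: "p \<sqinter> x \<sqsubset> p \<and> p \<sqinter> y \<sqsubset> p"
    have "\<exists>x \<in> carrier P. \<exists>y \<in> carrier P. x \<sqsubset> p \<and> y \<sqsubset> p \<and> p = x \<squnion> y"
    proof (intro bexI)
      show "p \<sqinter> x \<sqsubset> p \<and> p \<sqinter> y \<sqsubset> p \<and> p = (p \<sqinter> x) \<squnion> (p \<sqinter> y)" by (intro conjI e) (use h in auto)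
    qed (use pc xy in auto)
    then show False using p by (simp add: join_irreducible_def)
  qed
  then have "p \<sqinter> x = p \<or> p \<sqinter> y = p"
    using meet_left pc xy by (auto simp: lless_eq)
  then show ?thesis using meet_right[OF pc xy(1)] meet_right[OF pc xy(2)] by auto
qed

text \<open>The least element satisfies \<open>join_irreducible\<close> vacuously, yet it lies below
  the empty join and below no member of it; hence the hypothesis
  \<open>p \<noteq> \<Squnion>{}\<close>.\<close>

lemma join_prime_sup:
  assumes p: "join_irreducible P p" "p \<noteq> \<Squnion>{}"
  shows "\<lbrakk>finite S; S \<subseteq> carrier P; p \<sqsubseteq> \<Squnion>S\<rbrakk> \<Longrightarrow> \<exists>s \<in> S. p \<sqsubseteq> s"
proof (induction S rule: finite_induct)
  case empty
  then show ?case using p sup_empty_minimal by (auto simp: minimal_in_def join_irreducible_def)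
next
  case (insert a S)
  then have "p \<sqsubseteq> a \<or> p \<sqsubseteq> \<Squnion>S"
    using join_prime[OF p(1), of a "\<Squnion>S"] sup_insert sup_closed by simp
  then show ?case using insert by auto
qed

lemma irredundant_setD:
  assumes "irredundant_set P v S"
  shows "finite S" "S \<subseteq> carrier P" "\<Squnion>S = v" "v \<in> carrier P" "\<And>s. s \<in> S \<Longrightarrow> join_irreducible P s"
    and "\<And>s. s \<in> S \<Longrightarrow> \<Squnion>(S - {s}) \<noteq> v" "\<And>s. s \<in> S \<Longrightarrow> s \<in> carrier P"
  using assms sup_closed by (auto simp: irredundant_set_def join_irreducible_def)

lemma irredundant_not_le:
  assumes S: "irredundant_set P v S" and s: "s \<in> S"
  shows "\<not> s \<sqsubseteq> \<Squnion>(S - {s})"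
proof
  note D = irredundant_setD[OF S]
  have c: "finite (S - {s})" "S - {s} \<subseteq> carrier P" using D by auto
  assume "s \<sqsubseteq> \<Squnion>(S - {s})"
  then have "\<Squnion>S \<sqsubseteq> \<Squnion>(S - {s})"
    using sup_le_iff[OF D(1,2) sup_closed[OF c]] sup_upper[OF c] by blast
  then have "\<Squnion>(S - {s}) = v"
    using sup_mono[OF D(1,2), of "S - {s}"] D sup_closed[OF c] by (intro le_antisym) auto
  then show False using D(6)[OF s] by simp
qed

text \<open>Primality sends \<open>s\<close> in \<open>S\<close> below some \<open>s'\<close> in
  \<open>S'\<close>, and \<open>s'\<close> below some \<open>s''\<close> in \<open>S\<close>.
  Irredundance of \<open>S\<close> forces \<open>s = s''\<close>, so \<open>s = s'\<close>.\<close>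

lemma irredundant_set_unique:
  assumes S: "irredundant_set P v S" and S': "irredundant_set P v S'"
  shows "S = S'"
proof -
  have "S \<subseteq> S'" if S: "irredundant_set P v S" and S': "irredundant_set P v S'" for S S'
  proof
    note D = irredundant_setD[OF S] and D' = irredundant_setD[OF S']
    fix s assume s: "s \<in> S"
    \<comment> \<open>The least element is never a member, since it lies below the join of the
      others.\<close>
    have nb: "s \<noteq> \<Squnion>{}" if S: "irredundant_set P v S" and s: "s \<in> S" for s S
      using irredundant_not_le[OF S s] minimal_least[OF sup_empty_minimal] sup_closed
        irredundant_setD[OF S]
      by (metis Diff_subset finite_Diff subset_trans)
    have "s \<sqsubseteq> \<Squnion>S'" using sup_upper[OF D(1,2) s] D D' by simp
    then obtain s' where s': "s' \<in> S'" "s \<sqsubseteq> s'"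
      using join_prime_sup[OF D(5)[OF s] nb[OF S s] D'(1,2)] by blast
    have "s' \<sqsubseteq> \<Squnion>S" using sup_upper[OF D'(1,2) s'(1)] D D' by simp
    then obtain s'' where s'': "s'' \<in> S" "s' \<sqsubseteq> s''"
      using join_prime_sup[OF D'(5)[OF s'(1)] nb[OF S' s'(1)] D(1,2)] by blast
    have le: "s \<sqsubseteq> s''" using le_trans[OF s'(2) s''(2)] D(7) D'(7) s s' s'' by simp
    have "s = s''"
    proof (rule ccontr)
      assume "s \<noteq> s''"
      then have "s'' \<sqsubseteq> \<Squnion>(S - {s})" using s'' D by (intro sup_upper) auto
      then have "s \<sqsubseteq> \<Squnion>(S - {s})"
        using le_trans[OF le] D(7) s s'' sup_closed[of "S - {s}"] D(1)
          subset_trans[OF Diff_subset D(2)] by simp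
      then show False using irredundant_not_le[OF S s] by simp
    qed
    then have "s = s'" using s' s'' D(7) D'(7) by (intro le_antisym) auto
    then show "s \<in> S'" using s' by simp
  qed
  then show ?thesis using S S' by blast
qed

lemma irredundant_set_of_decomposition:
  assumes r: "reduced_decomposition P v k p" and i: "indecomposable_decomposition P v k p"
  shows "irredundant_set P v (p ` {..<k})" and "card (p ` {..<k}) = k"
proof -
  have jd: "0 < k" "p ` {..<k} \<subseteq> carrier P" "v = \<Squnion>(p ` {..<k})"
    using r by (auto simp: reduced_decomposition_def join_decomposition_def)
  have irr: "\<And>i. i < k \<Longrightarrow> join_irreducible P (p i)" using i
    by (auto simp: indecomposable_decomposition_def)
  \<comment> \<open>For \<open>k = 1\<close> omitting the only factor leaves the empty join, and the
    convention that \<open>v\<close> is not minimal says precisely that this differs from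
    \<open>v\<close>.\<close>
  have red: "\<Squnion>(p ` ({..<k} - {i})) \<noteq> v" if "i < k" for i
  proof (cases "k = 1")
    case True
    then have e: "{..<k} - {i} = {}" using that by auto
    have "v \<noteq> \<Squnion>{}" using r True minimal_iff[of v] by (simp add: reduced_decomposition_def)
    then show ?thesis unfolding e by simp
  qed (use r that in \<open>simp add: reduced_decomposition_def\<close>)
  \<comment> \<open>A repeated factor could be omitted without changing the join.\<close>
  have inj: "inj_on p {..<k}"
  proof (rule inj_onI, rule ccontr)
    fix i j assume ij: "i \<in> {..<k}" "j \<in> {..<k}" "p i = p j" "i \<noteq> j"
    have "p i \<in> p ` ({..<k} - {i})" using ij by (intro image_eqI[of _ _ j]) auto
    then have "p ` ({..<k} - {i}) = p ` {..<k}" by auto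
    then show False using red[of i] ij jd by simp
  qed
  then show "card (p ` {..<k}) = k" by (simp add: card_image)
  have "p ` {..<k} - {p i} = p ` ({..<k} - {i})" if "i < k" for i
    using inj that by (auto simp: inj_on_def)
  then show "irredundant_set P v (p ` {..<k})"
    using red irr jd by (auto simp: irredundant_set_def)
qed

lemma decomposition_of_irredundant_set:
  assumes S: "irredundant_set P v S" and v: "\<not> minimal_in P (carrier P) v"
  shows "\<exists>p. reduced_decomposition P v (card S) p \<and> indecomposable_decomposition P v (card S) p"
proof -
  note D = irredundant_setD[OF S]
  have "S \<noteq> {}" using D v minimal_iff by auto
  then have k: "0 < card S" using D by (simp add: card_gt_0_iff)
  obtain p where p: "bij_betw p {..<card S} S"
    using ex_bij_betw_nat_finite[OF D(1)] by (auto simp: lessThan_atLeast0)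
  have im: "p ` {..<card S} = S" using p by (simp add: bij_betw_def)
  have "p ` ({..<card S} - {i}) = S - {p i}" if "i < card S" for i
    using p that by (auto simp: bij_betw_def inj_on_def)
  moreover have "p i \<in> S" if "i < card S" for i using im that by auto
  ultimately show ?thesis
    using D v k im unfolding reduced_decomposition_def indecomposable_decomposition_def
      join_decomposition_def
    by (intro exI[of _ p]) auto
qed

text \<open>By uniqueness of the irredundant set, all reduced indecomposable decompositions of
  \<open>v\<close> have the same size, so the description in \<open>jdim\<close> is well
  defined.\<close>

lemma jdim_eq_card:
  assumes S: "irredundant_set P v S"
  shows "jdim P v = enat (card S)"
proof (cases "minimal_in P (carrier P) v")
  case True
  have "irredundant_set P v {}" using True minimal_iff by (simp add: irredundant_set_def)
  then have "S = {}" using irredundant_set_unique[OF S] by simp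
  then show ?thesis using True by (simp add: jdim_def zero_enat_def)
next
  case False
  have ex: "\<exists>k p. reduced_decomposition P v k p \<and> indecomposable_decomposition P v k p"
    using decomposition_of_irredundant_set[OF S False] by blast
  have "(THE k. \<exists>p. reduced_decomposition P v k p \<and> indecomposable_decomposition P v k p) = card S"
    using decomposition_of_irredundant_set[OF S False] irredundant_set_of_decomposition
      irredundant_set_unique[OF S]
    by (intro the_equality) metis+
  then show ?thesis
    unfolding jdim_def by (simp only: if_not_P[OF False] if_P[OF ex])
qed

lemma irredundant_set_ex:
  assumes "jdim P v \<noteq> \<infinity>"
  shows "\<exists>S. irredundant_set P v S"
proof (cases "minimal_in P (carrier P) v")
  case True
  then have "irredundant_set P v {}" using minimal_iff by (simp add: irredundant_set_def)
  then show ?thesis by blast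
next
  case False
  have "\<exists>k p. reduced_decomposition P v k p \<and> indecomposable_decomposition P v k p"
    using assms unfolding jdim_def if_not_P[OF False]
      by (rule contrapos_np) (simp only: if_False simp_thms)
  then show ?thesis using irredundant_set_of_decomposition by blast
qed

text \<open>A minimal element without a finite decomposition into join-irreducibles would not be
  irreducible itself, hence a join of two smaller elements that have one; their union decomposes it.
  Among the finite decompositions, one of least cardinality is irredundant.\<close>

lemma dcc_irredundant_set_ex:
  assumes dcc: "descending_chain_condition P" and v: "v \<in> carrier P"
  shows "\<exists>S. irredundant_set P v S"
proof -
  let ?D = "\<lambda>v S. finite S \<and> (\<forall>s \<in> S. join_irreducible P s) \<and> \<Squnion>S = v"
  have "\<exists>S. ?D v S"
  proof (rule ccontr)
    let ?B = "{v \<in> carrier P. \<nexists>S. ?D v S}"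
    assume "\<nexists>S. ?D v S"
    then have "?B \<subseteq> carrier P" "?B \<noteq> {}" using v by auto
    then obtain w where w: "minimal_in P ?B w"
      using dcc[unfolded descending_chain_condition_def, rule_format, of ?B] by blast
    then have wc: "w \<in> carrier P" "\<nexists>S. ?D w S" by (auto simp: minimal_in_def)
    have "\<Squnion>{w} = w"
      using sup_le_iff[of "{w}" w] sup_upper[of "{w}" w] sup_closed[of "{w}"] wc(1)
        by (intro le_antisym) auto
    then have "?D w {w}" if "join_irreducible P w" using that by simp
    then have "\<not> join_irreducible P w" using wc(2) by blast
    then obtain x y where xy: "x \<in> carrier P" "y \<in> carrier P" "x \<sqsubset> w" "y \<sqsubset> w" "w = x \<squnion> y"
      using wc by (auto simp: join_irreducible_def)
    have "x \<notin> ?B" "y \<notin> ?B" using w xy(3,4) unfolding minimal_in_def lless_eq by blast+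
    then obtain S S' where S: "?D x S" "?D y S'" using xy(1,2) by blast
    have Sc: "S \<subseteq> carrier P" "S' \<subseteq> carrier P" using S by (auto simp: join_irreducible_def)
    have "\<Squnion>(S \<union> S') = w"
    proof (rule le_antisym)
      have c: "finite (S \<union> S')" "S \<union> S' \<subseteq> carrier P" using S Sc by auto
      have "s \<sqsubseteq> w" if "s \<in> S \<union> S'" for s
      proof -
        have "s \<sqsubseteq> x \<or> s \<sqsubseteq> y" using that S Sc sup_upper by blast
        moreover have "x \<sqsubseteq> w" "y \<sqsubseteq> w" using xy by (auto simp: lless_eq)
        ultimately show ?thesis using that c xy wc le_trans by blast
      qed
      then show "\<Squnion>(S \<union> S') \<sqsubseteq> w" using sup_le_iff[OF c wc(1)] by simp
      show "w \<sqsubseteq> \<Squnion>(S \<union> S')"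
        using sup_mono[OF c, of S] sup_mono[OF c, of S'] S join_le_iff[OF xy(1,2) sup_closed[OF c]]
          xy(5) by auto
      show "\<Squnion>(S \<union> S') \<in> carrier P" by (rule sup_closed[OF c])
    qed (rule wc(1))
    then have "?D w (S \<union> S')" using S by blast
    then show False using wc(2) by blast
  qed
  then obtain S0 where "?D v S0" ..
  from ex_has_least_nat[of "?D v", OF this, of card]
  obtain S where S: "?D v S" "\<And>S'. ?D v S' \<Longrightarrow> card S \<le> card S'" by auto
  have "\<Squnion>(S - {s}) \<noteq> v" if "s \<in> S" for s
  proof
    assume "\<Squnion>(S - {s}) = v"
    then have "?D v (S - {s})" using S(1) by blast
    then have "card S \<le> card (S - {s})" by (rule S(2))
    then show False using card_Diff1_less[of S s] S(1) that by simp
  qed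
  then show ?thesis using S(1) unfolding irredundant_set_def by blast
qed

lemma irredundant_set_remove:
  assumes S: "irredundant_set P v S" and d: "d \<in> S"
  shows "irredundant_set P (\<Squnion>(S - {d})) (S - {d})"
proof -
  note D = irredundant_setD[OF S]
  have c: "finite (S - {d})" "S - {d} \<subseteq> carrier P" using D by auto
  have "\<Squnion>(S - {d} - {s}) \<noteq> \<Squnion>(S - {d})" if s: "s \<in> S - {d}" for s
  proof
    assume e: "\<Squnion>(S - {d} - {s}) = \<Squnion>(S - {d})"
    have "s \<sqsubseteq> \<Squnion>(S - {d})" by (rule sup_upper[OF c s])
    moreover have "\<Squnion>(S - {d} - {s}) \<sqsubseteq> \<Squnion>(S - {s})" using D by (intro sup_mono) auto
    ultimately have "s \<sqsubseteq> \<Squnion>(S - {s})"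
      using e le_trans[of s "\<Squnion>(S - {d})" "\<Squnion>(S - {s})"] D(7)[of s] s sup_closed[OF c]
        sup_closed[of "S - {s}"] D(1) subset_trans[OF Diff_subset D(2)] by simp
    then show False using irredundant_not_le[OF S] s by auto
  qed
  then show ?thesis using D c by (auto simp: irredundant_set_def)
qed

lemma jdim_remove_neq:
  assumes S: "irredundant_set P v S" and d: "d \<in> S"
  shows "jdim P (\<Squnion>(S - {d})) \<noteq> jdim P v"
  using jdim_eq_card[OF S] jdim_eq_card[OF irredundant_set_remove[OF assms]]
    card_Diff1_less[OF irredundant_setD(1)[OF S] d]
  by simp

end

lemma bottomed_distrib_latticeI:
  "\<lbrakk>distributive_lattice P; \<exists>v. minimal_in P (carrier P) v\<rbrakk> \<Longrightarrow> bottomed_distrib_lattice P"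
  by (auto simp: distributive_lattice_def bottomed_distrib_lattice_def
    bottomed_distrib_lattice_axioms_def)

text \<open>Finiteness of the join-dimension follows from the descending chain condition in
  \<open>Q\<close> and is pulled back along \<open>f\<close>, which preserves
  \<open>jdim\<close>.\<close>

lemma join_factorization_lattice_irredundant_ex:
  fixes P :: "('p, 'z) gorder_scheme"
  assumes P: "join_factorization_lattice TYPE('q) P" and v: "v \<in> carrier P"
  shows "\<exists>S. irredundant_set P v S"
proof -
  interpret P: bottomed_distrib_lattice P
    using P by (intro bottomed_distrib_latticeI) (auto simp: join_factorization_lattice_def)
  obtain Q :: "'q gorder" and f where Q: "distributive_lattice Q" "descending_chain_condition Q"
    and f: "f \<in> carrier P \<rightarrow> carrier Q" "\<And>v. v \<in> carrier P \<Longrightarrow> jdim Q (f v) = jdim P v"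
    using P unfolding join_factorization_lattice_def by blast
  have fv: "f v \<in> carrier Q" using f v by auto
  then interpret Q: bottomed_distrib_lattice Q
    using Q by (intro bottomed_distrib_latticeI) (auto simp: descending_chain_condition_def)
  obtain S where "irredundant_set Q (f v) S" using Q.dcc_irredundant_set_ex[OF Q(2) fv] by blast
  from Q.jdim_eq_card[OF this] have "jdim P v \<noteq> \<infinity>" using f(2)[OF v] by simp
  then show ?thesis by (rule P.irredundant_set_ex)
qed

text \<open>
  If \<open>w \<le> u \<le> v\<close> with \<open>jdim u \<noteq> jdim v\<close>, then \<open>f w < f v\<close> in the lattice with descending chain condition.
\<close>

lemma join_factorization_lattice_induct:
  fixes P :: "('p, 'z) gorder_scheme"
  assumes P: "join_factorization_lattice TYPE('q) P" and v: "v \<in> carrier P"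
    and step: "\<And>v. \<lbrakk>v \<in> carrier P; \<And>w u. \<lbrakk>w \<in> carrier P; u \<in> carrier P; w \<sqsubseteq>\<^bsub>P\<^esub> u; u \<sqsubseteq>\<^bsub>P\<^esub> v;
      jdim P u \<noteq> jdim P v\<rbrakk> \<Longrightarrow> R w\<rbrakk>
      \<Longrightarrow> R v"
  shows "R v"
proof (rule ccontr)
  assume nR: "\<not> R v"
  obtain Q :: "'q gorder" and f where Q: "distributive_lattice Q" "descending_chain_condition Q"
    and f: "f \<in> carrier P \<rightarrow> carrier Q"
      "\<And>v. v \<in> carrier P \<Longrightarrow> jdim Q (f v) = jdim P v" and iso: "isotone P Q f"
    using P unfolding join_factorization_lattice_def by blast
  interpret Q: Lattice.lattice Q using Q by (simp add: distributive_lattice_def)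
  let ?B = "f ` {v \<in> carrier P. \<not> R v}"
  have "?B \<subseteq> carrier Q" "?B \<noteq> {}" using f v nR by auto
  then obtain b where b: "minimal_in Q ?B b"
    using Q(2)[unfolded descending_chain_condition_def, rule_format, of ?B] by blast
  then obtain w where w: "w \<in> carrier P" "\<not> R w" "b = f w" by (auto simp: minimal_in_def)
  have "R w"
  proof (rule step[OF w(1)])
    fix x u assume x: "x \<in> carrier P" and u: "u \<in> carrier P" and le: "x \<sqsubseteq>\<^bsub>P\<^esub> u"
      "u \<sqsubseteq>\<^bsub>P\<^esub> w" and j: "jdim P u \<noteq> jdim P w"
    have fc: "f x \<in> carrier Q" "f u \<in> carrier Q" "f w \<in> carrier Q" using f x u w by auto
    have fl: "f x \<sqsubseteq>\<^bsub>Q\<^esub> f u" "f u \<sqsubseteq>\<^bsub>Q\<^esub> f w" using use_iso2[OF iso] le x u w by auto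
    show "R x"
    proof (rule ccontr)
      assume "\<not> R x"
      then have "f x = f w"
        using b w x Q.le_trans[OF fl fc] by (auto simp: minimal_in_def)
      then have "f u = f w" using fl fc Q.le_antisym by metis
      then show False using j f(2)[OF u] f(2)[OF w(1)] by simp
    qed
  qed
  then show False using w by simp
qed

section \<open>Cubes in distributive lattices\<close>

abbreviation subset_poset :: "nat set set \<Rightarrow> nat set gorder" where
  "subset_poset A \<equiv> \<lparr> carrier = A, eq = (=), le = (\<subseteq>) \<rparr>"

lemma partial_order_subset_poset: "partial_order (subset_poset A)"
  by standard auto

section \<open>Square faces, least vertices and proper vertices of strongly bicartesian
  cubes\<close>

lemma poset_hom_iff:
  "f \<in> Hom (poset_cat P) x y \<longleftrightarrow> f = (x, y) \<and> x \<in> carrier P \<and> y \<in> carrier P \<and> x \<sqsubseteq>\<^bsub>P\<^esub> y"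
  by (auto simp: Hom_def poset_cat_def)

lemma poset_isoD:
  assumes "is_iso (poset_cat P) u" "u \<in> Hom (poset_cat P) x y"
  shows "y \<sqsubseteq>\<^bsub>P\<^esub> x"
  using assms(1) HomD[OF assms(2)] by (auto simp: is_iso_def poset_hom_iff)

lemma poset_id_iso: "\<lbrakk>partial_order P; x \<in> carrier P\<rbrakk> \<Longrightarrow> is_iso (poset_cat P) (x, x)"
  using partial_order.axioms(1) weak_partial_order.le_refl by (fastforce simp: is_iso_def poset_hom_iff)

lemma cubeD:
  assumes "is_functor (cube_cat N) (poset_cat P) X"
  shows "S \<subseteq> N \<Longrightarrow> fobj X S \<in> carrier P"
    and "\<lbrakk>S \<subseteq> T; T \<subseteq> N\<rbrakk> \<Longrightarrow> farr X (S, T) = (fobj X S, fobj X T)"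
    and "\<lbrakk>S \<subseteq> T; T \<subseteq> N\<rbrakk> \<Longrightarrow> fobj X S \<sqsubseteq>\<^bsub>P\<^esub> fobj X T"
  using poset_functorD(1,2)[OF assms[unfolded cube_cat_def subset_cat_def], of S]
    poset_functorD(2)[OF assms[unfolded cube_cat_def subset_cat_def], of S T]
  by (auto simp: poset_hom_iff)

lemma cube_face_simps [simp]:
  "T \<subseteq> B - S \<Longrightarrow> fobj (cube_face X S B) T = fobj X (S \<union> T)"
  "\<lbrakk>T \<subseteq> T'; T' \<subseteq> B - S\<rbrakk> \<Longrightarrow> farr (cube_face X S B) (T, T') = farr X (S \<union> T, S \<union> T')"
  by (auto simp: cube_face_def cube_cat_def subset_cat_def)

lemma cartesian_face_le:
  assumes X: "is_functor (cube_cat N) (poset_cat P) X"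
    and bi: "strongly_bicartesian_cube (poset_cat P) N X"
    and S: "insert i (insert j S) \<subseteq> N" "i \<noteq> j" "i \<notin> S" "j \<notin> S"
    and v: "v \<in> carrier P" "v \<sqsubseteq>\<^bsub>P\<^esub> fobj X (insert i S)" "v \<sqsubseteq>\<^bsub>P\<^esub> fobj X (insert j S)"
    and po: "partial_order P"
  shows "v \<sqsubseteq>\<^bsub>P\<^esub> fobj X S"
proof -
  interpret partial_order P by (rule po)
  let ?B = "insert i (insert j S)"
  have BS: "?B - S = {i, j}" using S by auto
  let ?Y = "cube_face X S ?B" and ?J = "subset_cat (Pow {i, j} - {{}})"
  have "cartesian_cube (poset_cat P) (?B - S) ?Y"
    by (rule bi[unfolded strongly_bicartesian_cube_def, rule_format, THEN conjunct1])
      (use S in \<open>simp add: BS subset_insertI2\<close>)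
  then obtain c l u where lim: "is_limit ?J (poset_cat P) (comp_functor ?J ?Y (incl_functor ?J)) c l"
    and u: "u \<in> Hom (poset_cat P) (fobj ?Y {}) c" "is_iso (poset_cat P) u"
    unfolding cartesian_cube_def Let_def BS by blast
  note c = cubeD[OF X]
  have sub: "S \<union> T \<subseteq> N" if "T \<subseteq> {i, j}" for T using S that by auto
  have le: "v \<sqsubseteq>\<^bsub>P\<^esub> fobj X (S \<union> T)" if T: "T \<subseteq> {i, j}" "T \<noteq> {}" for T
  proof -
    have "insert i S \<subseteq> S \<union> T \<or> insert j S \<subseteq> S \<union> T" using T by auto
    then show ?thesis
      using le_trans[OF v(2) c(3)[OF _ sub[OF T(1)]] v(1) c(1) c(1)[OF sub[OF T(1)]]]
        le_trans[OF v(3) c(3)[OF _ sub[OF T(1)]] v(1) c(1) c(1)[OF sub[OF T(1)]]] S(1) by blast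
  qed
  have Y: "fobj ?Y T = fobj X (S \<union> T)" if "T \<subseteq> {i, j}" for T
    using that S by (intro cube_face_simps) auto
  have Ya: "farr ?Y (T, T') = (fobj X (S \<union> T), fobj X (S \<union> T'))" if "T \<subseteq> T'" "T' \<subseteq> {i, j}" for T T'
  proof -
    have "farr ?Y (T, T') = farr X (S \<union> T, S \<union> T')" using that S by (intro cube_face_simps) auto
    also have "\<dots> = (fobj X (S \<union> T), fobj X (S \<union> T'))" using that sub[OF that(2)] by (intro c) auto
    finally show ?thesis .
  qed
  have "is_cone ?J (poset_cat P) (comp_functor ?J ?Y (incl_functor ?J)) v (\<lambda>T. (v, fobj X (S \<union> T)))"
    unfolding is_cone_def
  proof (intro conjI ballI)
    show "v \<in> Obj (poset_cat P)" using v by simp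
    show "(v, fobj X (S \<union> T)) \<in> Hom (poset_cat P) v (fobj (comp_functor ?J ?Y (incl_functor ?J)) T)"
      if "T \<in> Obj ?J" for T
      using that v(1) le[of T] c(1)[OF sub] Y[of T] by (simp add: poset_hom_iff subset_cat_def)
    show "farr (comp_functor ?J ?Y (incl_functor ?J)) f \<cdot>\<^bsub>poset_cat P\<^esub> (v, fobj X (S \<union> Dom ?J f))
      = (v, fobj X (S \<union> Cod ?J f))"
      if "f \<in> Arr ?J" for f
      using that Ya by (auto simp: subset_cat_def elim!: poset_cat_arrE)
  qed
  then obtain g where "g \<in> Hom (poset_cat P) v c"
    using lim unfolding is_limit_def by blast
  then have vc: "v \<sqsubseteq>\<^bsub>P\<^esub> c" "c \<in> carrier P" by (auto simp: poset_hom_iff)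
  have "c \<sqsubseteq>\<^bsub>P\<^esub> fobj X S" using poset_isoD[OF u(2,1)] Y[of "{}"] by simp
  then show ?thesis using le_trans[OF vc(1) _ v(1) vc(2) c(1)] S by auto
qed

text \<open>The square face ending at the top in the directions \<open>i\<close> and
  \<open>j\<close> is a pushout, so the top vertex is the join of any two facets.\<close>

lemma cocartesian_face_le:
  assumes X: "is_functor (cube_cat N) (poset_cat P) X"
    and bi: "strongly_bicartesian_cube (poset_cat P) N X"
    and ij: "i \<in> N" "j \<in> N" "i \<noteq> j"
    and w: "w \<in> carrier P" "fobj X (N - {i}) \<sqsubseteq>\<^bsub>P\<^esub> w" "fobj X (N - {j}) \<sqsubseteq>\<^bsub>P\<^esub> w"
    and po: "partial_order P"
  shows "fobj X N \<sqsubseteq>\<^bsub>P\<^esub> w"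
proof -
  interpret partial_order P by (rule po)
  let ?S = "N - {i, j}"
  have BS: "N - ?S = {i, j}" using ij by auto
  let ?Y = "cube_face X ?S N" and ?J = "subset_cat (Pow {i, j} - {{i, j}})"
  have "cocartesian_cube (poset_cat P) (N - ?S) ?Y"
    by (rule bi[unfolded strongly_bicartesian_cube_def, rule_format, THEN conjunct2])
      (use ij in \<open>simp add: BS\<close>)
  then obtain c l u where col: "is_colimit ?J (poset_cat P) (comp_functor ?J ?Y (incl_functor ?J)) c l"
    and u: "u \<in> Hom (poset_cat P) c (fobj ?Y {i, j})" "is_iso (poset_cat P) u"
    unfolding cocartesian_cube_def Let_def BS by blast
  note c = cubeD[OF X]
  have sub: "?S \<union> T \<subseteq> N" if "T \<subseteq> {i, j}" for T using ij that by auto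
  have le: "fobj X (?S \<union> T) \<sqsubseteq>\<^bsub>P\<^esub> w" if T: "T \<subseteq> {i, j}" "T \<noteq> {i, j}" for T
  proof -
    have "?S \<union> T \<subseteq> N - {i} \<or> ?S \<union> T \<subseteq> N - {j}" using T ij by blast
    then show ?thesis
      using le_trans[OF c(3)[of "?S \<union> T" "N - {i}"] w(2) c(1)[OF sub[OF T(1)]] c(1)[of "N - {i}"] w(1)]
        le_trans[OF c(3)[of "?S \<union> T" "N - {j}"] w(3) c(1)[OF sub[OF T(1)]] c(1)[of "N - {j}"]
          w(1)] by auto
  qed
  have Y: "fobj ?Y T = fobj X (?S \<union> T)" if "T \<subseteq> {i, j}" for T
    using that BS by (intro cube_face_simps) auto
  have Ya: "farr ?Y (T, T') = (fobj X (?S \<union> T), fobj X (?S \<union> T'))" if "T \<subseteq> T'" "T' \<subseteq> {i, j}" for T T'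
  proof -
    have "farr ?Y (T, T') = farr X (?S \<union> T, ?S \<union> T')" using that BS by (intro cube_face_simps) auto
    also have "\<dots> = (fobj X (?S \<union> T), fobj X (?S \<union> T'))" using that sub[OF that(2)] by (intro c) auto
    finally show ?thesis .
  qed
  have "is_cocone ?J (poset_cat P) (comp_functor ?J ?Y (incl_functor ?J)) w (\<lambda>T. (fobj X (?S \<union> T), w))"
    unfolding is_cocone_def
  proof (intro conjI ballI)
    show "w \<in> Obj (poset_cat P)" using w by simp
    show "(fobj X (?S \<union> T), w) \<in> Hom (poset_cat P)
      (fobj (comp_functor ?J ?Y (incl_functor ?J)) T) w" if "T \<in> Obj ?J" for T
      using that w(1) le[of T] c(1)[OF sub] Y[of T] by (simp add: poset_hom_iff subset_cat_def)
    show "(fobj X (?S \<union> Cod ?J f), w) \<cdot>\<^bsub>poset_cat P\<^esub> farr (comp_functor ?J ?Y (incl_functor ?J)) f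
      = (fobj X (?S \<union> Dom ?J f), w)"
      if "f \<in> Arr ?J" for f
      using that Ya by (auto simp: subset_cat_def elim!: poset_cat_arrE)
  qed
  then obtain g where "g \<in> Hom (poset_cat P) c w"
    using col unfolding is_colimit_def by blast
  then have cw: "c \<sqsubseteq>\<^bsub>P\<^esub> w" "c \<in> carrier P" by (auto simp: poset_hom_iff)
  have "?S \<union> {i, j} = N" using ij by auto
  then have "fobj X N \<sqsubseteq>\<^bsub>P\<^esub> c" using poset_isoD[OF u(2,1)] Y[of "{i, j}"] by simp
  then show ?thesis using le_trans[OF _ cw(1) c(1) cw(2) w(1)] by auto
qed

text \<open>Take \<open>S\<close> of least size. If some \<open>T\<close> with \<open>v\<close>
  below its vertex misses an \<open>a\<close> in \<open>S\<close>, then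
  \<open>S - {a} \<union> (T - S)\<close> contains \<open>T\<close>, and the directions in
  \<open>T - S\<close> can be removed one at a time. This ends at \<open>S - {a}\<close>, which is
  smaller than \<open>S\<close>.\<close>

lemma least_vertex:
  assumes X: "is_functor (cube_cat N) (poset_cat P) X"
    and bi: "strongly_bicartesian_cube (poset_cat P) N X"
    and po: "partial_order P" and N: "finite N" and v: "v \<in> carrier P" "v \<sqsubseteq>\<^bsub>P\<^esub> fobj X N"
  obtains S where "S \<subseteq> N" "v \<sqsubseteq>\<^bsub>P\<^esub> fobj X S" "\<And>T. \<lbrakk>T \<subseteq> N; v \<sqsubseteq>\<^bsub>P\<^esub> fobj X T\<rbrakk> \<Longrightarrow> S \<subseteq> T"
proof -
  interpret partial_order P by (rule po)
  let ?Q = "\<lambda>S. S \<subseteq> N \<and> v \<sqsubseteq>\<^bsub>P\<^esub> fobj X S"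
  have up: "?Q T" if "?Q S" "S \<subseteq> T" "T \<subseteq> N" for S T
    using that cubeD(1)[OF X, of S] cubeD(1)[OF X, of T] cubeD(3)[OF X that(2,3)]
      le_trans[of v "fobj X S" "fobj X T"] v by auto
  have "?Q N" using v by simp
  from ex_has_least_nat[of ?Q, OF this, of card]
  obtain S where S: "?Q S" "\<And>T. ?Q T \<Longrightarrow> card S \<le> card T" by auto
  have least: "S \<subseteq> T" if T: "?Q T" for T
  proof (rule ccontr)
    assume "\<not> S \<subseteq> T"
    then obtain a where a: "a \<in> S" "a \<notin> T" by auto
    have fin: "finite S" using S(1) N finite_subset by blast
    \<comment> \<open>A direction \<open>x\<close> of \<open>U\<close> is removed by the square in
      the directions \<open>x\<close> and \<open>a\<close>: the neighbour containing
      \<open>a\<close> contains \<open>S\<close>, and the other one is the vertex given by the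
      premise.\<close>
    have "?Q (S - {a} \<union> U) \<Longrightarrow> ?Q (S - {a})" if "finite U" "U \<subseteq> N - S" for U
      using that
    proof (induction U rule: finite_induct)
      case (insert x U)
      have qx: "?Q (insert x (S - {a} \<union> U))" using insert.prems(1) by simp
      have qa: "?Q (insert a (S - {a} \<union> U))"
        by (rule up[OF S(1)]) (use insert.prems(2) S(1) a in auto)
      have "v \<sqsubseteq>\<^bsub>P\<^esub> fobj X (S - {a} \<union> U)"
      proof (rule cartesian_face_le[OF X bi _ _ _ _ v(1) _ _ po])
        show "insert x (insert a (S - {a} \<union> U)) \<subseteq> N" using qx qa by blast
        show "x \<noteq> a" "x \<notin> S - {a} \<union> U" "a \<notin> S - {a} \<union> U" using insert.hyps insert.prems(2) a by blast+
        show "v \<sqsubseteq>\<^bsub>P\<^esub> fobj X (insert x (S - {a} \<union> U))" "v \<sqsubseteq>\<^bsub>P\<^esub> fobj X (insert a (S - {a} \<union> U))"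
          using qx qa by blast+
      qed
      then have "?Q (S - {a} \<union> U)" using qx by blast
      then show ?case by (rule insert.IH) (use insert.prems(2) in blast)
    qed simp
    moreover have "?Q (S - {a} \<union> (T - S))"
      by (rule up[OF T]) (use a T S(1) in auto)
    moreover have "finite (T - S)" "T - S \<subseteq> N - S" using T finite_subset[OF _ N, of T] by auto
    ultimately have "?Q (S - {a})" by metis
    then show False using S(2)[of "S - {a}"] card_Diff1_less[OF fin a(1)] by simp
  qed
  show ?thesis
    by (rule that[OF conjunct1[OF S(1)] conjunct2[OF S(1)] least]) (rule conjI)
qed

text \<open>Pigeonhole. Otherwise every direction \<open>i\<close> has a factor of \<open>v\<close>
  not below the facet opposite to it. No factor serves two directions, because it is join-prime and
  the top is the join of any two facets; so there are at least as many factors as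
  directions.\<close>

lemma (in bottomed_distrib_lattice) proper_vertex:
  assumes X: "is_functor (cube_cat N) (poset_cat P) X"
    and bi: "strongly_bicartesian_cube (poset_cat P) N X"
    and S: "irredundant_set P v S" "card S < card N" and v: "v \<sqsubseteq> fobj X N"
  shows "\<exists>i \<in> N. v \<sqsubseteq> fobj X (N - {i})"
proof (rule ccontr)
  note D = irredundant_setD[OF S(1)] and c = cubeD[OF X]
  assume neg: "\<not> (\<exists>i \<in> N. v \<sqsubseteq> fobj X (N - {i}))"
  have "\<exists>s \<in> S. \<not> s \<sqsubseteq> fobj X (N - {i})" if "i \<in> N" for i
  proof -
    have "\<not> \<Squnion>S \<sqsubseteq> fobj X (N - {i})" using neg that unfolding D(3) by blast
    then show ?thesis using sup_le_iff[OF D(1,2) c(1)[OF Diff_subset]] by blast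
  qed
  then obtain g where g: "\<And>i. i \<in> N \<Longrightarrow> g i \<in> S \<and> \<not> g i \<sqsubseteq> fobj X (N - {i})" by metis
  have "inj_on g N"
  proof (rule inj_onI, rule ccontr)
    fix i j assume ij: "i \<in> N" "j \<in> N" "g i = g j" "i \<noteq> j"
    have c2: "fobj X (N - {i}) \<in> carrier P" "fobj X (N - {j}) \<in> carrier P" using c(1) by auto
    have gi: "g i \<in> carrier P" using D(7) g[OF ij(1)] by blast
    have "g i \<sqsubseteq> v" using sup_upper[OF D(1,2)] g[OF ij(1)] D(3) by blast
    then have "g i \<sqsubseteq> fobj X N" by (rule le_trans[OF _ v gi D(4) c(1)[OF subset_refl]])
    moreover have "fobj X N \<sqsubseteq> fobj X (N - {i}) \<squnion> fobj X (N - {j})"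
      by (rule cocartesian_face_le[OF X bi ij(1,2,4) join_closed[OF c2] join_left[OF c2]
        join_right[OF c2] po])
    ultimately have "g i \<sqsubseteq> fobj X (N - {i}) \<squnion> fobj X (N - {j})"
      by (rule le_trans[OF _ _ gi c(1)[OF subset_refl] join_closed[OF c2]])
    then have "g i \<sqsubseteq> fobj X (N - {i}) \<or> g i \<sqsubseteq> fobj X (N - {j})"
      using join_prime[OF D(5) c2] g[OF ij(1)] by blast
    then show False using g[OF ij(1)] g[OF ij(2)] ij(3) by auto
  qed
  moreover have "g ` N \<subseteq> S" using g by auto
  ultimately have "card N \<le> card S" using D(1) card_inj_on_le by blast
  then show False using S(2) by simp
qed

text \<open>In a poset only the existence of mediating maps has to be shown. A cone over a punctured
  face has legs to two neighbours of its initial vertex, and a cocone has legs from two facets, so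
  conditions on pairs of directions settle faces of every dimension.\<close>

lemma strongly_bicartesian_cubeI:
  fixes x :: "nat set \<Rightarrow> 'p" and P :: "('p, 'z) gorder_scheme"
  assumes po: "partial_order P" and N: "finite N"
    and closed: "\<And>S. S \<subseteq> N \<Longrightarrow> x S \<in> carrier P"
    and mono: "\<And>S T. \<lbrakk>S \<subseteq> T; T \<subseteq> N\<rbrakk> \<Longrightarrow> x S \<sqsubseteq>\<^bsub>P\<^esub> x T"
    and meet: "\<And>A i j c. \<lbrakk>A \<subseteq> N; i \<in> N - A; j \<in> N - A; i \<noteq> j; c \<in> carrier P;
      c \<sqsubseteq>\<^bsub>P\<^esub> x (insert i A); c \<sqsubseteq>\<^bsub>P\<^esub> x (insert j A)\<rbrakk> \<Longrightarrow> c \<sqsubseteq>\<^bsub>P\<^esub> x A"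
    and join: "\<And>B i j c. \<lbrakk>B \<subseteq> N; i \<in> B; j \<in> B; i \<noteq> j; c \<in> carrier P;
      x (B - {i}) \<sqsubseteq>\<^bsub>P\<^esub> c; x (B - {j}) \<sqsubseteq>\<^bsub>P\<^esub> c\<rbrakk> \<Longrightarrow> x B \<sqsubseteq>\<^bsub>P\<^esub> c"
  defines "X \<equiv> mk_functor (subset_poset (Pow N)) x (\<lambda>S T. (x S, x T))"
  shows "is_functor (cube_cat N) (poset_cat P) X" and "strongly_bicartesian_cube (poset_cat P) N X"
proof -
  interpret partial_order P by (rule po)
  show X: "is_functor (cube_cat N) (poset_cat P) X"
    unfolding cube_cat_def subset_cat_def X_def
    by (rule is_functor_mk_functor[OF partial_order_subset_poset category_poset_cat[OF po]])
      (auto simp: poset_hom_iff closed mono)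
  have Xo: "fobj X S = x S" if "S \<subseteq> N" for S
    using that by (simp add: X_def)
  have Xa: "farr X (S, T) = (x S, x T)" if "S \<subseteq> T" "T \<subseteq> N" for S T
    using that by (simp add: X_def)
  show "strongly_bicartesian_cube (poset_cat P) N X"
    unfolding strongly_bicartesian_cube_def
  proof (intro allI impI)
    fix A B assume AB: "A \<subseteq> B \<and> B \<subseteq> N \<and> 2 \<le> card (B - A)"
    then have "\<not> card (B - A) \<le> Suc 0" by simp
    moreover have finBA: "finite (B - A)" using AB N finite_subset by blast
    ultimately obtain i j where ij: "i \<in> B - A" "j \<in> B - A" "i \<noteq> j"
      using card_le_Suc0_iff_eq[OF finBA] by blast
    let ?Y = "cube_face X A B"
    have Y: "fobj ?Y U = x (A \<union> U)" "x (A \<union> U) \<in> carrier P" "A \<union> U \<subseteq> N" if "U \<subseteq> B - A" for U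
    proof -
      show s: "A \<union> U \<subseteq> N" using that AB by auto
      show "fobj ?Y U = x (A \<union> U)" using that Xo[OF s] by simp
      show "x (A \<union> U) \<in> carrier P" by (rule closed[OF s])
    qed
    have Ya: "farr ?Y (U, V) = (x (A \<union> U), x (A \<union> V))" if "U \<subseteq> V" "V \<subseteq> B - A" for U V
    proof -
      have "farr ?Y (U, V) = farr X (A \<union> U, A \<union> V)" by (rule cube_face_simps(2)[OF that])
      also have "\<dots> = (x (A \<union> U), x (A \<union> V))" by (rule Xa) (use that AB in auto)
      finally show ?thesis .
    qed
    have ABe: "A \<union> (B - A) = B" using AB by auto
    have xA: "x A \<in> carrier P" and xB: "x B \<in> carrier P" using AB by (auto intro: closed)
    let ?J = "subset_cat (Pow (B - A) - {{}})" and ?J' = "subset_cat (Pow (B - A) - {B - A})"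
    have Yc: "fobj (comp_functor ?J ?Y (incl_functor ?J)) U = x (A \<union> U)" if "U \<in> Pow (B - A) - {{}}" for U
      using that Y(1)[of U] by (simp add: subset_cat_def)
    have Yc': "fobj (comp_functor ?J' ?Y (incl_functor ?J')) U = x (A \<union> U)"
      if "U \<in> Pow (B - A) - {B - A}" for U
      using that Y(1)[of U] by (simp add: subset_cat_def)
    have "cartesian_cube (poset_cat P) (B - A) ?Y"
      unfolding cartesian_cube_def Let_def
    proof (intro exI conjI)
      show "(x A, x A) \<in> Hom (poset_cat P) (fobj ?Y {}) (x A)"
        using Y(1)[of "{}"] xA by (simp add: poset_hom_iff)
      show "is_iso (poset_cat P) (x A, x A)" by (rule poset_id_iso[OF po xA])
      show "\<forall>S \<in> Obj ?J. (x A, x (A \<union> S)) \<cdot>\<^bsub>poset_cat P\<^esub> (x A, x A) = farr ?Y ({}, S)"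
        using Ya[of "{}"] by (auto simp: subset_cat_def)
      show "is_limit ?J (poset_cat P) (comp_functor ?J ?Y (incl_functor ?J)) (x A) (\<lambda>S. (x A, x (A \<union> S)))"
        unfolding is_limit_def
      proof (intro conjI allI impI)
        show "is_cone ?J (poset_cat P) (comp_functor ?J ?Y (incl_functor ?J)) (x A)
          (\<lambda>S. (x A, x (A \<union> S)))"
          unfolding is_cone_def
        proof (intro conjI ballI)
          show "x A \<in> Obj (poset_cat P)" using xA by simp
          show "(x A, x (A \<union> S)) \<in> Hom (poset_cat P) (x A)
            (fobj (comp_functor ?J ?Y (incl_functor ?J)) S)" if "S \<in> Obj ?J" for S
            using that Y(2,3)[of S] Yc[of S] xA mono[of A "A \<union> S"]
              by (simp add: poset_hom_iff subset_cat_def)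
          show "farr (comp_functor ?J ?Y (incl_functor ?J)) f \<cdot>\<^bsub>poset_cat P\<^esub> (x A, x (A \<union> Dom ?J f))
            = (x A, x (A \<union> Cod ?J f))"
            if "f \<in> Arr ?J" for f
            using that Ya by (auto simp: subset_cat_def elim!: poset_cat_arrE)
        qed
        fix c' l' assume co: "is_cone ?J (poset_cat P) (comp_functor ?J ?Y (incl_functor ?J)) c' l'"
        have h: "l' U = (c', x (A \<union> U)) \<and> c' \<in> carrier P \<and> c' \<sqsubseteq>\<^bsub>P\<^esub> x (A \<union> U)"
          if "U \<in> Pow (B - A) - {{}}" for U
        proof -
          have "U \<in> Obj ?J" using that by (simp add: subset_cat_def)
          then have "l' U \<in> Hom (poset_cat P) c' (fobj (comp_functor ?J ?Y (incl_functor ?J)) U)"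
            using co unfolding is_cone_def by blast
          then show ?thesis unfolding Yc[OF that] by (simp add: poset_hom_iff)
        qed
        have "c' \<sqsubseteq>\<^bsub>P\<^esub> x A"
          by (rule meet[of A i j]) (use h[of "{i}"] h[of "{j}"] ij AB in auto)
        then show "\<exists>!u. u \<in> Hom (poset_cat P) c' (x A)
          \<and> (\<forall>j\<in>Obj ?J. (x A, x (A \<union> j)) \<cdot>\<^bsub>poset_cat P\<^esub> u = l' j)"
          using h h[of "{i}"] xA ij by (intro ex1I[of _ "(c', x A)"])
            (auto simp: poset_hom_iff subset_cat_def)
      qed
    qed
    moreover have "cocartesian_cube (poset_cat P) (B - A) ?Y"
      unfolding cocartesian_cube_def Let_def
    proof (intro exI conjI)
      show "(x B, x B) \<in> Hom (poset_cat P) (x B) (fobj ?Y (B - A))"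
        using Y(1)[of "B - A"] xB ABe by (simp add: poset_hom_iff)
      show "is_iso (poset_cat P) (x B, x B)" by (rule poset_id_iso[OF po xB])
      show "\<forall>S \<in> Obj ?J'. (x B, x B) \<cdot>\<^bsub>poset_cat P\<^esub> (x (A \<union> S), x B) = farr ?Y (S, B - A)"
        using Ya[of _ "B - A"] ABe by (auto simp: subset_cat_def)
      show "is_colimit ?J' (poset_cat P) (comp_functor ?J' ?Y (incl_functor ?J')) (x B)
        (\<lambda>S. (x (A \<union> S), x B))"
        unfolding is_colimit_def
      proof (intro conjI allI impI)
        show "is_cocone ?J' (poset_cat P) (comp_functor ?J' ?Y (incl_functor ?J')) (x B)
          (\<lambda>S. (x (A \<union> S), x B))"
          unfolding is_cocone_def
        proof (intro conjI ballI)
          show "x B \<in> Obj (poset_cat P)" using xB by simp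
          show "(x (A \<union> S), x B) \<in> Hom (poset_cat P)
            (fobj (comp_functor ?J' ?Y (incl_functor ?J')) S) (x B)" if S: "S \<in> Obj ?J'" for S
          proof -
            have "A \<union> S \<subseteq> B" "B \<subseteq> N" using S AB by (auto simp: subset_cat_def)
            from mono[OF this] show ?thesis
              using S Y(2)[of S] Yc'[of S] xB by (simp add: poset_hom_iff subset_cat_def)
          qed
          show "(x (A \<union> Cod ?J' f), x B) \<cdot>\<^bsub>poset_cat P\<^esub> farr (comp_functor ?J' ?Y (incl_functor ?J'))
            f = (x (A \<union> Dom ?J' f), x B)"
            if "f \<in> Arr ?J'" for f
            using that Ya by (auto simp: subset_cat_def elim!: poset_cat_arrE)
        qed
        fix c' l' assume co: "is_cocone ?J' (poset_cat P) (comp_functor ?J' ?Y (incl_functor ?J')) c' l'"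
        have h: "l' U = (x (A \<union> U), c') \<and> c' \<in> carrier P \<and> x (A \<union> U) \<sqsubseteq>\<^bsub>P\<^esub> c'"
          if "U \<in> Pow (B - A) - {B - A}" for U
        proof -
          have "U \<in> Obj ?J'" using that by (simp add: subset_cat_def)
          then have "l' U \<in> Hom (poset_cat P) (fobj (comp_functor ?J' ?Y (incl_functor ?J')) U) c'"
            using co unfolding is_cocone_def by blast
          then show ?thesis unfolding Yc'[OF that] by (simp add: poset_hom_iff)
        qed
        have e: "A \<union> (B - A - {k}) = B - {k}" if "k \<in> B - A" for k using that AB by auto
        have hk: "c' \<in> carrier P \<and> x (B - {k}) \<sqsubseteq>\<^bsub>P\<^esub> c'" if k: "k \<in> B - A" for k
        proof -
          have "B - A - {k} \<in> Pow (B - A) - {B - A}" using k by auto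
          from h[OF this] show ?thesis unfolding e[OF k] by simp
        qed
        have "x B \<sqsubseteq>\<^bsub>P\<^esub> c'"
          by (rule join[of B i j]) (use hk[of i] hk[of j] ij AB in auto)
        then show "\<exists>!u. u \<in> Hom (poset_cat P) (x B) c'
          \<and> (\<forall>j\<in>Obj ?J'. u \<cdot>\<^bsub>poset_cat P\<^esub> (x (A \<union> j), x B) = l' j)"
          using h hk[OF ij(1)] xB ij by (intro ex1I[of _ "(x B, c')"])
            (auto simp: poset_hom_iff subset_cat_def)
      qed
    qed
    ultimately show "cartesian_cube (poset_cat P) (B - A) ?Y
      \<and> cocartesian_cube (poset_cat P) (B - A) ?Y" by simp
  qed
qed

text \<open>The vertex at \<open>U\<close> is the meet of the joins omitting one of the chosen factors \<open>d i\<close>, \<open>i \<notin> U\<close>.\<close>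

lemma (in bottomed_distrib_lattice) cube_with_top_vertex:
  assumes D: "irredundant_set P v D" and n: "n < card D"
  obtains X where "is_functor (cube_cat {0..n}) (poset_cat P) X"
    "strongly_bicartesian_cube (poset_cat P) {0..n} X"
    "fobj X {0..n} = v"
    "\<And>U. U \<subset> {0..n} \<Longrightarrow> \<exists>u \<in> carrier P. fobj X U \<sqsubseteq> u \<and> u \<sqsubseteq> v \<and> jdim P u \<noteq> jdim P v"
proof -
  note DD = irredundant_setD[OF D]
  let ?N = "{0..n}"
  \<comment> \<open>\<open>n < card D\<close> provides \<open>n + 1\<close> distinct factors, one
    for each direction. Factors that are not chosen occur in every \<open>w i\<close>.\<close>
  obtain d where d: "inj_on d ?N" "d ` ?N \<subseteq> D"
    using card_le_inj[of ?N D] n DD(1) by auto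
  define w where "w i = \<Squnion>(D - {d i})" for i
  have Dc: "finite (D - {s})" "D - {s} \<subseteq> carrier P" for s using DD by auto
  have wc: "w i \<in> carrier P" for i unfolding w_def by (rule sup_closed[OF Dc])
  have wv: "w i \<sqsubseteq> v" for i unfolding w_def using sup_mono[OF DD(1,2), of "D - {d i}"] DD(3) by simp
  have wj: "w i \<squnion> w j = v" if "i \<in> ?N" "j \<in> ?N" "i \<noteq> j" for i j
  proof (rule le_antisym)
    show "w i \<squnion> w j \<sqsubseteq> v" using join_le_iff[OF wc wc DD(4)] wv by simp
    have "s \<sqsubseteq> w i \<squnion> w j" if s: "s \<in> D" for s
    proof -
      have "d i \<noteq> d j" using d \<open>i \<in> ?N\<close> \<open>j \<in> ?N\<close> \<open>i \<noteq> j\<close> by (meson inj_on_eq_iff)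
      then have "s \<in> D - {d i} \<or> s \<in> D - {d j}" using s by auto
      then have "s \<sqsubseteq> w i \<or> s \<sqsubseteq> w j" unfolding w_def using sup_upper[OF Dc] by blast
      then show ?thesis
        using le_trans[OF _ join_left[OF wc wc] DD(7)[OF s] wc join_closed[OF wc wc]]
          le_trans[OF _ join_right[OF wc wc] DD(7)[OF s] wc join_closed[OF wc wc]] by blast
    qed
    then show "v \<sqsubseteq> w i \<squnion> w j" using sup_le_iff[OF DD(1,2) join_closed[OF wc wc]] DD(3) by simp
  qed (use wc DD join_closed in auto)
  \<comment> \<open>Inserting \<open>v\<close> keeps the meet nonempty for
    \<open>U = {0..n}\<close>, where it yields the top vertex.\<close>
  define x where "x U = \<Sqinter>(insert v (w ` (?N - U)))" for U
  have xg: "greatest P (x U) (Lower P (insert v (w ` (?N - U))))" for U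
    unfolding x_def by (rule finite_inf_greatest) (use DD(4) wc in auto)
  then have xc: "x U \<in> carrier P" for U by blast
  have x_iff: "c \<sqsubseteq> x U \<longleftrightarrow> c \<sqsubseteq> v \<and> (\<forall>i \<in> ?N - U. c \<sqsubseteq> w i)" if c: "c \<in> carrier P" for c U
  proof
    assume le: "c \<sqsubseteq> x U"
    have "c \<sqsubseteq> a" if a: "a \<in> insert v (w ` (?N - U))" for a
    proof -
      have ac: "a \<in> carrier P" using a DD(4) wc by auto
      have "insert v (w ` (?N - U)) \<subseteq> carrier P" using DD(4) wc by auto
      from greatest_Lower_below[OF xg a this] show ?thesis by (rule le_trans[OF le _ c xc ac])
    qed
    then show "c \<sqsubseteq> v \<and> (\<forall>i \<in> ?N - U. c \<sqsubseteq> w i)" by simp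
  next
    assume "c \<sqsubseteq> v \<and> (\<forall>i \<in> ?N - U. c \<sqsubseteq> w i)"
    then have "c \<in> Lower P (insert v (w ` (?N - U)))" using c by (auto simp: Lower_def)
    then show "c \<sqsubseteq> x U" by (rule greatest_le[OF xg])
  qed
  have xv: "x U \<sqsubseteq> v" for U
    using x_iff[OF xc, of U U] xc by auto
  have xw: "x U \<sqsubseteq> w i" if "i \<in> ?N - U" for U i
    using x_iff[OF xc, of U U] xc that by auto
  let ?X = "mk_functor (subset_poset (Pow ?N)) x (\<lambda>S T. (x S, x T))"
  have mono: "x S \<sqsubseteq> x T" if "S \<subseteq> T" for S T
    unfolding x_iff[OF xc[of S]] using xv[of S] xw[of _ S] that by blast
  have meet: "c \<sqsubseteq> x A" if "i \<noteq> j" "c \<in> carrier P" "c \<sqsubseteq> x (insert i A)" "c \<sqsubseteq> x (insert j A)" for A i j c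
    using that(1,3,4) unfolding x_iff[OF that(2)] by auto
  have join: "x B \<sqsubseteq> c" if B: "B \<subseteq> ?N" "i \<in> B" "j \<in> B" "i \<noteq> j" and c: "c \<in> carrier P"
    "x (B - {i}) \<sqsubseteq> c" "x (B - {j}) \<sqsubseteq> c" for B i j c
  proof -
    have N: "i \<in> ?N" "j \<in> ?N" using B by auto
    \<comment> \<open>Because \<open>w i\<close> and \<open>w j\<close> join to \<open>v\<close>,
      distributivity will present \<open>x B\<close> as the join of its meets with them; each meet
      lies below the vertex that lacks the corresponding direction.\<close>
    have le: "x B \<sqinter> w k \<sqsubseteq> x (B - {k})" for k
    proof -
      have m: "x B \<sqinter> w k \<in> carrier P" "x B \<sqinter> w k \<sqsubseteq> x B" "x B \<sqinter> w k \<sqsubseteq> w k"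
        using meet_closed[OF xc wc] meet_left[OF xc wc] meet_right[OF xc wc] by auto
      have "x B \<sqinter> w k \<sqsubseteq> v \<and> (\<forall>l \<in> ?N - B. x B \<sqinter> w k \<sqsubseteq> w l)" using x_iff[OF m(1)] m(2) by blast
      then have "x B \<sqinter> w k \<sqsubseteq> v \<and> (\<forall>l \<in> ?N - (B - {k}). x B \<sqinter> w k \<sqsubseteq> w l)" using m(3) by blast
      then show ?thesis using x_iff[OF m(1)] by blast
    qed
    have mc: "x B \<sqinter> w i \<in> carrier P" "x B \<sqinter> w j \<in> carrier P" using xc wc by auto
    have "x B = x B \<sqinter> v"
      using meet_ge_iff[OF xc DD(4) xc] xv meet_left[OF xc DD(4)] xc DD(4) by (intro le_antisym) auto
    also have "\<dots> = (x B \<sqinter> w i) \<squnion> (x B \<sqinter> w j)"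
      using distrib[OF xc[of B] wc[of i] wc[of j]] wj[OF N B(4)] by simp
    finally have e: "x B = (x B \<sqinter> w i) \<squnion> (x B \<sqinter> w j)" .
    have "x B \<sqinter> w i \<sqsubseteq> c" "x B \<sqinter> w j \<sqsubseteq> c"
      using le_trans[OF le c(2) mc(1) xc c(1)] le_trans[OF le c(3) mc(2) xc c(1)] by auto
    then show ?thesis using join_le_iff[OF mc c(1)] e by simp
  qed
  have cube: "is_functor (cube_cat ?N) (poset_cat P) ?X" "strongly_bicartesian_cube (poset_cat P) ?N ?X"
    by (rule strongly_bicartesian_cubeI[OF po finite_atLeastAtMost xc];
        (erule mono | (rule meet; assumption) | (rule join; assumption)))+
  show ?thesis
  proof (rule that[OF cube])
    have "v \<sqsubseteq> x ?N" using x_iff[OF DD(4), of ?N] DD(4) by simp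
    then show "fobj ?X ?N = v" using xv[of ?N] xc DD(4) by (simp add: le_antisym)
    fix U assume U: "U \<subset> ?N"
    then obtain i where i: "i \<in> ?N - U" by blast
    have "jdim P (w i) \<noteq> jdim P v" unfolding w_def by (rule jdim_remove_neq[OF D]) (use d i in auto)
    then show "\<exists>u \<in> carrier P. fobj ?X U \<sqsubseteq> u \<and> u \<sqsubseteq> v \<and> jdim P u \<noteq> jdim P v"
      using wc wv xw[OF i] U by (intro bexI[of _ "w i"]) auto
  qed
qed

section \<open>Cubes of left Kan extensions\<close>

abbreviation punctured :: "nat set \<Rightarrow> nat set gorder" where
  "punctured N \<equiv> subset_poset (Pow N - {N})"

lemma carrier_punctured: "S \<in> carrier (punctured N) \<longleftrightarrow> S \<subset> N"
  by auto

text \<open>Composed in two stages to match the diagram in \<open>homotopy_cocartesian_cube\<close>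
  literally.\<close>

definition punctured_diagram where
  "punctured_diagram N F X = comp_functor (poset_cat (punctured N)) (comp_functor (cube_cat N) F X)
     (incl_functor (poset_cat (punctured N)))"

lemma is_functor_incl_punctured:
  "is_functor (poset_cat (punctured N)) (cube_cat N) (incl_functor (poset_cat (punctured N)))"
  using is_functor_incl_poset[OF partial_order_subset_poset, of "Pow N - {N}" "Pow N"]
  by (simp add: cube_cat_def subset_cat_def)

lemma category_cube_cat: "category (cube_cat N)"
  unfolding cube_cat_def subset_cat_def by (rule category_poset_cat[OF partial_order_subset_poset])

lemma is_functor_punctured_diagram:
  assumes "is_functor (cube_cat N) C X" "is_functor C M F"
  shows "is_functor (poset_cat (punctured N)) M (punctured_diagram N F X)"
  unfolding punctured_diagram_def
  by (intro is_functor_comp[OF _ is_functor_incl_punctured] is_functor_comp[OF category_cube_cat assms]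
      category_poset_cat partial_order_subset_poset)

lemma cube_cat_simps [simp]:
  "Obj (cube_cat N) = Pow N"
  "(S, T) \<in> Arr (cube_cat N) \<longleftrightarrow> S \<subseteq> T \<and> T \<subseteq> N"
  by (auto simp: cube_cat_def subset_cat_def)

lemma punctured_diagram_simps:
  assumes X: "is_functor (cube_cat N) (poset_cat P) X"
  shows "S \<subset> N \<Longrightarrow> fobj (punctured_diagram N F X) S = fobj F (fobj X S)"
    and "\<lbrakk>S \<subseteq> T; T \<subset> N\<rbrakk> \<Longrightarrow> farr (punctured_diagram N F X) (S, T) = farr F (fobj X S, fobj X T)"
proof -
  show "fobj (punctured_diagram N F X) S = fobj F (fobj X S)" if "S \<subset> N"
  proof -
    have "S \<in> Obj (poset_cat (punctured N))" "S \<in> Obj (cube_cat N)" using that by auto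
    then show ?thesis by (simp add: punctured_diagram_def del: cube_cat_simps poset_cat_simps)
  qed
  show "farr (punctured_diagram N F X) (S, T) = farr F (fobj X S, fobj X T)" if "S \<subseteq> T" "T \<subset> N"
  proof -
    have "(S, T) \<in> Arr (poset_cat (punctured N))" "(S, T) \<in> Arr (cube_cat N)" using that by auto
    then show ?thesis
      using cubeD(2)[OF X, of S T] that
        by (simp add: punctured_diagram_def del: cube_cat_simps poset_cat_simps)
  qed
qed

lemma cube_comp_simps:
  assumes X: "is_functor (cube_cat N) (poset_cat P) X"
  shows "S \<subseteq> N \<Longrightarrow> fobj (comp_functor (cube_cat N) F X) S = fobj F (fobj X S)"
    and "\<lbrakk>S \<subseteq> T; T \<subseteq> N\<rbrakk> \<Longrightarrow> farr (comp_functor (cube_cat N) F X) (S, T) = farr F (fobj X S, fobj X T)"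
proof -
  show "fobj (comp_functor (cube_cat N) F X) S = fobj F (fobj X S)" if "S \<subseteq> N" using that by simp
  show "farr (comp_functor (cube_cat N) F X) (S, T) = farr F (fobj X S, fobj X T)" if "S \<subseteq> T" "T \<subseteq> N"
  proof -
    have "(S, T) \<in> Arr (cube_cat N)" using that by simp
    then show ?thesis using cubeD(2)[OF X that] by (simp del: cube_cat_simps)
  qed
qed

lemma homotopy_cocartesian_cube_iff:
  assumes X: "is_functor (cube_cat N) (poset_cat P) X"
  shows "homotopy_cocartesian_cube M N (comp_functor (cube_cat N) F X) \<longleftrightarrow>
    (\<exists>Q q c l u. cofibrant_replacement (projective (poset_cat (punctured N)) M)
      (punctured_diagram N F X) Q q \<and>
        is_colimit (poset_cat (punctured N)) M Q c l \<and> u \<in> Hom M c (fobj F (fobj X N)) \<and>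
        (\<forall>S. S \<subset> N \<longrightarrow> u \<cdot>\<^bsub>M\<^esub> l S = farr F (fobj X S, fobj X N) \<cdot>\<^bsub>M\<^esub> nt_at q S) \<and> u \<in> weq M)"
proof -
  have "S \<in> Obj (poset_cat (punctured N)) \<longleftrightarrow> S \<subset> N" for S by auto
  then have b: "(\<forall>S \<in> Obj (poset_cat (punctured N)). R S) \<longleftrightarrow> (\<forall>S. S \<subset> N \<longrightarrow> R S)" for R
    unfolding Ball_def by simp
  have eq: "(\<forall>S. S \<subset> N \<longrightarrow> u \<cdot>\<^bsub>M\<^esub> l S = farr (comp_functor (cube_cat N) F X) (S, N) \<cdot>\<^bsub>M\<^esub> nt_at q S) \<longleftrightarrow>
      (\<forall>S. S \<subset> N \<longrightarrow> u \<cdot>\<^bsub>M\<^esub> l S = farr F (fobj X S, fobj X N) \<cdot>\<^bsub>M\<^esub> nt_at q S)" for u l q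
    by (simp only: cube_comp_simps(2)[OF X psubset_imp_subset subset_refl] cong: imp_cong)
  show ?thesis
    unfolding homotopy_cocartesian_cube_def Let_def subset_cat_def b punctured_diagram_def[symmetric]
      cube_comp_simps(1)[OF X subset_refl] eq ..
qed

lemma poset_colimitD:
  assumes "is_colimit (poset_cat K) M Q c l"
  shows "c \<in> Obj M" and "S \<in> carrier K \<Longrightarrow> l S \<in> Hom M (fobj Q S) c"
    and "\<lbrakk>S \<in> carrier K; T \<in> carrier K; S \<sqsubseteq>\<^bsub>K\<^esub> T\<rbrakk> \<Longrightarrow> l T \<cdot>\<^bsub>M\<^esub> farr Q (S, T) = l S"
proof -
  have cc: "is_cocone (poset_cat K) M Q c l" using assms by (simp add: is_colimit_def)
  then show "c \<in> Obj M" "S \<in> carrier K \<Longrightarrow> l S \<in> Hom M (fobj Q S) c"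
    by (auto simp: is_cocone_def)
  show "l T \<cdot>\<^bsub>M\<^esub> farr Q (S, T) = l S" if "S \<in> carrier K" "T \<in> carrier K" "S \<sqsubseteq>\<^bsub>K\<^esub> T"
  proof -
    have "(S, T) \<in> Arr (poset_cat K)" using that by simp
    then show ?thesis using cc unfolding is_cocone_def by fastforce
  qed
qed

lemma poset_coconeI:
  assumes "c \<in> Obj M" "\<And>S. S \<in> carrier K \<Longrightarrow> l S \<in> Hom M (fobj Q S) c"
    and "\<And>S T. \<lbrakk>S \<in> carrier K; T \<in> carrier K; S \<sqsubseteq>\<^bsub>K\<^esub> T\<rbrakk> \<Longrightarrow> l T \<cdot>\<^bsub>M\<^esub> farr Q (S, T) = l S"
  shows "is_cocone (poset_cat K) M Q c l"
  using assms by (auto simp: is_cocone_def elim!: poset_cat_arrE)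

lemma poset_colimit_whole_eqI:
  assumes "category M" "is_functor (poset_cat K) M Q" "is_colimit (poset_cat K) M Q c l"
    and "u \<in> Hom M c z" "u' \<in> Hom M c z" "\<And>v. v \<in> carrier K \<Longrightarrow> u \<cdot>\<^bsub>M\<^esub> l v = u' \<cdot>\<^bsub>M\<^esub> l v"
  shows "u = u'"
  by (rule poset_colimit_eqI[OF assms(1,2) subset_refl _ assms(4-6)]) (use assms(3) in simp_all)

context approximation
begin

section \<open>Cubes in \<open>P\<close> composed with a left Kan extension of a cofibrant
  diagram\<close>

lemma lan_leg_hom:
  assumes "is_lan Q T \<eta>" "v \<in> A" "x \<in> carrier P" "v \<sqsubseteq>\<^bsub>P\<^esub> x"
  shows "farr T (v, x) \<cdot> nt_at \<eta> v \<in> Hom M (fobj Q v) (fobj T x)"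
  using poset_natD(1)[OF is_lanD(2)[OF assms(1)], of v]
    poset_functorD(2)[OF is_lanD(1)[OF assms(1)], of v x] assms
  by (auto intro: M.comp_hom)

lemma lan_leg_comp:
  assumes "is_lan Q T \<eta>" "v \<in> A" "x \<in> carrier P" "y \<in> carrier P" "v \<sqsubseteq>\<^bsub>P\<^esub> x" "x \<sqsubseteq>\<^bsub>P\<^esub> y"
  shows "farr T (x, y) \<cdot> (farr T (v, x) \<cdot> nt_at \<eta> v) = farr T (v, y) \<cdot> nt_at \<eta> v"
proof -
  note tf = poset_functorD[OF is_lanD(1)[OF assms(1)]]
  have "nt_at \<eta> v \<in> Hom M (fobj Q v) (fobj T v)"
    using poset_natD(1)[OF is_lanD(2)[OF assms(1)], of v] assms by simp
  from M.comp_assoc[OF this tf(2) tf(2), of x y] show ?thesis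
    using tf(4)[of v x y] assms by simp
qed

lemma lan_leg_natural:
  assumes "is_lan Q T \<eta>" "v \<in> A" "w \<in> A" "x \<in> carrier P" "v \<sqsubseteq>\<^bsub>P\<^esub> w" "w \<sqsubseteq>\<^bsub>P\<^esub> x"
  shows "(farr T (w, x) \<cdot> nt_at \<eta> w) \<cdot> farr Q (v, w) = farr T (v, x) \<cdot> nt_at \<eta> v"
  using poset_colimitD(3)[OF lan_pointwise[OF assms(1,4)], of v w] assms P.le_trans[of v w x] by simp

text \<open>
  For \<open>v \<in> A\<close> below the top vertex let \<open>s v\<close> be the least vertex above \<open>v\<close>. Then the restriction
  of \<open>T \<circ> X\<close> to the punctured cube is the left Kan extension along \<open>s\<close> of the restriction of
  \<open>Q\<close> to a down-set; hence it is cofibrant, with colimit \<open>T (X N)\<close>.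
\<close>

context
  fixes N :: "nat set" and X :: "(nat set, nat set \<times> nat set, 'p, 'p \<times> 'p) func" and s :: "'p \<Rightarrow> nat set"
    and Q T \<eta>
  assumes X: "is_functor (cube_cat N) (poset_cat P) X"
    and s: "\<And>v. \<lbrakk>v \<in> A; v \<sqsubseteq>\<^bsub>P\<^esub> fobj X N\<rbrakk> \<Longrightarrow> s v \<subset> N \<and> v \<sqsubseteq>\<^bsub>P\<^esub> fobj X (s v)"
    and s_least: "\<And>v S. \<lbrakk>v \<in> A; v \<sqsubseteq>\<^bsub>P\<^esub> fobj X N; S \<subseteq> N; v \<sqsubseteq>\<^bsub>P\<^esub> fobj X S\<rbrakk> \<Longrightarrow> s v \<subseteq> S"
    and PM: "projective_model M (poset_cat (punctured N))"
    and lan: "is_lan Q T \<eta>"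
begin

interpretation PM: projective_model M "poset_cat (punctured N)" by (rule PM)

abbreviation (input) leg where "leg v x \<equiv> farr T (v, x) \<cdot> nt_at \<eta> v"

lemma lan_functor: "is_functor CP M T" by (rule is_lanD(1)[OF lan])

lemma vertex: "S \<subseteq> N \<Longrightarrow> fobj X S \<in> carrier P" by (rule cubeD(1)[OF X])

lemma vertex_mono: "\<lbrakk>S \<subseteq> S'; S' \<subseteq> N\<rbrakk> \<Longrightarrow> fobj X S \<sqsubseteq>\<^bsub>P\<^esub> fobj X S'" by (rule cubeD(3)[OF X])

lemma below_top:
  assumes "v \<in> A" "S \<subseteq> N" "v \<sqsubseteq>\<^bsub>P\<^esub> fobj X S"
  shows "v \<sqsubseteq>\<^bsub>P\<^esub> fobj X N"
  using P.le_trans[OF assms(3) vertex_mono[OF assms(2) subset_refl] _ vertex[OF assms(2)]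
    vertex[OF subset_refl]] assms by simp

lemma s_mono:
  assumes "v \<in> A" "w \<in> A" "v \<sqsubseteq>\<^bsub>P\<^esub> w" "w \<sqsubseteq>\<^bsub>P\<^esub> fobj X N"
  shows "s v \<subseteq> s w"
proof -
  have sw: "s w \<subset> N" "w \<sqsubseteq>\<^bsub>P\<^esub> fobj X (s w)" using s[OF assms(2,4)] by auto
  have c: "fobj X (s w) \<in> carrier P" using vertex sw by auto
  have "v \<sqsubseteq>\<^bsub>P\<^esub> fobj X (s w)" using P.le_trans[OF assms(3) sw(2) _ _ c] assms by simp
  moreover have "v \<sqsubseteq>\<^bsub>P\<^esub> fobj X N" using P.le_trans[OF assms(3,4) _ _ vertex[OF subset_refl]] assms by simp
  ultimately show ?thesis using s_least assms(1) sw by blast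
qed

lemma face_hom:
  assumes "S \<subseteq> S'" "S' \<subseteq> N"
  shows "farr T (fobj X S, fobj X S') \<in> Hom M (fobj T (fobj X S)) (fobj T (fobj X S'))"
  using poset_functorD(2)[OF lan_functor vertex vertex vertex_mono] assms by auto

lemma leg_hom:
  assumes "v \<in> A" "S \<subseteq> N" "v \<sqsubseteq>\<^bsub>P\<^esub> fobj X S"
  shows "leg v (fobj X S) \<in> Hom M (fobj Q v) (fobj T (fobj X S))"
  using lan_leg_hom[OF lan assms(1) vertex assms(3)] assms by simp

lemma leg_comp:
  assumes "v \<in> A" "v \<sqsubseteq>\<^bsub>P\<^esub> fobj X S" "S \<subseteq> S'" "S' \<subseteq> N"
  shows "farr T (fobj X S, fobj X S') \<cdot> leg v (fobj X S) = leg v (fobj X S')"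
  using lan_leg_comp[OF lan assms(1) vertex vertex assms(2) vertex_mono] assms by auto

lemma punctured_lan_fun: "is_functor (poset_cat (punctured N)) M (punctured_diagram N T X)"
  by (rule is_functor_punctured_diagram[OF X lan_functor])

text \<open>The value of \<open>T\<close> at a vertex is the colimit of \<open>Q\<close> over the
  elements below it, and \<open>v\<close> enters first at the vertex \<open>s v\<close>. A lifting
  problem against \<open>p\<close> thus becomes one for \<open>Q\<close> against the extension of
  \<open>p\<close> along \<open>s\<close>, which is still an objectwise trivial fibration.\<close>

lemma punctured_lan_cofibrant:
  assumes Q: "proj_cofibrant Q"
  shows "PM.proj_cofibrant (punctured_diagram N T X)"
  unfolding PM.proj_cofibrant_def
proof (intro conjI ballI punctured_lan_fun)
  let ?H = "punctured_diagram N T X" and ?D = "{v \<in> A. v \<sqsubseteq>\<^bsub>P\<^esub> fobj X N}"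
  fix p b assume p: "p \<in> objectwise (poset_cat (punctured N)) M (fib M \<inter> weq M)"
    and b: "b \<in> Hom PM.F ?H (Cod PM.F p)"
  define B where "B = Dom PM.F p"
  define B' where "B' = Cod PM.F p"
  have ph: "p \<in> Hom PM.F B B'" using p by (simp add: B_def B'_def Hom_def objectwise_def)
  have b: "b \<in> Hom PM.F ?H B'" using b by (simp add: B'_def)
  note BF = natD(1,2)[OF ph]
  note H = punctured_diagram_simps[OF X, where F = T]
  interpret E: terminal_extension M J "punctured N" ?D s t
  proof (rule terminal_extension.intro)
    show "w \<in> ?D \<Longrightarrow> v \<in> carrier J \<Longrightarrow> v \<sqsubseteq>\<^bsub>J\<^esub> w \<Longrightarrow> v \<in> ?D" for v w
      using P.le_trans[of v w "fobj X N"] vertex[OF subset_refl] by simp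
  qed (use s s_mono in \<open>auto simp: cat_M po_J partial_order_subset_poset terminal\<close>)
  have sD: "s v \<subset> N" "fobj X (s v) \<in> carrier P" "v \<sqsubseteq>\<^bsub>P\<^esub> fobj X (s v)" "v \<in> A" if "v \<in> ?D" for v
    using s[of v] that vertex[of "s v"] by auto
  have bh: "nt_at b S \<in> Hom M (fobj T (fobj X S)) (fobj B' S)" if "S \<subset> N" for S
    using poset_natD(1)[OF b, of S] that H(1)[OF that] by auto
  have bn: "nt_at b S' \<cdot> farr T (fobj X S, fobj X S') = farr B' (S, S') \<cdot> nt_at b S"
    if "S \<subseteq> S'" "S' \<subset> N" for S S'
    using poset_natD(2)[OF b, of S S'] that H(2)[OF that] by auto
  have B'h: "farr B' (S, S') \<in> Hom M (fobj B' S) (fobj B' S')"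
    and Bh: "farr B (S, S') \<in> Hom M (fobj B S) (fobj B S')"
    if "S \<subseteq> S'" "S' \<subset> N" for S S'
    using poset_functorD(2)[OF BF(2), of S S'] poset_functorD(2)[OF BF(1), of S S'] that by auto
  have Bc: "farr B (S', S'') \<cdot> farr B (S, S') = farr B (S, S'')"
    if "S \<subseteq> S'" "S' \<subseteq> S''" "S'' \<subset> N" for S S' S''
    by (rule poset_functorD(4)[OF BF(1)]; (unfold carrier_punctured)?) (use that in auto)
  have pS: "nt_at p S \<in> Hom M (fobj B S) (fobj B' S)" if "S \<subset> N" for S
    using poset_natD(1)[OF ph, of S] that by auto
  have pn: "nt_at p S' \<cdot> farr B (S, S') = farr B' (S, S') \<cdot> nt_at p S" if "S \<subseteq> S'" "S' \<subset> N" for S S'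
    using poset_natD(2)[OF ph, of S S'] that by auto
  \<comment> \<open>The transformation \<open>b\<close> evaluated where \<open>v\<close> first
    appears; its values at larger vertices follow by naturality.\<close>
  let ?\<beta> = "\<lambda>v. nt_at b (s v) \<cdot> leg v (fobj X (s v))"
  have "natural_on M J ?D s Q B' ?\<beta>"
    unfolding natural_on_def
  proof (intro conjI ballI impI)
    fix v assume v: "v \<in> ?D"
    show "?\<beta> v \<in> Hom M (fobj Q v) (fobj B' (s v))"
      by (rule M.comp_hom[OF leg_hom bh]) (use sD[OF v] in auto)
    fix w assume w: "w \<in> ?D" and "v \<sqsubseteq>\<^bsub>J\<^esub> w"
    then have vw: "v \<sqsubseteq>\<^bsub>P\<^esub> w" by simp
    note sv = sD[OF v] and sw = sD[OF w]
    have ss: "s v \<subseteq> s w" using s_mono v w vw by simp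
    have swN: "s w \<subseteq> N" and svN: "s v \<subseteq> N" using sw sv by auto
    have qh: "farr Q (v, w) \<in> Hom M (fobj Q v) (fobj Q w)"
      using poset_functorD(2)[OF is_lanD(3)[OF lan], of v w] sv sw vw by simp
    have "?\<beta> w \<cdot> farr Q (v, w) = nt_at b (s w) \<cdot> leg v (fobj X (s w))"
      using M.comp_assoc[OF qh leg_hom[OF sw(4) swN sw(3)] bh[OF sw(1)]]
        lan_leg_natural[OF lan sv(4) sw(4) sw(2) vw sw(3)] by simp
    also have "\<dots> = nt_at b (s w) \<cdot> (farr T (fobj X (s v), fobj X (s w)) \<cdot> leg v (fobj X (s v)))"
      using leg_comp[OF sv(4,3) ss swN] by simp
    also have "\<dots> = farr B' (s v, s w) \<cdot> ?\<beta> v"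
      using M.comp_assoc[OF leg_hom[OF sv(4) svN sv(3)] face_hom[OF ss swN] bh[OF sw(1)]] bn[OF ss sw(1)]
        M.comp_assoc[OF leg_hom[OF sv(4) svN sv(3)] bh[OF sv(1)] B'h[OF ss sw(1)]] by simp
    finally show "?\<beta> w \<cdot> farr Q (v, w) = farr B' (s v, s w) \<cdot> ?\<beta> v" .
  qed
  from E.ext_transpose_hom[OF is_lanD(3)[OF lan] BF(2) this]
  have bt: "E.ext_transpose Q B' ?\<beta> \<in> Hom FJ Q (E.ext B')" .
  have "Id M t \<in> fib M \<inter> weq M" using id_fib[OF E.t_obj] id_weq[OF E.t_obj] by simp
  from E.ext_nat_objectwise[OF p this]
  obtain h where h: "h \<in> Hom FJ Q (E.ext B)" "E.ext_nat p \<cdot>\<^bsub>FJ\<^esub> h = E.ext_transpose Q B' ?\<beta>"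
    by (rule proj_cofibrant_lift[OF Q _ E.ext_nat_hom[OF ph] bt])
  have nh: "natural_on M J ?D s Q B (nt_at h)" by (rule E.natural_on_ext[OF h(1)])
  have hh: "nt_at h v \<in> Hom M (fobj Q v) (fobj B (s v))" if "v \<in> ?D" for v
    using nh that unfolding natural_on_def by blast
  have hn: "nt_at h w \<cdot> farr Q (v, w) = farr B (s v, s w) \<cdot> nt_at h v"
    if "v \<in> ?D" "w \<in> ?D" "v \<sqsubseteq>\<^bsub>P\<^esub> w" for v w
    using nh that unfolding natural_on_def by simp
  have ph_v: "nt_at p (s v) \<cdot> nt_at h v = ?\<beta> v" if v: "v \<in> ?D" for v
    using arg_cong[OF h(2), of "\<lambda>n. nt_at n v"] v E.ext_transpose_at[OF v] E.ext_nat_at(1)[OF v] by simp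
  have inD: "v \<in> ?D" "s v \<subseteq> S" if "v \<in> A" "S \<subset> N" "v \<sqsubseteq>\<^bsub>P\<^esub> fobj X S" for v S
    using that below_top[of v S] s_least[of v S] by auto
  \<comment> \<open>The solution on \<open>Q\<close> is spread over the cube: \<open>v\<close>
    enters at \<open>s v\<close> and is pushed on to \<open>S\<close> by \<open>B\<close>. These
    maps form a cocone over the elements below the vertex \<open>S\<close>.\<close>
  have "\<exists>k. k \<in> Hom M (fobj T (fobj X S)) (fobj B S) \<and>
      (\<forall>v\<in>A. v \<sqsubseteq>\<^bsub>P\<^esub> fobj X S \<longrightarrow> k \<cdot> leg v (fobj X S) = farr B (s v, S) \<cdot> nt_at h v)" if S: "S \<subset> N" for S
  proof -
    have SN: "S \<subseteq> N" using S by auto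
    have "is_cocone (poset_cat (P\<lparr>carrier := below (fobj X S)\<rparr>)) M Q (fobj B S)
      (\<lambda>v. farr B (s v, S) \<cdot> nt_at h v)"
    proof (rule poset_coconeI)
      show "fobj B S \<in> Obj M" using poset_functorD(1)[OF BF(1)] S by auto
      show "farr B (s v, S) \<cdot> nt_at h v \<in> Hom M (fobj Q v) (fobj B S)"
        if "v \<in> carrier (P\<lparr>carrier := below (fobj X S)\<rparr>)" for v
        using M.comp_hom[OF hh Bh] inD[of v S] that S by simp
      fix v w assume "v \<in> carrier (P\<lparr>carrier := below (fobj X S)\<rparr>)"
        "w \<in> carrier (P\<lparr>carrier := below (fobj X S)\<rparr>)"
        and "v \<sqsubseteq>\<^bsub>P\<lparr>carrier := below (fobj X S)\<rparr>\<^esub> w"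
      then have v: "v \<in> A" "v \<sqsubseteq>\<^bsub>P\<^esub> fobj X S" and w: "w \<in> A" "w \<sqsubseteq>\<^bsub>P\<^esub> fobj X S" and vw: "v \<sqsubseteq>\<^bsub>P\<^esub> w" by auto
      note iv = inD[OF v(1) S v(2)] and iw = inD[OF w(1) S w(2)]
      have ss: "s v \<subseteq> s w" using s_mono iv(1) iw(1) vw by simp
      have qh: "farr Q (v, w) \<in> Hom M (fobj Q v) (fobj Q w)"
        using poset_functorD(2)[OF is_lanD(3)[OF lan], of v w] v w vw by simp
      have "(farr B (s w, S) \<cdot> nt_at h w) \<cdot> farr Q (v, w)
        = farr B (s w, S) \<cdot> (farr B (s v, s w) \<cdot> nt_at h v)"
        using M.comp_assoc[OF qh hh[OF iw(1)] Bh[OF iw(2) S]] hn[OF iv(1) iw(1) vw] by simp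
      also have "\<dots> = farr B (s v, S) \<cdot> nt_at h v"
        using M.comp_assoc[OF hh[OF iv(1)] Bh[OF ss sD(1)[OF iw(1)]] Bh[OF iw(2) S]]
          Bc[OF ss iw(2) S] by simp
      finally show "(farr B (s w, S) \<cdot> nt_at h w) \<cdot> farr Q (v, w) = farr B (s v, S) \<cdot> nt_at h v" .
    qed
    from colimit_ex[OF lan_pointwise[OF lan vertex[OF SN]] this]
    obtain k where "k \<in> Hom M (fobj T (fobj X S)) (fobj B S)"
      "\<And>v. v \<in> below (fobj X S) \<Longrightarrow> k \<cdot> leg v (fobj X S) = farr B (s v, S) \<cdot> nt_at h v" by auto
    then show ?thesis by auto
  qed
  then obtain k where kh: "\<And>S. S \<subset> N \<Longrightarrow> k S \<in> Hom M (fobj T (fobj X S)) (fobj B S)"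
    and kl: "\<And>S v. \<lbrakk>S \<subset> N; v \<in> A; v \<sqsubseteq>\<^bsub>P\<^esub> fobj X S\<rbrakk> \<Longrightarrow> k S \<cdot> leg v (fobj X S) = farr B (s v, S) \<cdot> nt_at h v"
    by metis
  let ?k = "mk_nat (poset_cat (punctured N)) ?H B k"
  have k: "?k \<in> Hom PM.F ?H B"
  proof (rule poset_natI[OF partial_order_subset_poset punctured_lan_fun BF(1)])
    show "k S \<in> Hom M (fobj ?H S) (fobj B S)" if "S \<in> carrier (punctured N)" for S
      using kh[OF that[unfolded carrier_punctured]] H(1)[OF that[unfolded carrier_punctured]] by simp
    fix S S' assume "S \<in> carrier (punctured N)" "S' \<in> carrier (punctured N)" "S \<sqsubseteq>\<^bsub>punctured N\<^esub> S'"
    then have S: "S \<subset> N" "S' \<subset> N" "S \<subseteq> S'" by auto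
    then have SN: "S \<subseteq> N" "S' \<subseteq> N" by auto
    have "k S' \<cdot> farr T (fobj X S, fobj X S') = farr B (S, S') \<cdot> k S"
    proof (rule lan_eqI[OF lan vertex[OF SN(1)] M.comp_hom[OF face_hom[OF S(3) SN(2)] kh[OF S(2)]]
      M.comp_hom[OF kh[OF S(1)] Bh[OF S(3,2)]]])
      fix v assume v: "v \<in> A" "v \<sqsubseteq>\<^bsub>P\<^esub> fobj X S"
      have v': "v \<sqsubseteq>\<^bsub>P\<^esub> fobj X S'"
        using P.le_trans[OF v(2) vertex_mono[OF S(3) SN(2)] _ vertex[OF SN(1)] vertex[OF SN(2)]] v by simp
      note iv = inD[OF v(1) S(1) v(2)]
      have "(k S' \<cdot> farr T (fobj X S, fobj X S')) \<cdot> leg v (fobj X S) = farr B (s v, S') \<cdot> nt_at h v"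
        using M.comp_assoc[OF leg_hom[OF v(1) SN(1) v(2)] face_hom[OF S(3) SN(2)] kh[OF S(2)]]
          leg_comp[OF v S(3) SN(2)] kl[OF S(2) v(1) v'] by simp
      also have "\<dots> = farr B (S, S') \<cdot> (farr B (s v, S) \<cdot> nt_at h v)"
        using M.comp_assoc[OF hh[OF iv(1)] Bh[OF iv(2) S(1)] Bh[OF S(3,2)]]
          Bc[OF iv(2) S(3,2)] by simp
      also have "\<dots> = (farr B (S, S') \<cdot> k S) \<cdot> leg v (fobj X S)"
        using M.comp_assoc[OF leg_hom[OF v(1) SN(1) v(2)] kh[OF S(1)] Bh[OF S(3,2)]] kl[OF S(1) v] by simp
      finally show "(k S' \<cdot> farr T (fobj X S, fobj X S')) \<cdot> leg v (fobj X S)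
        = (farr B (S, S') \<cdot> k S) \<cdot> leg v (fobj X S)" .
    qed
    then show "k S' \<cdot> farr ?H (S, S') = farr B (S, S') \<cdot> k S"
      using H(2)[OF S(3,2)] by simp
  qed
  have "p \<cdot>\<^bsub>PM.F\<^esub> ?k = b"
  proof (rule nat_eqI[OF PM.F.comp_hom[OF k ph] b])
    fix S assume SK: "S \<in> Obj (poset_cat (punctured N))"
    then have S: "S \<subset> N" and SN: "S \<subseteq> N" by auto
    have "nt_at p S \<cdot> k S = nt_at b S"
    proof (rule lan_eqI[OF lan vertex[OF SN] M.comp_hom[OF kh[OF S] pS[OF S]] bh[OF S]])
      fix v assume v: "v \<in> A" "v \<sqsubseteq>\<^bsub>P\<^esub> fobj X S"
      note iv = inD[OF v(1) S v(2)] 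
      note sv = sD[OF iv(1)]
      have svN: "s v \<subseteq> N" using sv by auto
      have "(nt_at p S \<cdot> k S) \<cdot> leg v (fobj X S) = nt_at p S \<cdot> (farr B (s v, S) \<cdot> nt_at h v)"
        using M.comp_assoc[OF leg_hom[OF v(1) SN v(2)] kh[OF S] pS[OF S]] kl[OF S v] by simp
      also have "\<dots> = farr B' (s v, S) \<cdot> ?\<beta> v"
        using M.comp_assoc[OF hh[OF iv(1)] Bh[OF iv(2) S] pS[OF S]] pn[OF iv(2) S]
          M.comp_assoc[OF hh[OF iv(1)] pS[OF sv(1)] B'h[OF iv(2) S]] ph_v[OF iv(1)] by simp
      also have "\<dots> = nt_at b S \<cdot> (farr T (fobj X (s v), fobj X S) \<cdot> leg v (fobj X (s v)))"
        using M.comp_assoc[OF leg_hom[OF sv(4) svN sv(3)] bh[OF sv(1)] B'h[OF iv(2) S]] bn[OF iv(2) S]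
          M.comp_assoc[OF leg_hom[OF sv(4) svN sv(3)] face_hom[OF iv(2) SN] bh[OF S]] by simp
      also have "\<dots> = nt_at b S \<cdot> leg v (fobj X S)"
        using leg_comp[OF sv(4,3) iv(2) SN] by simp
      finally show "(nt_at p S \<cdot> k S) \<cdot> leg v (fobj X S) = nt_at b S \<cdot> leg v (fobj X S)" .
    qed
    then show "nt_at (p \<cdot>\<^bsub>PM.F\<^esub> ?k) S = nt_at b S" using SK by simp
  qed
  then show "\<exists>h \<in> Hom PM.F ?H (Dom PM.F p). p \<cdot>\<^bsub>PM.F\<^esub> h = b"
    using k by (auto simp: B_def)
qed

text \<open>Every leg into \<open>T\<close> at the top factors through the least vertex of its
  index, which is a proper one. Hence a cocone on the punctured cube is determined by its values on
  the legs, and it induces a map out of the colimit at the top.\<close>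

lemma punctured_lan_colimit:
  "is_colimit (poset_cat (punctured N)) M (punctured_diagram N T X) (fobj T (fobj X N))
     (\<lambda>S. farr T (fobj X S, fobj X N))"
  unfolding is_colimit_def
proof (intro conjI allI impI)
  let ?H = "punctured_diagram N T X"
  note H = punctured_diagram_simps[OF X, where F = T]
  note tf = poset_functorD[OF lan_functor]
  have XN: "fobj X N \<in> carrier P" by (rule vertex[OF subset_refl])
  show "is_cocone (poset_cat (punctured N)) M ?H (fobj T (fobj X N)) (\<lambda>S. farr T (fobj X S, fobj X N))"
  proof (rule poset_coconeI)
    show "fobj T (fobj X N) \<in> Obj M" by (rule tf(1)[OF XN])
    show "farr T (fobj X S, fobj X N) \<in> Hom M (fobj ?H S) (fobj T (fobj X N))"
      if "S \<in> carrier (punctured N)" for S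
      using face_hom[of S N] H(1)[OF that[unfolded carrier_punctured]] that by auto
    show "farr T (fobj X S', fobj X N) \<cdot> farr ?H (S, S') = farr T (fobj X S, fobj X N)"
      if "S \<in> carrier (punctured N)" "S' \<in> carrier (punctured N)" "S \<sqsubseteq>\<^bsub>punctured N\<^esub> S'" for S S'
    proof -
      have S: "S \<subseteq> S'" "S' \<subset> N" "S \<subseteq> N" "S' \<subseteq> N" using that by auto
      show ?thesis
        using H(2)[OF S(1,2)] tf(4)[OF vertex[OF S(3)] vertex[OF S(4)] XN vertex_mono[OF S(1,4)]
          vertex_mono[OF S(4) subset_refl]] by simp
    qed
  qed
  fix c' l' assume co: "is_cocone (poset_cat (punctured N)) M ?H c' l'"
  have c': "c' \<in> Obj M" using co by (simp add: is_cocone_def)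
  have lh: "l' S \<in> Hom M (fobj T (fobj X S)) c'" if "S \<subset> N" for S
  proof -
    have "S \<in> Obj (poset_cat (punctured N))" using that by auto
    then have "l' S \<in> Hom M (fobj ?H S) c'" using co unfolding is_cocone_def by blast
    then show ?thesis using H(1)[OF that] by simp
  qed
  have ln: "l' S' \<cdot> farr T (fobj X S, fobj X S') = l' S" if "S \<subseteq> S'" "S' \<subset> N" for S S'
  proof -
    have "(S, S') \<in> Arr (poset_cat (punctured N))" using that by auto
    then have "l' (Cod (poset_cat (punctured N)) (S, S')) \<cdot> farr ?H (S, S')
      = l' (Dom (poset_cat (punctured N)) (S, S'))"
      using co unfolding is_cocone_def by blast
    then show ?thesis using H(2)[OF that] by simp
  qed
  \<comment> \<open>The contribution of \<open>v\<close> is read off at its least vertex;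
    \<open>m\<close> says that every proper vertex above \<open>v\<close> gives the same.\<close>
  let ?m = "\<lambda>v. l' (s v) \<cdot> leg v (fobj X (s v))"
  have m: "l' S \<cdot> leg v (fobj X S) = ?m v" if v: "v \<in> A" "v \<sqsubseteq>\<^bsub>P\<^esub> fobj X S" and S: "S \<subset> N" for v S
  proof -
    have SN: "S \<subseteq> N" using S by auto
    have vN: "v \<sqsubseteq>\<^bsub>P\<^esub> fobj X N" by (rule below_top[OF v(1) SN v(2)])
    have sv: "s v \<subset> N" "v \<sqsubseteq>\<^bsub>P\<^esub> fobj X (s v)" "s v \<subseteq> S" "s v \<subseteq> N"
      using s[OF v(1) vN] s_least[OF v(1) vN SN v(2)] by auto
    show ?thesis
      using leg_comp[OF v(1) sv(2,3) SN]
        M.comp_assoc[OF leg_hom[OF v(1) sv(4,2)] face_hom[OF sv(3) SN] lh[OF S]] ln[OF sv(3) S] by simp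
  qed
  have "is_cocone (poset_cat (P\<lparr>carrier := below (fobj X N)\<rparr>)) M Q c' ?m"
  proof (rule poset_coconeI[OF c'])
    show "?m v \<in> Hom M (fobj Q v) c'" if "v \<in> carrier (P\<lparr>carrier := below (fobj X N)\<rparr>)" for v
      using M.comp_hom[OF leg_hom lh, of v "s v"] s[of v] that by auto
    fix v w assume "v \<in> carrier (P\<lparr>carrier := below (fobj X N)\<rparr>)"
      "w \<in> carrier (P\<lparr>carrier := below (fobj X N)\<rparr>)"
      and "v \<sqsubseteq>\<^bsub>P\<lparr>carrier := below (fobj X N)\<rparr>\<^esub> w"
    then have v: "v \<in> A" "v \<sqsubseteq>\<^bsub>P\<^esub> fobj X N" and w: "w \<in> A" "w \<sqsubseteq>\<^bsub>P\<^esub> fobj X N" and vw: "v \<sqsubseteq>\<^bsub>P\<^esub> w" by auto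
    have sw: "s w \<subset> N" "w \<sqsubseteq>\<^bsub>P\<^esub> fobj X (s w)" "s w \<subseteq> N" using s[OF w] by auto
    have qh: "farr Q (v, w) \<in> Hom M (fobj Q v) (fobj Q w)"
      using poset_functorD(2)[OF is_lanD(3)[OF lan], of v w] v w vw by simp
    have vs: "v \<sqsubseteq>\<^bsub>P\<^esub> fobj X (s w)" using P.le_trans[OF vw sw(2) _ _ vertex[OF sw(3)]] v w by simp
    have "?m w \<cdot> farr Q (v, w) = l' (s w) \<cdot> leg v (fobj X (s w))"
      using M.comp_assoc[OF qh leg_hom[OF w(1) sw(3,2)] lh[OF sw(1)]]
        lan_leg_natural[OF lan v(1) w(1) vertex[OF sw(3)] vw sw(2)] by simp
    then show "?m w \<cdot> farr Q (v, w) = ?m v" using m[OF v(1) vs sw(1)] by simp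
  qed
  from colimit_ex[OF lan_pointwise[OF lan XN] this]
  obtain u where u: "u \<in> Hom M (fobj T (fobj X N)) c'"
    "\<And>v. v \<in> below (fobj X N) \<Longrightarrow> u \<cdot> leg v (fobj X N) = ?m v" by auto
  have uS: "u \<cdot> farr T (fobj X S, fobj X N) = l' S" if S: "S \<subset> N" for S
  proof -
    have SN: "S \<subseteq> N" using S by auto
    note th = face_hom[OF SN subset_refl]
    show ?thesis
    proof (rule lan_eqI[OF lan vertex[OF SN] M.comp_hom[OF th u(1)] lh[OF S]])
      fix v assume v: "v \<in> A" "v \<sqsubseteq>\<^bsub>P\<^esub> fobj X S"
      show "(u \<cdot> farr T (fobj X S, fobj X N)) \<cdot> leg v (fobj X S) = l' S \<cdot> leg v (fobj X S)"
        using M.comp_assoc[OF leg_hom[OF v(1) SN v(2)] th u(1)] leg_comp[OF v SN subset_refl]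
          u(2)[of v] below_top[OF v(1) SN v(2)]
          v m[OF v S] by simp
    qed
  qed
  show "\<exists>!u. u \<in> Hom M (fobj T (fobj X N)) c' \<and>
     (\<forall>S \<in> Obj (poset_cat (punctured N)). u \<cdot> farr T (fobj X S, fobj X N) = l' S)"
  proof (rule ex1I[of _ u])
    show "u \<in> Hom M (fobj T (fobj X N)) c'
      \<and> (\<forall>S \<in> Obj (poset_cat (punctured N)). u \<cdot> farr T (fobj X S, fobj X N) = l' S)"
      using u(1) uS by auto
    fix w assume w: "w \<in> Hom M (fobj T (fobj X N)) c'
      \<and> (\<forall>S \<in> Obj (poset_cat (punctured N)). w \<cdot> farr T (fobj X S, fobj X N) = l' S)"
    then have w1: "w \<in> Hom M (fobj T (fobj X N)) c'" by simp
    show "w = u"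
    proof (rule lan_eqI[OF lan XN w1 u(1)])
      fix v assume v: "v \<in> A" "v \<sqsubseteq>\<^bsub>P\<^esub> fobj X N"
      have sv: "s v \<subset> N" "v \<sqsubseteq>\<^bsub>P\<^esub> fobj X (s v)" "s v \<subseteq> N" using s[OF v] by auto
      have "s v \<in> Obj (poset_cat (punctured N))" using sv by auto
      then have "w \<cdot> farr T (fobj X (s v), fobj X N) = l' (s v)" using w by blast
      then have "w \<cdot> leg v (fobj X N) = ?m v"
        using leg_comp[OF v(1) sv(2,3) subset_refl]
          M.comp_assoc[OF leg_hom[OF v(1) sv(3,2)] face_hom[OF sv(3) subset_refl] w1] by simp
      then show "w \<cdot> leg v (fobj X N) = u \<cdot> leg v (fobj X N)" using u(2)[of v] v by simp
    qed
  qed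
qed

text \<open>The punctured diagram is its own cofibrant replacement by the identity, and the
  comparison map at the top is an identity as well.\<close>

lemma lan_homotopy_cocartesian:
  assumes Q: "proj_cofibrant Q"
  shows "homotopy_cocartesian_cube M N (comp_functor (cube_cat N) T X)"
  unfolding homotopy_cocartesian_cube_iff[OF X]
proof (intro exI conjI)
  let ?H = "punctured_diagram N T X"
  have TN: "fobj T (fobj X N) \<in> Obj M" by (rule poset_functorD(1)[OF lan_functor vertex[OF subset_refl]])
  have Hf: "?H \<in> Obj PM.F" using punctured_lan_fun by simp
  have idw: "Id PM.F ?H \<in> objectwise (poset_cat (punctured N)) M (weq M)"
    by (rule objectwiseI[OF PM.F.id_hom[OF Hf]]) (use functorD(1)[OF punctured_lan_fun] id_weq in simp)
  show "cofibrant_replacement (projective (poset_cat (punctured N)) M) ?H ?H (Id PM.F ?H)"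
    unfolding cofibrant_replacement_def PM.cofibrant_iff
    using punctured_lan_cofibrant[OF Q] PM.F.id_hom[OF Hf] idw by simp
  show "is_colimit (poset_cat (punctured N)) M ?H (fobj T (fobj X N)) (\<lambda>S. farr T (fobj X S, fobj X N))"
    by (rule punctured_lan_colimit)
  show "Id M (fobj T (fobj X N)) \<in> Hom M (fobj T (fobj X N)) (fobj T (fobj X N))"
    by (rule M.id_hom[OF TN])
  show "Id M (fobj T (fobj X N)) \<in> weq M" by (rule id_weq[OF TN])
  show "\<forall>S. S \<subset> N \<longrightarrow> Id M (fobj T (fobj X N)) \<cdot> farr T (fobj X S, fobj X N)
      = farr T (fobj X S, fobj X N) \<cdot> nt_at (Id PM.F ?H) S"
  proof (intro allI impI)
    fix S assume S: "S \<subset> N"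
    then have SN: "S \<subseteq> N" by auto
    have th: "farr T (fobj X S, fobj X N) \<in> Hom M (fobj T (fobj X S)) (fobj T (fobj X N))"
      by (rule poset_functorD(2)[OF lan_functor vertex[OF SN] vertex[OF subset_refl]
        vertex_mono[OF SN subset_refl]])
    have "nt_at (Id PM.F ?H) S = Id M (fobj T (fobj X S))"
      using S punctured_diagram_simps(1)[OF X S, of T] by (subst nat_id_at) auto
    then show "Id M (fobj T (fobj X N)) \<cdot> farr T (fobj X S, fobj X N)
      = farr T (fobj X S, fobj X N) \<cdot> nt_at (Id PM.F ?H) S"
      using M.id_left[OF th] M.id_right[OF th] by simp
  qed
qed

text \<open>
  Both homotopy colimits are computed by cofibrant replacements of the punctured cube of \<open>G\<close>, so the
  comparison of colimits at the top vertex is a weak equivalence for one of them iff it is for the other.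
\<close>

lemma approx_top_vertex_weq:
  assumes Q: "proj_cofibrant Q" and e: "e \<in> Hom FP T G"
    and hc: "homotopy_cocartesian_cube M N (comp_functor (cube_cat N) G X)"
    and ew: "\<And>S. S \<subset> N \<Longrightarrow> nt_at e (fobj X S) \<in> weq M"
    and col: "\<And>Y. is_functor (poset_cat (punctured N)) M Y
      \<Longrightarrow> \<exists>c l. is_colimit (poset_cat (punctured N)) M Y c l"
  shows "nt_at e (fobj X N) \<in> weq M"
proof -
  let ?K = "poset_cat (punctured N)"
  let ?H = "punctured_diagram N T X" and ?HG = "punctured_diagram N G X"
  have G: "is_functor CP M G" using natD(2)[OF e] .
  note gf = poset_functorD[OF G] and tf = poset_functorD[OF lan_functor]
  have XN: "fobj X N \<in> carrier P" by (rule vertex[OF subset_refl])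
  have HG: "is_functor ?K M ?HG" by (rule is_functor_punctured_diagram[OF X G])
  note Hs = punctured_diagram_simps[OF X, where F = T] and HGs
    = punctured_diagram_simps[OF X, where F = G]
  obtain Q2 q2 c l u where q2: "PM.proj_cofibrant Q2" "q2 \<in> Hom PM.F Q2 ?HG"
    "q2 \<in> objectwise ?K M (weq M)"
    and cl: "is_colimit ?K M Q2 c l" and u: "u \<in> Hom M c (fobj G (fobj X N))" "u \<in> weq M"
      "\<And>S. S \<subset> N \<Longrightarrow> u \<cdot> l S = farr G (fobj X S, fobj X N) \<cdot> nt_at q2 S"
    using hc unfolding homotopy_cocartesian_cube_iff[OF X] cofibrant_replacement_def
      PM.cofibrant_iff by auto
  let ?q1 = "mk_nat ?K ?H ?HG (\<lambda>S. nt_at e (fobj X S))"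
  have carr: "S \<in> carrier (punctured N) \<longleftrightarrow> S \<subset> N" for S by auto
  have q1: "?q1 \<in> Hom PM.F ?H ?HG"
  proof (rule poset_natI[OF partial_order_subset_poset punctured_lan_fun HG])
    show "nt_at e (fobj X S) \<in> Hom M (fobj ?H S) (fobj ?HG S)" if "S \<in> carrier (punctured N)" for S
      using that poset_natD(1)[OF e vertex, of S] Hs(1)[OF that[unfolded carrier_punctured]]
        HGs(1)[OF that[unfolded carrier_punctured]] by auto
    show "nt_at e (fobj X S') \<cdot> farr ?H (S, S') = farr ?HG (S, S') \<cdot> nt_at e (fobj X S)"
      if "S \<in> carrier (punctured N)" "S' \<in> carrier (punctured N)" "S \<sqsubseteq>\<^bsub>punctured N\<^esub> S'" for S S'
    proof -
      have S: "S \<subseteq> S'" "S' \<subset> N" "S \<subseteq> N" "S' \<subseteq> N" using that by auto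
      show ?thesis
        using poset_natD(2)[OF e vertex[OF S(3)] vertex[OF S(4)] vertex_mono[OF S(1,4)]]
          Hs(2)[OF S(1,2)] HGs(2)[OF S(1,2)] by simp
    qed
  qed
  \<comment> \<open>With this, the punctured cube of \<open>T\<close> is a second cofibrant
    replacement of the punctured cube of \<open>G\<close>, by way of \<open>e\<close>.\<close>
  have q1w: "?q1 \<in> objectwise ?K M (weq M)"
    by (rule objectwiseI[OF q1]) (use ew carr in auto)
  obtain Y j j' r where j: "j \<in> Hom PM.F ?H Y" "j' \<in> Hom PM.F Q2 Y" and r: "r \<in> Hom PM.F Y ?HG"
    and rj: "r \<cdot>\<^bsub>PM.F\<^esub> j = ?q1" "r \<cdot>\<^bsub>PM.F\<^esub> j' = q2"
    and lift: "\<And>p. p \<in> objectwise ?K M (fib M) \<Longrightarrow> has_lifting PM.F j p"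
      "\<And>p. p \<in> objectwise ?K M (fib M) \<Longrightarrow> has_lifting PM.F j' p"
    by (rule PM.cofibrant_cospan[OF punctured_lan_cofibrant[OF Q] q2(1) q1 q1w q2(2,3)]) blast
  have Y: "is_functor ?K M Y" using natD(1)[OF r] .
  obtain cY lY where Yc: "is_colimit ?K M Y cY lY" using col[OF Y] by blast
  note lYh = poset_colimitD[OF Yc, unfolded carr] and lh = poset_colimitD[OF cl, unfolded carr]
  note TC = punctured_lan_colimit
  have rh: "nt_at r S \<in> Hom M (fobj Y S) (fobj G (fobj X S))" if "S \<subset> N" for S
    using poset_natD(1)[OF r, unfolded carr, OF that] HGs(1)[OF that] by simp
  have Gh: "farr G (fobj X S, fobj X S') \<in> Hom M (fobj G (fobj X S)) (fobj G (fobj X S'))"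
    if "S \<subseteq> S'" "S' \<subseteq> N" for S S'
    using gf(2)[OF vertex vertex vertex_mono] that by auto
  have jh: "nt_at j S \<in> Hom M (fobj T (fobj X S)) (fobj Y S)" if "S \<subset> N" for S
    using poset_natD(1)[OF j(1), unfolded carr, OF that] Hs(1)[OF that] by simp
  have j'h: "nt_at j' S \<in> Hom M (fobj Q2 S) (fobj Y S)" if "S \<subset> N" for S
    using poset_natD(1)[OF j(2), unfolded carr, OF that] .
  have le: "S \<sqsubseteq>\<^bsub>punctured N\<^esub> S' \<longleftrightarrow> S \<subseteq> S'" for S S' by simp
  have down: "is_colimit (poset_cat (punctured N\<lparr>carrier := carrier (punctured N)\<rparr>)) M Z z m
    \<longleftrightarrow> is_colimit ?K M Z z m" for Z z m
    by simp
  \<comment> \<open>Both replacements map into the common target \<open>Y\<close> by projective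
    trivial cofibrations. These induce weak equivalences on colimits, by
    \<open>colimit_map_weq\<close> with the whole punctured cube as the down-set.\<close>
  have ind: "\<exists>w. w \<in> Hom M z cY \<and> (\<forall>S. S \<subset> N \<longrightarrow> w \<cdot> m S = lY S \<cdot> nt_at i S) \<and> w \<in> weq M"
    if Zc: "is_colimit ?K M Z z m" and i: "i \<in> Hom PM.F Z Y"
      and il: "\<And>p. p \<in> objectwise ?K M (fib M) \<Longrightarrow> has_lifting PM.F i p" for Z z m i
  proof -
    note zi = poset_natD[OF i, unfolded carr le] and Zf = natD(1)[OF i]
    have "is_cocone ?K M Z cY (\<lambda>S. lY S \<cdot> nt_at i S)"
    proof (rule poset_coconeI[OF lYh(1)])
      show "lY S \<cdot> nt_at i S \<in> Hom M (fobj Z S) cY" if "S \<in> carrier (punctured N)" for S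
        using M.comp_hom[OF zi(1) lYh(2)] that carr by blast
      fix S S' assume SS: "S \<in> carrier (punctured N)" "S' \<in> carrier (punctured N)" "S \<sqsubseteq>\<^bsub>punctured N\<^esub> S'"
      then have S: "S \<subset> N" "S' \<subset> N" by auto
      show "(lY S' \<cdot> nt_at i S') \<cdot> farr Z (S, S') = lY S \<cdot> nt_at i S"
        using M.comp_assoc[OF poset_functorD(2)[OF Zf SS] zi(1)[OF S(2)] lYh(2)[OF S(2)]]
          poset_natD(2)[OF i SS]
          M.comp_assoc[OF zi(1)[OF S(1)] poset_functorD(2)[OF Y SS] lYh(2)[OF S(2)]]
            poset_colimitD(3)[OF Yc SS] by simp
    qed
    from colimit_ex[OF Zc this] obtain w where w: "w \<in> Hom M z cY"
      "\<And>S. S \<in> Obj ?K \<Longrightarrow> w \<cdot> m S = lY S \<cdot> nt_at i S" by auto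
    have wS: "w \<cdot> m S = lY S \<cdot> nt_at i S" if "S \<subset> N" for S using w(2)[of S] that by auto
    have "w \<in> weq M"
      by (rule colimit_map_weq[OF model_core_axioms terminal partial_order_subset_poset _ _ i il
        Zc[folded down] Yc[folded down] w(1)])
        (use wS carr in auto)
    then show ?thesis using w(1) wS by blast
  qed
  obtain u1 where u1: "u1 \<in> Hom M (fobj T (fobj X N)) cY" "u1 \<in> weq M"
    "\<And>S. S \<subset> N \<Longrightarrow> u1 \<cdot> farr T (fobj X S, fobj X N) = lY S \<cdot> nt_at j S"
    using ind[OF TC j(1) lift(1)] by blast
  obtain u2 where u2: "u2 \<in> Hom M c cY" "u2 \<in> weq M" "\<And>S. S \<subset> N \<Longrightarrow> u2 \<cdot> l S = lY S \<cdot> nt_at j' S"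
    using ind[OF cl j(2) lift(2)] by blast
  have "is_cocone ?K M Y (fobj G (fobj X N)) (\<lambda>S. farr G (fobj X S, fobj X N) \<cdot> nt_at r S)"
  proof (rule poset_coconeI[OF gf(1)[OF XN]])
    show "farr G (fobj X S, fobj X N) \<cdot> nt_at r S \<in> Hom M (fobj Y S) (fobj G (fobj X N))"
      if "S \<in> carrier (punctured N)" for S
      using M.comp_hom[OF rh Gh, of S N] that by auto
    fix S S' assume SS: "S \<in> carrier (punctured N)" "S' \<in> carrier (punctured N)" "S \<sqsubseteq>\<^bsub>punctured N\<^esub> S'"
    then have S: "S \<subset> N" "S' \<subset> N" "S \<subseteq> S'" "S \<subseteq> N" "S' \<subseteq> N" by auto
    have "(farr G (fobj X S', fobj X N) \<cdot> nt_at r S') \<cdot> farr Y (S, S')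
      = farr G (fobj X S', fobj X N) \<cdot> (farr G (fobj X S, fobj X S') \<cdot> nt_at r S)"
      using M.comp_assoc[OF poset_functorD(2)[OF Y SS] rh[OF S(2)] Gh[OF S(5) subset_refl]]
        poset_natD(2)[OF r SS] HGs(2)[OF S(3,2)] by simp
    also have "\<dots> = farr G (fobj X S, fobj X N) \<cdot> nt_at r S"
      using M.comp_assoc[OF rh[OF S(1)] Gh[OF S(3,5)] Gh[OF S(5) subset_refl]]
        gf(4)[OF vertex[OF S(4)] vertex[OF S(5)] XN vertex_mono[OF S(3,5)]
          vertex_mono[OF S(5) subset_refl]] by simp
    finally show "(farr G (fobj X S', fobj X N) \<cdot> nt_at r S') \<cdot> farr Y (S, S')
      = farr G (fobj X S, fobj X N) \<cdot> nt_at r S" .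
  qed
  from colimit_ex[OF Yc this] obtain uY where uY: "uY \<in> Hom M cY (fobj G (fobj X N))"
    "\<And>S. S \<in> Obj ?K \<Longrightarrow> uY \<cdot> lY S = farr G (fobj X S, fobj X N) \<cdot> nt_at r S" by auto
  have uYS: "uY \<cdot> lY S = farr G (fobj X S, fobj X N) \<cdot> nt_at r S" if "S \<subset> N" for S
    using uY(2)[of S] that by auto
  \<comment> \<open>The hypothesis on \<open>G\<close> makes \<open>u\<close> a weak equivalence, so
    \<open>uY\<close> is one by two-out-of-three. The component of \<open>e\<close> at the top is
    then the composite of the weak equivalences \<open>u1\<close> and \<open>uY\<close>.\<close>
  have "uY \<cdot> u2 = u"
  proof (rule poset_colimit_whole_eqI[OF cat_M natD(1)[OF q2(2)] cl M.comp_hom[OF u2(1) uY(1)] u(1)])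
    fix S assume "S \<in> carrier (punctured N)"
    then have SK: "S \<in> Obj ?K" and S: "S \<subset> N" and SN: "S \<subseteq> N" by auto
    have e2: "nt_at r S \<cdot> nt_at j' S = nt_at q2 S"
      using arg_cong[OF rj(2), of "\<lambda>n. nt_at n S"] nat_comp_at[OF SK] by metis
    show "(uY \<cdot> u2) \<cdot> l S = u \<cdot> l S"
      using M.comp_assoc[OF lh(2)[OF S] u2(1) uY(1)] u2(3)[OF S]
        M.comp_assoc[OF j'h[OF S] lYh(2)[OF S] uY(1)]
        uYS[OF S] M.comp_assoc[OF j'h[OF S] rh[OF S] Gh[OF SN subset_refl]] e2 u(3)[OF S] by simp
  qed
  then have uYw: "uY \<in> weq M" using weq_cancel_right[OF u2(1) uY(1) u2(2)] u(2) by simp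
  have "uY \<cdot> u1 = nt_at e (fobj X N)"
  proof (rule poset_colimit_whole_eqI[OF cat_M punctured_lan_fun TC M.comp_hom[OF u1(1) uY(1)]
    poset_natD(1)[OF e XN]])
    fix S assume "S \<in> carrier (punctured N)"
    then have SK: "S \<in> Obj ?K" and S: "S \<subset> N" and SN: "S \<subseteq> N" by auto
    have "nt_at r S \<cdot> nt_at j S = nt_at ?q1 S"
      using arg_cong[OF rj(1), of "\<lambda>n. nt_at n S"] nat_comp_at[OF SK] by metis
    then have e1: "nt_at r S \<cdot> nt_at j S = nt_at e (fobj X S)" using mk_nat_at[OF SK] by metis
    show "(uY \<cdot> u1) \<cdot> farr T (fobj X S, fobj X N) = nt_at e (fobj X N) \<cdot> farr T (fobj X S, fobj X N)"
      using M.comp_assoc[OF face_hom[OF SN subset_refl] u1(1) uY(1)] u1(3)[OF S]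
        M.comp_assoc[OF jh[OF S] lYh(2)[OF S] uY(1)]
        uYS[OF S] M.comp_assoc[OF jh[OF S] rh[OF S] Gh[OF SN subset_refl]] e1
        poset_natD(2)[OF e vertex[OF SN] XN vertex_mono[OF SN subset_refl]] by simp
  qed
  then show ?thesis using weq_comp[OF u1(1) uY(1) u1(2) uYw] by simp
qed

end

end

section \<open>The universal property of the codegree approximation\<close>

text \<open>Arrows of \<open>poset_cat\<close> are pairs, and smallness bounds arrows as well as
  objects. For infinite \<open>'p\<close> pairs fit into \<open>'p\<close> itself; for finite
  \<open>'p\<close> they fit into \<open>nat\<close>, whence the second summand.\<close>

lemma ex_inj_prod: "\<exists>f :: 'p \<times> 'p \<Rightarrow> 'p + nat. inj f"
proof (cases "finite (UNIV :: 'p set)")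
  case True
  then have "finite (UNIV :: ('p \<times> 'p) set)" by (simp add: finite_prod)
  from finite_imp_inj_to_nat_seg[OF this] obtain f :: "'p \<times> 'p \<Rightarrow> nat" where "inj f" by auto
  then have "inj (Inr \<circ> f :: 'p \<times> 'p \<Rightarrow> 'p + nat)" by (intro inj_compose inj_Inr)
  then show ?thesis by (rule exI[of _ "Inr \<circ> f"])
next
  case False
  then have "\<exists>f. bij_betw f (UNIV \<times> UNIV :: ('p \<times> 'p) set) (UNIV :: 'p set)"
    using card_of_Times_same_infinite[OF False] unfolding card_of_ordIso[symmetric] by simp
  then obtain f :: "'p \<times> 'p \<Rightarrow> 'p" where "inj f" by (auto simp: bij_betw_def)
  then have "inj (Inl \<circ> f :: 'p \<times> 'p \<Rightarrow> 'p + nat)" by (intro inj_compose inj_Inl)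
  then show ?thesis by (rule exI[of _ "Inl \<circ> f"])
qed

text \<open>Serves the punctured cubes, whose vertices are sets of naturals and unrelated to
  \<open>'p\<close>.\<close>

lemma finite_ex_inj:
  assumes "finite (A :: 'x set)"
  shows "\<exists>f :: 'x \<Rightarrow> 'p + nat. inj_on f A"
proof -
  obtain f :: "'x \<Rightarrow> nat" where "inj_on f A" using finite_imp_inj_to_nat_seg[OF assms] by auto
  then have "inj_on (Inr \<circ> f :: 'x \<Rightarrow> 'p + nat) A" by (intro comp_inj_on inj_Inr)
  then show ?thesis by (rule exI[of _ "Inr \<circ> f"])
qed

theorem proposition4p29:
  fixes P :: "'p gorder"
    and M :: "('o, 'a) premodel"
    and F T :: "('p, 'p \<times> 'p, 'o, 'a) func"
    and \<epsilon> :: "('p, 'p \<times> 'p, 'o, 'a) ntrans"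
    and n :: nat
  assumes "join_factorization_lattice TYPE('q) P"
    and "good_model_category TYPE('p + nat) M"
    and "F \<in> Obj (Fun P M)"
    and "codegree_approximation P M n F T \<epsilon>"
  shows "codegree P M n T \<and>
    (\<forall>G \<in> Obj (Fun P M). codegree P M n G \<longrightarrow>
       (\<forall>\<zeta> \<in> Hom (Ho_Fun P M) G F.
          \<exists>!\<upsilon>. \<upsilon> \<in> Hom (Ho_Fun P M) G T \<and> \<zeta> = Ho_class P M \<epsilon> \<cdot>\<^bsub>Ho_Fun P M\<^esub> \<upsilon>) \<and>
       (\<forall>\<zeta> \<in> Hom (Fun P M) G F.
          \<exists>!\<upsilon>. \<upsilon> \<in> Hom (Ho_Fun P M) G T \<and>
              Ho_class P M \<zeta> = Ho_class P M \<epsilon> \<cdot>\<^bsub>Ho_Fun P M\<^esub> \<upsilon>))"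
proof -
  interpret L: bottomed_distrib_lattice P
    using assms(1) by (intro bottomed_distrib_latticeI) (auto simp: join_factorization_lattice_def)
  have M: "model_category TYPE('p + nat) M" using assms(2) by (simp add: good_model_category_def)
  interpret MC: model_core M by (rule model_core[OF M])
  have cocomplete: "small_cocomplete TYPE('p + nat) M" and complete: "small_complete TYPE('p + nat) M"
    using M by (auto simp: model_category_def)
  obtain t where t: "is_terminal M t" by (rule has_terminal[OF complete])
  \<comment> \<open>Two distinct elements of the smallness type, for the index category of binary
    coproducts.\<close>
  let ?e = "\<lambda>b :: bool. Inr (if b then 0 else 1) :: 'p + nat"
  have e: "inj ?e" by (auto simp: inj_on_def split: if_splits)
  define A where "A = {v \<in> carrier P. jdim P v \<le> enat n}"
  have A_iff: "v \<in> A \<longleftrightarrow> v \<in> carrier P \<and> jdim P v \<le> enat n" for v by (simp add: A_def)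
  have jd: "jdim_le P n = P\<lparr>carrier := A\<rparr>" by (simp add: jdim_le_def A_def)
  have A: "A \<subseteq> carrier P" by (auto simp: A_def)
  interpret K: subposet_kan M P A t
    by (rule subposet_kan.intro[OF MC.cat_M L.po A t])
  have lan_ex: "\<exists>T \<eta>. K.is_lan Q T \<eta>" if Q: "is_functor K.CJ M Q" for Q
  proof -
    have "\<exists>c l. is_colimit (poset_cat (P\<lparr>carrier := K.below x\<rparr>)) M Q c l" for x
    proof -
      let ?J = "poset_cat (P\<lparr>carrier := K.below x\<rparr>)"
      have po: "partial_order (P\<lparr>carrier := K.below x\<rparr>)"
        by (rule partial_order_subset[OF L.po]) auto
      have J: "category ?J" by (rule category_poset_cat[OF po])
      have "is_functor ?J K.CJ (incl_functor ?J)"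
        using is_functor_incl_poset[OF K.po_J, of "K.below x"] by auto
      from is_functor_comp[OF J this Q] have D: "is_functor ?J M (comp_functor ?J Q (incl_functor ?J))" .
      obtain f :: "'p \<times> 'p \<Rightarrow> 'p + nat" where "inj f" using ex_inj_prod by blast
      then have f: "inj_on f (Arr ?J)" by (rule inj_on_subset) simp
      have g: "inj_on (Inl :: 'p \<Rightarrow> 'p + nat) (Obj ?J)" by simp
      obtain c l where "is_colimit ?J M (comp_functor ?J Q (incl_functor ?J)) c l"
        by (rule has_colimit[OF cocomplete J g f D])
      then have "is_colimit ?J M Q c l" unfolding colimit_incl_functor[OF J] .
      then show ?thesis by (intro exI)
    qed
    from K.lan_exists[OF Q this] show ?thesis by blast
  qed
  have inl: "inj_on (Inl :: 'p \<Rightarrow> 'p + nat) (carrier (P\<lparr>carrier := A\<rparr>))" by simp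
  have "projective_model M K.CJ" by (rule projective_model_poset[OF assms(2) K.po_J inl e])
  then interpret K: approximation M P A t
    by (intro approximation.intro approximation_axioms.intro K.subposet_kan_axioms lan_ex)
  let ?N = "{0..n}"
  let ?PC = "poset_cat (punctured ?N)"
  have fin: "finite (carrier (punctured ?N))" by simp
  obtain g :: "nat set \<Rightarrow> 'p + nat" where g: "inj_on g (carrier (punctured ?N))"
    using finite_ex_inj[OF fin] ..
  have PM: "projective_model M ?PC"
    by (rule projective_model_poset[OF assms(2) partial_order_subset_poset g e])
  have col: "\<exists>c l. is_colimit ?PC M Y c l" if Y: "is_functor ?PC M Y" for Y
  proof -
    have "f \<in> Pow ?N \<times> Pow ?N" if "f \<in> Arr ?PC" for f
      using that by (rule poset_cat_arrE) simp
    then have "Arr ?PC \<subseteq> Pow ?N \<times> Pow ?N" by (rule subsetI)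
    then have "finite (Arr ?PC)" by (rule finite_subset) simp
    from finite_ex_inj[OF this] obtain f :: "nat set \<times> nat set \<Rightarrow> 'p + nat"
      where f: "inj_on f (Arr ?PC)" ..
    have g': "inj_on g (Obj ?PC)" using g by simp
    obtain c l where "is_colimit ?PC M Y c l"
      by (rule has_colimit[OF cocomplete category_poset_cat[OF partial_order_subset_poset] g' f Y])
    then show ?thesis by (intro exI)
  qed
  let ?least = "\<lambda>X s. \<forall>v. v \<in> A \<longrightarrow> v \<sqsubseteq>\<^bsub>P\<^esub> fobj X ?N \<longrightarrow> (s v \<subset> ?N \<and> v \<sqsubseteq>\<^bsub>P\<^esub> fobj X (s v)) \<and>
      (\<forall>S. S \<subseteq> ?N \<longrightarrow> v \<sqsubseteq>\<^bsub>P\<^esub> fobj X S \<longrightarrow> s v \<subseteq> S)"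
  have least_vertices: "\<exists>s. ?least X s"
    if X: "is_functor (cube_cat ?N) (poset_cat P) X" "strongly_bicartesian_cube (poset_cat P) ?N X" for X
  proof -
    have "\<exists>S. (S \<subset> ?N \<and> v \<sqsubseteq>\<^bsub>P\<^esub> fobj X S) \<and> (\<forall>S'. S' \<subseteq> ?N \<longrightarrow> v \<sqsubseteq>\<^bsub>P\<^esub> fobj X S' \<longrightarrow> S \<subseteq> S')"
      if v: "v \<in> A" "v \<sqsubseteq>\<^bsub>P\<^esub> fobj X ?N" for v
    proof -
      have vP: "v \<in> carrier P" using v(1) A by (rule subsetD[rotated])
      have jv: "jdim P v \<le> enat n" using v(1) unfolding A_iff by (rule conjunct2)
      then have "jdim P v \<noteq> \<infinity>" by (rule contrapos_pn) simp
      from L.irredundant_set_ex[OF this] obtain S where S: "irredundant_set P v S" ..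
      \<comment> \<open>\<open>?N\<close> has \<open>n + 1\<close> elements, one more than
        \<open>v\<close> can have factors.\<close>
      have "card S < card ?N" using L.jdim_eq_card[OF S] jv by simp
      from L.proper_vertex[OF X S this v(2)] obtain i where i: "i \<in> ?N" "v \<sqsubseteq>\<^bsub>P\<^esub> fobj X (?N - {i})" by blast
      obtain S0 where S0: "S0 \<subseteq> ?N" "v \<sqsubseteq>\<^bsub>P\<^esub> fobj X S0" "\<And>S'. \<lbrakk>S' \<subseteq> ?N; v \<sqsubseteq>\<^bsub>P\<^esub> fobj X S'\<rbrakk> \<Longrightarrow> S0 \<subseteq> S'"
        using least_vertex[OF X L.po _ vP v(2)] by auto
      have "S0 \<subseteq> ?N - {i}" by (rule S0(3)[OF Diff_subset i(2)])
      then have "S0 \<subset> ?N" using i(1) by blast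
      then show ?thesis using S0 by blast
    qed
    then show ?thesis by metis
  qed
  have lan_codegree: "codegree P M n T'"
    if Q: "K.proj_cofibrant Q'" and lan: "K.is_lan Q' T' \<eta>'" for Q' T' \<eta>'
    unfolding codegree_def
  proof (intro allI impI, elim conjE)
    fix X assume X: "is_functor (cube_cat ?N) (poset_cat P) X"
      "strongly_bicartesian_cube (poset_cat P) ?N X"
    from least_vertices[OF X] obtain s where s: "?least X s" ..
    note s' = s[rule_format, THEN conjunct1] s[rule_format, THEN conjunct2, rule_format]
    show "homotopy_cocartesian_cube M ?N (comp_functor (cube_cat ?N) T' X)"
      by (rule K.lan_homotopy_cocartesian[OF X(1) s' PM lan Q])
  qed
  have approx_weq: "e' \<in> K.WP" if G: "codegree P M n G" and ap: "K.trivfib_approx G Q' T' \<eta>' e'"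
    for G Q' T' \<eta>' e'
  proof -
    have Q: "K.proj_cofibrant Q'" and lan: "K.is_lan Q' T' \<eta>'" and e': "e' \<in> Hom K.FP T' G"
      using ap by (auto simp: K.trivfib_approx_def)
    show ?thesis
    proof (rule objectwiseI[OF e'])
      fix v assume "v \<in> Obj K.CP"
      then have v: "v \<in> carrier P" by simp
      show "nt_at e' v \<in> weq M"
      proof (rule join_factorization_lattice_induct[OF assms(1) v, where R = "\<lambda>v. nt_at e' v \<in> weq M"])
        fix v assume v: "v \<in> carrier P"
          and IH: "\<And>w u. \<lbrakk>w \<in> carrier P; u \<in> carrier P; w \<sqsubseteq>\<^bsub>P\<^esub> u; u \<sqsubseteq>\<^bsub>P\<^esub> v; jdim P u \<noteq> jdim P v\<rbrakk>
          \<Longrightarrow> nt_at e' w \<in> weq M"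
        show "nt_at e' v \<in> weq M"
        proof (cases "v \<in> A")
          case True
          then show ?thesis
            using objectwiseD[OF K.approx_restrict_trivfib[OF ap], of v] by simp
        next
          case False
          \<comment> \<open>Outside \<open>A\<close> the join-dimension exceeds \<open>n\<close>; it
            is still finite, so \<open>v\<close> has more than \<open>n\<close> irreducible factors,
            enough for an \<open>(n+1)\<close>-cube with top \<open>v\<close>.\<close>
          obtain D where D: "irredundant_set P v D"
            using join_factorization_lattice_irredundant_ex[OF assms(1) v] by blast
          then have "n < card D" using L.jdim_eq_card[OF D] False v unfolding A_iff by simp
          then obtain X where X: "is_functor (cube_cat ?N) (poset_cat P) X"
            "strongly_bicartesian_cube (poset_cat P) ?N X"
            and top: "fobj X ?N = v"
            and faces: "\<And>U. U \<subset> ?N \<Longrightarrow> \<exists>u \<in> carrier P. fobj X U \<sqsubseteq>\<^bsub>P\<^esub> u \<and> u \<sqsubseteq>\<^bsub>P\<^esub> v \<and> jdim P u \<noteq> jdim P v"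
            using L.cube_with_top_vertex[OF D] by blast
          from least_vertices[OF X] obtain s where s: "?least X s" ..
          note s' = s[rule_format, THEN conjunct1] s[rule_format, THEN conjunct2, rule_format]
          have hc: "homotopy_cocartesian_cube M ?N (comp_functor (cube_cat ?N) G X)"
            using G X unfolding codegree_def by blast
          \<comment> \<open>A proper vertex lies below some \<open>u\<close> under \<open>v\<close>
            whose join-dimension differs from that of \<open>v\<close>, which is the descent
            required by the induction.\<close>
          have ew: "nt_at e' (fobj X S) \<in> weq M" if S: "S \<subset> ?N" for S
          proof -
            obtain u where u: "u \<in> carrier P" "fobj X S \<sqsubseteq>\<^bsub>P\<^esub> u" "u \<sqsubseteq>\<^bsub>P\<^esub> v" "jdim P u \<noteq> jdim P v"
              using faces[OF S] by blast
            show ?thesis by (rule IH[OF cubeD(1)[OF X(1) psubset_imp_subset[OF S]] u])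
          qed
          show ?thesis
            using K.approx_top_vertex_weq[OF X(1) s' PM lan Q e' hc ew col] by (simp add: top)
        qed
      qed
    qed
  qed
  obtain Q q \<eta> where Q: "K.proj_cofibrant Q" and q: "q \<in> K.WJ" and lan: "K.is_lan Q T \<eta>"
    and eps: "\<epsilon> \<in> Hom K.FP T F" and eq: "K.Rn \<epsilon> \<cdot>\<^bsub>K.FJ\<^esub> \<eta> = q"
    using assms(4) unfolding codegree_approximation_def Let_def jd cofibrant_replacement_def
      K.cofibrant_iff by auto
  \<comment> \<open>The unit of the Kan extension is invertible on \<open>J\<close>, so
    \<open>\<epsilon>\<close> inherits from \<open>q\<close> the property of being a weak
    equivalence there.\<close>
  have epsW: "K.Rn \<epsilon> \<in> K.WJ"
    by (rule K.approx_restrict_weq[OF lan eps]) (use eq q in simp)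
  have universal: "\<exists>!\<upsilon>. \<upsilon> \<in> Hom (Ho_Fun P M) G T \<and> \<zeta> = Ho_class P M \<epsilon> \<cdot>\<^bsub>Ho_Fun P M\<^esub> \<upsilon>"
    if G: "G \<in> Obj (Fun P M)" "codegree P M n G" and zeta: "\<zeta> \<in> Hom (Ho_Fun P M) G F" for G \<zeta>
    unfolding Ho_Fun_def Ho_class_def
    by (rule K.approximation_universal[OF _ approx_weq[OF G(2)] eps epsW])
      (use G(1) zeta in \<open>simp_all add: Ho_Fun_def\<close>)
  have "Ho_class P M \<zeta> \<in> Hom (Ho_Fun P M) G F" if z: "\<zeta> \<in> Hom (Fun P M) G F" for G \<zeta>
    using K.loc.zigzag_Fwd[OF z] HomD(2,3)[OF z]
    unfolding Ho_Fun_def Ho_class_def K.loc.localization_hom loc_arr_def by auto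
  then show ?thesis
    using lan_codegree[OF Q lan] universal by blast
qed

end
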